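(* Let $0<p<q<\infty$, $0<\theta\le\infty$, $L\in\mathbb N$ with $L>1/q$, and $\mathbf r$ a smoothness vector as in the context with $r_1>1/p$. Choose $\boldsymbol\nu\in\mathbb R^d$ with $\nu_s=r_s$ for $s\le\mu$ and $r_1<\nu_s<r_s$ for $s>\mu$, and put $\boldsymbol\eta=\boldsymbol\nu-1/p+1/q$. Then there is $C>0$ such that for all $m\in\mathbb N$ and all $f\in S^{\mathbf r}_{p,\theta}B(\mathbb T^d)$ $$\|f-T^{L,\boldsymbol\eta}_mf\|_{L_q(\mathbb T^d)}\le C\,2^{-m(r_1-1/p+1/q)}m^{(\mu-1)(1/q-1/\theta)_+}\|f|S^{\mathbf r}_{p,\theta}B(\mathbb T^d)\|.$$
   Context: $a_+=\max\{a,0\}$, $1/\infty=0$. Smoothness vector: $\mathbf r=(r_1,\dots,r_d)$ with $r_1=\dots=r_\mu<r_{\mu+1}\le\dots\le r_d<\infty$ for some $\mu\in\{1,\dots,d\}$. $\mathbb T^d=[-\pi,\pi]^d$ with opposite points identified. Spaces: with an admissible system $(\varphi_j)\subset C_0^\infty(\mathbb R)$ ($\mathrm{supp}\,\varphi_0\subset[-A,A]$, $\mathrm{supp}\,\varphi_j\subset\{B2^j\le|\xi|\le C2^j\}$, $\sup_{\xi,j}2^{jr}|D^r\varphi_j|<\infty$, $\sum\varphi_j\equiv1$), $\delta_{\mathbf j}[f]=\sum_{\mathbf k}\varphi_{j_1}(k_1)\cdots\varphi_{j_d}(k_d)\hat f(\mathbf k)e^{i\mathbf k\cdot\mathbf x}$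 and $\|f|S^{\mathbf r}_{p,\theta}B\|=(\sum_{\mathbf j}2^{\theta\mathbf r\cdot\mathbf j}\|\delta_{\mathbf j}[f]\|_{L_p}^\theta)^{1/\theta}$ (sup if $\theta=\infty$). Kernels: $\mathrm{sinc}(x)=\sin x/x$, $\mathrm{sinc}(0)=1$; for $L\ge2$, $K^L(x)=\prod_{\ell=1}^L\mathrm{sinc}(2^{-\ell}x)$, $K^L_{\pi,j}(x)=\sum_{k}K^L(2^j(x+2\pi k))$; $K^1_{\pi,0}\equiv1$, $K^1_{\pi,j}(x)=2^{-j}\sum_{k=-2^{j-1}}^{2^{j-1}-1}e^{ikx}$. With $U_0=\{0\}$, $U_j=\{-2^{j-1},\dots,2^{j-1}-1\}$: $I^L_j[f](x)=\sum_{u\in U_j}f(2\pi u/2^j)K^L_{\pi,j}(x-2\pi u/2^j)$; $\eta^L_0=I^L_0$, $\eta^L_j=I^L_j-I^L_{j-1}$; $q^L_{\mathbf j}[f]=(\eta^L_{j_1}\otimes\cdots\otimes\eta^L_{j_d})f$ (the $i$-th factor acts in the $i$-th variable). Smolyak operator: for $\boldsymbol\eta\in(0,\infty)^d$, $T^{L,\boldsymbol\eta}_mf=\sum_{\mathbf j\in\mathbb N_0^d:\ \boldsymbol\eta\cdot\mathbf j\le\eta_1m}q^L_{\mathbf j}[f]$. *)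

theory Defs
  imports "HOL-Analysis.Analysis"
begin

(* Coordinates are indexed 0..d-1 (paper: 1..d). Points of T^d and multi-indices
   are functions on nat, only coordinates < d being relevant. *)

definition sinc :: "real \<Rightarrow> real" where
  "sinc x = (if x = 0 then 1 else sin x / x)"

definition KL :: "nat \<Rightarrow> real \<Rightarrow> real" where
  "KL L x = (\<Prod>l\<in>{1..L}. sinc (x / 2 ^ l))"

definition Kpi :: "nat \<Rightarrow> nat \<Rightarrow> real \<Rightarrow> complex" where
  "Kpi L j x =
     (if L = 1 then
        (if j = 0 then 1
         else complex_of_real (1 / 2 ^ j) *
              (\<Sum>k\<in>{-(2 ^ (j - 1)) .. 2 ^ (j - 1) - 1 :: int}. cis (of_int k * x)))
      else complex_of_real (infsum (\<lambda>k::int. KL L (2 ^ j * (x + 2 * pi * of_int k))) UNIV))"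

definition Uset :: "nat \<Rightarrow> int set" where
  "Uset j = (if j = 0 then {0} else {-(2 ^ (j - 1)) .. 2 ^ (j - 1) - 1})"

definition Iop :: "nat \<Rightarrow> nat \<Rightarrow> (real \<Rightarrow> complex) \<Rightarrow> real \<Rightarrow> complex" where
  "Iop L j g x = (\<Sum>u\<in>Uset j. g (2 * pi * of_int u / 2 ^ j) * Kpi L j (x - 2 * pi * of_int u / 2 ^ j))"

definition eta_op :: "nat \<Rightarrow> nat \<Rightarrow> (real \<Rightarrow> complex) \<Rightarrow> real \<Rightarrow> complex" where
  "eta_op L j g x = (if j = 0 then Iop L 0 g x else Iop L j g x - Iop L (j - 1) g x)"

definition in_var :: "nat \<Rightarrow> ((real \<Rightarrow> complex) \<Rightarrow> real \<Rightarrow> complex) \<Rightarrow>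
    ((nat \<Rightarrow> real) \<Rightarrow> complex) \<Rightarrow> (nat \<Rightarrow> real) \<Rightarrow> complex" where
  "in_var i A f x = A (\<lambda>t. f (x(i := t))) (x i)"

definition qop :: "nat \<Rightarrow> nat \<Rightarrow> (nat \<Rightarrow> nat) \<Rightarrow> ((nat \<Rightarrow> real) \<Rightarrow> complex) \<Rightarrow> (nat \<Rightarrow> real) \<Rightarrow> complex" where
  "qop L d j f = foldr (\<lambda>i g. in_var i (eta_op L (j i)) g) [0..<d] f"

definition idx :: "nat \<Rightarrow> (nat \<Rightarrow> nat) set" where
  "idx d = {j. \<forall>i\<ge>d. j i = 0}"

definition int_idx :: "nat \<Rightarrow> (nat \<Rightarrow> int) set" where
  "int_idx d = {k. \<forall>i\<ge>d. k i = 0}"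

definition smolyak :: "nat \<Rightarrow> nat \<Rightarrow> (nat \<Rightarrow> real) \<Rightarrow> nat \<Rightarrow> ((nat \<Rightarrow> real) \<Rightarrow> complex) \<Rightarrow> (nat \<Rightarrow> real) \<Rightarrow> complex" where
  "smolyak L d \<eta> m f = (\<lambda>x. \<Sum>j\<in>{j\<in>idx d. (\<Sum>i<d. \<eta> i * real (j i)) \<le> \<eta> 0 * real m}. qop L d j f x)"

definition torus :: "nat \<Rightarrow> (nat \<Rightarrow> real) measure" where
  "torus d = PiM {..<d} (\<lambda>_. restrict_space lborel {-pi..pi})"

definition Lp_norm :: "nat \<Rightarrow> real \<Rightarrow> ((nat \<Rightarrow> real) \<Rightarrow> complex) \<Rightarrow> real" where
  "Lp_norm d p g = (integral\<^sup>L (torus d) (\<lambda>x. norm (g x) powr p)) powr (1 / p)"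

definition fourier_coeff :: "nat \<Rightarrow> ((nat \<Rightarrow> real) \<Rightarrow> complex) \<Rightarrow> (nat \<Rightarrow> int) \<Rightarrow> complex" where
  "fourier_coeff d f k = complex_of_real (1 / (2 * pi) ^ d) *
     integral\<^sup>L (torus d) (\<lambda>x. f x * cis (- (\<Sum>i<d. of_int (k i) * x i)))"

definition delta :: "(nat \<Rightarrow> real \<Rightarrow> real) \<Rightarrow> nat \<Rightarrow> (nat \<Rightarrow> nat) \<Rightarrow> ((nat \<Rightarrow> real) \<Rightarrow> complex) \<Rightarrow> (nat \<Rightarrow> real) \<Rightarrow> complex" where
  "delta \<phi> d j f x = infsum (\<lambda>k. complex_of_real (\<Prod>i<d. \<phi> (j i) (of_int (k i))) * fourier_coeff d f k *
       cis (\<Sum>i<d. of_int (k i) * x i)) (int_idx d)"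

definition admissible :: "(nat \<Rightarrow> real \<Rightarrow> real) \<Rightarrow> bool" where
  "admissible \<phi> \<longleftrightarrow> (\<exists>A B C. 0 < A \<and> 0 < B \<and> 0 < C \<and>
     (\<forall>j n x. (deriv ^^ n) (\<phi> j) differentiable (at x)) \<and>
     (\<forall>x. \<phi> 0 x \<noteq> 0 \<longrightarrow> \<bar>x\<bar> \<le> A) \<and>
     (\<forall>j\<ge>1. \<forall>x. \<phi> j x \<noteq> 0 \<longrightarrow> B * 2 ^ j \<le> \<bar>x\<bar> \<and> \<bar>x\<bar> \<le> C * 2 ^ j) \<and>
     (\<forall>n. \<exists>M. \<forall>j x. 2 ^ (j * n) * \<bar>(deriv ^^ n) (\<phi> j) x\<bar> \<le> M) \<and>
     (\<forall>x. (\<lambda>j. \<phi> j x) sums 1))"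

definition besov_term :: "(nat \<Rightarrow> real) \<Rightarrow> real \<Rightarrow> (nat \<Rightarrow> real \<Rightarrow> real) \<Rightarrow> nat \<Rightarrow> ((nat \<Rightarrow> real) \<Rightarrow> complex) \<Rightarrow> (nat \<Rightarrow> nat) \<Rightarrow> real" where
  "besov_term r p \<phi> d f j = 2 powr (\<Sum>i<d. r i * real (j i)) * Lp_norm d p (delta \<phi> d j f)"

definition in_besov :: "(nat \<Rightarrow> real) \<Rightarrow> real \<Rightarrow> ereal \<Rightarrow> (nat \<Rightarrow> real \<Rightarrow> real) \<Rightarrow> nat \<Rightarrow> ((nat \<Rightarrow> real) \<Rightarrow> complex) \<Rightarrow> bool" where
  "in_besov r p \<theta> \<phi> d f =
     (if \<theta> = \<infinity> then bdd_above (besov_term r p \<phi> d f ` idx d)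
      else (\<lambda>j. besov_term r p \<phi> d f j powr real_of_ereal \<theta>) summable_on idx d)"

definition besov_norm :: "(nat \<Rightarrow> real) \<Rightarrow> real \<Rightarrow> ereal \<Rightarrow> (nat \<Rightarrow> real \<Rightarrow> real) \<Rightarrow> nat \<Rightarrow> ((nat \<Rightarrow> real) \<Rightarrow> complex) \<Rightarrow> real" where
  "besov_norm r p \<theta> \<phi> d f =
     (if \<theta> = \<infinity> then Sup (besov_term r p \<phi> d f ` idx d)
      else (infsum (\<lambda>j. besov_term r p \<phi> d f j powr real_of_ereal \<theta>) (idx d)) powr (1 / real_of_ereal \<theta>))"

definition inv_theta :: "ereal \<Rightarrow> real" where
  "inv_theta \<theta> = (if \<theta> = \<infinity> then 0 else 1 / real_of_ereal \<theta>)"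

definition periodic_torus :: "nat \<Rightarrow> ((nat \<Rightarrow> real) \<Rightarrow> complex) \<Rightarrow> bool" where
  "periodic_torus d f \<longleftrightarrow> (\<forall>x y. (\<forall>i<d. \<exists>k::int. x i = y i + 2 * pi * of_int k) \<longrightarrow> f x = f y)"

end

theory Submission
  imports Defs
begin

text \<open>Write \<open>f\<close> as the sum of its dyadic blocks \<open>D\<^sub>k\<close>, trigonometric polynomials of coordinate degrees
  \<open>\<lesssim> 2^(k i)\<close>. By Poisson summation the periodized kernels turn exponentials into trigonometric polynomials
  of degree \<open>2^j\<close> and reproduce those of degree \<open>< 2^(j - L)\<close>, so that \<open>q\<^sub>j D\<^sub>k = 0\<close> unless \<open>j \<le> k + c\<close>, and the
  error is the sum of \<open>q\<^sub>j D\<^sub>k\<close> over all \<open>j\<close> outside the Smolyak index set.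
  Choose \<open>P < q\<close> with \<open>P > max p (max (1/L) (q/2))\<close>. A sampling inequality for the nodes in \<open>L\<^sub>p\<close> and a synthesis
  estimate for the kernels, whose \<open>P\<close>-th powers are integrable, give \<open>\<parallel>q\<^sub>j D\<^sub>k\<parallel>\<^sub>P \<lesssim> 2^(|k|/p - |j|/P) \<parallel>D\<^sub>k\<parallel>\<^sub>p\<close>.
  The Jawerth--Franke inequality \<open>\<parallel>\<Sum>F\<^sub>j\<parallel>\<^sub>q^q \<lesssim> \<Sum> 2^(|j|(q/P - 1)) \<parallel>F\<^sub>j\<parallel>\<^sub>P^q\<close> then replaces a Littlewood--Paley
  argument; it holds because pairs of polynomials of different degrees are almost orthogonal by Nikolskii's
  inequality. What remains is a weighted sum over the indices outside the hyperbolic layer, where the logarithmic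
  factor arises from Hoelder's inequality with exponent \<open>\<theta>/q\<close> if \<open>\<theta> > q\<close>. The case of general \<open>f\<close> follows from
  partial sums by Fatou's lemma; they converge to \<open>f\<close> pointwise since \<open>r\<^sub>1 > 1/p\<close> makes them converge uniformly.\<close>

text \<open>Exponents below 1 are allowed throughout, so neither the triangle inequality nor duality
  can be relied on: estimates are made for integrals of powers, and sums are handled by
  subadditivity of small powers or by geometric weights. Each condition on \<open>P\<close> has its
  own task. \<open>P > 1/L\<close> makes the \<open>P\<close>-th powers of the kernels integrable
  when \<open>P <= 1\<close>. \<open>P > p\<close> lets \<open>l_p\<close> sums of samples dominate
  \<open>l_P\<close> sums and leaves the room by which synthesis tolerates the slow decay for
  \<open>L = 1\<close>. \<open>q/2 < P < q\<close> puts \<open>q/P - 1\<close> into (0,1), where it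
  serves as a Hoelder weight for pairs. The functions \<open>q_j D_k\<close> are controlled through
  upper bounds for their degrees, so decay between levels comes from Nikolskii's inequality, applied
  in each coordinate to the factor of lower degree. The margin \<open>\<beta> = r_1 - 1/p\<close> is
  used twice: one half pays for summing over \<open>k\<close> with \<open>j\<close> fixed, the other
  half remains as a geometric weight coupling \<open>j\<close> and \<open>k\<close>. Inequalities in
  \<open>d\<close> variables follow from those in one variable by induction over the coordinates and
  Fubini's theorem, hence the description of polynomials by their slices.\<close>

section \<open>Integration over one period\<close>

abbreviation circ :: "real measure" where
  "circ \<equiv> restrict_space lborel {-pi..pi}"

lemma finite_measure_circ: "finite_measure circ"
  by (intro finite_measureI) (simp add: emeasure_restrict_space)

lemma space_circ [simp]: "space circ = {-pi..pi}"
  by (simp add: space_restrict_space)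

lemma sigma_finite_circ: "sigma_finite_measure circ"
  using finite_measure_circ finite_measure.axioms(1) by blast

lemma measurable_circ_cont:
  fixes g :: "real \<Rightarrow> 'b::topological_space"
  assumes "continuous_on UNIV g"
  shows "g \<in> borel_measurable circ"
  using borel_measurable_continuous_onI[OF assms] by (simp add: measurable_restrict_space1)

lemma integrable_circ_cont:
  fixes g :: "real \<Rightarrow> 'b::euclidean_space"
  assumes "continuous_on UNIV g"
  shows "integrable circ g"
proof -
  have "set_integrable lborel {-pi..pi} g"
    using borel_integrable_compact[of "{-pi..pi}" g] continuous_on_subset[OF assms]
    unfolding set_integrable_def by (simp add: indicator_scaleR_eq_if cong: if_cong)
  then show ?thesis
    unfolding set_integrable_def by (subst integrable_restrict_space) auto
qed

lemma nn_integral_circ_cont: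
  fixes g :: "real \<Rightarrow> real"
  assumes "continuous_on UNIV g" "\<And>x. 0 \<le> g x"
  shows "(\<integral>\<^sup>+t. ennreal (g t) \<partial>circ) = ennreal (integral\<^sup>L circ g)"
  using nn_integral_eq_integral[OF integrable_circ_cont[OF assms(1)]] assms(2) by simp

lemma continuous_on_cis_int [continuous_intros]:
  "continuous_on S (\<lambda>t. cis (of_int k * t))"
  by (intro continuous_intros)

lemma integral_circ_cis:
  "integral\<^sup>L circ (\<lambda>t. cis (of_int k * t)) = (if k = 0 then complex_of_real (2 * pi) else 0)"
proof (cases "k = 0")
  case True
  have "measure circ {-pi..pi} = 2 * pi"
    by (simp add: measure_restrict_space)
  with True show ?thesis using lebesgue_integral_const[of circ "1::complex"]
    by (simp add: scaleR_conv_of_real)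
next
  case False
  define F where "F = (\<lambda>t. cis (of_int k * t) / (\<i> * of_int k))"
  have "(LBINT x. indicator {-pi..pi} x *\<^sub>R cis (of_int k * x)) = F pi - F (-pi)"
  proof (rule integral_FTC_Icc)
    fix x :: real
    have "((\<lambda>z. exp (\<i> * of_int k * z) / (\<i> * of_int k)) has_field_derivative exp (\<i> * of_int k * of_real x)) (at (of_real x))"
      using False by (auto intro!: derivative_eq_intros)
    from has_vector_derivative_real_field[OF this]
    show "(F has_vector_derivative cis (of_int k * x)) (at x within {-pi..pi})"
      unfolding F_def by (simp add: cis_conv_exp mult.assoc)
  qed (auto intro!: continuous_intros)
  moreover have "F pi = F (-pi)"
  proof -
    have "cis (of_int k * pi) = cis (of_int k * (-pi)) * cis (2 * pi * of_int k)"
      by (simp add: cis_mult algebra_simps)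
    also have "cis (2 * pi * of_int k) = 1"
      by (simp add: cis_multiple_2pi)
    finally show ?thesis by (simp add: F_def)
  qed
  ultimately show ?thesis using False
    by (simp add: integral_restrict_space)
qed

subsection \<open>Trigonometric polynomials\<close>

definition trig_poly :: "nat \<Rightarrow> (real \<Rightarrow> complex) \<Rightarrow> bool" where
  "trig_poly n g \<longleftrightarrow> (\<exists>c. g = (\<lambda>t. \<Sum>k\<in>{-int n..int n}. c k * cis (of_int k * t)))"

lemma trig_poly_cis:
  assumes "\<bar>k\<bar> \<le> int n"
  shows "trig_poly n (\<lambda>t. cis (of_int k * t))"
  unfolding trig_poly_def
proof (rule exI[of _ "\<lambda>l. if l = k then 1 else 0"], rule ext)
  fix t
  have "(\<Sum>l = - int n..int n. (if l = k then 1 else 0) * cis (of_int l * t)) =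
      (\<Sum>l = - int n..int n. (if l = k then cis (of_int l * t) else 0))"
    by (intro sum.cong) auto
  also have "\<dots> = cis (of_int k * t)"
    using assms by (subst sum.delta) auto
  finally show "cis (of_int k * t) = (\<Sum>l = - int n..int n. (if l = k then 1 else 0) * cis (of_int l * t))"
    by simp
qed

lemma trig_poly_add:
  assumes "trig_poly n g" "trig_poly n h"
  shows "trig_poly n (\<lambda>t. g t + h t)"
proof -
  obtain a b where "g = (\<lambda>t. \<Sum>k\<in>{-int n..int n}. a k * cis (of_int k * t))"
    "h = (\<lambda>t. \<Sum>k\<in>{-int n..int n}. b k * cis (of_int k * t))"
    using assms unfolding trig_poly_def by blast
  then show ?thesis unfolding trig_poly_def
    by (intro exI[of _ "\<lambda>k. a k + b k"]) (simp add: sum.distrib distrib_right)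
qed

lemma trig_poly_cmult:
  assumes "trig_poly n g"
  shows "trig_poly n (\<lambda>t. c * g t)"
proof -
  obtain a where "g = (\<lambda>t. \<Sum>k\<in>{-int n..int n}. a k * cis (of_int k * t))"
    using assms unfolding trig_poly_def by blast
  then show ?thesis unfolding trig_poly_def
    by (intro exI[of _ "\<lambda>k. c * a k"]) (simp add: sum_distrib_left mult.assoc)
qed

lemma trig_poly_zero: "trig_poly n (\<lambda>t. 0)"
  unfolding trig_poly_def by (intro exI[of _ "\<lambda>k. 0"]) simp

lemma trig_poly_sum:
  assumes "\<And>i. i \<in> S \<Longrightarrow> trig_poly n (g i)"
  shows "trig_poly n (\<lambda>t. \<Sum>i\<in>S. g i t)"
  using assms
proof (induction S rule: infinite_finite_induct)
  case (insert x F)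
  then show ?case using trig_poly_add[of n "g x" "\<lambda>t. \<Sum>i\<in>F. g i t"] by simp
qed (simp_all add: trig_poly_zero)

lemma trig_poly_const: "trig_poly n (\<lambda>t. c)"
  using trig_poly_cmult[OF trig_poly_cis[of 0 n], of c] by simp

lemma trig_poly_mono:
  assumes "trig_poly n g" "n \<le> m"
  shows "trig_poly m g"
proof -
  obtain a where a: "g = (\<lambda>t. \<Sum>k\<in>{-int n..int n}. a k * cis (of_int k * t))"
    using assms unfolding trig_poly_def by blast
  show ?thesis unfolding a using assms(2)
    by (intro trig_poly_sum trig_poly_cmult trig_poly_cis) auto
qed

lemma trig_poly_mult:
  assumes "trig_poly n g" "trig_poly m h"
  shows "trig_poly (n + m) (\<lambda>t. g t * h t)"
proof -
  obtain a b where a: "g = (\<lambda>t. \<Sum>k\<in>{-int n..int n}. a k * cis (of_int k * t))"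
    and b: "h = (\<lambda>t. \<Sum>k\<in>{-int m..int m}. b k * cis (of_int k * t))"
    using assms unfolding trig_poly_def by blast
  have "trig_poly (n + m) (\<lambda>t. \<Sum>k\<in>{-int n..int n}. \<Sum>l\<in>{-int m..int m}. (a k * b l) * cis (of_int (k + l) * t))"
    by (intro trig_poly_sum trig_poly_cmult trig_poly_cis) auto
  moreover have "(\<lambda>t. g t * h t) = (\<lambda>t. \<Sum>k\<in>{-int n..int n}. \<Sum>l\<in>{-int m..int m}. (a k * b l) * cis (of_int (k + l) * t))"
    unfolding a b by (simp add: sum_product cis_mult distrib_left distrib_right ac_simps)
  ultimately show ?thesis by simp
qed

lemma trig_poly_power:
  assumes "trig_poly n g"
  shows "trig_poly (N * n) (\<lambda>t. g t ^ N)"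
proof (induction N)
  case 0
  then show ?case using trig_poly_const[of 0 1] by simp
next
  case (Suc N)
  then show ?case using trig_poly_mult[OF assms Suc] by simp
qed

lemma trig_poly_shift:
  assumes "trig_poly n g"
  shows "trig_poly n (\<lambda>t. g (t - c))"
proof -
  obtain a where a: "g = (\<lambda>t. \<Sum>k\<in>{-int n..int n}. a k * cis (of_int k * t))"
    using assms unfolding trig_poly_def by blast
  have "(\<lambda>t. g (t - c)) = (\<lambda>t. \<Sum>k\<in>{-int n..int n}. (a k * cis (- of_int k * c)) * cis (of_int k * t))"
    unfolding a by (simp add: cis_mult mult.assoc algebra_simps)
  then show ?thesis unfolding trig_poly_def by (intro exI)
qed

lemma trig_poly_continuous:
  assumes "trig_poly n g"
  shows "continuous_on S g"
  using assms unfolding trig_poly_def by (auto intro!: continuous_intros)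

lemma cis_plus_2pi_int: "cis (of_int k * (t + 2 * pi * of_int l)) = cis (of_int k * t)"
proof -
  have "cis (of_int k * (t + 2 * pi * of_int l)) = cis (of_int k * t) * cis (2 * pi * of_int (k * l))"
    by (simp add: cis_mult algebra_simps)
  also have "cis (2 * pi * of_int (k * l)) = 1" by (rule cis_multiple_2pi) auto
  finally show ?thesis by simp
qed

lemma trig_poly_periodic:
  assumes "trig_poly n g"
  shows "g (t + 2 * pi * of_int l) = g t"
proof -
  obtain a where a: "g = (\<lambda>t. \<Sum>k\<in>{-int n..int n}. a k * cis (of_int k * t))"
    using assms unfolding trig_poly_def by blast
  show ?thesis unfolding a by (simp only: cis_plus_2pi_int)
qed

lemma reduce_2pi: "\<exists>l::int. x - 2 * pi * of_int l \<in> {-pi..pi::real}"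
proof -
  define l where "l = \<lfloor>(x + pi) / (2 * pi)\<rfloor>"
  have "of_int l \<le> (x + pi) / (2 * pi)" "(x + pi) / (2 * pi) < of_int l + 1"
    unfolding l_def by linarith+
  then have "of_int l * (2 * pi) \<le> x + pi" "x + pi < (of_int l + 1) * (2 * pi)"
    by (simp_all add: pos_le_divide_eq pos_divide_less_eq)
  then show ?thesis by (intro exI[of _ l]) (auto simp: algebra_simps)
qed

text \<open>Parseval's identity controls the coefficients in \<open>l_2\<close>; Cauchy-Schwarz over
  the \<open>2 * n + 1\<close> frequencies passes to their \<open>l_1\<close> norm, which dominates
  every value of the polynomial.\<close>

lemma trig_poly_L2_bound:
  assumes "trig_poly n g"
  shows "(cmod (g x))\<^sup>2 \<le> (2 * real n + 1) / (2 * pi) * integral\<^sup>L circ (\<lambda>t. (cmod (g t))\<^sup>2)"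
proof -
  let ?S = "{-int n..int n}"
  obtain a where a: "g = (\<lambda>t. \<Sum>k\<in>?S. a k * cis (of_int k * t))"
    using assms unfolding trig_poly_def by blast
  have sq: "complex_of_real ((cmod (g t))\<^sup>2) = (\<Sum>k\<in>?S. \<Sum>l\<in>?S. a k * cnj (a l) * cis (of_int (k - l) * t))" for t
  proof -
    have "complex_of_real ((cmod (g t))\<^sup>2) = g t * cnj (g t)"
      by (simp add: complex_norm_square[symmetric])
    also have "\<dots> = (\<Sum>k\<in>?S. \<Sum>l\<in>?S. (a k * cis (of_int k * t)) * (cnj (a l) * cis (- (of_int l * t))))"
      unfolding a by (simp add: sum_product cis_cnj)
    also have "\<dots> = (\<Sum>k\<in>?S. \<Sum>l\<in>?S. a k * cnj (a l) * cis (of_int (k - l) * t))"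
    proof (intro sum.cong refl)
      fix k l
      have "cis (of_int k * t) * cis (- (of_int l * t)) = cis (of_int (k - l) * t)"
        by (simp add: cis_mult algebra_simps)
      then show "a k * cis (of_int k * t) * (cnj (a l) * cis (- (of_int l * t))) = a k * cnj (a l) * cis (of_int (k - l) * t)"
        by (metis (no_types, lifting) mult.assoc mult.left_commute)
    qed
    finally show ?thesis .
  qed
  have "complex_of_real (integral\<^sup>L circ (\<lambda>t. (cmod (g t))\<^sup>2)) = integral\<^sup>L circ (\<lambda>t. complex_of_real ((cmod (g t))\<^sup>2))"
    by (rule integral_complex_of_real[symmetric])
  also have "\<dots> = (\<Sum>k\<in>?S. \<Sum>l\<in>?S. a k * cnj (a l) * integral\<^sup>L circ (\<lambda>t. cis (of_int (k - l) * t)))"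
    unfolding sq
    by (subst Bochner_Integration.integral_sum; (intro Bochner_Integration.integrable_sum)?;
       ((subst Bochner_Integration.integral_sum)?; (intro integrable_circ_cont)?; simp?; (intro continuous_intros)?))
  also have "\<dots> = (\<Sum>k\<in>?S. \<Sum>l\<in>?S. (if l = k then a k * cnj (a l) * complex_of_real (2 * pi) else 0))"
    unfolding integral_circ_cis by (intro sum.cong refl) auto
  also have "\<dots> = (\<Sum>k\<in>?S. a k * cnj (a k) * complex_of_real (2 * pi))"
    by (intro sum.cong refl) (subst sum.delta, auto)
  also have "\<dots> = complex_of_real (2 * pi * (\<Sum>k\<in>?S. (cmod (a k))\<^sup>2))"
    by (simp add: complex_norm_square[symmetric] sum_distrib_left sum_distrib_right mult.commute)
  finally have parseval: "integral\<^sup>L circ (\<lambda>t. (cmod (g t))\<^sup>2) = 2 * pi * (\<Sum>k\<in>?S. (cmod (a k))\<^sup>2)"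
    using of_real_eq_iff by blast
  have "cmod (g x) \<le> (\<Sum>k\<in>?S. cmod (a k))"
    unfolding a by (rule order_trans[OF norm_sum]) (simp add: norm_mult)
  then have "(cmod (g x))\<^sup>2 \<le> (\<Sum>k\<in>?S. 1 * cmod (a k))\<^sup>2"
    by (simp add: power_mono)
  also have "\<dots> \<le> (\<Sum>k\<in>?S. 1\<^sup>2) * (\<Sum>k\<in>?S. (cmod (a k))\<^sup>2)"
    by (rule Cauchy_Schwarz_ineq_sum)
  also have "\<dots> = (2 * real n + 1) * (\<Sum>k\<in>?S. (cmod (a k))\<^sup>2)"
    by simp
  finally show ?thesis by (simp add: parseval)
qed

section \<open>Nikolskii's inequality on the circle\<close>

lemma continuous_on_cmod_powr [continuous_intros]:
  "continuous_on S g \<Longrightarrow> 0 < p \<Longrightarrow> continuous_on S (\<lambda>x. cmod (g x) powr p)"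
  by (rule continuous_on_powr') (auto intro!: continuous_intros)

lemma trig_poly_sup:
  assumes "trig_poly n g"
  obtains x0 where "\<And>x. cmod (g x) \<le> cmod (g x0)"
proof -
  obtain x0 where x0: "x0 \<in> {-pi..pi}" "\<And>x. x \<in> {-pi..pi} \<Longrightarrow> cmod (g x) \<le> cmod (g x0)"
    using continuous_attains_sup[of "{-pi..pi}" "\<lambda>x. cmod (g x)"] trig_poly_continuous[OF assms]
    by (auto intro!: continuous_on_norm simp: Ball_def Bex_def) 
  have "cmod (g x) \<le> cmod (g x0)" for x
  proof -
    obtain l :: int where l: "x - 2 * pi * of_int l \<in> {-pi..pi}" using reduce_2pi by blast
    have "g (x - 2 * pi * of_int l + 2 * pi * of_int l) = g (x - 2 * pi * of_int l)"
      by (rule trig_poly_periodic[OF assms])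
    then show ?thesis using x0(2)[OF l] by simp
  qed
  then show ?thesis using that by blast
qed

text \<open>With \<open>M\<close> the maximum of \<open>|g|\<close>, the bound
  \<open>|g|^2 <= M^(2-p) * |g|^p\<close> turns the quadratic estimate for \<open>M^2\<close> into
  one from which \<open>M^(2-p)\<close> cancels. Nonnegativity of \<open>2 - p\<close> is where
  \<open>p <= 2\<close> enters.\<close>

lemma nikolskii_le2:
  assumes g: "trig_poly n g" and p: "0 < p" "p \<le> 2"
  shows "cmod (g x) powr p \<le> (2 * real n + 1) / (2 * pi) * integral\<^sup>L circ (\<lambda>t. cmod (g t) powr p)"
proof -
  obtain x0 where x0: "\<And>x. cmod (g x) \<le> cmod (g x0)" using trig_poly_sup[OF g] by blast
  define M where "M = cmod (g x0)"
  have cont: "continuous_on UNIV (\<lambda>t. cmod (g t) powr p)"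
    using trig_poly_continuous[OF g] p by (intro continuous_intros)
  have cont2: "continuous_on UNIV (\<lambda>t. (cmod (g t))\<^sup>2)"
    using trig_poly_continuous[OF g] by (intro continuous_intros) auto
  have nn: "0 \<le> integral\<^sup>L circ (\<lambda>t. cmod (g t) powr p)"
    by (intro integral_nonneg_AE) auto
  show ?thesis
  proof (cases "M = 0")
    case True
    then have "cmod (g x) = 0" using x0[of x] by (simp add: M_def)
    then show ?thesis using nn by simp
  next
    case False
    then have M: "M > 0" by (simp add: M_def)
    have le: "(cmod (g t))\<^sup>2 \<le> M powr (2 - p) * cmod (g t) powr p" for t
    proof (cases "g t = 0")
      case False
      have "(cmod (g t))\<^sup>2 = cmod (g t) powr (2 - p) * cmod (g t) powr p"
        using False by (simp add: powr_add[symmetric])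
      also have "\<dots> \<le> M powr (2 - p) * cmod (g t) powr p"
        using p x0[of t] by (intro mult_right_mono powr_mono2) (auto simp: M_def)
      finally show ?thesis .
    qed simp
    have "M powr (2 - p) * M powr p = M\<^sup>2"
      using M by (simp add: powr_add[symmetric])
    also have "M\<^sup>2 \<le> (2 * real n + 1) / (2 * pi) * integral\<^sup>L circ (\<lambda>t. (cmod (g t))\<^sup>2)"
      unfolding M_def by (rule trig_poly_L2_bound[OF g])
    also have "\<dots> \<le> (2 * real n + 1) / (2 * pi) * integral\<^sup>L circ (\<lambda>t. M powr (2 - p) * cmod (g t) powr p)"
      using le cont cont2
      by (intro mult_left_mono integral_mono integrable_circ_cont continuous_on_mult continuous_on_const) auto
    also have "\<dots> = M powr (2 - p) * ((2 * real n + 1) / (2 * pi) * integral\<^sup>L circ (\<lambda>t. cmod (g t) powr p))"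
      by simp
    finally have "M powr p \<le> (2 * real n + 1) / (2 * pi) * integral\<^sup>L circ (\<lambda>t. cmod (g t) powr p)"
      by (rule mult_left_le_imp_le) (use M in simp)
    moreover have "cmod (g x) powr p \<le> M powr p"
      using x0[of x] p by (intro powr_mono2) (auto simp: M_def)
    ultimately show ?thesis by linarith
  qed
qed

text \<open>For \<^term>\<open>p > 2\<close> the case \<^term>\<open>p \<le> 2\<close> is applied to a power of the polynomial.\<close>

lemma nikolskii:
  assumes p: "0 < p"
  shows "\<exists>c>0. \<forall>n g x. 1 \<le> n \<longrightarrow> trig_poly n g \<longrightarrow>
    ennreal (cmod (g x) powr p) \<le> ennreal (c * real n) * (\<integral>\<^sup>+t. ennreal (cmod (g t) powr p) \<partial>circ)"
proof -
  \<comment> \<open>Rounding \<open>p\<close> up gives \<open>p / N <= 1\<close>, so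
    \<open>nikolskii_le2\<close> applies to \<open>g ^ N\<close>; the degree \<open>N * n\<close> of
    this power affects only the constant.\<close>
  define N where "N = nat \<lceil>p\<rceil>"
  have N: "N \<ge> 1" "real N \<ge> p" using p unfolding N_def by linarith+
  show ?thesis
  proof (intro exI[of _ "2 * real N + 1"] conjI allI impI)
    fix n :: nat and g :: "real \<Rightarrow> complex" and x
    assume n: "1 \<le> n" and g: "trig_poly n g"
    have e: "cmod (g t ^ N) powr (p / N) = cmod (g t) powr p" for t
      using N by (cases "g t = 0") (auto simp: norm_power powr_realpow[symmetric] powr_powr)
    have "cmod (g x ^ N) powr (p / N) \<le> (2 * real (N * n) + 1) / (2 * pi) * integral\<^sup>L circ (\<lambda>t. cmod (g t ^ N) powr (p / N))"
      using N p by (intro nikolskii_le2[of _ "\<lambda>t. g t ^ N"] trig_poly_power g) (auto simp: divide_simps)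
    then have *: "cmod (g x) powr p \<le> (2 * real (N * n) + 1) / (2 * pi) * integral\<^sup>L circ (\<lambda>t. cmod (g t) powr p)"
      unfolding e .
    have nn: "0 \<le> integral\<^sup>L circ (\<lambda>t. cmod (g t) powr p)"
      by (intro integral_nonneg_AE) auto
    have "(2 * real (N * n) + 1) / (2 * pi) \<le> 2 * real (N * n) + 1"
    proof -
      have "(2 * real (N * n) + 1) / (2 * pi) \<le> (2 * real (N * n) + 1) / 1"
        using pi_gt3 by (intro divide_left_mono) auto
      then show ?thesis by simp
    qed
    also have "\<dots> \<le> (2 * real N + 1) * real n"
      using n by (simp add: algebra_simps)
    finally have "cmod (g x) powr p \<le> ((2 * real N + 1) * real n) * integral\<^sup>L circ (\<lambda>t. cmod (g t) powr p)"
      using * nn by (meson mult_right_mono order_trans)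
    then have "ennreal (cmod (g x) powr p) \<le> ennreal ((2 * real N + 1) * real n) * ennreal (integral\<^sup>L circ (\<lambda>t. cmod (g t) powr p))"
      using nn by (simp add: ennreal_mult[symmetric] ennreal_leI)
    also have "ennreal (integral\<^sup>L circ (\<lambda>t. cmod (g t) powr p)) = (\<integral>\<^sup>+t. ennreal (cmod (g t) powr p) \<partial>circ)"
      using trig_poly_continuous[OF g] p
      by (intro nn_integral_circ_cont[symmetric] continuous_intros) auto
    finally show "ennreal (cmod (g x) powr p) \<le> ennreal ((2 * real N + 1) * real n) * (\<integral>\<^sup>+t. ennreal (cmod (g t) powr p) \<partial>circ)" .
  qed simp
qed


section \<open>Dyadic grids: discrete orthogonality and sampling\<close>

lemma Uset_alt: "Uset j = {-(2 ^ j div 2)..<2 ^ j - 2 ^ j div 2}"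
  by (cases j) (auto simp: Uset_def)

lemma finite_Uset [simp]: "finite (Uset j)"
  by (simp add: Uset_alt)

lemma Uset_image: "bij_betw (\<lambda>i. int i - 2 ^ j div 2) {..<2 ^ j} (Uset j)"
proof (rule bij_betw_imageI)
  show "(\<lambda>i. int i - 2 ^ j div 2) ` {..<2 ^ j} = Uset j"
  proof (intro equalityI subsetI)
    fix u assume "u \<in> Uset j"
    then have "u + 2 ^ j div 2 \<ge> 0" "u + 2 ^ j div 2 < 2 ^ j" by (auto simp: Uset_alt)
    then show "u \<in> (\<lambda>i. int i - 2 ^ j div 2) ` {..<2 ^ j}"
      by (intro image_eqI[of _ _ "nat (u + 2 ^ j div 2)"]) (auto simp: nat_less_iff)
  qed (auto simp: Uset_alt algebra_simps)
qed (auto simp: inj_on_def)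

text \<open>Orthogonality of the characters of the cyclic group of order \<open>2 ^ j\<close>: after
  a shift of the index the sum is geometric in a \<open>2 ^ j\<close>-th root of unity
  \<open>w\<close>, and it vanishes unless \<open>w = 1\<close>. Aliasing and the identification of
  the kernels both rest on this.\<close>

lemma sum_Uset_cis:
  "(\<Sum>u\<in>Uset j. cis (2 * pi * of_int k * of_int u / 2 ^ j)) = (if 2 ^ j dvd k then 2 ^ j else 0)"
proof -
  define h :: int where "h = 2 ^ j div 2"
  define w where "w = cis (2 * pi * of_int k / 2 ^ j)"
  have wN: "w ^ (2 ^ j) = 1"
  proof -
    have "w ^ (2 ^ j) = cis (2 * pi * of_int k)" unfolding w_def Complex.DeMoivre by simp
    also have "\<dots> = 1" by (rule cis_multiple_2pi) auto
    finally show ?thesis .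
  qed
  have "(\<Sum>u\<in>Uset j. cis (2 * pi * of_int k * of_int u / 2 ^ j)) =
      (\<Sum>i<2 ^ j. cis (2 * pi * of_int k * of_int (int i - h) / 2 ^ j))"
    unfolding h_def by (rule sum.reindex_bij_betw[OF Uset_image, symmetric])
  also have "\<dots> = (\<Sum>i<2 ^ j. cis (- (2 * pi * of_int k * of_int h / 2 ^ j)) * w ^ i)"
    unfolding w_def Complex.DeMoivre cis_mult
    by (intro sum.cong refl arg_cong[where f = cis]) (simp add: diff_divide_distrib algebra_simps)
  also have "\<dots> = cis (- (2 * pi * of_int k * of_int h / 2 ^ j)) * (\<Sum>i<2 ^ j. w ^ i)"
    by (simp add: sum_distrib_left)
  finally have *: "(\<Sum>u\<in>Uset j. cis (2 * pi * of_int k * of_int u / 2 ^ j)) =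
      cis (- (2 * pi * of_int k * of_int h / 2 ^ j)) * (\<Sum>i<2 ^ j. w ^ i)" .
  show ?thesis
  proof (cases "2 ^ j dvd k")
    case True
    then obtain m where m: "k = 2 ^ j * m" by blast
    have c1: "cis (2 * pi * of_int k * of_int u / 2 ^ j) = 1" for u :: int
    proof -
      have "cis (2 * pi * of_int k * of_int u / 2 ^ j) = cis (2 * pi * of_int (m * u))"
        unfolding m by (simp add: field_simps)
      also have "\<dots> = 1" by (rule cis_multiple_2pi) auto
      finally show ?thesis .
    qed
    have "card (Uset j) = 2 ^ j" using bij_betw_same_card[OF Uset_image, of j] by simp
    with True show ?thesis by (simp add: c1)
  next
    case False
    have "w \<noteq> 1"
    proof
      assume "w = 1"
      then obtain m :: int where "2 * pi * of_int k / 2 ^ j = of_int m * (2 * pi)"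
        unfolding w_def complex_eq_iff by (auto simp: cos_one_2pi_int)
      then have "real_of_int k = real_of_int (m * 2 ^ j)" by (simp add: field_simps)
      then have "k = m * 2 ^ j" by (simp only: of_int_eq_iff)
      with False show False by simp
    qed
    then have "(\<Sum>i<2 ^ j. w ^ i) = 0" by (simp add: geometric_sum wN)
    with * False show ?thesis by simp
  qed
qed

text \<open>Expanding the square produces the frequencies \<open>m - l\<close>, all smaller than
  \<open>2 ^ j\<close> in absolute value, so by discrete orthogonality only the diagonal survives.
  The squares thus form a partition of unity indexed by the grid.\<close>

lemma sum_Uset_dirichlet:
  "(\<Sum>u\<in>Uset j. (cmod ((1 / 2 ^ j) * (\<Sum>l<2 ^ j. cis (real l * (t - 2 * pi * of_int u / 2 ^ j)))))\<^sup>2) = 1"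
proof -
  let ?N = "2 ^ j :: nat"
  have sq: "complex_of_real ((cmod ((1 / 2 ^ j) * (\<Sum>l<?N. cis (real l * (t - 2 * pi * of_int u / 2 ^ j)))))\<^sup>2)
      = (\<Sum>l<?N. \<Sum>m<?N. 1 / 2 ^ j * (1 / 2 ^ j) * cis ((real l - real m) * t) *
           cis (2 * pi * of_int (int m - int l) * of_int u / 2 ^ j))" for u
  proof -
    have e: "cis (real l * (t - 2 * pi * of_int u / 2 ^ j)) * cis (- (real m * (t - 2 * pi * of_int u / 2 ^ j))) =
        cis ((real l - real m) * t) * cis (2 * pi * of_int (int m - int l) * of_int u / 2 ^ j)" for l m
      unfolding cis_mult by (rule arg_cong[where f = cis]) (simp add: diff_divide_distrib algebra_simps)
    have "complex_of_real ((cmod ((1 / 2 ^ j) * (\<Sum>l<?N. cis (real l * (t - 2 * pi * of_int u / 2 ^ j)))))\<^sup>2)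
      = 1 / 2 ^ j * (1 / 2 ^ j) * (\<Sum>l<?N. \<Sum>m<?N. cis (real l * (t - 2 * pi * of_int u / 2 ^ j)) * cis (- (real m * (t - 2 * pi * of_int u / 2 ^ j))))"
      unfolding complex_norm_square by (simp add: sum_product cis_cnj)
    then show ?thesis unfolding e by (simp only: sum_distrib_left mult.assoc)
  qed
  have "complex_of_real (\<Sum>u\<in>Uset j. (cmod ((1 / 2 ^ j) * (\<Sum>l<?N. cis (real l * (t - 2 * pi * of_int u / 2 ^ j)))))\<^sup>2)
      = (\<Sum>u\<in>Uset j. \<Sum>l<?N. \<Sum>m<?N. 1 / 2 ^ j * (1 / 2 ^ j) * cis ((real l - real m) * t) *
           cis (2 * pi * of_int (int m - int l) * of_int u / 2 ^ j))"
    unfolding of_real_sum sq ..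
  also have "\<dots> = (\<Sum>l<?N. \<Sum>m<?N. 1 / 2 ^ j * (1 / 2 ^ j) * cis ((real l - real m) * t) *
           (\<Sum>u\<in>Uset j. cis (2 * pi * of_int (int m - int l) * of_int u / 2 ^ j)))"
    unfolding sum_distrib_left
    by (subst sum.swap, intro sum.cong refl, subst sum.swap, rule refl)
  also have "\<dots> = (\<Sum>l<?N. \<Sum>m<?N. (if m = l then 1 / 2 ^ j else 0))"
    unfolding sum_Uset_cis
  proof (intro sum.cong refl)
    fix l m assume lm: "l \<in> {..<?N}" "m \<in> {..<?N}"
    have d: "(2 ^ j dvd int m - int l) \<longleftrightarrow> m = l"
    proof
      assume dv: "2 ^ j dvd int m - int l"
      have "\<bar>int m - int l\<bar> < 2 ^ j"
      proof -
        have "int m < int ?N" "int l < int ?N" using lm by (simp_all only: of_nat_less_iff lessThan_iff)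
        then have "int m < 2 ^ j" "int l < 2 ^ j" by simp_all
        then show ?thesis by linarith
      qed
      then show "m = l" using dv dvd_imp_le_int[of "int m - int l" "2 ^ j"] by force
    qed simp
    show "1 / 2 ^ j * (1 / 2 ^ j) * cis ((real l - real m) * t) * (if 2 ^ j dvd int m - int l then 2 ^ j else 0) =
        (if m = l then 1 / 2 ^ j else (0::complex))"
      unfolding d by auto
  qed
  also have "\<dots> = (\<Sum>l<?N. 1 / 2 ^ j)" by (simp add: sum.delta)
  also have "\<dots> = 1" by simp
  finally show ?thesis using of_real_eq_1_iff by blast
qed

text \<open>Localization: near a node \<open>u\<close> the polynomial is multiplied by a power of the normalized
  Dirichlet kernel of the grid, centred at \<open>u\<close>; the squares of these kernels sum to one over the grid.\<close>

lemma sampling_inequality: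
  assumes p: "0 < p"
  shows "\<exists>c>0. \<forall>m j g. 2 ^ j \<le> m \<longrightarrow> trig_poly m g \<longrightarrow>
    (\<Sum>u\<in>Uset j. ennreal (cmod (g (2 * pi * of_int u / 2 ^ j)) powr p))
      \<le> ennreal (c * real m) * (\<integral>\<^sup>+t. ennreal (cmod (g t) powr p) \<partial>circ)"
proof -
  obtain c where c: "c > 0" "\<And>n g x. 1 \<le> n \<Longrightarrow> trig_poly n g \<Longrightarrow>
    ennreal (cmod (g x) powr p) \<le> ennreal (c * real n) * (\<integral>\<^sup>+t. ennreal (cmod (g t) powr p) \<partial>circ)"
    using nikolskii[OF p] by blast
  \<comment> \<open>The exponent is chosen so that \<open>M * p >= 2\<close>; since the normalized
    kernel \<open>D\<close> is at most 1, the \<open>p\<close>-th power of \<open>|D ^ M|\<close> is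
    then dominated by \<open>|D|^2\<close>, which sums to one over the grid.\<close>
  define M where "M = nat \<lceil>2 / p\<rceil>"
  have M: "real M * p \<ge> 2"
  proof -
    have "real M \<ge> 2 / p" unfolding M_def by linarith
    then show ?thesis using p by (simp add: divide_le_eq)
  qed
  show ?thesis
  proof (intro exI[of _ "c * (real M + 1)"] conjI allI impI)
    fix m j :: nat and g :: "real \<Rightarrow> complex"
    assume m: "2 ^ j \<le> m" and g: "trig_poly m g"
    have m1: "1 \<le> m" using m by (meson le_trans one_le_numeral one_le_power)
    define D where "D = (\<lambda>t. (1 / 2 ^ j) * (\<Sum>l<(2::nat) ^ j. cis (real l * t)))"
    define p' where "p' = (\<lambda>u::int. 2 * pi * of_int u / 2 ^ j)"
    have D: "trig_poly m D" unfolding D_def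
    proof (intro trig_poly_cmult trig_poly_sum)
      fix l assume "l \<in> {..<(2::nat) ^ j}"
      then show "trig_poly m (\<lambda>t. cis (real l * t))"
        using m trig_poly_cis[of "int l" m] by simp
    qed
    have D1: "cmod (D t) \<le> 1" for t
    proof -
      have "cmod (\<Sum>l<(2::nat) ^ j. cis (real l * t)) \<le> (\<Sum>l<(2::nat) ^ j. 1)"
        by (rule order_trans[OF norm_sum]) simp
      then show ?thesis unfolding D_def by (simp add: norm_mult norm_divide norm_power)
    qed
    have Dle: "cmod (D t ^ M) powr p \<le> (cmod (D t))\<^sup>2" for t
    proof (cases "D t = 0")
      case True
      then show ?thesis using M by (cases "M = 0") auto
    next
      case False
      have "cmod (D t ^ M) powr p = cmod (D t) powr (real M * p)"
        using False by (simp add: norm_power powr_realpow[symmetric] powr_powr)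
      also have "\<dots> \<le> cmod (D t) powr 2"
        using M D1[of t] by (intro powr_mono') auto
      finally show ?thesis using False by simp
    qed
    have D0: "D 0 = 1" unfolding D_def by simp
    have "(\<Sum>u\<in>Uset j. ennreal (cmod (g (p' u)) powr p)) \<le>
        (\<Sum>u\<in>Uset j. ennreal (c * (real M + 1) * real m) * (\<integral>\<^sup>+t. ennreal (cmod (g t) powr p * (cmod (D (t - p' u)))\<^sup>2) \<partial>circ))"
    proof (intro sum_mono)
      fix u
      \<comment> \<open>The localized polynomial agrees with \<open>g\<close> at the node
        \<open>p' u\<close> because \<open>D 0 = 1\<close>, and its degree grows only by the factor
        \<open>M + 1\<close>. Nikolskii's inequality at that node then yields an integral weighted
        by the localizing factor.\<close>
      have tp: "trig_poly (m + M * m) (\<lambda>t. g t * D (t - p' u) ^ M)"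
        by (intro trig_poly_mult trig_poly_power trig_poly_shift D g)
      have "ennreal (cmod (g (p' u)) powr p) = ennreal (cmod (g (p' u) * D (p' u - p' u) ^ M) powr p)"
        by (simp add: D0)
      also have "\<dots> \<le> ennreal (c * real (m + M * m)) * (\<integral>\<^sup>+t. ennreal (cmod (g t * D (t - p' u) ^ M) powr p) \<partial>circ)"
        using m1 by (intro c(2) tp) simp
      also have "\<dots> \<le> ennreal (c * (real M + 1) * real m) * (\<integral>\<^sup>+t. ennreal (cmod (g t) powr p * (cmod (D (t - p' u)))\<^sup>2) \<partial>circ)"
      proof (rule mult_mono, rule ennreal_leI)
        show "(\<integral>\<^sup>+t. ennreal (cmod (g t * D (t - p' u) ^ M) powr p) \<partial>circ)
          \<le> (\<integral>\<^sup>+t. ennreal (cmod (g t) powr p * (cmod (D (t - p' u)))\<^sup>2) \<partial>circ)"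
        proof (intro nn_integral_mono ennreal_leI)
        fix t
        have "cmod (g t * D (t - p' u) ^ M) powr p = cmod (g t) powr p * cmod (D (t - p' u) ^ M) powr p"
          by (simp add: norm_mult powr_mult)
        also have "\<dots> \<le> cmod (g t) powr p * (cmod (D (t - p' u)))\<^sup>2"
          by (intro mult_left_mono Dle) auto
        finally show "cmod (g t * D (t - p' u) ^ M) powr p \<le> cmod (g t) powr p * (cmod (D (t - p' u)))\<^sup>2" .
        qed
        show "c * real (m + M * m) \<le> c * (real M + 1) * real m" by (simp add: algebra_simps)
      qed simp_all
      finally show "ennreal (cmod (g (p' u)) powr p) \<le> ennreal (c * (real M + 1) * real m) * (\<integral>\<^sup>+t. ennreal (cmod (g t) powr p * (cmod (D (t - p' u)))\<^sup>2) \<partial>circ)" .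
    qed
    also have "\<dots> = ennreal (c * (real M + 1) * real m) * (\<Sum>u\<in>Uset j. \<integral>\<^sup>+t. ennreal (cmod (g t) powr p * (cmod (D (t - p' u)))\<^sup>2) \<partial>circ)"
      by (simp add: sum_distrib_left)
    also have "(\<Sum>u\<in>Uset j. \<integral>\<^sup>+t. ennreal (cmod (g t) powr p * (cmod (D (t - p' u)))\<^sup>2) \<partial>circ) =
        (\<integral>\<^sup>+t. (\<Sum>u\<in>Uset j. ennreal (cmod (g t) powr p * (cmod (D (t - p' u)))\<^sup>2)) \<partial>circ)"
    proof (intro nn_integral_sum[symmetric])
      fix u
      have "continuous_on UNIV (\<lambda>t. cmod (g t) powr p * (cmod (D (t - p' u)))\<^sup>2)"
        using p trig_poly_continuous[OF g] trig_poly_continuous[OF trig_poly_shift[OF D]]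
        by (intro continuous_intros)
      then show "(\<lambda>t. ennreal (cmod (g t) powr p * (cmod (D (t - p' u)))\<^sup>2)) \<in> borel_measurable circ"
        by (intro measurable_compose[OF measurable_circ_cont measurable_ennreal])
    qed
    also have "\<dots> = (\<integral>\<^sup>+t. ennreal (cmod (g t) powr p) \<partial>circ)"
    proof (intro nn_integral_cong)
      fix t
      have "(\<Sum>u\<in>Uset j. ennreal (cmod (g t) powr p * (cmod (D (t - p' u)))\<^sup>2)) =
          ennreal (cmod (g t) powr p * (\<Sum>u\<in>Uset j. (cmod (D (t - p' u)))\<^sup>2))"
        by (simp add: sum_ennreal sum_distrib_left)
      also have "(\<Sum>u\<in>Uset j. (cmod (D (t - p' u)))\<^sup>2) = 1"
        unfolding D_def p'_def by (rule sum_Uset_dirichlet)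
      finally show "(\<Sum>u\<in>Uset j. ennreal (cmod (g t) powr p * (cmod (D (t - p' u)))\<^sup>2)) = ennreal (cmod (g t) powr p)" by simp
    qed
    finally show "(\<Sum>u\<in>Uset j. ennreal (cmod (g (2 * pi * of_int u / 2 ^ j)) powr p))
      \<le> ennreal (c * (real M + 1) * real m) * (\<integral>\<^sup>+t. ennreal (cmod (g t) powr p) \<partial>circ)"
      unfolding p'_def .
  qed (use c in auto)
qed

subsection \<open>The torus\<close>

interpretation torus: product_sigma_finite "\<lambda>_::nat. circ"
  by (simp add: product_sigma_finite_def sigma_finite_circ)

lemma finite_measure_torus: "finite I \<Longrightarrow> finite_measure (PiM I (\<lambda>_::nat. circ))"
proof (rule finite_measureI)
  assume "finite I"
  then interpret finite_product_sigma_finite "\<lambda>_::nat. circ" I by unfold_locales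
  show "emeasure (PiM I (\<lambda>_. circ)) (space (PiM I (\<lambda>_. circ))) \<noteq> \<infinity>"
    unfolding space_PiM
    by (subst measure_times) (auto simp: emeasure_restrict_space ennreal_power sets_restrict_space)
qed

text \<open>Points of the product space are extensional, so a coordinate outside \<open>I\<close> is
  constantly \<open>undefined\<close>. This lets Borel functions on the whole space
  \<open>nat => real\<close> be integrated over any set of coordinates, so that the same function
  can occur at every stage of an induction over coordinates.\<close>

lemma measurable_id_torus: "(\<lambda>x. x) \<in> measurable (PiM I (\<lambda>_::nat. circ)) borel"
proof (rule measurable_coordinatewise_then_product)
  fix i
  show "(\<lambda>x. x i) \<in> borel_measurable (PiM I (\<lambda>_::nat. circ))"
  proof (cases "i \<in> I")
    case True
    have "(\<lambda>x. x) \<in> measurable circ (borel::real measure)"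
      by (rule measurable_circ_cont) (rule continuous_on_id)
    then show ?thesis using True measurable_compose[OF measurable_component_singleton[of i I "\<lambda>_. circ"]] by blast
  next
    case False
    then have "(\<lambda>x. x i) \<in> borel_measurable (PiM I (\<lambda>_::nat. circ)) \<longleftrightarrow>
        (\<lambda>x. undefined :: real) \<in> borel_measurable (PiM I (\<lambda>_::nat. circ))"
      by (intro measurable_cong) (auto simp: space_PiM PiE_def extensional_def)
    then show ?thesis by simp
  qed
qed

lemma measurable_torus: "A \<in> measurable borel N \<Longrightarrow> A \<in> measurable (PiM I (\<lambda>_::nat. circ)) N"
  using measurable_compose[OF measurable_id_torus] by blast

lemma measurable_torus_cont:
  fixes f :: "(nat \<Rightarrow> real) \<Rightarrow> 'b::topological_space"
  shows "continuous_on UNIV f \<Longrightarrow> f \<in> borel_measurable (PiM I (\<lambda>_::nat. circ))"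
  by (rule measurable_torus) (rule borel_measurable_continuous_onI)

lemma continuous_on_fun_upd:
  fixes x :: "nat \<Rightarrow> real"
  shows "continuous_on S (\<lambda>t. x(i := t))"
proof (rule continuous_on_coordinatewise_then_product)
  fix k show "continuous_on S (\<lambda>t. (x(i := t)) k)" by (cases "k = i") auto
qed

lemma continuous_on_coord [continuous_intros]:
  "continuous_on S (\<lambda>x::nat \<Rightarrow> real. x i)"
  by (rule continuous_on_subset[OF continuous_on_product_coordinates subset_UNIV])

lemma measurable_fun_upd_pair:
  "(\<lambda>(x, t). x(i := t)) \<in> measurable (borel \<Otimes>\<^sub>M circ) (borel :: (nat \<Rightarrow> real) measure)"
proof (rule measurable_coordinatewise_then_product)
  fix k
  have 1: "(\<lambda>x. x k) \<in> borel_measurable (borel :: (nat \<Rightarrow> real) measure)"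
    by (intro borel_measurable_continuous_onI continuous_intros)
  have 2: "(\<lambda>t. t) \<in> borel_measurable circ"
    by (intro measurable_circ_cont continuous_intros)
  show "(\<lambda>z. (case z of (x, t) \<Rightarrow> x(i := t)) k) \<in> borel_measurable (borel \<Otimes>\<^sub>M circ)"
    using measurable_compose[OF measurable_fst 1] measurable_compose[OF measurable_snd 2]
    by (cases "k = i") (simp_all add: case_prod_beta)
qed

lemma measurable_circ_integral:
  assumes "A \<in> borel_measurable (borel :: (nat \<Rightarrow> real) measure)"
  shows "(\<lambda>x. \<integral>\<^sup>+t. A (x(i := t)) \<partial>circ) \<in> borel_measurable borel"
proof -
  show ?thesis
    using measurable_compose[OF measurable_fun_upd_pair[of i] assms]
    by (intro sigma_finite_measure.borel_measurable_nn_integral[OF sigma_finite_circ]) (simp add: case_prod_beta)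
qed

lemma measurable_fun_upd_circ:
  assumes "A \<in> borel_measurable (borel :: (nat \<Rightarrow> real) measure)"
  shows "(\<lambda>t. A (x(i := t))) \<in> borel_measurable circ"
  by (rule measurable_compose[OF _ assms]) (intro measurable_circ_cont continuous_on_fun_upd)

lemma nn_integral_torus_insert:
  assumes "finite I" "i \<notin> I" "A \<in> borel_measurable (borel :: (nat \<Rightarrow> real) measure)"
  shows "(\<integral>\<^sup>+x. A x \<partial>PiM (insert i I) (\<lambda>_. circ)) = (\<integral>\<^sup>+x. (\<integral>\<^sup>+t. A (x(i := t)) \<partial>circ) \<partial>PiM I (\<lambda>_. circ))"
  using torus.product_nn_integral_insert[OF assms(1,2) measurable_torus[OF assms(3)]] .

subsection \<open>Uniqueness of Fourier coefficients\<close>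

text \<open>The distance \<open>|t - x0|\<close> may exceed \<open>pi\<close>, where the cosine
  rises again; the condition on \<open>\<delta>\<close> keeps it at most
  \<open>2 * pi - \<delta>\<close>, so the cosine does not climb back above
  \<open>cos \<delta>\<close>.\<close>

lemma cos_gap:
  assumes "0 < \<delta>" "\<delta> \<le> pi - \<bar>x0\<bar>" "t \<in> {-pi..pi}" "cos \<delta> < cos (t - x0)"
  shows "\<bar>t - x0\<bar> < \<delta>"
proof (rule ccontr)
  assume "\<not> \<bar>t - x0\<bar> < \<delta>"
  then have s: "\<delta> \<le> \<bar>t - x0\<bar>" "\<bar>t - x0\<bar> \<le> 2 * pi - \<delta>" using assms by auto
  have "cos \<bar>t - x0\<bar> \<le> cos \<delta>"
  proof (cases "\<bar>t - x0\<bar> \<le> pi")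
    case True
    then show ?thesis using s assms by (intro cos_monotone_0_pi_le) auto
  next
    case False
    have "cos \<bar>t - x0\<bar> = cos (2 * pi - \<bar>t - x0\<bar>)" by (simp add: cos_diff)
    also have "\<dots> \<le> cos \<delta>" using False s assms by (intro cos_monotone_0_pi_le) auto
    finally show ?thesis .
  qed
  then show False using assms(4) by simp
qed

text \<open>A basic neighbourhood in the product topology is a product of open sets. Among the first
  \<open>d\<close> coordinates the radii have a positive minimum, and in the others \<open>x\<close>
  agrees with \<open>x0\<close>.\<close>

lemma continuous_at_first_coords:
  fixes h :: "(nat \<Rightarrow> real) \<Rightarrow> 'a::metric_space"
  assumes "continuous_on UNIV h" "0 < \<epsilon>"
  obtains \<delta> where "\<delta> > 0" "\<And>x. (\<And>i. i < d \<Longrightarrow> \<bar>x i - x0 i\<bar> < \<delta>) \<Longrightarrow> (\<And>i. d \<le> i \<Longrightarrow> x i = x0 i) \<Longrightarrow> dist (h x) (h x0) < \<epsilon>"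
proof -
  have "open (h -` ball (h x0) \<epsilon>)"
    using assms(1) by (intro open_vimage) auto
  then have "openin (product_topology (\<lambda>i. euclidean) UNIV) (h -` ball (h x0) \<epsilon>)"
    by (simp add: open_fun_def)
  from product_topology_open_contains_basis[OF this, of x0]
  obtain X where X: "x0 \<in> (\<Pi>\<^sub>E i\<in>UNIV. X i)" "\<And>i. open (X i)" "(\<Pi>\<^sub>E i\<in>UNIV. X i) \<subseteq> h -` ball (h x0) \<epsilon>"
    using assms(2) by (auto simp: open_openin[symmetric])
  have "\<exists>e>0. ball (x0 i) e \<subseteq> X i" for i
    using X(1,2) open_contains_ball by blast
  then obtain e where e: "\<And>i. e i > 0" "\<And>i. ball (x0 i) (e i) \<subseteq> X i" by metis
  define \<delta> where "\<delta> = Min (insert 1 (e ` {..<d}))"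
  have "\<delta> > 0" unfolding \<delta>_def using e(1) by auto
  moreover have "dist (h x) (h x0) < \<epsilon>"
    if "\<And>i. i < d \<Longrightarrow> \<bar>x i - x0 i\<bar> < \<delta>" "\<And>i. d \<le> i \<Longrightarrow> x i = x0 i" for x
  proof -
    have "x i \<in> X i" for i
    proof (cases "i < d")
      case True
      then have "\<delta> \<le> e i" unfolding \<delta>_def by auto
      then have "x i \<in> ball (x0 i) (e i)" using that(1)[OF True] by (auto simp: dist_real_def)
      then show ?thesis using e(2) by blast
    next
      case False
      then show ?thesis using that(2)[of i] X(1) by auto
    qed
    then have "x \<in> (\<Pi>\<^sub>E i\<in>UNIV. X i)" by (simp add: PiE_def Pi_def)
    then have "x \<in> h -` ball (h x0) \<epsilon>" using X(3) by blast
    then show ?thesis by (simp add: dist_commute)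
  qed
  ultimately show ?thesis using that by blast
qed

lemma prod_cis: "(\<Prod>i\<in>S. cis (f i)) = cis (\<Sum>i\<in>S. f i)"
  by (induction S rule: infinite_finite_induct) (auto simp: cis_mult)

lemma one_plus_cos_nonneg: "0 \<le> (1 + cos x) / (2::real)"
proof -
  have "- 1 \<le> y \<Longrightarrow> 0 \<le> (1 + y) / (2::real)" for y by simp
  then show ?thesis using cos_ge_minus_one by blast
qed

text \<open>A nonnegative polynomial with peak value 1 at \<open>c\<close>. The lower bound for its
  mass is Nikolskii's inequality with exponent 1, read at the peak.\<close>

lemma fourier_kernel:
  defines "Q \<equiv> \<lambda>N c t. ((1 + cos (t - c)) / 2) ^ N"
  shows "trig_poly N (\<lambda>t. complex_of_real (Q N c t))"
    and "2 * pi / (2 * real N + 1) \<le> integral\<^sup>L circ (Q N c)"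
proof -
  have 1: "trig_poly 1 (\<lambda>t. complex_of_real ((1 + cos (t - c)) / 2))"
  proof -
    have "trig_poly 1 (\<lambda>t. 1 / 2 + 1 / 4 * (cis (of_int 1 * (t - c)) + cis (of_int (-1) * (t - c))))"
      by (intro trig_poly_add trig_poly_cmult trig_poly_const trig_poly_shift trig_poly_cis) auto
    moreover have "1 / 2 + 1 / 4 * (cis (of_int 1 * (t - c)) + cis (of_int (-1) * (t - c))) = complex_of_real ((1 + cos (t - c)) / 2)" for t
      using cos_minus[of "t - c"] sin_minus[of "t - c"] by (simp add: complex_eq_iff algebra_simps)
    ultimately show ?thesis by (simp only:)
  qed
  show tp: "trig_poly N (\<lambda>t. complex_of_real (Q N c t))"
    using trig_poly_power[OF 1, of N] unfolding Q_def by simp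
  have nn: "0 \<le> Q N c t" for t
    unfolding Q_def by (intro zero_le_power one_plus_cos_nonneg)
  have "cmod (complex_of_real (Q N c c)) powr 1 \<le> (2 * real N + 1) / (2 * pi) * integral\<^sup>L circ (\<lambda>t. cmod (complex_of_real (Q N c t)) powr 1)"
    by (rule nikolskii_le2[OF tp]) auto
  moreover have "(\<lambda>t. cmod (complex_of_real (Q N c t)) powr 1) = Q N c"
    using nn by (intro ext) (simp only: norm_of_real powr_one abs_of_nonneg abs_ge_zero)
  moreover have "Q N c c = 1" by (simp add: Q_def)
  ultimately have "1 \<le> (2 * real N + 1) / (2 * pi) * integral\<^sup>L circ (Q N c)"
    by simp
  then show "2 * pi / (2 * real N + 1) \<le> integral\<^sup>L circ (Q N c)"
    by (simp add: field_simps)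
qed

lemma integrable_torus_bounded:
  fixes h :: "(nat \<Rightarrow> real) \<Rightarrow> 'b::euclidean_space"
  assumes "finite I" "continuous_on UNIV h" "\<And>x. x \<in> space (PiM I (\<lambda>_. circ)) \<Longrightarrow> norm (h x) \<le> M"
  shows "integrable (PiM I (\<lambda>_. circ)) h"
proof -
  interpret finite_measure "PiM I (\<lambda>_::nat. circ)" by (rule finite_measure_torus[OF assms(1)])
  show ?thesis
    using assms measurable_torus_cont[OF assms(2)]
    by (intro integrable_const_bound[where B = M]) auto
qed

text \<open>An approximate identity argument: the product \<open>P N\<close> of one-dimensional
  kernels peaks at \<open>x0\<close>, and the integral of \<open>h\<close> against it is zero. Away
  from the peak it decays exponentially in \<open>N\<close>, while its mass decays only
  polynomially, so the vanishing averages converge to \<open>h x0\<close>. The point is interior,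
  hence a full neighbourhood of the peak lies in the cube.\<close>

lemma fourier_uniqueness:
  fixes h :: "(nat \<Rightarrow> real) \<Rightarrow> complex"
  assumes cont: "continuous_on UNIV h" and bd: "\<And>x. cmod (h x) \<le> M"
    and zero: "\<And>k. integral\<^sup>L (torus d) (\<lambda>x. h x * cis (- (\<Sum>i<d. of_int (k i) * x i))) = 0"
    and x0: "x0 \<in> extensional {..<d}" "\<And>i. i < d \<Longrightarrow> \<bar>x0 i\<bar> < pi"
  shows "h x0 = 0"
proof -
  let ?T = "PiM {..<d} (\<lambda>_::nat. circ)"
  interpret T: finite_measure ?T by (rule finite_measure_torus) simp
  have T: "torus d = ?T" by (simp add: torus_def)
  have M: "M \<ge> 0" using bd[of x0] norm_ge_zero order_trans by blast
  define Q :: "nat \<Rightarrow> real \<Rightarrow> real \<Rightarrow> real" where "Q = (\<lambda>N c t. ((1 + cos (t - c)) / 2) ^ N)"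
  have Qnn: "0 \<le> Q N c t" and Qle: "Q N c t \<le> 1" for N c t
    unfolding Q_def using one_plus_cos_nonneg[of "t - c"] by (auto intro!: zero_le_power power_le_one)
  have Qcont: "continuous_on S (Q N c)" for S N c
    unfolding Q_def by (intro continuous_intros) auto
  have Qcont': "continuous_on UNIV (\<lambda>x. Q N c (x i))" for N c and i :: nat
    unfolding Q_def by (intro continuous_intros) auto
  define I where "I = (\<lambda>N c. integral\<^sup>L circ (Q N c))"
  have I: "2 * pi / (2 * real N + 1) \<le> I N c" for N c
    unfolding I_def Q_def by (rule fourier_kernel(2))
  have Ipos: "0 < I N c" for N c
  proof -
    have "0 < 2 * pi / (2 * real N + 1)" by (intro divide_pos_pos) auto
    then show ?thesis using I[of N c] by linarith
  qed
  define P where "P = (\<lambda>N x. \<Prod>i<d. Q N (x0 i) (x i))"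
  have Pcont: "continuous_on UNIV (P N)" for N
    unfolding P_def by (intro continuous_on_prod Qcont')
  have Pbd: "0 \<le> P N x" "P N x \<le> 1" for N x
    unfolding P_def using Qnn Qle by (auto intro!: prod_nonneg prod_le_1)
  have Pint: "integral\<^sup>L ?T (P N) = (\<Prod>i<d. I N (x0 i))" for N
    unfolding P_def I_def
    by (rule torus.product_integral_prod[where f = "\<lambda>i. Q N (x0 i)"]) (auto intro!: integrable_circ_cont Qcont)
  \<comment> \<open>\<open>P N\<close> is a trigonometric polynomial in all variables, so the
    integral is a finite combination of Fourier coefficients of \<open>h\<close>.\<close>
  have hP0: "integral\<^sup>L ?T (\<lambda>x. h x * complex_of_real (P N x)) = 0" for N
  proof -
    have "\<forall>i. \<exists>c. (\<lambda>t. complex_of_real (Q N (x0 i) t)) = (\<lambda>t. \<Sum>k\<in>{-int N..int N}. c k * cis (of_int k * t))"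
      using fourier_kernel(1)[of N] unfolding Q_def trig_poly_def by blast
    then obtain c where "\<And>i. (\<lambda>t. complex_of_real (Q N (x0 i) t)) = (\<lambda>t. \<Sum>k\<in>{-int N..int N}. c i k * cis (of_int k * t))"
      using choice[of "\<lambda>i c. (\<lambda>t. complex_of_real (Q N (x0 i) t)) = (\<lambda>t. \<Sum>k\<in>{-int N..int N}. c k * cis (of_int k * t))"] by blast
    then have c: "\<And>i t. complex_of_real (Q N (x0 i) t) = (\<Sum>k\<in>{-int N..int N}. c i k * cis (of_int k * t))"
      by (rule fun_cong)
    have cp: "(\<Prod>i<d. cis (of_int (\<kappa> i) * x i)) = cis (- (\<Sum>i<d. of_int (- \<kappa> i) * x i))" for \<kappa> x
      by (simp add: prod_cis sum_negf)
    have "complex_of_real (P N x) = (\<Sum>\<kappa>\<in>PiE {..<d} (\<lambda>_. {-int N..int N}). (\<Prod>i<d. c i (\<kappa> i)) * cis (- (\<Sum>i<d. of_int (- \<kappa> i) * x i)))" for x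
      unfolding P_def of_real_prod c by (subst prod_sum_PiE) (auto simp: prod.distrib cp)
    then have "integral\<^sup>L ?T (\<lambda>x. h x * complex_of_real (P N x)) =
      integral\<^sup>L ?T (\<lambda>x. \<Sum>\<kappa>\<in>PiE {..<d} (\<lambda>_. {-int N..int N}). (\<Prod>i<d. c i (\<kappa> i)) * (h x * cis (- (\<Sum>i<d. of_int (- \<kappa> i) * x i))))"
      by (simp add: sum_distrib_left mult.left_commute)
    also have "\<dots> = (\<Sum>\<kappa>\<in>PiE {..<d} (\<lambda>_. {-int N..int N}). (\<Prod>i<d. c i (\<kappa> i)) * integral\<^sup>L ?T (\<lambda>x. h x * cis (- (\<Sum>i<d. of_int (- \<kappa> i) * x i))))"
      using cont bd
      by (subst Bochner_Integration.integral_sum)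
        (auto intro!: integrable_mult_right integrable_torus_bounded[where M = M] continuous_intros simp: norm_mult)
    also have "\<dots> = 0"
      using zero[of "\<lambda>i. - \<kappa> i" for \<kappa> :: "nat \<Rightarrow> int"] unfolding T by simp
    finally show ?thesis .
  qed
  have "cmod (h x0) \<le> \<epsilon>" if \<epsilon>: "\<epsilon> > 0" for \<epsilon>
  proof -
    obtain \<delta>0 where \<delta>0: "\<delta>0 > 0" "\<And>x. (\<And>i. i < d \<Longrightarrow> \<bar>x i - x0 i\<bar> < \<delta>0) \<Longrightarrow> (\<And>i. d \<le> i \<Longrightarrow> x i = x0 i) \<Longrightarrow> dist (h x) (h x0) < \<epsilon>"
      by (rule continuous_at_first_coords[OF cont \<epsilon>, of d x0]) blast
    define \<delta> where "\<delta> = Min (insert (min \<delta>0 pi) ((\<lambda>i. pi - \<bar>x0 i\<bar>) ` {..<d}))"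
    have "\<delta> \<le> min \<delta>0 pi" unfolding \<delta>_def by (intro Min_le) auto
    moreover have "0 < \<delta>" unfolding \<delta>_def using x0(2) \<delta>0(1) by auto
    ultimately have \<delta>: "0 < \<delta>" "\<delta> \<le> \<delta>0" "\<delta> \<le> pi" by auto
    have \<delta>i: "\<delta> \<le> pi - \<bar>x0 i\<bar>" if "i < d" for i
      unfolding \<delta>_def using that by auto
    define \<rho> where "\<rho> = (1 + cos \<delta>) / 2"
    have \<rho>: "0 \<le> \<rho>" "\<rho> < 1"
    proof -
      have "cos \<delta> < cos 0" using \<delta> by (intro cos_monotone_0_pi) auto
      then show "\<rho> < 1" unfolding \<rho>_def by simp
      show "0 \<le> \<rho>" unfolding \<rho>_def using one_plus_cos_nonneg[of \<delta>] by blast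
    qed
    \<comment> \<open>\<open>R N i\<close> bounds \<open>P N\<close> at points that are far from
      \<open>x0\<close> in direction \<open>i\<close>: that factor is at most
      \<open>\<rho> ^ N\<close>, the other factors are kept. The remaining product still has almost
      the mass of \<open>P N\<close>, up to one factor \<open>I N (x0 i)\<close>.\<close>
    define R where "R = (\<lambda>N i x. \<rho> ^ N * (\<Prod>k<d. if k = i then 1 else Q N (x0 k) (x k)))"
    have Rint: "integral\<^sup>L ?T (R N i) = \<rho> ^ N * (2 * pi * (\<Prod>k\<in>{..<d} - {i}. I N (x0 k)))" if "i < d" for N i
    proof -
      have 1: "integral\<^sup>L circ (\<lambda>t. if k = i then 1 else Q N (x0 k) t) = (if k = i then 2 * pi else I N (x0 k))" for k
        by (auto simp: I_def measure_restrict_space)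
      have "continuous_on UNIV (\<lambda>t. if k = i then 1 else Q N (x0 k) t)" for k
        using Qcont by (cases "k = i") auto
      note Qc = this
      have "integral\<^sup>L ?T (\<lambda>x. \<Prod>k<d. (if k = i then 1 else Q N (x0 k) (x k))) = (\<Prod>k<d. integral\<^sup>L circ (\<lambda>t. if k = i then 1 else Q N (x0 k) t))"
        by (rule torus.product_integral_prod[where f = "\<lambda>k t. if k = i then 1 else Q N (x0 k) t"])
           (auto intro!: integrable_circ_cont Qc)
      also have "\<dots> = (\<Prod>k<d. (if k = i then 2 * pi else I N (x0 k)))" unfolding 1 ..
      also have "\<dots> = 2 * pi * (\<Prod>k\<in>{..<d} - {i}. I N (x0 k))"
        using that by (subst prod.remove[of _ i]) auto
      finally show ?thesis unfolding R_def by simp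
    qed
    have Rnn: "0 \<le> R N i x" for N i x
      unfolding R_def using \<rho> Qnn by (auto intro!: mult_nonneg_nonneg prod_nonneg)
    have Rbd: "R N i x \<le> 1" for N i x
      unfolding R_def using \<rho> Qnn Qle by (intro mult_le_one prod_nonneg prod_le_1 power_le_one) auto
    have Rcont: "continuous_on UNIV (R N i)" for N i
    proof -
      have "continuous_on UNIV (\<lambda>x. if k = i then 1 else Q N (x0 k) (x k))" for k
        using Qcont' by (cases "k = i") auto
      then show ?thesis
        unfolding R_def by (intro continuous_on_mult continuous_on_const continuous_on_prod)
    qed
    have ptw: "cmod (h x - h x0) * P N x \<le> \<epsilon> * P N x + 2 * M * (\<Sum>i<d. R N i x)" if x: "x \<in> space ?T" for N x
    proof (cases "\<forall>i<d. cos \<delta> < cos (x i - x0 i)")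
      case True
      have "dist (h x) (h x0) < \<epsilon>"
      proof (rule \<delta>0(2))
        fix i assume i: "i < d"
        have "x i \<in> {-pi..pi}" using x i by (auto simp: space_PiM PiE_def Pi_def)
        then have "\<bar>x i - x0 i\<bar> < \<delta>" using cos_gap[OF \<delta>(1) \<delta>i[OF i]] True i by blast
        then show "\<bar>x i - x0 i\<bar> < \<delta>0" using \<delta> by simp
      next
        fix i assume "d \<le> i"
        then show "x i = x0 i" using x x0(1) by (auto simp: space_PiM PiE_def extensional_def)
      qed
      then have "cmod (h x - h x0) * P N x \<le> \<epsilon> * P N x"
        using Pbd by (intro mult_right_mono) (auto simp: dist_norm)
      then show ?thesis using M Rnn by (simp add: sum_nonneg add_increasing2)
    next
      case False
      then obtain i where i: "i < d" "cos (x i - x0 i) \<le> cos \<delta>" by force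
      have "P N x = Q N (x0 i) (x i) * (\<Prod>k\<in>{..<d} - {i}. Q N (x0 k) (x k))"
        unfolding P_def using i by (subst prod.remove[of _ i]) auto
      also have "\<dots> \<le> \<rho> ^ N * (\<Prod>k\<in>{..<d} - {i}. Q N (x0 k) (x k))"
      proof (intro mult_right_mono prod_nonneg)
        show "Q N (x0 i) (x i) \<le> \<rho> ^ N"
          unfolding Q_def \<rho>_def using i one_plus_cos_nonneg[of "x i - x0 i"] by (intro power_mono) auto
      qed (use Qnn in auto)
      also have "\<dots> = R N i x"
        unfolding R_def using i by (subst prod.remove[of _ i]) auto
      also have "\<dots> \<le> (\<Sum>i<d. R N i x)"
        using i Rnn by (intro member_le_sum) auto
      finally have PR: "P N x \<le> (\<Sum>i<d. R N i x)" .
      have "cmod (h x - h x0) \<le> 2 * M"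
        using norm_triangle_ineq4[of "h x" "h x0"] bd[of x] bd[of x0] by linarith
      then have "cmod (h x - h x0) * P N x \<le> 2 * M * (\<Sum>i<d. R N i x)"
        using PR Pbd M by (intro mult_mono) auto
      then show ?thesis using Pbd[of N x] \<epsilon> by (simp add: add_increasing)
    qed
    \<comment> \<open>Dividing by the mass of \<open>P N\<close> costs at most
      \<open>2 * N + 1\<close> for the missing factor in each \<open>R N i\<close>, which
      \<open>\<rho> ^ N\<close> overcomes as \<open>N\<close> grows.\<close>
    have main: "cmod (h x0) \<le> \<epsilon> + 2 * M * real d * ((2 * real N + 1) * \<rho> ^ N)" for N
    proof -
      let ?\<Pi> = "\<Prod>i<d. I N (x0 i)"
      have \<Pi>: "?\<Pi> > 0" using Ipos by (intro prod_pos) auto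
      have intP: "integrable ?T (P N)"
        using Pcont Pbd by (intro integrable_torus_bounded[where M = 1]) auto
      have intR: "integrable ?T (R N i)" for i
        using Rcont Rbd Rnn by (intro integrable_torus_bounded[where M = 1]) auto
      have inthP: "integrable ?T (\<lambda>x. h x * complex_of_real (P N x))"
        using cont Pcont bd Pbd M
        by (intro integrable_torus_bounded[where M = "M * 1"] continuous_intros)
           (auto simp: norm_mult simp del: mult_1_right intro!: mult_mono)
      have "h x0 * complex_of_real ?\<Pi> = integral\<^sup>L ?T (\<lambda>x. h x0 * complex_of_real (P N x)) - integral\<^sup>L ?T (\<lambda>x. h x * complex_of_real (P N x))"
        using intP by (simp add: hP0 Pint)
      also have "\<dots> = integral\<^sup>L ?T (\<lambda>x. h x0 * complex_of_real (P N x) - h x * complex_of_real (P N x))"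
        using intP inthP by (subst Bochner_Integration.integral_diff) auto
      finally have e: "h x0 * complex_of_real ?\<Pi> = integral\<^sup>L ?T (\<lambda>x. (h x0 - h x) * complex_of_real (P N x))"
        by (simp add: left_diff_distrib)
      have "cmod (h x0) * ?\<Pi> = cmod (h x0 * complex_of_real ?\<Pi>)"
        using \<Pi> by (simp only: norm_mult norm_of_real abs_of_pos)
      also have "\<dots> \<le> integral\<^sup>L ?T (\<lambda>x. cmod ((h x0 - h x) * complex_of_real (P N x)))"
        unfolding e by (rule integral_norm_bound)
      also have "\<dots> \<le> integral\<^sup>L ?T (\<lambda>x. \<epsilon> * P N x + 2 * M * (\<Sum>i<d. R N i x))"
      proof (rule integral_mono)
        show "integrable ?T (\<lambda>x. cmod ((h x0 - h x) * complex_of_real (P N x)))"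
          using intP inthP by (intro integrable_norm) (simp add: left_diff_distrib)
        show "integrable ?T (\<lambda>x. \<epsilon> * P N x + 2 * M * (\<Sum>i<d. R N i x))"
          using intP intR by auto
        fix x assume "x \<in> space ?T"
        then show "cmod ((h x0 - h x) * complex_of_real (P N x)) \<le> \<epsilon> * P N x + 2 * M * (\<Sum>i<d. R N i x)"
          using ptw[of x N] Pbd[of N x] by (simp add: norm_mult norm_minus_commute)
      qed
      also have "\<dots> = \<epsilon> * ?\<Pi> + 2 * M * (\<Sum>i<d. \<rho> ^ N * (2 * pi * (\<Prod>k\<in>{..<d} - {i}. I N (x0 k))))"
        using intP intR by (simp add: Pint Rint)
      also have "\<dots> \<le> \<epsilon> * ?\<Pi> + 2 * M * (\<Sum>i<d. \<rho> ^ N * ((2 * real N + 1) * ?\<Pi>))"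
      proof (intro add_left_mono mult_left_mono sum_mono)
        fix i assume "i \<in> {..<d}"
        then have "?\<Pi> = I N (x0 i) * (\<Prod>k\<in>{..<d} - {i}. I N (x0 k))"
          by (subst prod.remove[of _ i]) auto
        moreover have "2 * pi \<le> (2 * real N + 1) * I N (x0 i)"
          using I[of N "x0 i"] by (simp add: pos_divide_le_eq mult.commute add_nonneg_pos)
        moreover have "0 \<le> (\<Prod>k\<in>{..<d} - {i}. I N (x0 k))"
          using Ipos by (intro prod_nonneg) (auto intro: less_imp_le)
        ultimately show "2 * pi * (\<Prod>k\<in>{..<d} - {i}. I N (x0 k)) \<le> (2 * real N + 1) * ?\<Pi>"
          by (metis mult.assoc mult_right_mono)
      qed (use \<rho> M in auto)
      also have "\<dots> = (\<epsilon> + 2 * M * real d * ((2 * real N + 1) * \<rho> ^ N)) * ?\<Pi>"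
        by (simp add: algebra_simps)
      finally show ?thesis using \<Pi> by (simp add: mult_le_cancel_right)
    qed
    have "(\<lambda>N. real N * \<rho> ^ N) \<longlonglongrightarrow> 0"
      by (rule powser_times_n_limit_0) (use \<rho> in simp)
    moreover have "(\<lambda>N. \<rho> ^ N) \<longlonglongrightarrow> 0" using \<rho> by (intro LIMSEQ_power_zero) auto
    ultimately have "(\<lambda>N. \<epsilon> + 2 * M * real d * (2 * (real N * \<rho> ^ N) + \<rho> ^ N)) \<longlonglongrightarrow> \<epsilon> + 2 * M * real d * (2 * 0 + 0)"
      by (intro tendsto_add tendsto_mult tendsto_const)
    then have "(\<lambda>N. \<epsilon> + 2 * M * real d * ((2 * real N + 1) * \<rho> ^ N)) \<longlonglongrightarrow> \<epsilon>"
      by (simp add: algebra_simps)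
    then show ?thesis
      using main by (intro LIMSEQ_le_const) auto
  qed
  then have "cmod (h x0) \<le> 0" by (rule_tac field_le_epsilon) simp
  then show ?thesis by simp
qed

lemma integral_circ_eq:
  fixes g :: "real \<Rightarrow> 'b::euclidean_space"
  assumes "continuous_on UNIV g"
  shows "integral\<^sup>L circ g = integral {-pi..pi} g"
proof -
  have "set_integrable lborel {-pi..pi} g"
    using integrable_circ_cont[OF assms] unfolding set_integrable_def
    by (subst (asm) integrable_restrict_space) auto
  from set_borel_integral_eq_integral(2)[OF this] show ?thesis
    unfolding set_lebesgue_integral_def by (subst integral_restrict_space) auto
qed

text \<open>The case \<open>d = 1\<close> settles the open interval and continuity extends it to the
  closed one. The endpoints matter: Poisson summation uses them for
  \<open>|\<xi>| = 1 / 2\<close>.\<close>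

lemma fourier_uniqueness_interval:
  fixes g :: "real \<Rightarrow> complex"
  assumes cont: "continuous_on UNIV g" and bd: "\<And>t. cmod (g t) \<le> M"
    and zero: "\<And>k::int. integral {-pi..pi} (\<lambda>t. g t * cis (- of_int k * t)) = 0"
    and t: "t \<in> {-pi..pi}"
  shows "g t = 0"
proof -
  have inner: "g s = 0" if s: "\<bar>s\<bar> < pi" for s
  proof -
    have "(\<lambda>x. g (x 0)) ((\<lambda>_::nat. undefined)(0 := s)) = 0"
    proof (rule fourier_uniqueness[where d = 1 and M = M and h = "\<lambda>x. g (x 0)" and ?x0.0 = "(\<lambda>_. undefined)(0 := s)"])
      show "continuous_on UNIV (\<lambda>x::nat \<Rightarrow> real. g (x 0))"
        by (rule continuous_on_compose2[OF cont]) (auto intro!: continuous_intros)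
      fix k :: "nat \<Rightarrow> int"
      have c: "continuous_on UNIV (\<lambda>t. g t * cis (- of_int (k 0) * t))"
        by (intro continuous_intros cont)
      have "integral\<^sup>L (torus 1) (\<lambda>x. g (x 0) * cis (- (\<Sum>i<1. of_int (k i) * x i)))
          = integral\<^sup>L (PiM {0::nat} (\<lambda>_. circ)) (\<lambda>x. (\<lambda>t. g t * cis (- of_int (k 0) * t)) (x 0))"
        by (simp add: torus_def lessThan_Suc)
      also have "\<dots> = integral\<^sup>L circ (\<lambda>t. g t * cis (- of_int (k 0) * t))"
        by (rule torus.product_integral_singleton) (rule measurable_circ_cont[OF c])
      also have "\<dots> = 0" using integral_circ_eq[OF c] zero[of "k 0"] by simp
      finally show "integral\<^sup>L (torus 1) (\<lambda>x. g (x 0) * cis (- (\<Sum>i<1. of_int (k i) * x i))) = 0" .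
    qed (use bd s in \<open>auto simp: extensional_def\<close>)
    then show ?thesis by simp
  qed
  have "{-pi..pi} = closure {-pi<..<pi}" by simp
  moreover have "g s = 0" if "s \<in> closure {-pi<..<pi}" for s
    by (rule continuous_constant_on_closure[OF continuous_on_subset[OF cont] _ that]) (auto intro: inner)
  ultimately show ?thesis using t by blast
qed

subsection \<open>The kernel\<close>

lemma abs_sinc_le_1: "\<bar>sinc x\<bar> \<le> 1"
  by (auto simp: sinc_def abs_divide divide_le_eq_1 abs_sin_x_le_abs_x)

lemma abs_sinc_le_inverse: "x \<noteq> 0 \<Longrightarrow> \<bar>sinc x\<bar> \<le> 1 / \<bar>x\<bar>"
  by (auto simp: sinc_def abs_divide intro!: divide_right_mono)

text \<open>The factor \<open>sinc (h * x)\<close> is the Fourier transform of the normalized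
  indicator of \<open>[-h, h]\<close>. Each factor of \<open>KL\<close> therefore acts as an
  averaging on the frequency side.\<close>

lemma sinc_average:
  assumes "0 < h"
  shows "complex_of_real (sinc (h * x)) = 1 / (2 * h) * integral {-h..h} (\<lambda>\<omega>. cis (\<omega> * x))"
proof (cases "x = 0")
  case True
  then show ?thesis using assms by (simp add: sinc_def scaleR_conv_of_real)
next
  case False
  define F where "F = (\<lambda>\<omega>. cis (\<omega> * x) / (\<i> * of_real x))"
  have "((\<lambda>\<omega>. cis (\<omega> * x)) has_integral (F h - F (-h))) {-h..h}"
  proof (rule fundamental_theorem_of_calculus)
    fix \<omega> :: real
    have "((\<lambda>z. exp (\<i> * z * of_real x) / (\<i> * of_real x)) has_field_derivative exp (\<i> * of_real \<omega> * of_real x)) (at (of_real \<omega>))"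
      using False by (auto intro!: derivative_eq_intros)
    from has_vector_derivative_real_field[OF this]
    show "(F has_vector_derivative cis (\<omega> * x)) (at \<omega> within {-h..h})"
      unfolding F_def by (simp add: cis_conv_exp mult.assoc)
  qed (use assms in simp)
  then have "integral {-h..h} (\<lambda>\<omega>. cis (\<omega> * x)) = F h - F (-h)" by (rule integral_unique)
  also have "\<dots> = complex_of_real (2 * sin (h * x) / x)"
    using False by (simp add: F_def complex_eq_iff Re_divide Im_divide field_simps power2_eq_square)
  finally show ?thesis using False assms by (simp add: sinc_def)
qed

text \<open>A discrete version of \<^term>\<open>min 1 (1 / \<bar>t\<bar>)\<close> that majorizes all kernels.\<close>

definition decay :: "real \<Rightarrow> real" where
  "decay t = 1 / max 1 \<bar>t\<bar>"

lemma decay_bounds: "0 < decay t" "decay t \<le> 1"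
  by (auto simp: decay_def)

text \<open>Each sinc factor decays to first order, which gives order \<open>L\<close> in total.
  Writing the argument as \<open>2 * pi * t\<close> turns the lattice of translates into the
  integers.\<close>

lemma abs_KL_le:
  "\<bar>KL L (2 * pi * t)\<bar> \<le> (\<Prod>l\<in>{1..L}. 2 ^ l) * decay t ^ L"
proof -
  have "\<bar>KL L (2 * pi * t)\<bar> = (\<Prod>l\<in>{1..L}. \<bar>sinc (2 * pi * t / 2 ^ l)\<bar>)"
    by (simp add: KL_def abs_prod)
  also have "\<dots> \<le> (\<Prod>l\<in>{1..L}. 2 ^ l * decay t)"
  proof (intro prod_mono conjI)
    fix l assume "l \<in> {1..L}"
    show "\<bar>sinc (2 * pi * t / 2 ^ l)\<bar> \<le> 2 ^ l * decay t"
    proof (cases "\<bar>t\<bar> \<le> 1")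
      case True
      then have "decay t = 1" by (simp add: decay_def)
      then show ?thesis
        using order_trans[OF abs_sinc_le_1, of "2 ^ l"] by (simp add: one_le_power)
    next
      case False
      then have "\<bar>sinc (2 * pi * t / 2 ^ l)\<bar> \<le> 1 / \<bar>2 * pi * t / 2 ^ l\<bar>"
        by (intro abs_sinc_le_inverse) auto
      also have "\<dots> = 2 ^ l * (1 / (2 * pi)) * (1 / \<bar>t\<bar>)"
        using False by (simp add: abs_mult field_simps)
      also have "\<dots> \<le> 2 ^ l * 1 * (1 / \<bar>t\<bar>)"
        using pi_gt3 by (intro mult_right_mono mult_left_mono) auto
      finally show ?thesis using False by (simp add: decay_def)
    qed
  qed auto
  finally show ?thesis by (simp add: prod.distrib)
qed

text \<open>Uniformity in \<open>y\<close> comes from counting integers by their distance from the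
  floor of \<open>y\<close>: each distance occurs at most twice, so two copies of the series over
  \<open>k^(-s)\<close> dominate.\<close>

lemma lattice_sum_bound:
  assumes "1 < s"
  shows "\<exists>C>0. \<forall>y Z. finite Z \<longrightarrow> (\<Sum>z\<in>Z. decay (y - of_int z) powr s) \<le> C"
proof -
  define a where "a = (\<lambda>k::nat. 3 powr s * real (Suc k) powr (- s))"
  have "summable (\<lambda>k::nat. real k powr (- s))"
    using assms by (simp add: summable_real_powr_iff)
  then have sa: "summable a"
    unfolding a_def by (intro summable_mult) (subst summable_Suc_iff)
  have a0: "0 \<le> a k" for k by (simp add: a_def)
  have le: "(\<Sum>z\<in>Z. decay (y - of_int z) powr s) \<le> 2 * suminf a" if Z: "finite Z" for y :: real and Z :: "int set"
  proof -
    define n where "n = (\<lambda>z. z - \<lfloor>y\<rfloor>)"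
    have pt: "decay (y - of_int z) powr s \<le> a (nat \<bar>n z\<bar>)" for z
    proof -
      have "real_of_int \<bar>n z\<bar> - 1 \<le> \<bar>y - of_int z\<bar>" unfolding n_def by linarith
      \<comment> \<open>The 1 lost to the floor is absorbed by the factor 3: up to
        \<open>m = 2\<close> the left side is at most 1, and from there on \<open>m - 1\<close> is
        the larger one.\<close>
      moreover have "(m + 1) / 3 \<le> max 1 (m - 1)" for m :: real
        by (auto simp: max_def field_simps)
      ultimately have "(real_of_int \<bar>n z\<bar> + 1) / 3 \<le> max 1 \<bar>y - of_int z\<bar>"
        by (meson max.mono order_refl order_trans)
      then have "decay (y - of_int z) \<le> 1 / ((real_of_int \<bar>n z\<bar> + 1) / 3)"
        unfolding decay_def by (intro divide_left_mono) auto
      then have "decay (y - of_int z) powr s \<le> (3 * (1 / real (Suc (nat \<bar>n z\<bar>)))) powr s"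
        using assms decay_bounds(1)[of "y - of_int z"] by (intro powr_mono2) (auto simp: add.commute)
      also have "\<dots> = a (nat \<bar>n z\<bar>)"
        unfolding a_def by (simp add: powr_mult powr_minus_divide powr_divide)
      finally show ?thesis .
    qed
    have half: "(\<Sum>z\<in>Z'. a (nat \<bar>n z\<bar>)) \<le> suminf a" if "finite Z'" "inj_on (\<lambda>z. nat \<bar>n z\<bar>) Z'" for Z'
    proof -
      have "(\<Sum>z\<in>Z'. a (nat \<bar>n z\<bar>)) = sum a ((\<lambda>z. nat \<bar>n z\<bar>) ` Z')"
        using that by (simp add: sum.reindex o_def)
      also have "\<dots> \<le> suminf a" using that sa a0 by (intro sum_le_suminf) auto
      finally show ?thesis .
    qed
    have "(\<Sum>z\<in>Z. decay (y - of_int z) powr s) \<le> (\<Sum>z\<in>Z. a (nat \<bar>n z\<bar>))"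
      by (intro sum_mono pt)
    also have "\<dots> = (\<Sum>z\<in>{z\<in>Z. 0 \<le> n z}. a (nat \<bar>n z\<bar>)) + (\<Sum>z\<in>{z\<in>Z. \<not> 0 \<le> n z}. a (nat \<bar>n z\<bar>))"
      using Z by (subst sum.union_disjoint[symmetric]) (auto intro: sum.cong)
    also have "\<dots> \<le> suminf a + suminf a"
      using Z by (intro add_mono half) (auto simp: inj_on_def n_def)
    finally show ?thesis by simp
  qed
  have "0 < suminf a"
    using suminf_pos[OF sa] by (simp add: a_def)
  with le show ?thesis by (intro exI[of _ "2 * suminf a"]) auto
qed

text \<open>For \<open>L >= 2\<close> the decay is of order at least 2 and hence absolutely summable
  over a lattice. The kernel for \<open>L = 1\<close> is a Dirichlet kernel and is treated by
  explicit formulas instead.\<close>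

lemma summable_KL:
  assumes "2 \<le> L"
  shows "(\<lambda>v::int. \<bar>KL L (y - 2 * pi * of_int v)\<bar>) summable_on UNIV"
proof -
  define c where "c = (\<Prod>l\<in>{1..L}. (2::real) ^ l)"
  have c: "c > 0" unfolding c_def by (intro prod_pos) auto
  obtain C where C: "C > 0" "\<And>y (Z::int set). finite Z \<Longrightarrow> (\<Sum>z\<in>Z. decay (y - of_int z) powr (real L)) \<le> C"
    using lattice_sum_bound[of "real L"] assms by auto
  show ?thesis
  proof (rule nonneg_bounded_partial_sums_imp_summable_on[where C = "c * C"])
    show "\<forall>\<^sub>F X in finite_subsets_at_top UNIV. (\<Sum>v\<in>X. \<bar>KL L (y - 2 * pi * of_int v)\<bar>) \<le> c * C"
    proof (rule eventually_finite_subsets_at_top_weakI)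
      fix X :: "int set" assume X: "finite X"
      have "\<bar>KL L (y - 2 * pi * of_int v)\<bar> \<le> c * decay (y / (2 * pi) - of_int v) powr (real L)" for v :: int
        using abs_KL_le[of L "y / (2 * pi) - of_int v"] decay_bounds(1)[of "y / (2 * pi) - of_int v"]
        by (simp add: c_def powr_realpow right_diff_distrib)
      then have "(\<Sum>v\<in>X. \<bar>KL L (y - 2 * pi * of_int v)\<bar>) \<le> (\<Sum>v\<in>X. c * decay (y / (2 * pi) - of_int v) powr (real L))"
        by (intro sum_mono)
      also have "\<dots> \<le> c * C"
        unfolding sum_distrib_left[symmetric] using C(2)[OF X] c by (intro mult_left_mono) auto
      finally show "(\<Sum>v\<in>X. \<bar>KL L (y - 2 * pi * of_int v)\<bar>) \<le> c * C" .
    qed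
  qed simp
qed


subsection \<open>Poisson summation for the kernel\<close>

lemma uniform_limit_infsum_cis:
  fixes K :: "int \<Rightarrow> real" and f :: "int \<Rightarrow> real \<Rightarrow> complex"
  assumes "(\<lambda>v. \<bar>K v\<bar>) summable_on UNIV" "\<And>v t. cmod (f v t) \<le> \<bar>K v\<bar>"
  shows "uniform_limit UNIV (\<lambda>X t. \<Sum>v\<in>X. f v t) (\<lambda>t. \<Sum>\<^sub>\<infinity>v. f v t) (finite_subsets_at_top UNIV)"
    and "\<And>t. (\<lambda>v. f v t) summable_on UNIV"
    and "\<And>t. cmod (\<Sum>\<^sub>\<infinity>v. f v t) \<le> (\<Sum>\<^sub>\<infinity>v. \<bar>K v\<bar>)"
proof -
  show "uniform_limit UNIV (\<lambda>X t. \<Sum>v\<in>X. f v t) (\<lambda>t. \<Sum>\<^sub>\<infinity>v. f v t) (finite_subsets_at_top UNIV)"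
    by (rule Weierstrass_m_test_general[OF _ assms(1)]) (use assms in auto)
  show s: "(\<lambda>v. f v t) summable_on UNIV" for t
    by (rule abs_summable_summable, rule summable_on_comparison_test[OF assms(1)]) (use assms in auto)
  have "(\<lambda>v. norm (f v t)) summable_on UNIV" for t
    by (rule summable_on_comparison_test[OF assms(1)]) (use assms in auto)
  then show "cmod (\<Sum>\<^sub>\<infinity>v. f v t) \<le> (\<Sum>\<^sub>\<infinity>v. \<bar>K v\<bar>)" for t
    using norm_infsum_bound[of "\<lambda>v. f v t" UNIV] infsum_mono[of "\<lambda>v. norm (f v t)" UNIV "\<lambda>v. \<bar>K v\<bar>"] assms
    by (meson order_trans)
qed

text \<open>The M-test makes the series converge uniformly, which gives continuity of the sum and
  integration term by term.\<close>

lemma integral_infsum_cis: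
  fixes K :: "int \<Rightarrow> real" and f :: "int \<Rightarrow> real \<Rightarrow> complex"
  assumes "(\<lambda>v. \<bar>K v\<bar>) summable_on UNIV" "\<And>v t. cmod (f v t) \<le> \<bar>K v\<bar>"
    and "\<And>v. continuous_on UNIV (f v)"
  shows "continuous_on UNIV (\<lambda>t. \<Sum>\<^sub>\<infinity>v. f v t)"
    and "((\<lambda>v. integral {a..b} (f v)) has_sum integral {a..b} (\<lambda>t. \<Sum>\<^sub>\<infinity>v. f v t)) UNIV"
proof -
  note u = uniform_limit_infsum_cis(1)[of K f, OF assms(1,2)]
  show "continuous_on UNIV (\<lambda>t. \<Sum>\<^sub>\<infinity>v. f v t)"
    by (rule uniform_limit_theorem[OF _ u]) (auto intro!: always_eventually continuous_on_sum assms)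
  have c: "continuous_on {a..b} (f v)" for v by (rule continuous_on_subset[OF assms(3)]) simp
  have "uniform_limit (cbox a b) (\<lambda>X t. \<Sum>v\<in>X. f v t) (\<lambda>t. \<Sum>\<^sub>\<infinity>v. f v t) (finite_subsets_at_top UNIV)"
    by (rule uniform_limit_on_subset[OF u]) simp
  from uniform_limit_integral_cbox[OF this]
  obtain I J where IJ: "\<And>X. ((\<lambda>t. \<Sum>v\<in>X. f v t) has_integral I X) (cbox a b)"
    "((\<lambda>t. \<Sum>\<^sub>\<infinity>v. f v t) has_integral J) (cbox a b)" "(I \<longlongrightarrow> J) (finite_subsets_at_top UNIV)"
    using c by (auto intro!: continuous_on_sum)
  have "I X = (\<Sum>v\<in>X. integral {a..b} (f v))" if "finite X" for X
  proof -
    have "I X = integral {a..b} (\<lambda>t. \<Sum>v\<in>X. f v t)"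
      using integral_unique[OF IJ(1)[of X]] by simp
    also have "\<dots> = (\<Sum>v\<in>X. integral {a..b} (f v))"
      using that c by (intro integral_sum integrable_continuous_interval)
    finally show ?thesis .
  qed
  then have "((\<lambda>X. \<Sum>v\<in>X. integral {a..b} (f v)) \<longlongrightarrow> J) (finite_subsets_at_top UNIV)"
    using IJ(3) by (rule_tac Lim_transform_eventually[of I]) (auto intro: eventually_finite_subsets_at_top_weakI)
  moreover have "J = integral {a..b} (\<lambda>t. \<Sum>\<^sub>\<infinity>v. f v t)"
    using integral_unique[OF IJ(2)] by simp
  ultimately show "((\<lambda>v. integral {a..b} (f v)) has_sum integral {a..b} (\<lambda>t. \<Sum>\<^sub>\<infinity>v. f v t)) UNIV"
    by (simp add: has_sum_def)
qed

text \<open>The convolution of the normalized indicators of \<open>[-1/2, 1/2]\<close> and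
  \<open>[-1/4, 1/4]\<close>, that is, the frequency profile of \<open>KL 2\<close>: it equals 1 up
  to \<open>|t| = 1/4\<close> and vanishes from \<open>|t| = 3/4\<close> on.\<close>

definition trapezoid :: "real \<Rightarrow> real" where
  "trapezoid t = max 0 (min 1 (2 * (3 / 4 - \<bar>t\<bar>)))"

text \<open>Splitting into ramps reduces the Fourier integral of the trapezoid to four instances of
  a single integration.\<close>

lemma trapezoid_ramps:
  "trapezoid t = 2 * (max 0 (t + 3 / 4) - max 0 (t + 1 / 4) - max 0 (t - 1 / 4) + max 0 (t - 3 / 4))"
  unfolding trapezoid_def by (auto simp: max_def min_def abs_if)

lemma continuous_trapezoid: "continuous_on S trapezoid"
  unfolding trapezoid_def by (intro continuous_intros)

text \<open>The interval \<open>[-3/2, 3/2]\<close> is the union of the three unit periods around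
  -1, 0 and 1, as it occurs in \<open>integral_periodization\<close>. Ramps do not vanish at its
  right end, which accounts for the boundary terms.\<close>

lemma ramp_integral:
  assumes "\<bar>a\<bar> \<le> 3 / 2" "z \<noteq> 0"
  shows "((\<lambda>t. complex_of_real (max 0 (t - a)) * cis (t * z)) has_integral
    (of_real (3 / 2 - a) * cis (3 / 2 * z) / (\<i> * of_real z) + (cis (3 / 2 * z) - cis (a * z)) / of_real (z\<^sup>2))) {-(3 / 2)..3 / 2}"
proof -
  have 1: "((\<lambda>t. complex_of_real (max 0 (t - a)) * cis (t * z)) has_integral 0) {-(3 / 2)..a}"
    by (rule has_integral_is_0) auto
  define F where "F = (\<lambda>t. of_real (t - a) * cis (t * z) / (\<i> * of_real z) + cis (t * z) / of_real (z\<^sup>2))"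
  have 2: "((\<lambda>t. complex_of_real (t - a) * cis (t * z)) has_integral F (3 / 2) - F a) {a..3 / 2}"
  proof (rule fundamental_theorem_of_calculus)
    fix t :: real
    have "((\<lambda>w. (w - of_real a) * exp (\<i> * w * of_real z) / (\<i> * of_real z) + exp (\<i> * w * of_real z) / of_real (z\<^sup>2))
        has_field_derivative (of_real t - of_real a) * exp (\<i> * of_real t * of_real z)) (at (of_real t))"
      using assms(2) by (auto intro!: derivative_eq_intros simp: field_simps power2_eq_square)
    from has_vector_derivative_real_field[OF this]
    show "(F has_vector_derivative complex_of_real (t - a) * cis (t * z)) (at t within {a..3 / 2})"
      unfolding F_def by (simp add: cis_conv_exp mult.assoc)
  qed (use assms in auto)
  have "((\<lambda>t. complex_of_real (max 0 (t - a)) * cis (t * z)) has_integral F (3 / 2) - F a) {a..3 / 2}"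
    by (rule has_integral_eq[OF _ 2]) auto
  from has_integral_combine[OF _ _ 1 this] assms(1) 
  have "((\<lambda>t. complex_of_real (max 0 (t - a)) * cis (t * z)) has_integral 0 + (F (3 / 2) - F a)) {-(3 / 2)..3 / 2}"
    by (simp add: abs_le_iff)
  moreover have "0 + (F (3 / 2) - F a) = of_real (3 / 2 - a) * cis (3 / 2 * z) / (\<i> * of_real z) + (cis (3 / 2 * z) - cis (a * z)) / of_real (z\<^sup>2)"
    unfolding F_def by (simp add: diff_divide_distrib)
  ultimately show ?thesis by simp
qed

lemma ramp_integral_0:
  assumes "\<bar>a\<bar> \<le> 3 / 2"
  shows "((\<lambda>t. complex_of_real (max 0 (t - a))) has_integral of_real ((3 / 2 - a)\<^sup>2 / 2)) {-(3 / 2)..3 / 2}"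
proof -
  have 1: "((\<lambda>t. complex_of_real (max 0 (t - a))) has_integral 0) {-(3 / 2)..a}"
    by (rule has_integral_is_0) auto
  have 2: "((\<lambda>t. complex_of_real (t - a)) has_integral of_real ((3 / 2 - a)\<^sup>2 / 2) - of_real ((a - a)\<^sup>2 / 2)) {a..3 / 2}"
  proof (rule fundamental_theorem_of_calculus)
    fix t :: real
    have "((\<lambda>w. (w - of_real a)\<^sup>2 / 2) has_field_derivative (of_real t - of_real a)) (at (complex_of_real t))"
      by (auto intro!: derivative_eq_intros)
    from has_vector_derivative_real_field[OF this]
    show "((\<lambda>t. complex_of_real ((t - a)\<^sup>2 / 2)) has_vector_derivative complex_of_real (t - a)) (at t within {a..3 / 2})"
      by simp
  qed (use assms in auto)
  have "((\<lambda>t. complex_of_real (max 0 (t - a))) has_integral of_real ((3 / 2 - a)\<^sup>2 / 2)) {a..3 / 2}"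
    by (rule has_integral_eq[rotated]) (use 2 in auto)
  from has_integral_combine[OF _ _ 1 this] assms show ?thesis
    by (simp add: abs_le_iff)
qed

lemma trapezoid_integral:
  "((\<lambda>t. complex_of_real (trapezoid t) * cis (t * z)) has_integral complex_of_real (KL 2 z)) {-(3 / 2)..3 / 2}"
proof (cases "z = 0")
  case True
  have "((\<lambda>t. 2 * (complex_of_real (max 0 (t - (-3 / 4))) - complex_of_real (max 0 (t - (-1 / 4)))
      - complex_of_real (max 0 (t - 1 / 4)) + complex_of_real (max 0 (t - 3 / 4)))) has_integral
      2 * (of_real ((3 / 2 - (-3 / 4))\<^sup>2 / 2) - of_real ((3 / 2 - (-1 / 4))\<^sup>2 / 2) - of_real ((3 / 2 - 1 / 4)\<^sup>2 / 2) + of_real ((3 / 2 - 3 / 4)\<^sup>2 / 2))) {-(3 / 2)..3 / 2}"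
    by (intro has_integral_mult_right has_integral_add has_integral_diff ramp_integral_0) auto
  then show ?thesis
    by (simp add: True trapezoid_ramps KL_def sinc_def power2_eq_square)
next
  case False
  have "((\<lambda>t. 2 * (complex_of_real (max 0 (t - (-3 / 4))) * cis (t * z) - complex_of_real (max 0 (t - (-1 / 4))) * cis (t * z)
      - complex_of_real (max 0 (t - 1 / 4)) * cis (t * z) + complex_of_real (max 0 (t - 3 / 4)) * cis (t * z))) has_integral
      2 * ((of_real (3 / 2 - (-3 / 4)) * cis (3 / 2 * z) / (\<i> * of_real z) + (cis (3 / 2 * z) - cis ((-3 / 4) * z)) / of_real (z\<^sup>2))
      - (of_real (3 / 2 - (-1 / 4)) * cis (3 / 2 * z) / (\<i> * of_real z) + (cis (3 / 2 * z) - cis ((-1 / 4) * z)) / of_real (z\<^sup>2))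
      - (of_real (3 / 2 - 1 / 4) * cis (3 / 2 * z) / (\<i> * of_real z) + (cis (3 / 2 * z) - cis ((1 / 4) * z)) / of_real (z\<^sup>2))
      + (of_real (3 / 2 - 3 / 4) * cis (3 / 2 * z) / (\<i> * of_real z) + (cis (3 / 2 * z) - cis ((3 / 4) * z)) / of_real (z\<^sup>2)))) {-(3 / 2)..3 / 2}"
    (is "(?f has_integral ?v) _")
    using False by (intro has_integral_mult_right has_integral_add has_integral_diff ramp_integral) auto
  moreover have "?f = (\<lambda>t. complex_of_real (trapezoid t) * cis (t * z))"
    by (rule ext) (simp add: trapezoid_ramps algebra_simps)
  moreover have "?v = complex_of_real (KL 2 z)"
  proof -
    define E G where "E = cis (3 / 2 * z) / (\<i> * of_real z)" and "G = cis (3 / 2 * z)"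
    \<comment> \<open>The boundary terms at \<open>3 / 2\<close> cancel in the combination, both the
      slopes \<open>9/4 - 7/4 - 5/4 + 3/4 = 0\<close> and the constant parts, since the trapezoid
      itself vanishes there.\<close>
    have "?v = 2 * ((of_real (9 / 4) - of_real (7 / 4) - of_real (5 / 4) + of_real (3 / 4)) * E
        + (cis ((-1 / 4) * z) + cis ((1 / 4) * z) - cis ((-3 / 4) * z) - cis ((3 / 4) * z)) / of_real (z\<^sup>2))"
      unfolding E_def[symmetric] G_def[symmetric] times_divide_eq_right[symmetric]
      by (simp add: diff_divide_distrib add_divide_distrib algebra_simps)
    also have "\<dots> = 2 * ((cis ((-1 / 4) * z) + cis ((1 / 4) * z) - cis ((-3 / 4) * z) - cis ((3 / 4) * z)) / of_real (z\<^sup>2))"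
      by simp
    also have "\<dots> = complex_of_real (4 * (cos (z / 4) - cos (3 * z / 4)) / z\<^sup>2)"
      by (simp add: complex_eq_iff Re_divide Im_divide field_simps power2_eq_square)
    also have "cos (z / 4) - cos (3 * z / 4) = 2 * sin (z / 2) * sin (z / 4)"
      using cos_diff_cos[of "z / 4" "3 * z / 4"] by (simp add: field_simps)
    also have "4 * (2 * sin (z / 2) * sin (z / 4)) / z\<^sup>2 = KL 2 z"
      using False by (simp add: KL_def sinc_def numeral_2_eq_2 power2_eq_square field_simps)
    finally show ?thesis .
  qed
  ultimately show ?thesis by simp
qed

text \<open>An integer shift merely permutes the translates; the truncations are harmless once they
  contain every \<open>n\<close> with \<open>|\<xi> + n| < 1\<close>.\<close>

lemma sum_periodization_shift:
  fixes g :: "real \<Rightarrow> complex"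
  assumes "\<And>t. 1 \<le> \<bar>t\<bar> \<Longrightarrow> g t = 0" "\<bar>\<xi>\<bar> + 1 \<le> real N" "\<bar>\<xi> - of_int l\<bar> + 1 \<le> real N'"
  shows "(\<Sum>n\<in>{-int N..int N}. g (\<xi> + of_int n)) = (\<Sum>n\<in>{-int N'..int N'}. g (\<xi> - of_int l + of_int n))"
proof -
  have red: "(\<Sum>n\<in>{-int N..int N}. g (\<xi> + of_int n)) = (\<Sum>n\<in>{n. \<bar>\<xi> + of_int n\<bar> < 1}. g (\<xi> + of_int n))"
    if "\<bar>\<xi>\<bar> + 1 \<le> real N" for \<xi> N
  proof (rule sum.mono_neutral_right)
    show "{n. \<bar>\<xi> + of_int n\<bar> < 1} \<subseteq> {-int N..int N}"
    proof
      fix n assume "n \<in> {n. \<bar>\<xi> + of_int n\<bar> < 1}"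
      then have "\<bar>real_of_int n\<bar> \<le> real_of_int (int N)" using that by auto
      then show "n \<in> {-int N..int N}" by (simp only: atLeastAtMost_iff) linarith
    qed
  qed (use assms(1) in \<open>auto simp: not_less\<close>)
  have "(\<Sum>n\<in>{n. \<bar>\<xi> + of_int n\<bar> < 1}. g (\<xi> + of_int n)) = (\<Sum>n\<in>{n. \<bar>\<xi> - of_int l + of_int n\<bar> < 1}. g (\<xi> - of_int l + of_int n))"
    by (rule sum.reindex_bij_witness[of _ "\<lambda>n. n - l" "\<lambda>n. n + l"]) (auto simp: algebra_simps)
  then show ?thesis using red[OF assms(2)] red[OF assms(3)] by simp
qed

lemma integral_circle_cis:
  "integral {-pi..pi} (\<lambda>t. cis (of_int k * t)) = (if k = 0 then complex_of_real (2 * pi) else 0)"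
  by (subst integral_circ_eq[symmetric]) (auto intro!: continuous_intros simp: integral_circ_cis)

text \<open>Unfolding: after the substitution \<open>t = 2 * pi * \<xi>\<close> the three translates
  over one period cover the three unit intervals of \<open>[-3/2, 3/2]\<close>.\<close>

lemma integral_periodization:
  fixes \<phi> :: "real \<Rightarrow> complex"
  assumes "continuous_on UNIV \<phi>"
  shows "integral {-pi..pi} (\<lambda>t. \<Sum>n\<in>{-1..1}. \<phi> (t / (2 * pi) + of_int n)) = 2 * pi * integral {-(3 / 2)..3 / 2} \<phi>"
proof -
  have int: "\<phi> integrable_on {a..b}" for a b
    by (intro integrable_continuous_interval continuous_on_subset[OF assms]) auto
  have "((\<lambda>t. \<phi> ((1 / (2 * pi)) *\<^sub>R t + of_int n)) has_integral
      integral {of_int n - 1 / 2..of_int n + 1 / 2} \<phi> /\<^sub>R (1 / (2 * pi)) ^ DIM(real))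
      (cbox ((of_int n - 1 / 2 - of_int n) /\<^sub>R (1 / (2 * pi))) ((of_int n + 1 / 2 - of_int n) /\<^sub>R (1 / (2 * pi))))" for n :: int
    by (rule has_integral_affinity') (auto intro!: integrable_integral int)
  then have "((\<lambda>t. \<phi> (t / (2 * pi) + of_int n)) has_integral 2 * pi * integral {of_int n - 1 / 2..of_int n + 1 / 2} \<phi>) {-pi..pi}" for n :: int
    by (simp add: scaleR_conv_of_real mult.commute)
  then have "((\<lambda>t. \<Sum>n\<in>{-1..1}. \<phi> (t / (2 * pi) + of_int n)) has_integral
      (\<Sum>n\<in>{-1..1::int}. 2 * pi * integral {of_int n - 1 / 2..of_int n + 1 / 2} \<phi>)) {-pi..pi}"
    by (intro has_integral_sum) auto
  moreover have "(\<Sum>n\<in>{-1..1::int}. 2 * pi * integral {of_int n - 1 / 2..of_int n + 1 / 2} \<phi>) = 2 * pi * integral {-(3 / 2)..3 / 2} \<phi>"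
  proof -
    have "integral {-(3 / 2)..3 / 2} \<phi> = integral {-(3 / 2)..-(1 / 2)} \<phi> + integral {-(1 / 2)..3 / 2} \<phi>"
      by (rule Henstock_Kurzweil_Integration.integral_combine[symmetric]) (use int in auto)
    also have "integral {-(1 / 2)..3 / 2} \<phi> = integral {-(1 / 2)..1 / 2} \<phi> + integral {1 / 2..3 / 2} \<phi>"
      by (rule Henstock_Kurzweil_Integration.integral_combine[symmetric]) (use int in auto)
    moreover have "{-1..1::int} = {-1, 0, 1}" by auto
    ultimately show ?thesis by (simp add: algebra_simps)
  qed
  ultimately show ?thesis using integral_unique by (simp only:) blast
qed

text \<open>As functions of \<open>t = 2 * pi * \<xi>\<close> on one period both sides are
  continuous, and both have the Fourier coefficients \<open>2 * pi * K k\<close>: on the left by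
  orthogonality, on the right by unfolding to the transform of the trapezoid. For
  \<open>|\<xi>| <= 1/2\<close> only the translates by -1, 0 and 1 can meet its support.\<close>

lemma poisson_KL2:
  assumes "\<bar>\<xi>\<bar> \<le> 1 / 2"
  shows "(\<Sum>\<^sub>\<infinity>v::int. cis (2 * pi * \<xi> * of_int v) * complex_of_real (KL 2 (y - 2 * pi * of_int v))) =
    (\<Sum>n\<in>{-1..1}. complex_of_real (trapezoid (\<xi> + of_int n)) * cis ((\<xi> + of_int n) * y))"
proof -
  define K where "K = (\<lambda>v::int. KL 2 (y - 2 * pi * of_int v))"
  have sK: "(\<lambda>v. \<bar>K v\<bar>) summable_on UNIV" unfolding K_def by (rule summable_KL) simp
  define f where "f = (\<lambda>(v::int) t. cis (of_int v * t) * complex_of_real (K v))"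
  define S where "S = (\<lambda>t. \<Sum>\<^sub>\<infinity>v. f v t)"
  define R where "R = (\<lambda>t. \<Sum>n\<in>{-1..1}. complex_of_real (trapezoid (t / (2 * pi) + of_int n)) * cis ((t / (2 * pi) + of_int n) * y))"
  have fK: "cmod (f v t) \<le> \<bar>K v\<bar>" for v t by (simp add: f_def norm_mult)
  have fc: "continuous_on UNIV (f v)" for v unfolding f_def by (intro continuous_intros)
  have Sc: "continuous_on UNIV S" unfolding S_def by (rule integral_infsum_cis(1)[OF sK fK fc])
  have Rc: "continuous_on UNIV R" unfolding R_def
    by (intro continuous_on_sum continuous_on_mult continuous_on_of_real continuous_on_compose2[OF continuous_trapezoid[of UNIV]] continuous_intros) auto
  have Sb: "cmod (S t) \<le> (\<Sum>\<^sub>\<infinity>v. \<bar>K v\<bar>)" for t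
    unfolding S_def by (rule uniform_limit_infsum_cis(3)[OF sK fK])
  have Rb: "cmod (R t) \<le> 3" for t
  proof -
    have "cmod (R t) \<le> (\<Sum>n\<in>{-1..1::int}. 1)"
      unfolding R_def by (rule order_trans[OF norm_sum], rule sum_mono) (auto simp: norm_mult trapezoid_def)
    then show ?thesis by simp
  qed
  have S_coeff: "integral {-pi..pi} (\<lambda>t. S t * cis (- of_int k * t)) = 2 * pi * K k" for k :: int
  proof -
    define g where "g = (\<lambda>(v::int) t. f v t * cis (- of_int k * t))"
    have gK: "cmod (g v t) \<le> \<bar>K v\<bar>" for v t using fK by (simp add: g_def norm_mult)
    have gc: "continuous_on UNIV (g v)" for v unfolding g_def by (intro continuous_intros fc)
    have "S t * cis (- of_int k * t) = (\<Sum>\<^sub>\<infinity>v. g v t)" for t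
      unfolding S_def g_def by (rule infsum_cmult_left'[symmetric])
    then have "integral {-pi..pi} (\<lambda>t. S t * cis (- of_int k * t)) = integral {-pi..pi} (\<lambda>t. \<Sum>\<^sub>\<infinity>v. g v t)" by simp
    moreover have "((\<lambda>v. integral {-pi..pi} (g v)) has_sum integral {-pi..pi} (\<lambda>t. \<Sum>\<^sub>\<infinity>v. g v t)) UNIV"
      by (rule integral_infsum_cis(2)[OF sK gK gc])
    moreover have "integral {-pi..pi} (g v) = (if v = k then complex_of_real (2 * pi * K k) else 0)" for v
    proof -
      have "g v = (\<lambda>t. cis (of_int (v - k) * t) * complex_of_real (K v))"
        unfolding g_def f_def by (rule ext) (simp add: cis_mult algebra_simps)
      then show ?thesis by (simp only: integral_mult_left integral_circle_cis) simp
    qed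
    moreover have "((\<lambda>v. if v = k then complex_of_real (2 * pi * K k) else 0) has_sum complex_of_real (2 * pi * K k)) UNIV"
      by (rule has_sum_finite_neutralI[of "{k}"]) auto
    ultimately show ?thesis using has_sum_unique by (simp only:) blast
  qed
  have R_coeff: "integral {-pi..pi} (\<lambda>t. R t * cis (- of_int k * t)) = 2 * pi * K k" for k :: int
  proof -
    define \<phi> where "\<phi> = (\<lambda>\<xi>. complex_of_real (trapezoid \<xi>) * cis (\<xi> * (y - 2 * pi * of_int k)))"
    have "R t * cis (- of_int k * t) = (\<Sum>n\<in>{-1..1}. \<phi> (t / (2 * pi) + of_int n))" for t
    proof -
      have "cis ((t / (2 * pi) + of_int n) * (y - 2 * pi * of_int k)) = cis ((t / (2 * pi) + of_int n) * y) * cis (- of_int k * t)" for n :: int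
      proof -
        have "cis ((t / (2 * pi) + of_int n) * (y - 2 * pi * of_int k)) =
            cis ((t / (2 * pi) + of_int n) * y) * cis (- of_int k * t) * cis (2 * pi * of_int (- n * k))"
          by (simp add: cis_mult algebra_simps)
        also have "cis (2 * pi * of_int (- n * k)) = 1" by (rule cis_multiple_2pi) auto
        finally show ?thesis by simp
      qed
      then show ?thesis unfolding R_def \<phi>_def by (simp add: sum_distrib_right mult.assoc)
    qed
    then have "integral {-pi..pi} (\<lambda>t. R t * cis (- of_int k * t)) = integral {-pi..pi} (\<lambda>t. \<Sum>n\<in>{-1..1}. \<phi> (t / (2 * pi) + of_int n))"
      by simp
    also have "\<dots> = 2 * pi * integral {-(3 / 2)..3 / 2} \<phi>"
      unfolding \<phi>_def
      by (intro integral_periodization continuous_intros continuous_trapezoid)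
    also have "integral {-(3 / 2)..3 / 2} \<phi> = K k"
      unfolding \<phi>_def K_def by (rule integral_unique[OF trapezoid_integral])
    finally show ?thesis by (simp only: of_real_mult)
  qed
  have "S (2 * pi * \<xi>) - R (2 * pi * \<xi>) = 0"
  proof (rule fourier_uniqueness_interval[where g = "\<lambda>t. S t - R t" and M = "(\<Sum>\<^sub>\<infinity>v. \<bar>K v\<bar>) + 3"])
    show "continuous_on UNIV (\<lambda>t. S t - R t)" by (intro continuous_intros Sc Rc)
    show "cmod (S t - R t) \<le> (\<Sum>\<^sub>\<infinity>v. \<bar>K v\<bar>) + 3" for t
      using norm_triangle_ineq4[of "S t" "R t"] Sb[of t] Rb[of t] by linarith
    show "integral {-pi..pi} (\<lambda>t. (S t - R t) * cis (- of_int k * t)) = 0" for k :: int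
    proof -
      have c: "continuous_on {-pi..pi} (\<lambda>t. cis (- of_int k * t))" by (intro continuous_intros)
      have "integral {-pi..pi} (\<lambda>t. (S t - R t) * cis (- of_int k * t)) =
        integral {-pi..pi} (\<lambda>t. S t * cis (- of_int k * t)) - integral {-pi..pi} (\<lambda>t. R t * cis (- of_int k * t))"
        unfolding left_diff_distrib
        by (intro integral_diff integrable_continuous_interval continuous_on_mult c continuous_on_subset[OF Sc] continuous_on_subset[OF Rc]) auto
      then show ?thesis by (simp only: S_coeff R_coeff diff_self)
    qed
    have "\<bar>2 * pi * \<xi>\<bar> \<le> pi" using assms by (simp add: abs_mult)
    then show "2 * pi * \<xi> \<in> {-pi..pi}" by (simp add: abs_le_iff)
  qed
  then have "S (2 * pi * \<xi>) = R (2 * pi * \<xi>)" by simp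
  then show ?thesis
    unfolding S_def R_def f_def K_def by (simp add: mult.commute mult.left_commute)
qed

text \<open>\<open>\<rho>\<close> is the Fourier transform of \<^term>\<open>KL L\<close>: a trapezoid for \<open>L = 2\<close>, and each further factor
  averages it over an interval.\<close>

lemma poisson_KL:
  assumes "2 \<le> L"
  shows "\<exists>\<rho>. continuous_on UNIV \<rho> \<and> (\<forall>t. 1 - 1 / 2 ^ L \<le> \<bar>t\<bar> \<longrightarrow> \<rho> t = 0) \<and> (\<forall>t. \<bar>t\<bar> \<le> 1 / 2 ^ L \<longrightarrow> \<rho> t = 1) \<and>
    (\<forall>y \<xi> N. \<bar>\<xi>\<bar> + 1 \<le> real N \<longrightarrow>
      (\<Sum>\<^sub>\<infinity>v::int. cis (2 * pi * \<xi> * of_int v) * complex_of_real (KL L (y - 2 * pi * of_int v))) =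
      (\<Sum>n\<in>{-int N..int N}. complex_of_real (\<rho> (\<xi> + of_int n)) * cis ((\<xi> + of_int n) * y)))"
  using assms
proof (induction L rule: nat_induct_at_least)
  case base
  show ?case
  proof (intro exI[of _ trapezoid] conjI allI impI)
    fix y \<xi> :: real and N :: nat assume N: "\<bar>\<xi>\<bar> + 1 \<le> real N"
    \<comment> \<open>Both sides have period 1 in \<open>\<xi>\<close>, the left one because
      \<open>v\<close> is an integer, the right one by reindexing. Subtracting the nearest integer
      leads to the range of \<open>poisson_KL2\<close>.\<close>
    define l where "l = round \<xi>"
    have l: "\<bar>\<xi> - of_int l\<bar> \<le> 1 / 2" unfolding l_def using of_int_round_abs_le[of \<xi>] by (simp add: abs_minus_commute)
    have c: "cis (2 * pi * \<xi> * of_int v) = cis (2 * pi * (\<xi> - of_int l) * of_int v)" for v :: int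
    proof -
      have "cis (2 * pi * \<xi> * of_int v) = cis (2 * pi * (\<xi> - of_int l) * of_int v) * cis (2 * pi * of_int (l * v))"
        by (simp add: cis_mult algebra_simps)
      also have "cis (2 * pi * of_int (l * v)) = 1" by (rule cis_multiple_2pi) auto
      finally show ?thesis by simp
    qed
    define g where "g = (\<lambda>t. complex_of_real (trapezoid t) * cis (t * y))"
    have g: "g t = 0" if "1 \<le> \<bar>t\<bar>" for t using that by (simp add: g_def trapezoid_def)
    have "(\<Sum>n\<in>{-1..1}. g (\<xi> - of_int l + of_int n)) = (\<Sum>n\<in>{-2..2}. g (\<xi> - of_int l + of_int n))"
    proof (rule sum.mono_neutral_left)
      show "\<forall>n\<in>{-2..2} - {-1..1::int}. g (\<xi> - of_int l + of_int n) = 0"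
      proof
        fix n assume "n \<in> {-2..2} - {-1..1::int}"
        then have "n = -2 \<or> n = 2" by auto
        then have "1 \<le> \<bar>\<xi> - of_int l + real_of_int n\<bar>" using l by (auto simp: abs_if split: if_splits)
          then show "g (\<xi> - of_int l + of_int n) = 0" by (rule g)
      qed
    qed auto
    also have "\<dots> = (\<Sum>n\<in>{-int N..int N}. g (\<xi> + of_int n))"
      using sum_periodization_shift[of g \<xi> N l 2] g N l by simp
    finally show "(\<Sum>\<^sub>\<infinity>v::int. cis (2 * pi * \<xi> * of_int v) * complex_of_real (KL 2 (y - 2 * pi * of_int v))) =
      (\<Sum>n\<in>{-int N..int N}. complex_of_real (trapezoid (\<xi> + of_int n)) * cis ((\<xi> + of_int n) * y))"
      unfolding c poisson_KL2[OF l] g_def .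
  qed (rule continuous_trapezoid, auto simp: trapezoid_def)
next
  case (Suc L)
  then obtain \<rho> where \<rho>c: "continuous_on UNIV \<rho>" and \<rho>0: "\<And>t. 1 - 1 / 2 ^ L \<le> \<bar>t\<bar> \<Longrightarrow> \<rho> t = 0"
    and \<rho>1: "\<And>t. \<bar>t\<bar> \<le> 1 / 2 ^ L \<Longrightarrow> \<rho> t = 1"
    and \<rho>: "\<And>y \<xi> N. \<bar>\<xi>\<bar> + 1 \<le> real N \<Longrightarrow>
      (\<Sum>\<^sub>\<infinity>v::int. cis (2 * pi * \<xi> * of_int v) * complex_of_real (KL L (y - 2 * pi * of_int v))) =
      (\<Sum>n\<in>{-int N..int N}. complex_of_real (\<rho> (\<xi> + of_int n)) * cis ((\<xi> + of_int n) * y))"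
    by blast
  \<comment> \<open>The new factor of the kernel is \<open>sinc (h * x)\<close>. Averaging over
    \<open>[-h, h]\<close> shrinks the plateau from \<open>|t| <= 2 * h\<close> to
    \<open>|t| <= h\<close> and moves the zeros from \<open>|t| >= 1 - 2 * h\<close> to
    \<open>|t| >= 1 - h\<close>.\<close>
  define h :: real where "h = 1 / 2 ^ Suc L"
  have h: "0 < h" "h \<le> 1" "1 / 2 ^ L = 2 * h" unfolding h_def using one_le_power[of "2::real" "Suc L"] by auto
  define \<rho>' where "\<rho>' = (\<lambda>t. 1 / (2 * h) * integral {-h..h} (\<lambda>\<omega>. \<rho> (t - \<omega>)))"
  have \<rho>'0: "\<rho>' t = 0" if "1 - h \<le> \<bar>t\<bar>" for t
  proof -
    have "integral {-h..h} (\<lambda>\<omega>. \<rho> (t - \<omega>)) = integral {-h..h} (\<lambda>\<omega>. 0)"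
    proof (rule integral_cong)
      fix \<omega> assume "\<omega> \<in> {-h..h}"
      then have "1 - 2 * h \<le> \<bar>t - \<omega>\<bar>" using that by auto
      then show "\<rho> (t - \<omega>) = 0" using h by (intro \<rho>0) simp
    qed
    then show ?thesis by (simp add: \<rho>'_def)
  qed
  show ?case
  proof (intro exI[of _ \<rho>'] conjI allI impI)
    have "continuous_on UNIV (\<lambda>t. integral (cbox (-h) h) (\<lambda>\<omega>. \<rho> (t - \<omega>)))"
      unfolding split_def
      by (rule integral_continuous_on_param)
         (auto simp: split_def intro!: continuous_on_compose2[OF \<rho>c] continuous_intros)
    then show "continuous_on UNIV \<rho>'"
      unfolding \<rho>'_def by (intro continuous_intros) simp
  next
    fix t :: real assume "1 - 1 / 2 ^ Suc L \<le> \<bar>t\<bar>"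
    then show "\<rho>' t = 0" by (intro \<rho>'0) (simp add: h_def)
  next
    fix t :: real assume t: "\<bar>t\<bar> \<le> 1 / 2 ^ Suc L"
    have "integral {-h..h} (\<lambda>\<omega>. \<rho> (t - \<omega>)) = integral {-h..h} (\<lambda>\<omega>. 1)"
    proof (rule integral_cong)
      fix \<omega> assume "\<omega> \<in> {-h..h}"
      then have "\<bar>t - \<omega>\<bar> \<le> 2 * h" using t unfolding h_def[symmetric] by auto
      then show "\<rho> (t - \<omega>) = 1" using h by (intro \<rho>1) simp
    qed
    then show "\<rho>' t = 1" using h by (simp add: \<rho>'_def)
  next
    fix y \<xi> :: real and N :: nat assume N: "\<bar>\<xi>\<bar> + 1 \<le> real N"
    define K where "K = (\<lambda>v::int. KL L (y - 2 * pi * of_int v))"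
    have sK: "(\<lambda>v. \<bar>K v\<bar>) summable_on UNIV" unfolding K_def by (rule summable_KL) (use Suc in simp)
    define f where "f = (\<lambda>(v::int) \<omega>. cis (\<omega> * y) * (cis (2 * pi * (\<xi> - \<omega>) * of_int v) * complex_of_real (K v)))"
    have fK: "cmod (f v t) \<le> \<bar>K v\<bar>" for v t by (simp add: f_def norm_mult)
    have fc: "continuous_on UNIV (f v)" for v unfolding f_def by (intro continuous_intros)
    have hs: "((\<lambda>v. integral {-h..h} (f v)) has_sum integral {-h..h} (\<lambda>t. \<Sum>\<^sub>\<infinity>v. f v t)) UNIV"
      by (rule integral_infsum_cis(2)[OF sK fK fc])
    have If: "integral {-h..h} (f v) = 2 * h * (cis (2 * pi * \<xi> * of_int v) * complex_of_real (KL (Suc L) (y - 2 * pi * of_int v)))" for v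
    proof -
      have "f v = (\<lambda>\<omega>. cis (\<omega> * (y - 2 * pi * of_int v)) * (cis (2 * pi * \<xi> * of_int v) * complex_of_real (K v)))"
      proof (rule ext)
        fix \<omega>
        have "cis (\<omega> * y) * cis (2 * pi * (\<xi> - \<omega>) * of_int v) = cis (\<omega> * (y - 2 * pi * of_int v)) * cis (2 * pi * \<xi> * of_int v)"
          by (simp add: cis_mult algebra_simps)
        then show "f v \<omega> = cis (\<omega> * (y - 2 * pi * of_int v)) * (cis (2 * pi * \<xi> * of_int v) * complex_of_real (K v))"
          unfolding f_def by (metis mult.assoc)
      qed
      then have "integral {-h..h} (f v) = integral {-h..h} (\<lambda>\<omega>. cis (\<omega> * (y - 2 * pi * of_int v))) * (cis (2 * pi * \<xi> * of_int v) * complex_of_real (K v))"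
        by (simp only: integral_mult_left)
      also have "integral {-h..h} (\<lambda>\<omega>. cis (\<omega> * (y - 2 * pi * of_int v))) = 2 * h * complex_of_real (sinc (h * (y - 2 * pi * of_int v)))"
        using sinc_average[OF h(1), of "y - 2 * pi * of_int v"] h by simp
      finally show ?thesis
        by (simp add: K_def KL_def h_def mult.commute mult.left_commute)
    qed
    \<comment> \<open>A frequency shift \<open>\<omega>\<close> with
      \<open>|\<omega>| <= h <= 1\<close> may reach one more alias on either side, hence
      \<open>Suc N\<close>. The two additional terms vanish after averaging and are removed at the
      end.\<close>
    have RHS: "integral {-h..h} (\<lambda>t. \<Sum>\<^sub>\<infinity>v. f v t) =
      (\<Sum>n\<in>{-int (Suc N)..int (Suc N)}. 2 * h * (complex_of_real (\<rho>' (\<xi> + of_int n)) * cis ((\<xi> + of_int n) * y)))"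
    proof -
      have "integral {-h..h} (\<lambda>t. \<Sum>\<^sub>\<infinity>v. f v t) =
        integral {-h..h} (\<lambda>\<omega>. \<Sum>n\<in>{-int (Suc N)..int (Suc N)}. complex_of_real (\<rho> (\<xi> + of_int n - \<omega>)) * cis ((\<xi> + of_int n) * y))"
      proof (rule integral_cong)
        fix \<omega> assume \<omega>: "\<omega> \<in> {-h..h}"
        have "(\<Sum>\<^sub>\<infinity>v. f v \<omega>) = cis (\<omega> * y) * (\<Sum>\<^sub>\<infinity>v. cis (2 * pi * (\<xi> - \<omega>) * of_int v) * complex_of_real (K v))"
          unfolding f_def by (rule infsum_cmult_right')
        also have "(\<Sum>\<^sub>\<infinity>v. cis (2 * pi * (\<xi> - \<omega>) * of_int v) * complex_of_real (K v)) =
          (\<Sum>n\<in>{-int (Suc N)..int (Suc N)}. complex_of_real (\<rho> (\<xi> - \<omega> + of_int n)) * cis ((\<xi> - \<omega> + of_int n) * y))"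
          unfolding K_def using N \<omega> h by (intro \<rho>) auto
        also have "cis (\<omega> * y) * \<dots> = (\<Sum>n\<in>{-int (Suc N)..int (Suc N)}. complex_of_real (\<rho> (\<xi> + of_int n - \<omega>)) * cis ((\<xi> + of_int n) * y))"
          unfolding sum_distrib_left
        proof (rule sum.cong[OF refl])
          fix n :: int
          have "cis (\<omega> * y) * cis ((\<xi> - \<omega> + of_int n) * y) = cis ((\<xi> + of_int n) * y)"
            by (simp add: cis_mult algebra_simps)
          moreover have "\<xi> - \<omega> + of_int n = \<xi> + of_int n - \<omega>" by simp
          ultimately show "cis (\<omega> * y) * (complex_of_real (\<rho> (\<xi> - \<omega> + of_int n)) * cis ((\<xi> - \<omega> + of_int n) * y)) =
              complex_of_real (\<rho> (\<xi> + of_int n - \<omega>)) * cis ((\<xi> + of_int n) * y)"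
            by (metis mult.left_commute)
        qed
        finally show "(\<Sum>\<^sub>\<infinity>v. f v \<omega>) = (\<Sum>n\<in>{-int (Suc N)..int (Suc N)}. complex_of_real (\<rho> (\<xi> + of_int n - \<omega>)) * cis ((\<xi> + of_int n) * y))" .
      qed
      also have "\<dots> = (\<Sum>n\<in>{-int (Suc N)..int (Suc N)}. integral {-h..h} (\<lambda>\<omega>. complex_of_real (\<rho> (\<xi> + of_int n - \<omega>)) * cis ((\<xi> + of_int n) * y)))"
        by (intro integral_sum integrable_continuous_interval continuous_on_mult continuous_on_of_real continuous_on_compose2[OF \<rho>c] continuous_intros) auto
      also have "\<dots> = (\<Sum>n\<in>{-int (Suc N)..int (Suc N)}. 2 * h * (complex_of_real (\<rho>' (\<xi> + of_int n)) * cis ((\<xi> + of_int n) * y)))"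
      proof (rule sum.cong[OF refl])
        fix n :: int
        have "(\<lambda>\<omega>. \<rho> (\<xi> + of_int n - \<omega>)) integrable_on {-h..h}"
          by (intro integrable_continuous_interval continuous_on_compose2[OF \<rho>c] continuous_intros) auto
        from has_integral_of_real[OF integrable_integral[OF this]]
        have "integral {-h..h} (\<lambda>\<omega>. complex_of_real (\<rho> (\<xi> + of_int n - \<omega>))) = complex_of_real (integral {-h..h} (\<lambda>\<omega>. \<rho> (\<xi> + of_int n - \<omega>)))"
          by (rule integral_unique)
        then show "integral {-h..h} (\<lambda>\<omega>. complex_of_real (\<rho> (\<xi> + of_int n - \<omega>)) * cis ((\<xi> + of_int n) * y)) =
            2 * h * (complex_of_real (\<rho>' (\<xi> + of_int n)) * cis ((\<xi> + of_int n) * y))"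
          using h by (simp only: integral_mult_left) (simp add: \<rho>'_def)
      qed
      finally show ?thesis .
    qed
    have "((\<lambda>v. 2 * h * (cis (2 * pi * \<xi> * of_int v) * complex_of_real (KL (Suc L) (y - 2 * pi * of_int v)))) has_sum
       (\<Sum>n\<in>{-int (Suc N)..int (Suc N)}. 2 * h * (complex_of_real (\<rho>' (\<xi> + of_int n)) * cis ((\<xi> + of_int n) * y)))) UNIV"
      using hs unfolding If RHS .
    from infsumI[OF this]
    have "2 * h * (\<Sum>\<^sub>\<infinity>v::int. cis (2 * pi * \<xi> * of_int v) * complex_of_real (KL (Suc L) (y - 2 * pi * of_int v))) =
       2 * h * (\<Sum>n\<in>{-int (Suc N)..int (Suc N)}. complex_of_real (\<rho>' (\<xi> + of_int n)) * cis ((\<xi> + of_int n) * y))"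
      unfolding sum_distrib_left by (subst (asm) infsum_cmult_right')
    then have "(\<Sum>\<^sub>\<infinity>v::int. cis (2 * pi * \<xi> * of_int v) * complex_of_real (KL (Suc L) (y - 2 * pi * of_int v))) =
       (\<Sum>n\<in>{-int (Suc N)..int (Suc N)}. complex_of_real (\<rho>' (\<xi> + of_int n)) * cis ((\<xi> + of_int n) * y))"
      using h by simp
    also have "\<dots> = (\<Sum>n\<in>{-int N..int N}. complex_of_real (\<rho>' (\<xi> + of_int n)) * cis ((\<xi> + of_int n) * y))"
    proof (rule sum.mono_neutral_right)
      show "\<forall>n\<in>{-int (Suc N)..int (Suc N)} - {-int N..int N}. complex_of_real (\<rho>' (\<xi> + of_int n)) * cis ((\<xi> + of_int n) * y) = 0"
      proof
        fix n assume "n \<in> {-int (Suc N)..int (Suc N)} - {-int N..int N}"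
        then have "n = - int (Suc N) \<or> n = int (Suc N)" by auto
        then have "1 - h \<le> \<bar>\<xi> + of_int n\<bar>" using N h by auto
        then show "complex_of_real (\<rho>' (\<xi> + of_int n)) * cis ((\<xi> + of_int n) * y) = 0" by (simp add: \<rho>'0)
      qed
    qed auto
    finally show "(\<Sum>\<^sub>\<infinity>v::int. cis (2 * pi * \<xi> * of_int v) * complex_of_real (KL (Suc L) (y - 2 * pi * of_int v))) =
       (\<Sum>n\<in>{-int N..int N}. complex_of_real (\<rho>' (\<xi> + of_int n)) * cis ((\<xi> + of_int n) * y))" .
  qed
qed

subsection \<open>The interpolation operators on exponentials\<close>

lemma Uset_diff:
  assumes "u \<in> Uset j" "u' \<in> Uset j"
  shows "\<bar>u - u'\<bar> < 2 ^ j"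
proof -
  have "- h \<le> a \<Longrightarrow> a < N - h \<Longrightarrow> - h \<le> b \<Longrightarrow> b < N - h \<Longrightarrow> \<bar>a - b\<bar> < N" for a b h N :: int
    by linarith
  with assms show ?thesis unfolding Uset_alt atLeastLessThan_iff by blast
qed

text \<open>\<open>Uset j\<close> is a system of residues modulo \<open>2 ^ j\<close>. Thereby a sum
  over nodes and periods becomes one sum over all integers.\<close>

lemma bij_Uset_UNIV: "bij_betw (\<lambda>(u, n). u - 2 ^ j * n) (Uset j \<times> (UNIV :: int set)) UNIV"
proof (rule bij_betw_imageI)
  show "inj_on (\<lambda>(u, n). u - 2 ^ j * n) (Uset j \<times> (UNIV :: int set))"
  proof (rule inj_onI, clarify)
    fix u n u' n' :: int
    assume u: "u \<in> Uset j" "u' \<in> Uset j" and e: "u - 2 ^ j * n = u' - 2 ^ j * n'"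
    have "u - u' = 2 ^ j * (n - n')" using e by (simp add: algebra_simps)
    moreover have "\<bar>u - u'\<bar> < 2 ^ j" using u by (rule Uset_diff)
    ultimately have "2 ^ j * \<bar>n - n'\<bar> < 2 ^ j * 1" by (simp add: abs_mult)
    then have "n = n'" by (subst (asm) mult_less_cancel_left_pos) auto
    then show "u = u' \<and> n = n'" using e by simp
  qed
  have "v \<in> (\<lambda>(u, n). u - 2 ^ j * n) ` (Uset j \<times> (UNIV :: int set))" for v
  proof -
    define h :: int where "h = 2 ^ j div 2"
    define u where "u = (v + h) mod 2 ^ j - h"
    have "u \<in> Uset j" unfolding Uset_alt u_def h_def[symmetric] by auto
    moreover have "v = u - 2 ^ j * (- ((v + h) div 2 ^ j))"
    proof -
      have "a + b = v + h \<Longrightarrow> v = a - h + b" for a b :: int by simp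
      from this[OF mod_mult_div_eq[of "v + h" "2 ^ j"]] show ?thesis
        unfolding u_def by simp
    qed
    ultimately show ?thesis by (intro image_eqI[of _ _ "(u, - ((v + h) div 2 ^ j))"]) auto
  qed
  then show "(\<lambda>(u, n). u - 2 ^ j * n) ` (Uset j \<times> (UNIV :: int set)) = UNIV" by blast
qed

lemma summable_KL_grid:
  assumes "2 \<le> L"
  shows "(\<lambda>n::int. \<bar>KL L (2 ^ j * (x + 2 * pi * of_int n))\<bar>) summable_on UNIV"
proof -
  have "(\<lambda>v::int. \<bar>KL L (2 ^ j * x - 2 * pi * of_int v)\<bar>) summable_on (range (\<lambda>n. - (2 ^ j * n)))"
    by (rule summable_on_subset_banach[OF summable_KL[OF assms]]) simp
  then have "((\<lambda>v::int. \<bar>KL L (2 ^ j * x - 2 * pi * of_int v)\<bar>) \<circ> (\<lambda>n. - (2 ^ j * n))) summable_on UNIV"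
    by (rule summable_on_reindex[THEN iffD1, rotated]) (simp add: inj_on_def)
  moreover have "((\<lambda>v::int. \<bar>KL L (2 ^ j * x - 2 * pi * of_int v)\<bar>) \<circ> (\<lambda>n. - (2 ^ j * n))) = (\<lambda>n::int. \<bar>KL L (2 ^ j * (x + 2 * pi * of_int n))\<bar>)"
    by (rule ext) (simp add: algebra_simps)
  ultimately show ?thesis by simp
qed

text \<open>The exponential takes the same value at node \<open>u\<close> and at its translate by
  \<open>n\<close> periods, so the node sum and the periodization of the kernel merge into one
  lattice sum, to which Poisson summation applies.\<close>

lemma Iop_cis_eq_infsum:
  assumes L: "2 \<le> L"
  shows "Iop L j (\<lambda>t. cis (of_int k * t)) x =
    (\<Sum>\<^sub>\<infinity>v::int. cis (2 * pi * (of_int k / 2 ^ j) * of_int v) * complex_of_real (KL L (2 ^ j * x - 2 * pi * of_int v)))"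
proof -
  define F where "F = (\<lambda>v::int. cis (2 * pi * (of_int k / 2 ^ j) * of_int v) * complex_of_real (KL L (2 ^ j * x - 2 * pi * of_int v)))"
  have "(\<lambda>v. norm (F v)) summable_on UNIV"
    using summable_KL[OF L, of "2 ^ j * x"] by (simp add: F_def norm_mult)
  then have "F summable_on UNIV" by (rule abs_summable_summable)
  then have hs: "(F has_sum infsum F UNIV) UNIV" by simp
  have "((\<lambda>p. F (case p of (u, n) \<Rightarrow> u - 2 ^ j * n)) has_sum infsum F UNIV) (Uset j \<times> UNIV)"
    by (subst has_sum_reindex_bij_betw[OF bij_Uset_UNIV]) (rule hs)
  moreover have "((\<lambda>n. F (case (u, n) of (u, n) \<Rightarrow> u - 2 ^ j * n)) has_sum
      (cis (of_int k * (2 * pi * of_int u / 2 ^ j)) * Kpi L j (x - 2 * pi * of_int u / 2 ^ j))) UNIV" for u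
  proof -
    let ?x = "x - 2 * pi * of_int u / 2 ^ j"
    have "(\<lambda>n::int. KL L (2 ^ j * (?x + 2 * pi * of_int n))) summable_on UNIV"
      by (rule abs_summable_summable) (unfold real_norm_def, rule summable_KL_grid[OF L])
    then have "((\<lambda>n::int. complex_of_real (KL L (2 ^ j * (?x + 2 * pi * of_int n)))) has_sum
        complex_of_real (infsum (\<lambda>n::int. KL L (2 ^ j * (?x + 2 * pi * of_int n))) UNIV)) UNIV"
      by (intro has_sum_of_real has_sum_infsum)
    moreover have "Kpi L j ?x = complex_of_real (infsum (\<lambda>n::int. KL L (2 ^ j * (?x + 2 * pi * of_int n))) UNIV)"
      using L unfolding Kpi_def by simp
    ultimately have "((\<lambda>n::int. complex_of_real (KL L (2 ^ j * (?x + 2 * pi * of_int n)))) has_sum Kpi L j ?x) UNIV"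
      by (simp only:)
    then have "((\<lambda>n::int. cis (of_int k * (2 * pi * of_int u / 2 ^ j)) * complex_of_real (KL L (2 ^ j * (?x + 2 * pi * of_int n)))) has_sum
       cis (of_int k * (2 * pi * of_int u / 2 ^ j)) * Kpi L j ?x) UNIV"
      by (rule has_sum_cmult_right)
    moreover have "cis (of_int k * (2 * pi * of_int u / 2 ^ j)) * complex_of_real (KL L (2 ^ j * (?x + 2 * pi * of_int n))) = F (u - 2 ^ j * n)" for n
    proof -
      have "cis (2 * pi * (of_int k / 2 ^ j) * of_int (u - 2 ^ j * n)) = cis (of_int k * (2 * pi * of_int u / 2 ^ j)) * cis (2 * pi * of_int (- k * n))"
        unfolding cis_mult by (rule arg_cong[where f = cis]) (simp add: right_diff_distrib)
      also have "cis (2 * pi * of_int (- k * n)) = 1" by (rule cis_multiple_2pi) auto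
      moreover have "2 ^ j * (?x + 2 * pi * of_int n) = 2 ^ j * x - 2 * pi * of_int (u - 2 ^ j * n)"
        by (simp add: field_simps)
      ultimately show ?thesis unfolding F_def by (simp only: mult_1_right)
    qed
    ultimately show ?thesis by (simp only: prod.case)
  qed
  ultimately have "((\<lambda>u. cis (of_int k * (2 * pi * of_int u / 2 ^ j)) * Kpi L j (x - 2 * pi * of_int u / 2 ^ j)) has_sum infsum F UNIV) (Uset j)"
    by (rule has_sum_SigmaD)
  moreover have "((\<lambda>u. cis (of_int k * (2 * pi * of_int u / 2 ^ j)) * Kpi L j (x - 2 * pi * of_int u / 2 ^ j)) has_sum
      Iop L j (\<lambda>t. cis (of_int k * t)) x) (Uset j)"
    unfolding Iop_def by (rule has_sum_finite) simp
  ultimately show ?thesis unfolding F_def by (rule has_sum_unique[rotated])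
qed

lemma Kpi_1: "Kpi (Suc 0) j x = 1 / 2 ^ j * (\<Sum>k\<in>Uset j. cis (of_int k * x))"
  by (auto simp: Kpi_def Uset_def)

text \<open>Aliasing for the Dirichlet kernel: discrete orthogonality keeps only those
  \<open>l\<close> of \<open>Uset j\<close> that agree with \<open>k\<close> modulo
  \<open>2 ^ j\<close>.\<close>

lemma Iop_1_cis:
  "Iop (Suc 0) j (\<lambda>t. cis (of_int k * t)) x = (\<Sum>l\<in>Uset j. if 2 ^ j dvd (k - l) then cis (of_int l * x) else 0)"
proof -
  have e: "cis (of_int k * (2 * pi * of_int u / 2 ^ j)) * cis (of_int l * (x - 2 * pi * of_int u / 2 ^ j)) =
      cis (of_int l * x) * cis (2 * pi * of_int (k - l) * of_int u / 2 ^ j)" for u l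
    unfolding cis_mult by (rule arg_cong[where f = cis]) (simp add: field_simps)
  have "Iop (Suc 0) j (\<lambda>t. cis (of_int k * t)) x =
      (\<Sum>u\<in>Uset j. \<Sum>l\<in>Uset j. 1 / 2 ^ j * (cis (of_int k * (2 * pi * of_int u / 2 ^ j)) * cis (of_int l * (x - 2 * pi * of_int u / 2 ^ j))))"
    unfolding Iop_def Kpi_1 sum_distrib_left by (intro sum.cong refl) (simp add: mult.left_commute)
  also have "\<dots> = (\<Sum>l\<in>Uset j. \<Sum>u\<in>Uset j. 1 / 2 ^ j * (cis (of_int l * x) * cis (2 * pi * of_int (k - l) * of_int u / 2 ^ j)))"
    unfolding e by (rule sum.swap)
  also have "\<dots> = (\<Sum>l\<in>Uset j. 1 / 2 ^ j * (cis (of_int l * x) * (\<Sum>u\<in>Uset j. cis (2 * pi * of_int (k - l) * of_int u / 2 ^ j))))"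
    by (simp only: sum_distrib_left)
  also have "\<dots> = (\<Sum>l\<in>Uset j. if 2 ^ j dvd (k - l) then cis (of_int l * x) else 0)"
    unfolding sum_Uset_cis by (intro sum.cong refl) auto
  finally show ?thesis .
qed

lemma Uset_abs_le: "u \<in> Uset j \<Longrightarrow> \<bar>u\<bar> \<le> 2 ^ j"
  unfolding Uset_alt by auto

text \<open>The frequencies produced are the aliases \<open>k + 2 ^ j * n\<close>. For
  \<open>L >= 2\<close> they carry the weights \<open>\<rho> (\<xi> + n)\<close>, and the support of
  \<open>\<rho>\<close> removes those above \<open>2 ^ j\<close>.\<close>

lemma Iop_cis_trig_poly:
  assumes L: "1 \<le> L"
  shows "trig_poly (2 ^ j) (Iop L j (\<lambda>t. cis (of_int k * t)))"
proof (cases "L = 1")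
  case True
  have "trig_poly (2 ^ j) (\<lambda>x. \<Sum>l\<in>Uset j. if 2 ^ j dvd (k - l) then cis (of_int l * x) else 0)"
  proof (intro trig_poly_sum)
    fix l assume "l \<in> Uset j"
    then show "trig_poly (2 ^ j) (\<lambda>x. if 2 ^ j dvd (k - l) then cis (of_int l * x) else 0)"
      using trig_poly_cis[of l "2 ^ j"] Uset_abs_le[of l j] by (cases "2 ^ j dvd (k - l)") (auto simp: trig_poly_zero)
  qed
  then show ?thesis using True by (simp add: Iop_1_cis[abs_def])
next
  case False
  then have L: "2 \<le> L" using L by simp
  obtain \<rho> where \<rho>0: "\<And>t. 1 - 1 / 2 ^ L \<le> \<bar>t\<bar> \<Longrightarrow> \<rho> t = 0"
    and \<rho>: "\<And>y \<xi> N. \<bar>\<xi>\<bar> + 1 \<le> real N \<Longrightarrow>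
      (\<Sum>\<^sub>\<infinity>v::int. cis (2 * pi * \<xi> * of_int v) * complex_of_real (KL L (y - 2 * pi * of_int v))) =
      (\<Sum>n\<in>{-int N..int N}. complex_of_real (\<rho> (\<xi> + of_int n)) * cis ((\<xi> + of_int n) * y))"
    using poisson_KL[OF L] by blast
  define \<xi> where "\<xi> = real_of_int k / 2 ^ j"
  obtain N :: nat where N: "\<bar>\<xi>\<bar> + 1 \<le> real N" using real_arch_simple by blast
  have "trig_poly (2 ^ j) (\<lambda>x. \<Sum>n\<in>{-int N..int N}. complex_of_real (\<rho> (\<xi> + of_int n)) * cis (of_int (k + 2 ^ j * n) * x))"
  proof (intro trig_poly_sum)
    fix n :: int
    show "trig_poly (2 ^ j) (\<lambda>x. complex_of_real (\<rho> (\<xi> + of_int n)) * cis (of_int (k + 2 ^ j * n) * x))"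
    proof (cases "1 \<le> \<bar>\<xi> + of_int n\<bar>")
      case True
      then have "\<rho> (\<xi> + of_int n) = 0" proof (intro \<rho>0)
        have "0 \<le> (1::real) / 2 ^ L" by simp
        with True show "1 - 1 / 2 ^ L \<le> \<bar>\<xi> + of_int n\<bar>" by linarith
      qed
      then show ?thesis by (simp add: trig_poly_zero)
    next
      case False
      have "real_of_int (k + 2 ^ j * n) = 2 ^ j * (\<xi> + of_int n)" unfolding \<xi>_def by (simp add: field_simps)
      then have "\<bar>real_of_int (k + 2 ^ j * n)\<bar> \<le> 2 ^ j" using False by (simp add: abs_mult)
      then have "real_of_int \<bar>k + 2 ^ j * n\<bar> \<le> real_of_int (int (2 ^ j))" by simp
      then have "\<bar>k + 2 ^ j * n\<bar> \<le> int (2 ^ j)" by (simp only: of_int_le_iff)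
      then show ?thesis by (intro trig_poly_cmult trig_poly_cis)
    qed
  qed
  moreover have "Iop L j (\<lambda>t. cis (of_int k * t)) = (\<lambda>x. \<Sum>n\<in>{-int N..int N}. complex_of_real (\<rho> (\<xi> + of_int n)) * cis (of_int (k + 2 ^ j * n) * x))"
  proof (rule ext)
    fix x
    have "(\<xi> + of_int n) * (2 ^ j * x) = of_int (k + 2 ^ j * n) * x" for n
      unfolding \<xi>_def by (simp add: field_simps)
    then show "Iop L j (\<lambda>t. cis (of_int k * t)) x = (\<Sum>n\<in>{-int N..int N}. complex_of_real (\<rho> (\<xi> + of_int n)) * cis (of_int (k + 2 ^ j * n) * x))"
      unfolding Iop_cis_eq_infsum[OF L] \<xi>_def[symmetric] using \<rho>[OF N, of "2 ^ j * x"] by (simp only:)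
  qed
  ultimately show ?thesis by simp
qed

text \<open>For \<open>L >= 2\<close> the ratio \<open>\<xi> = k / 2 ^ j\<close> lies on the plateau
  of \<open>\<rho>\<close>, so \<open>k\<close> keeps weight 1; every other alias has
  \<open>|\<xi> + n| >= 1 - 1 / 2 ^ L\<close> and weight 0. For \<open>L = 1\<close> the condition
  puts \<open>k\<close> into \<open>Uset j\<close>, where it is its own alias.\<close>

lemma Iop_cis_reproduce:
  assumes L: "1 \<le> L" and k: "2 ^ L * \<bar>k\<bar> < 2 ^ j"
  shows "Iop L j (\<lambda>t. cis (of_int k * t)) = (\<lambda>t. cis (of_int k * t))"
proof (cases "L = 1")
  case True
  have kU: "k \<in> Uset j"
    using k True by (cases j) (auto simp: Uset_def)
  have "Iop (Suc 0) j (\<lambda>t. cis (of_int k * t)) x = cis (of_int k * x)" for x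
  proof -
    have "(\<Sum>l\<in>Uset j. if 2 ^ j dvd (k - l) then cis (of_int l * x) else 0) = (\<Sum>l\<in>Uset j. if l = k then cis (of_int l * x) else 0)"
    proof (intro sum.cong refl)
      fix l assume l: "l \<in> Uset j"
      have "\<bar>k - l\<bar> < 2 ^ j" using kU l by (rule Uset_diff)
      then have "2 ^ j dvd (k - l) \<longleftrightarrow> l = k"
        using dvd_imp_le_int[of "k - l" "2 ^ j"] by force
      then show "(if 2 ^ j dvd (k - l) then cis (of_int l * x) else 0) = (if l = k then cis (of_int l * x) else 0)" by simp
    qed
    then show ?thesis using kU by (simp add: Iop_1_cis)
  qed
  then show ?thesis using True by auto
next
  case False
  then have L: "2 \<le> L" using L by simp
  obtain \<rho> where \<rho>0: "\<And>t. 1 - 1 / 2 ^ L \<le> \<bar>t\<bar> \<Longrightarrow> \<rho> t = 0"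
    and \<rho>1: "\<And>t. \<bar>t\<bar> \<le> 1 / 2 ^ L \<Longrightarrow> \<rho> t = 1"
    and \<rho>: "\<And>y \<xi> N. \<bar>\<xi>\<bar> + 1 \<le> real N \<Longrightarrow>
      (\<Sum>\<^sub>\<infinity>v::int. cis (2 * pi * \<xi> * of_int v) * complex_of_real (KL L (y - 2 * pi * of_int v))) =
      (\<Sum>n\<in>{-int N..int N}. complex_of_real (\<rho> (\<xi> + of_int n)) * cis ((\<xi> + of_int n) * y))"
    using poisson_KL[OF L] by blast
  define \<xi> where "\<xi> = real_of_int k / 2 ^ j"
  have "real_of_int (2 ^ L * \<bar>k\<bar>) < real_of_int (2 ^ j)" using k by (simp only: of_int_less_iff)
  then have \<xi>: "\<bar>\<xi>\<bar> < 1 / 2 ^ L" unfolding \<xi>_def by (simp add: field_simps)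
  have "(1::real) / 2 ^ L \<le> 1" by simp
  then have N: "\<bar>\<xi>\<bar> + 1 \<le> real 2" using \<xi> by linarith
  show ?thesis
  proof (rule ext)
    fix x
    have "Iop L j (\<lambda>t. cis (of_int k * t)) x = (\<Sum>n\<in>{-int 2..int 2}. complex_of_real (\<rho> (\<xi> + of_int n)) * cis ((\<xi> + of_int n) * (2 ^ j * x)))"
      unfolding Iop_cis_eq_infsum[OF L] \<xi>_def[symmetric] by (rule \<rho>[OF N])
    also have "\<dots> = (\<Sum>n\<in>{0}. complex_of_real (\<rho> (\<xi> + of_int n)) * cis ((\<xi> + of_int n) * (2 ^ j * x)))"
    proof (rule sum.mono_neutral_right)
      show "\<forall>n\<in>{-int 2..int 2} - {0}. complex_of_real (\<rho> (\<xi> + of_int n)) * cis ((\<xi> + of_int n) * (2 ^ j * x)) = 0"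
      proof
        fix n assume "n \<in> {-int 2..int 2} - {0}"
        then have "1 \<le> \<bar>real_of_int n\<bar>" by auto
        then have "1 - 1 / 2 ^ L \<le> \<bar>\<xi> + of_int n\<bar>" using \<xi> by (simp add: abs_if split: if_splits)
        then show "complex_of_real (\<rho> (\<xi> + of_int n)) * cis ((\<xi> + of_int n) * (2 ^ j * x)) = 0" by (simp add: \<rho>0)
      qed
    qed auto
    also have "\<dots> = cis (of_int k * x)" using \<rho>1[of \<xi>] \<xi> by (simp add: \<xi>_def)
    finally show "Iop L j (\<lambda>t. cis (of_int k * t)) x = cis (of_int k * x)" .
  qed
qed

text \<open>The mean over all \<open>k\<close> in \<open>Uset j\<close> of the grid exponentials is
  the discrete delta at node 0, and interpolating this delta returns the kernel. So the kernel
  inherits its degree from the interpolated exponentials.\<close>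

lemma Kpi_trig_poly:
  assumes L: "1 \<le> L"
  shows "trig_poly (2 ^ j) (Kpi L j)"
proof -
  have "trig_poly (2 ^ j) (\<lambda>x. 1 / 2 ^ j * (\<Sum>k\<in>Uset j. Iop L j (\<lambda>t. cis (of_int k * t)) x))"
    by (intro trig_poly_cmult trig_poly_sum Iop_cis_trig_poly L)
  moreover have "1 / 2 ^ j * (\<Sum>k\<in>Uset j. Iop L j (\<lambda>t. cis (of_int k * t)) x) = Kpi L j x" for x
  proof -
    have "(\<Sum>k\<in>Uset j. Iop L j (\<lambda>t. cis (of_int k * t)) x) =
      (\<Sum>u\<in>Uset j. (\<Sum>k\<in>Uset j. cis (2 * pi * of_int u * of_int k / 2 ^ j)) * Kpi L j (x - 2 * pi * of_int u / 2 ^ j))"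
      unfolding Iop_def sum_distrib_right
      by (subst sum.swap) (intro sum.cong refl, simp add: mult_ac)
    also have "\<dots> = (\<Sum>u\<in>Uset j. if u = 0 then 2 ^ j * Kpi L j x else 0)"
    proof (intro sum.cong refl)
      fix u assume u: "u \<in> Uset j"
      have "\<bar>u\<bar> < 2 ^ j" using u unfolding Uset_alt by auto
      then have "2 ^ j dvd u \<longleftrightarrow> u = 0"
        using dvd_imp_le_int[of u "2 ^ j"] by force
      then show "(\<Sum>k\<in>Uset j. cis (2 * pi * of_int u * of_int k / 2 ^ j)) * Kpi L j (x - 2 * pi * of_int u / 2 ^ j) =
        (if u = 0 then 2 ^ j * Kpi L j x else 0)"
        unfolding sum_Uset_cis by simp
    qed
    also have "\<dots> = 2 ^ j * Kpi L j x"
    proof -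
      have "0 \<in> Uset j" unfolding Uset_alt by (cases j) auto
      then show ?thesis by simp
    qed
    finally show ?thesis by simp
  qed
  ultimately show ?thesis by simp
qed


subsection \<open>Size of the kernels\<close>

lemma powr_add_le:
  fixes a b s :: real
  assumes "0 \<le> a" "0 \<le> b" "0 < s" "s \<le> 1"
  shows "(a + b) powr s \<le> a powr s + b powr s"
proof (cases "a + b = 0")
  case False
  then have ab: "0 < a + b" using assms by auto
  have *: "c / (a + b) \<le> (c / (a + b)) powr s" if "0 \<le> c" "c \<le> a + b" for c
  proof (cases "c = 0")
    case False
    have "(c / (a + b)) powr 1 \<le> (c / (a + b)) powr s"
      using that ab assms by (intro powr_mono') auto
    then show ?thesis using False that ab by simp
  qed simp
  have "1 = a / (a + b) + b / (a + b)" using ab by (simp add: add_divide_distrib[symmetric])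
  also have "\<dots> \<le> (a / (a + b)) powr s + (b / (a + b)) powr s"
    using assms by (intro add_mono *) auto
  also have "\<dots> = (a powr s + b powr s) / (a + b) powr s"
    using assms ab by (simp add: powr_divide add_divide_distrib)
  finally show ?thesis using ab by (simp add: field_simps)
qed (use assms in auto)

lemma powr_sum_le:
  fixes s :: real
  assumes "finite A" "\<And>i. i \<in> A \<Longrightarrow> 0 \<le> f i" "0 < s" "s \<le> 1"
  shows "(\<Sum>i\<in>A. f i) powr s \<le> (\<Sum>i\<in>A. f i powr s)"
  using assms
proof (induction A rule: finite_induct)
  case (insert x A)
  have "(\<Sum>i\<in>insert x A. f i) powr s \<le> f x powr s + (\<Sum>i\<in>A. f i) powr s"
    using insert by (simp add: powr_add_le sum_nonneg)
  also have "\<dots> \<le> f x powr s + (\<Sum>i\<in>A. f i powr s)"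
    using insert by (intro add_left_mono) auto
  finally show ?case using insert by simp
qed simp

lemma jordan_sin:
  assumes "0 \<le> t" "t \<le> pi / 2"
  shows "2 / pi * t \<le> sin t"
proof -
  have "concave_on {0..pi / 2} sin"
  proof (rule f''_le0_imp_concave)
    fix x :: real assume "x \<in> {0..pi / 2}"
    then show "- sin x \<le> 0" by (auto intro!: sin_ge_zero)
  qed (auto intro!: derivative_eq_intros)
  from concave_onD[OF this, of "2 * t / pi" 0 "pi / 2"] assms show ?thesis
    by (simp add: field_simps)
qed

text \<open>Measured in node spacings, the Dirichlet kernel is dominated by \<open>decay\<close>
  within half a period. Each node is replaced by its translate nearest to the evaluation point;
  these translates are distinct integers, so the lattice bound applies.\<close>

lemma Kpi_sum_bound_1:
  assumes s: "1 < s"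
  shows "\<exists>C>0. \<forall>j x. (\<Sum>u\<in>Uset j. cmod (Kpi (Suc 0) j (x - 2 * pi * of_int u / 2 ^ j)) powr s) \<le> C"
proof -
  obtain C where C: "C > 0" "\<And>y (Z::int set). finite Z \<Longrightarrow> (\<Sum>z\<in>Z. decay (y - of_int z) powr s) \<le> C"
    using lattice_sum_bound[OF s] by auto
  have bd: "cmod (Kpi (Suc 0) j (2 * pi * \<tau> / 2 ^ j)) \<le> decay \<tau>" if \<tau>: "\<bar>\<tau>\<bar> \<le> 2 ^ j / 2" for j \<tau>
  proof -
    have c2: "card (Uset j) = 2 ^ j" using bij_betw_same_card[OF Uset_image, of j] by simp
    define x where "x = 2 * pi * \<tau> / 2 ^ j"
    have le1: "cmod (\<Sum>k\<in>Uset j. cis (of_int k * x)) \<le> 2 ^ j"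
      by (rule order_trans[OF norm_sum]) (simp add: c2)
    show ?thesis
    proof (cases "\<bar>\<tau>\<bar> \<le> 1")
      case True
      then have "decay \<tau> = 1" by (simp add: decay_def)
      then show ?thesis using le1 unfolding Kpi_1 x_def by (simp add: norm_mult norm_divide norm_power)
    next
      case False
      define h :: int where "h = 2 ^ j div 2"
      define w where "w = cis x"
      have "(\<Sum>k\<in>Uset j. cis (of_int k * x)) = (\<Sum>i<2 ^ j. cis (of_int (int i - h) * x))"
        unfolding h_def by (rule sum.reindex_bij_betw[OF Uset_image, symmetric])
      also have "\<dots> = (\<Sum>i<2 ^ j. cis (- of_int h * x) * w ^ i)"
        unfolding w_def Complex.DeMoivre cis_mult
        by (intro sum.cong refl arg_cong[where f = cis]) (simp add: algebra_simps)
      also have "\<dots> = cis (- of_int h * x) * (\<Sum>i<2 ^ j. w ^ i)" by (simp add: sum_distrib_left)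
      finally have "cmod (\<Sum>k\<in>Uset j. cis (of_int k * x)) = cmod (\<Sum>i<2 ^ j. w ^ i)"
        by (simp add: norm_mult)
      moreover have "cmod (1 - w) * cmod (\<Sum>i<2 ^ j. w ^ i) \<le> 2"
      proof -
        have "(1 - w) * (\<Sum>i<2 ^ j. w ^ i) = 1 - w ^ 2 ^ j" by (rule one_diff_power_eq[symmetric])
        then have "cmod (1 - w) * cmod (\<Sum>i<2 ^ j. w ^ i) = cmod (1 - w ^ 2 ^ j)" by (metis norm_mult)
        also have "\<dots> \<le> 2" using norm_triangle_ineq4[of 1 "w ^ 2 ^ j"] by (simp add: norm_power w_def)
        finally show ?thesis .
      qed
      \<comment> \<open>Here \<open>|1 - w|\<close> is the chord \<open>2 * |sin (x / 2)|\<close>.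
        Jordan's inequality bounds it from below, because \<open>|\<tau>| <= 2 ^ j / 2\<close> keeps
        \<open>|x / 2|\<close> below \<open>pi / 2\<close>.\<close>
      moreover have "4 * \<bar>\<tau>\<bar> / 2 ^ j \<le> cmod (1 - w)"
      proof -
        have "(cmod (1 - w))\<^sup>2 = (1 - cos x)\<^sup>2 + (sin x)\<^sup>2" by (simp add: cmod_power2 w_def)
        also have "\<dots> = 2 - 2 * cos x" using sin_cos_squared_add[of x] by (simp add: power2_eq_square algebra_simps)
        also have "\<dots> = (2 * sin (x / 2))\<^sup>2" using cos_double_sin[of "x / 2"] by (simp add: power2_eq_square)
        finally have "(cmod (1 - w))\<^sup>2 = (2 * \<bar>sin (x / 2)\<bar>)\<^sup>2" by (simp add: power_mult_distrib)
        then have w: "cmod (1 - w) = 2 * \<bar>sin (x / 2)\<bar>" by (rule power2_eq_imp_eq) auto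
        have x2: "\<bar>x / 2\<bar> = pi * (\<bar>\<tau>\<bar> / 2 ^ j)" unfolding x_def by (simp add: abs_mult)
        have "\<bar>\<tau>\<bar> / 2 ^ j \<le> 1 / 2" using \<tau> by (simp add: field_simps)
        then have "\<bar>x / 2\<bar> \<le> pi / 2" unfolding x2 by (simp add: field_simps)
        then have "2 / pi * \<bar>x / 2\<bar> \<le> sin \<bar>x / 2\<bar>"
          by (intro jordan_sin) auto
        also have "sin \<bar>x / 2\<bar> = \<bar>sin (x / 2)\<bar> \<or> sin \<bar>x / 2\<bar> = - \<bar>sin (x / 2)\<bar>" by (auto simp: abs_if)
        then have "sin \<bar>x / 2\<bar> \<le> \<bar>sin (x / 2)\<bar>" by linarith
        finally show ?thesis unfolding w x2 by (simp add: field_simps)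
      qed
      ultimately have "4 * \<bar>\<tau>\<bar> / 2 ^ j * cmod (\<Sum>k\<in>Uset j. cis (of_int k * x)) \<le> 2"
        by (smt (verit) mult_right_mono norm_ge_zero)
      then have "cmod (\<Sum>k\<in>Uset j. cis (of_int k * x)) / 2 ^ j \<le> 1 / (2 * \<bar>\<tau>\<bar>)"
        using False by (simp add: field_simps)
      also have "\<dots> \<le> 1 / \<bar>\<tau>\<bar>" using False by (intro divide_left_mono) auto
      also have "\<dots> = decay \<tau>" using False by (simp add: decay_def)
      finally show ?thesis unfolding Kpi_1 x_def by (simp add: norm_mult norm_divide norm_power)
    qed
  qed
  show ?thesis
  proof (intro exI[of _ C] conjI C(1) allI)
    fix j x
    define y where "y = x * 2 ^ j / (2 * pi)"
    \<comment> \<open>\<open>z u\<close> is the translate of \<open>u\<close> by whole periods that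
      is nearest to \<open>y\<close>. Distinct nodes differ modulo \<open>2 ^ j\<close>, hence have
      distinct translates.\<close>
    define z where "z = (\<lambda>u::int. u + 2 ^ j * round ((y - of_int u) / 2 ^ j))"
    have inj: "inj_on z (Uset j)"
    proof (rule inj_onI)
      fix u u' assume u: "u \<in> Uset j" "u' \<in> Uset j" and "z u = z u'"
      then have "u - u' = 2 ^ j * (round ((y - of_int u') / 2 ^ j) - round ((y - of_int u) / 2 ^ j))"
        unfolding z_def by (simp add: algebra_simps)
      then have "2 ^ j dvd u - u'" by simp
      moreover have "\<bar>u - u'\<bar> < 2 ^ j" using u by (rule Uset_diff)
      ultimately show "u = u'" using dvd_imp_le_int[of "u - u'" "2 ^ j"] by force
    qed
    have "cmod (Kpi (Suc 0) j (x - 2 * pi * of_int u / 2 ^ j)) powr s \<le> decay (y - of_int (z u)) powr s" for u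
    proof -
      have "\<bar>(y - of_int u) / 2 ^ j - of_int (round ((y - of_int u) / 2 ^ j))\<bar> \<le> 1 / 2"
        using of_int_round_abs_le[of "(y - of_int u) / 2 ^ j"] by (simp add: abs_minus_commute)
      moreover have "(y - of_int u) / 2 ^ j - of_int (round ((y - of_int u) / 2 ^ j)) = (y - of_int (z u)) / 2 ^ j"
        unfolding z_def by (simp add: field_simps)
      ultimately have "\<bar>y - of_int (z u)\<bar> \<le> 2 ^ j / 2" by (simp add: field_simps)
      then have "cmod (Kpi (Suc 0) j (2 * pi * (y - of_int (z u)) / 2 ^ j)) \<le> decay (y - of_int (z u))" by (rule bd)
      moreover have "x - 2 * pi * of_int u / 2 ^ j = 2 * pi * (y - of_int (z u)) / 2 ^ j + 2 * pi * of_int (round ((y - of_int u) / 2 ^ j))"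
        unfolding z_def y_def by (simp add: field_simps)
      ultimately show ?thesis
        using trig_poly_periodic[OF Kpi_trig_poly[of "Suc 0" j]] s by (intro powr_mono2) auto
    qed
    then have "(\<Sum>u\<in>Uset j. cmod (Kpi (Suc 0) j (x - 2 * pi * of_int u / 2 ^ j)) powr s) \<le> (\<Sum>u\<in>Uset j. decay (y - of_int (z u)) powr s)"
      by (intro sum_mono)
    also have "\<dots> = (\<Sum>v\<in>z ` Uset j. decay (y - of_int v) powr s)"
      using inj by (simp add: sum.reindex)
    also have "\<dots> \<le> C" by (intro C(2)) simp
    finally show "(\<Sum>u\<in>Uset j. cmod (Kpi (Suc 0) j (x - 2 * pi * of_int u / 2 ^ j)) powr s) \<le> C" .
  qed
qed

text \<open>For \<open>s <= 1\<close> the power is subadditive and may be moved inside the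
  periodization. Nodes and periods then combine into a lattice on which the decay has order
  \<open>L * s > 1\<close>.\<close>

lemma Kpi_sum_bound_small:
  assumes L: "2 \<le> L" and s: "1 / real L < s" "s \<le> 1"
  shows "\<exists>C>0. \<forall>j x. (\<Sum>u\<in>Uset j. cmod (Kpi L j (x - 2 * pi * of_int u / 2 ^ j)) powr s) \<le> C"
proof -
  have s0: "0 < s" using s(1) by (rule le_less_trans[rotated]) simp
  define c where "c = (\<Prod>l\<in>{1..L}. (2::real) ^ l)"
  have c: "c > 0" unfolding c_def by (intro prod_pos) auto
  have "1 < real L * s" using s L by (simp add: field_simps)
  then obtain C where C: "C > 0" "\<And>y (Z::int set). finite Z \<Longrightarrow> (\<Sum>z\<in>Z. decay (y - of_int z) powr (real L * s)) \<le> C"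
    using lattice_sum_bound by blast
  show ?thesis
  proof (intro exI[of _ "c powr s * C"] conjI allI)
    fix j x
    define y where "y = x * 2 ^ j / (2 * pi)"
    let ?x = "\<lambda>u. x - 2 * pi * of_int u / 2 ^ j"
    let ?K = "\<lambda>u n. KL L (2 ^ j * (?x u + 2 * pi * of_int n))"
    \<comment> \<open>Subadditivity is applied to finitely many periods; the full periodization is
      the limit, and the bound is uniform in the finite set \<open>F\<close>.\<close>
    have lim: "((\<lambda>F. \<Sum>u\<in>Uset j. norm (\<Sum>n\<in>F. ?K u n) powr s) \<longlongrightarrow> (\<Sum>u\<in>Uset j. norm (infsum (?K u) UNIV) powr s)) (finite_subsets_at_top UNIV)"
    proof (intro tendsto_sum tendsto_powr' tendsto_norm)
      fix u assume "u \<in> Uset j"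
      have "?K u summable_on UNIV"
        by (rule abs_summable_summable) (unfold real_norm_def, rule summable_KL_grid[OF L])
      then show "(sum (?K u) \<longlongrightarrow> infsum (?K u) UNIV) (finite_subsets_at_top UNIV)"
        by (rule infsum_tendsto)
    qed (use s0 in auto)
    have fin: "(\<Sum>u\<in>Uset j. norm (\<Sum>n\<in>F. ?K u n) powr s) \<le> c powr s * C" if F: "finite F" for F
    proof -
      have "(\<Sum>u\<in>Uset j. norm (\<Sum>n\<in>F. ?K u n) powr s) \<le> (\<Sum>u\<in>Uset j. \<Sum>n\<in>F. \<bar>?K u n\<bar> powr s)"
      proof (rule sum_mono)
        fix u
        have "norm (\<Sum>n\<in>F. ?K u n) powr s \<le> (\<Sum>n\<in>F. \<bar>?K u n\<bar>) powr s"
          using s0 by (intro powr_mono2) auto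
        also have "\<dots> \<le> (\<Sum>n\<in>F. \<bar>?K u n\<bar> powr s)"
          using F s0 s by (intro powr_sum_le) auto
        finally show "norm (\<Sum>n\<in>F. ?K u n) powr s \<le> (\<Sum>n\<in>F. \<bar>?K u n\<bar> powr s)" .
      qed
      also have "\<dots> \<le> (\<Sum>u\<in>Uset j. \<Sum>n\<in>F. c powr s * decay (y - of_int (u - 2 ^ j * n)) powr (real L * s))"
      proof (intro sum_mono)
        fix u n
        have "2 ^ j * (?x u + 2 * pi * of_int n) = 2 * pi * (y - of_int (u - 2 ^ j * n))"
          unfolding y_def by (simp add: field_simps)
        then have "\<bar>?K u n\<bar> \<le> c * decay (y - of_int (u - 2 ^ j * n)) ^ L"
          using abs_KL_le[of L "y - of_int (u - 2 ^ j * n)"] by (simp add: c_def)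
        then have "\<bar>?K u n\<bar> powr s \<le> (c * decay (y - of_int (u - 2 ^ j * n)) ^ L) powr s"
          using s0 by (intro powr_mono2) auto
        also have "\<dots> = c powr s * decay (y - of_int (u - 2 ^ j * n)) powr (real L * s)"
          using c decay_bounds(1)[of "y - of_int (u - 2 ^ j * n)"] by (simp add: powr_mult powr_realpow[symmetric] powr_powr)
        finally show "\<bar>?K u n\<bar> powr s \<le> c powr s * decay (y - of_int (u - 2 ^ j * n)) powr (real L * s)" .
      qed
      also have "\<dots> = c powr s * (\<Sum>(u, n)\<in>Uset j \<times> F. decay (y - of_int (u - 2 ^ j * n)) powr (real L * s))"
        by (simp add: sum_distrib_left sum.cartesian_product case_prod_beta)
      also have "(\<Sum>(u, n)\<in>Uset j \<times> F. decay (y - of_int (u - 2 ^ j * n)) powr (real L * s)) =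
          (\<Sum>z\<in>(\<lambda>(u, n). u - 2 ^ j * n) ` (Uset j \<times> F). decay (y - of_int z) powr (real L * s))"
        by (subst sum.reindex) (auto intro: inj_on_subset[OF bij_betw_imp_inj_on[OF bij_Uset_UNIV]] intro!: sum.cong)
      also have "c powr s * \<dots> \<le> c powr s * C"
        using F by (intro mult_left_mono C(2)) auto
      finally show ?thesis .
    qed
    have "(\<Sum>u\<in>Uset j. norm (infsum (?K u) UNIV) powr s) \<le> c powr s * C"
    proof (rule tendsto_upperbound[OF lim])
      show "\<forall>\<^sub>F F in finite_subsets_at_top UNIV. (\<Sum>u\<in>Uset j. norm (\<Sum>n\<in>F. ?K u n) powr s) \<le> c powr s * C"
        by (intro eventually_finite_subsets_at_top_weakI fin)
    qed simp
    then show "(\<Sum>u\<in>Uset j. cmod (Kpi L j (?x u)) powr s) \<le> c powr s * C"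
      using L by (simp add: Kpi_def)
  qed (use c C in auto)
qed

text \<open>For \<open>L >= 2\<close> the range \<open>s > 1\<close> is reduced to exponent
  \<open>min 1 s\<close>: a single term of that sum is at most \<open>C\<close>, so the surplus
  power is bounded by \<open>C powr (t - 1)\<close>.\<close>

lemma Kpi_sum_bound:
  assumes L: "1 \<le> L" and s: "1 / real L < s"
  shows "\<exists>C>0. \<forall>j x. (\<Sum>u\<in>Uset j. cmod (Kpi L j (x - 2 * pi * of_int u / 2 ^ j)) powr s) \<le> C"
proof (cases "L = 1")
  case True
  then show ?thesis using Kpi_sum_bound_1[of s] s by simp
next
  case False
  then have L2: "2 \<le> L" using L by simp
  have "1 / real L < 1" using L2 by simp
  then have s': "1 / real L < min 1 s" "min 1 s \<le> 1" "0 < min 1 s"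
    using s by (auto intro: le_less_trans[rotated])
  obtain C where C: "C > 0" "\<And>j x. (\<Sum>u\<in>Uset j. cmod (Kpi L j (x - 2 * pi * of_int u / 2 ^ j)) powr (min 1 s)) \<le> C"
    using Kpi_sum_bound_small[OF L2 s'(1,2)] by blast
  define t where "t = s / min 1 s"
  have t: "t \<ge> 1" "min 1 s * t = s" using s' by (auto simp: t_def min_def)
  show ?thesis
  proof (intro exI[of _ "C powr (t - 1) * C"] conjI allI)
    fix j x
    let ?b = "\<lambda>u. cmod (Kpi L j (x - 2 * pi * of_int u / 2 ^ j)) powr (min 1 s)"
    have "(\<Sum>u\<in>Uset j. cmod (Kpi L j (x - 2 * pi * of_int u / 2 ^ j)) powr s) \<le> (\<Sum>u\<in>Uset j. C powr (t - 1) * ?b u)"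
    proof (rule sum_mono)
      fix u assume u: "u \<in> Uset j"
      have b: "?b u \<le> C"
        using order_trans[OF member_le_sum[OF u, of ?b] C(2)] by simp
      have "cmod (Kpi L j (x - 2 * pi * of_int u / 2 ^ j)) powr s = ?b u powr t"
        by (simp add: powr_powr t)
      also have "\<dots> = ?b u powr (t - 1) * ?b u"
        by (cases "?b u = 0") (auto simp: powr_diff)
      also have "\<dots> \<le> C powr (t - 1) * ?b u"
        using t b by (intro mult_right_mono powr_mono2) auto
      finally show "cmod (Kpi L j (x - 2 * pi * of_int u / 2 ^ j)) powr s \<le> C powr (t - 1) * ?b u" .
    qed
    also have "\<dots> \<le> C powr (t - 1) * C"
      unfolding sum_distrib_left[symmetric] by (intro mult_left_mono C(2)) auto
    finally show "(\<Sum>u\<in>Uset j. cmod (Kpi L j (x - 2 * pi * of_int u / 2 ^ j)) powr s) \<le> C powr (t - 1) * C" .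
  qed (use C in auto)
qed

text \<open>After reducing the shift to \<open>[-pi, pi]\<close>, the piece cut off at one end of
  the interval is moved by a full period to the other end.\<close>

lemma nn_integral_circ_shift:
  fixes g :: "real \<Rightarrow> real"
  assumes g: "continuous_on UNIV g" "\<And>t. 0 \<le> g t" and per: "\<And>t l. g (t + 2 * pi * of_int l) = g t"
  shows "(\<integral>\<^sup>+t. ennreal (g (t - c)) \<partial>circ) = (\<integral>\<^sup>+t. ennreal (g t) \<partial>circ)"
proof -
  have int: "g integrable_on {a..b}" for a b
    by (rule integrable_continuous_interval[OF continuous_on_subset[OF g(1)]]) simp
  have gc: "continuous_on UNIV (\<lambda>t. g (t - c))"
    by (rule continuous_on_compose2[OF g(1)]) (auto intro!: continuous_intros)
  have step: "integral {a + e..a + e + 2 * pi} g = integral {a..a + 2 * pi} g" if e: "0 \<le> e" "e \<le> 2 * pi" for a e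
  proof -
    have "integral {a..a + 2 * pi} g = integral {a..a + e} g + integral {a + e..a + 2 * pi} g"
      using e int by (intro Henstock_Kurzweil_Integration.integral_combine[symmetric]) auto
    moreover have "integral {a + e..a + e + 2 * pi} g = integral {a + e..a + 2 * pi} g + integral {a + 2 * pi..a + e + 2 * pi} g"
      using e int by (intro Henstock_Kurzweil_Integration.integral_combine[symmetric]) auto
    moreover have "integral {a + 2 * pi..a + e + 2 * pi} g = integral {a..a + e} g"
    proof -
      have "integral {a..a + e} g = integral {a..a + e} (\<lambda>t. g (t + 2 * pi))"
        using per[of _ 1] by simp
      also have "\<dots> = integral {a + 2 * pi..a + e + 2 * pi} g"
        using integral_shift_real_ivl[of "a + 2 * pi" "2 * pi" "a + e + 2 * pi" g] by simp
      finally show ?thesis by simp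
    qed
    ultimately show ?thesis by simp
  qed
  obtain l :: int where l: "c - 2 * pi * of_int l \<in> {-pi..pi}" using reduce_2pi by blast
  define c' where "c' = c - 2 * pi * of_int l"
  have c': "-pi \<le> c'" "c' \<le> pi" using l by (auto simp: c'_def)
  have "g (t - c) = g (t - c')" for t
    using per[of "t - c" l] by (simp add: c'_def algebra_simps)
  then have "integral {-pi..pi} (\<lambda>t. g (t - c)) = integral {-pi..pi} (\<lambda>t. g (t + (- c')))" by simp
  also have "\<dots> = integral {-pi - c'..pi - c'} g"
    using integral_shift_real_ivl[of "-pi - c'" "-c'" "pi - c'" g] by simp
  also have "\<dots> = integral {-pi..pi} g"
  proof (cases "0 \<le> c'")
    case True
    then show ?thesis using step[of c' "-pi - c'"] c' by simp
  next
    case False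
    then show ?thesis using step[of "-c'" "-pi"] c' by simp
  qed
  finally have e: "integral {-pi..pi} (\<lambda>t. g (t - c)) = integral {-pi..pi} g" .
  then show ?thesis
    using nn_integral_circ_cont[OF g] nn_integral_circ_cont[OF gc] g(2)
      integral_circ_eq[OF g(1)] integral_circ_eq[OF gc] by simp
qed

text \<open>All \<open>2 ^ j\<close> translates to the nodes have the same integral, while the sum
  of their powers is bounded pointwise by \<open>Kpi_sum_bound\<close>. Dividing by their number
  gives the factor \<open>1 / 2 ^ j\<close>.\<close>

lemma Kpi_integral_bound:
  assumes L: "1 \<le> L" and s: "1 / real L < s"
  shows "\<exists>C>0. \<forall>j c. (\<integral>\<^sup>+t. ennreal (cmod (Kpi L j (t - c)) powr s) \<partial>circ) \<le> ennreal (C / 2 ^ j)"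
proof -
  have s0: "0 < s" using s by (rule le_less_trans[rotated]) simp
  obtain C where C: "C > 0" "\<And>j x. (\<Sum>u\<in>Uset j. cmod (Kpi L j (x - 2 * pi * of_int u / 2 ^ j)) powr s) \<le> C"
    using Kpi_sum_bound[OF L s] by blast
  show ?thesis
  proof (intro exI[of _ "2 * pi * C"] conjI allI)
    fix j c
    define g where "g = (\<lambda>t. cmod (Kpi L j t) powr s)"
    have gc: "continuous_on UNIV g" unfolding g_def
      by (intro continuous_on_cmod_powr trig_poly_continuous[OF Kpi_trig_poly] L s0)
    have gp: "g (t + 2 * pi * of_int l) = g t" for t l
      unfolding g_def using trig_poly_periodic[OF Kpi_trig_poly[OF L]] by simp
    have g0: "0 \<le> g t" for t by (simp add: g_def)
    note shift = nn_integral_circ_shift[OF gc g0 gp]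
    have "of_nat (2 ^ j) * (\<integral>\<^sup>+t. ennreal (g t) \<partial>circ) = (\<Sum>u\<in>Uset j. \<integral>\<^sup>+t. ennreal (g (t - 2 * pi * of_int u / 2 ^ j)) \<partial>circ)"
      unfolding shift using bij_betw_same_card[OF Uset_image, of j] by simp
    also have "\<dots> = (\<integral>\<^sup>+t. (\<Sum>u\<in>Uset j. ennreal (g (t - 2 * pi * of_int u / 2 ^ j))) \<partial>circ)"
    proof (intro nn_integral_sum[symmetric])
      fix u
      have "continuous_on UNIV (\<lambda>t. g (t - 2 * pi * of_int u / 2 ^ j))"
        by (rule continuous_on_compose2[OF gc]) (auto intro!: continuous_intros)
      then show "(\<lambda>t. ennreal (g (t - 2 * pi * of_int u / 2 ^ j))) \<in> borel_measurable circ"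
        by (intro measurable_compose[OF measurable_circ_cont measurable_ennreal])
    qed
    also have "\<dots> \<le> (\<integral>\<^sup>+t. ennreal C \<partial>circ)"
    proof (intro nn_integral_mono)
      fix t
      have "(\<Sum>u\<in>Uset j. ennreal (g (t - 2 * pi * of_int u / 2 ^ j))) = ennreal (\<Sum>u\<in>Uset j. g (t - 2 * pi * of_int u / 2 ^ j))"
        using g0 by (intro sum_ennreal) auto
      also have "\<dots> \<le> ennreal C" unfolding g_def by (intro ennreal_leI C(2))
      finally show "(\<Sum>u\<in>Uset j. ennreal (g (t - 2 * pi * of_int u / 2 ^ j))) \<le> ennreal C" .
    qed
    also have "\<dots> = ennreal (2 * pi * C)"
      using C by (simp add: emeasure_restrict_space ennreal_mult[symmetric] mult.commute)
    finally have 1: "of_nat (2 ^ j) * (\<integral>\<^sup>+t. ennreal (g t) \<partial>circ) \<le> ennreal (2 * pi * C)" .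
    have I: "(\<integral>\<^sup>+t. ennreal (g t) \<partial>circ) = ennreal (integral\<^sup>L circ g)"
      by (rule nn_integral_circ_cont[OF gc g0])
    have I0: "0 \<le> integral\<^sup>L circ g" using g0 by (intro integral_nonneg_AE) auto
    have "ennreal (2 ^ j * integral\<^sup>L circ g) \<le> ennreal (2 * pi * C)"
      using 1 unfolding I ennreal_of_nat_eq_real_of_nat using I0 by (simp add: ennreal_mult[symmetric])
    then have "2 ^ j * integral\<^sup>L circ g \<le> 2 * pi * C" using C by (subst (asm) ennreal_le_iff) auto
    then have "integral\<^sup>L circ g \<le> 2 * pi * C / 2 ^ j" by (simp add: field_simps)
    then have "(\<integral>\<^sup>+t. ennreal (g t) \<partial>circ) \<le> ennreal (2 * pi * C / 2 ^ j)" unfolding I by (rule ennreal_leI)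
    then show "(\<integral>\<^sup>+t. ennreal (cmod (Kpi L j (t - c)) powr s) \<partial>circ) \<le> ennreal (2 * pi * C / 2 ^ j)"
      using shift[of c] by (simp add: g_def)
  qed (use C in auto)
qed

subsection \<open>The difference operators\<close>

text \<open>The nodes of level \<open>j - 1\<close> are the nodes of level \<open>j\<close> with even index, so the difference of two
  consecutive interpolation operators samples on the finer grid only.\<close>

definition eta_kernel :: "nat \<Rightarrow> nat \<Rightarrow> real \<Rightarrow> int \<Rightarrow> complex" where
  "eta_kernel L j x u = Kpi L j (x - 2 * pi * of_int u / 2 ^ j) -
     (if 1 \<le> j \<and> even u then Kpi L (j - 1) (x - 2 * pi * of_int u / 2 ^ j) else 0)"

lemma Uset_even: "bij_betw (\<lambda>w. 2 * w) (Uset j) {u \<in> Uset (Suc j). even u}"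
proof (rule bij_betw_imageI)
  show "(\<lambda>w. 2 * w) ` Uset j = {u \<in> Uset (Suc j). even u}"
    by (cases j) (auto simp: Uset_def elim!: evenE)
qed (auto simp: inj_on_def)

lemma sum_Uset_even:
  "(\<Sum>u\<in>Uset (Suc j). if even u then f (2 * pi * of_int u / 2 ^ Suc j) else 0) = (\<Sum>w\<in>Uset j. f (2 * pi * of_int w / 2 ^ j))"
proof -
  have "(\<Sum>u\<in>Uset (Suc j). if even u then f (2 * pi * of_int u / 2 ^ Suc j) else 0) =
      (\<Sum>u\<in>{u \<in> Uset (Suc j). even u}. f (2 * pi * of_int u / 2 ^ Suc j))"
    by (subst sum.inter_filter) auto
  also have "\<dots> = (\<Sum>w\<in>Uset j. f (2 * pi * of_int (2 * w) / 2 ^ Suc j))"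
    by (rule sum.reindex_bij_betw[OF Uset_even, symmetric])
  also have "\<dots> = (\<Sum>w\<in>Uset j. f (2 * pi * of_int w / 2 ^ j))"
    by (intro sum.cong refl arg_cong[where f = f]) simp
  finally show ?thesis .
qed

lemma eta_op_kernel:
  "eta_op L j g x = (\<Sum>u\<in>Uset j. g (2 * pi * of_int u / 2 ^ j) * eta_kernel L j x u)"
proof (cases j)
  case 0
  then show ?thesis by (simp add: eta_op_def Iop_def eta_kernel_def)
next
  case (Suc i)
  have "Iop L i g x = (\<Sum>u\<in>Uset (Suc i). if even u then g (2 * pi * of_int u / 2 ^ Suc i) * Kpi L i (x - 2 * pi * of_int u / 2 ^ Suc i) else 0)"
    unfolding Iop_def by (rule sum_Uset_even[of "\<lambda>p. g p * Kpi L i (x - p)" i, symmetric])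
  moreover have "(\<Sum>u\<in>Uset (Suc i). g (2 * pi * of_int u / 2 ^ Suc i) * eta_kernel L (Suc i) x u) =
    (\<Sum>u\<in>Uset (Suc i). g (2 * pi * of_int u / 2 ^ Suc i) * Kpi L (Suc i) (x - 2 * pi * of_int u / 2 ^ Suc i)) -
    (\<Sum>u\<in>Uset (Suc i). if even u then g (2 * pi * of_int u / 2 ^ Suc i) * Kpi L i (x - 2 * pi * of_int u / 2 ^ Suc i) else 0)"
    unfolding sum_subtractf[symmetric] by (intro sum.cong refl) (simp add: eta_kernel_def right_diff_distrib)
  ultimately show ?thesis using Suc by (simp add: eta_op_def Iop_def)
qed

lemma cmod_diff_powr_le:
  assumes "0 < s"
  shows "cmod (a - b) powr s \<le> 2 powr s * (cmod a powr s + cmod b powr s)"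
proof -
  have "cmod (a - b) \<le> 2 * max (cmod a) (cmod b)"
    using norm_triangle_ineq4[of a b] by linarith
  then have "cmod (a - b) powr s \<le> (2 * max (cmod a) (cmod b)) powr s"
    using assms by (intro powr_mono2) auto
  also have "\<dots> = 2 powr s * max (cmod a) (cmod b) powr s" by (simp add: powr_mult)
  also have "\<dots> \<le> 2 powr s * (cmod a powr s + cmod b powr s)"
    by (intro mult_left_mono) (auto simp: max_def)
  finally show ?thesis .
qed

lemma continuous_eta_kernel:
  assumes "1 \<le> L"
  shows "continuous_on UNIV (\<lambda>x. eta_kernel L j x u)"
proof -
  have K: "continuous_on UNIV (\<lambda>x. Kpi L i (x - c))" for i c
    by (rule trig_poly_continuous[OF trig_poly_shift[OF Kpi_trig_poly[OF assms]]])
  show ?thesis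
    by (cases "1 \<le> j \<and> even u") (auto simp: eta_kernel_def[abs_def] intro!: continuous_intros K)
qed

lemma eta_kernel_sum_bound:
  assumes L: "1 \<le> L" and s: "1 / real L < s"
  shows "\<exists>C>0. \<forall>j x. (\<Sum>u\<in>Uset j. cmod (eta_kernel L j x u) powr s) \<le> C"
proof -
  have s0: "0 < s" using s by (rule le_less_trans[rotated]) simp
  obtain C where C: "C > 0" "\<And>j x. (\<Sum>u\<in>Uset j. cmod (Kpi L j (x - 2 * pi * of_int u / 2 ^ j)) powr s) \<le> C"
    using Kpi_sum_bound[OF L s] by blast
  show ?thesis
  proof (intro exI[of _ "2 powr s * (C + C)"] conjI allI)
    fix j x
    let ?f = "\<lambda>u. cmod (if 1 \<le> j \<and> even u then Kpi L (j - 1) (x - 2 * pi * of_int u / 2 ^ j) else 0) powr s"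
    have "(\<Sum>u\<in>Uset j. ?f u) \<le> C"
    proof (cases j)
      case (Suc i)
      have "(\<Sum>u\<in>Uset j. ?f u) = (\<Sum>u\<in>Uset (Suc i). if even u then cmod (Kpi L i (x - 2 * pi * of_int u / 2 ^ Suc i)) powr s else 0)"
        using Suc by (intro sum.cong) auto
      also have "\<dots> = (\<Sum>w\<in>Uset i. cmod (Kpi L i (x - 2 * pi * of_int w / 2 ^ i)) powr s)"
        by (rule sum_Uset_even[of "\<lambda>p. cmod (Kpi L i (x - p)) powr s" i])
      finally show ?thesis using C(2) by simp
    qed (use C in simp)
    then have "(\<Sum>u\<in>Uset j. cmod (Kpi L j (x - 2 * pi * of_int u / 2 ^ j)) powr s) + (\<Sum>u\<in>Uset j. ?f u) \<le> C + C"
      using C(2) by (intro add_mono)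
    then have "2 powr s * ((\<Sum>u\<in>Uset j. cmod (Kpi L j (x - 2 * pi * of_int u / 2 ^ j)) powr s) + (\<Sum>u\<in>Uset j. ?f u)) \<le> 2 powr s * (C + C)"
      by (intro mult_left_mono) auto
    moreover have "(\<Sum>u\<in>Uset j. cmod (eta_kernel L j x u) powr s) \<le>
      2 powr s * ((\<Sum>u\<in>Uset j. cmod (Kpi L j (x - 2 * pi * of_int u / 2 ^ j)) powr s) + (\<Sum>u\<in>Uset j. ?f u))"
      unfolding eta_kernel_def sum.distrib[symmetric] sum_distrib_left by (intro sum_mono cmod_diff_powr_le s0)
    ultimately show "(\<Sum>u\<in>Uset j. cmod (eta_kernel L j x u) powr s) \<le> 2 powr s * (C + C)" by linarith
  qed (use C in auto)
qed

lemma eta_kernel_integral_bound: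
  assumes L: "1 \<le> L" and s: "1 / real L < s"
  shows "\<exists>C>0. \<forall>j u. (\<integral>\<^sup>+t. ennreal (cmod (eta_kernel L j t u) powr s) \<partial>circ) \<le> ennreal (C / 2 ^ j)"
proof -
  have s0: "0 < s" using s by (rule le_less_trans[rotated]) simp
  obtain C where C: "C > 0" "\<And>j c. (\<integral>\<^sup>+t. ennreal (cmod (Kpi L j (t - c)) powr s) \<partial>circ) \<le> ennreal (C / 2 ^ j)"
    using Kpi_integral_bound[OF L s] by blast
  have K: "(\<lambda>t. ennreal (cmod (Kpi L i (t - c)) powr s)) \<in> borel_measurable circ" for i c
    by (intro measurable_compose[OF measurable_circ_cont measurable_ennreal] continuous_on_cmod_powr s0
        trig_poly_continuous[OF trig_poly_shift[OF Kpi_trig_poly[OF L]]])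
  show ?thesis
  proof (intro exI[of _ "2 powr s * (C + 2 * C)"] conjI allI)
    fix j u
    let ?c = "2 * pi * of_int u / 2 ^ j"
    have "(\<integral>\<^sup>+t. ennreal (cmod (eta_kernel L j t u) powr s) \<partial>circ) \<le>
      (\<integral>\<^sup>+t. ennreal (2 powr s) * (ennreal (cmod (Kpi L j (t - ?c)) powr s) + ennreal (cmod (Kpi L (j - 1) (t - ?c)) powr s)) \<partial>circ)"
    proof (intro nn_integral_mono)
      fix t
      let ?b = "if 1 \<le> j \<and> even u then Kpi L (j - 1) (t - ?c) else 0"
      have "cmod (eta_kernel L j t u) powr s \<le> 2 powr s * (cmod (Kpi L j (t - ?c)) powr s + cmod ?b powr s)"
        unfolding eta_kernel_def by (rule cmod_diff_powr_le[OF s0])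
      also have "\<dots> \<le> 2 powr s * (cmod (Kpi L j (t - ?c)) powr s + cmod (Kpi L (j - 1) (t - ?c)) powr s)"
        by (intro mult_left_mono add_left_mono) auto
      finally show "ennreal (cmod (eta_kernel L j t u) powr s) \<le>
        ennreal (2 powr s) * (ennreal (cmod (Kpi L j (t - ?c)) powr s) + ennreal (cmod (Kpi L (j - 1) (t - ?c)) powr s))"
        by (simp add: ennreal_mult[symmetric] ennreal_plus[symmetric] ennreal_leI del: ennreal_plus)
    qed
    also have "\<dots> = ennreal (2 powr s) * ((\<integral>\<^sup>+t. ennreal (cmod (Kpi L j (t - ?c)) powr s) \<partial>circ) + (\<integral>\<^sup>+t. ennreal (cmod (Kpi L (j - 1) (t - ?c)) powr s) \<partial>circ))"
      using K by (simp add: nn_integral_cmult nn_integral_add)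
    also have "\<dots> \<le> ennreal (2 powr s) * (ennreal (C / 2 ^ j) + ennreal (C / 2 ^ (j - 1)))"
      by (intro mult_left_mono add_mono C(2)) auto
    also have "\<dots> = ennreal (2 powr s * (C / 2 ^ j + C / 2 ^ (j - 1)))"
      using C by (simp add: ennreal_mult[symmetric] ennreal_plus[symmetric] del: ennreal_plus)
    also have "\<dots> \<le> ennreal (2 powr s * (C + 2 * C) / 2 ^ j)"
    proof (intro ennreal_leI)
      have "C / 2 ^ (j - 1) \<le> 2 * C / 2 ^ j"
        using C by (cases j) auto
      then have "2 powr s * (C / 2 ^ j + C / 2 ^ (j - 1)) \<le> 2 powr s * (C / 2 ^ j + 2 * C / 2 ^ j)"
        by (intro mult_left_mono add_left_mono) auto
      then show "2 powr s * (C / 2 ^ j + C / 2 ^ (j - 1)) \<le> 2 powr s * (C + 2 * C) / 2 ^ j"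
        by (simp add: add_divide_distrib distrib_left)
    qed
    finally show "(\<integral>\<^sup>+t. ennreal (cmod (eta_kernel L j t u) powr s) \<partial>circ) \<le> ennreal (2 powr s * (C + 2 * C) / 2 ^ j)" .
  qed (use C in auto)
qed

lemma eta_op_cis_trig_poly:
  assumes "1 \<le> L"
  shows "trig_poly (2 ^ j) (eta_op L j (\<lambda>t. cis (of_int k * t)))"
proof (cases j)
  case 0
  then show ?thesis using Iop_cis_trig_poly[OF assms, of 0 k] by (simp add: eta_op_def[abs_def])
next
  case (Suc i)
  have "trig_poly (2 ^ Suc i) (\<lambda>x. Iop L (Suc i) (\<lambda>t. cis (of_int k * t)) x + (-1) * Iop L i (\<lambda>t. cis (of_int k * t)) x)"
    using Iop_cis_trig_poly[OF assms, of "Suc i" k] trig_poly_mono[OF Iop_cis_trig_poly[OF assms, of i k], of "2 ^ Suc i"]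
    by (intro trig_poly_add trig_poly_cmult) auto
  then show ?thesis using Suc by (simp add: eta_op_def[abs_def])
qed

text \<open>The additional factor 2 in \<open>2 ^ Suc L\<close> makes the coarser level
  \<open>j - 1\<close> reproduce the exponential as well, so the two interpolants cancel. Level 0 is
  excluded since it is not a difference.\<close>

lemma eta_op_cis_vanish:
  assumes L: "1 \<le> L" and k: "2 ^ Suc L * \<bar>k\<bar> < 2 ^ j" and j: "1 \<le> j"
  shows "eta_op L j (\<lambda>t. cis (of_int k * t)) x = 0"
proof -
  obtain i where i: "j = Suc i" using j by (cases j) auto
  have 1: "2 ^ L * \<bar>k\<bar> < 2 ^ i" using k i by simp
  have "(2::int) ^ i \<le> 2 ^ j" unfolding i by simp
  then have 2: "2 ^ L * \<bar>k\<bar> < 2 ^ j" using 1 by linarith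
  show ?thesis using Iop_cis_reproduce[OF L 1] Iop_cis_reproduce[OF L 2] i by (simp add: eta_op_def)
qed

lemma sum_eta_op: "(\<Sum>j\<le>N. eta_op L j g x) = Iop L N g x"
  by (induction N) (auto simp: eta_op_def)

subsection \<open>Inequalities in several variables\<close>

lemma measurable_fun_upd_pair2:
  assumes "A \<in> borel_measurable (borel :: (nat \<Rightarrow> real) measure)"
  shows "(\<lambda>(t, s). A (x(i := t, k := s))) \<in> borel_measurable (circ \<Otimes>\<^sub>M circ)"
proof -
  have "(\<lambda>z. x(i := fst z, k := snd z)) \<in> measurable (circ \<Otimes>\<^sub>M circ) (borel :: (nat \<Rightarrow> real) measure)"
  proof (rule measurable_coordinatewise_then_product)
    fix l
    have 2: "(\<lambda>t. t) \<in> borel_measurable circ"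
      by (intro measurable_circ_cont continuous_intros)
    show "(\<lambda>z. (x(i := fst z, k := snd z)) l) \<in> borel_measurable (circ \<Otimes>\<^sub>M circ)"
      using measurable_compose[OF measurable_fst 2] measurable_compose[OF measurable_snd 2]
      by (cases "l = k"; cases "l = i") simp_all
  qed
  from measurable_compose[OF this assms] show ?thesis by (simp add: case_prod_beta)
qed

lemma circ_Fubini:
  assumes "A \<in> borel_measurable (borel :: (nat \<Rightarrow> real) measure)" "i \<noteq> k"
  shows "(\<integral>\<^sup>+t. \<integral>\<^sup>+s. A (x(i := t, k := s)) \<partial>circ \<partial>circ) = (\<integral>\<^sup>+s. \<integral>\<^sup>+t. A (x(k := s, i := t)) \<partial>circ \<partial>circ)"
proof -
  interpret pair_sigma_finite circ circ
    by (simp add: pair_sigma_finite_def sigma_finite_circ)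
  have "(\<integral>\<^sup>+t. \<integral>\<^sup>+s. A (x(i := t, k := s)) \<partial>circ \<partial>circ) = (\<integral>\<^sup>+s. \<integral>\<^sup>+t. A (x(i := t, k := s)) \<partial>circ \<partial>circ)"
    using Fubini'[of "\<lambda>t s. A (x(i := t, k := s))"] measurable_fun_upd_pair2[OF assms(1), of x i k] by simp
  then show ?thesis using assms(2) by (simp add: fun_upd_twist)
qed

text \<open>Integrating out coordinate \<open>i\<close> preserves a one-variable bound in another
  coordinate \<open>k\<close>, by Fubini's theorem. This keeps the hypothesis alive in the induction
  over coordinates.\<close>

lemma circ_integral_nikolskii:
  assumes A: "A \<in> borel_measurable (borel :: (nat \<Rightarrow> real) measure)" and "i \<noteq> k"
    and le: "\<And>x. A x \<le> a * (\<integral>\<^sup>+t. A (x(k := t)) \<partial>circ)"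
  shows "(\<integral>\<^sup>+t. A (x(i := t)) \<partial>circ) \<le> a * (\<integral>\<^sup>+s. \<integral>\<^sup>+t. A (x(k := s, i := t)) \<partial>circ \<partial>circ)"
proof -
  have "(\<integral>\<^sup>+t. A (x(i := t)) \<partial>circ) \<le> (\<integral>\<^sup>+t. a * (\<integral>\<^sup>+s. A (x(i := t, k := s)) \<partial>circ) \<partial>circ)"
    by (intro nn_integral_mono le)
  also have "\<dots> = a * (\<integral>\<^sup>+t. \<integral>\<^sup>+s. A (x(i := t, k := s)) \<partial>circ \<partial>circ)"
  proof (rule nn_integral_cmult)
    show "(\<lambda>t. \<integral>\<^sup>+s. A (x(i := t, k := s)) \<partial>circ) \<in> borel_measurable circ"
      by (rule measurable_fun_upd_circ[OF measurable_circ_integral[OF A]])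
  qed
  finally show ?thesis using circ_Fubini[OF A assms(2)] by simp
qed

text \<open>In each coordinate one of the two factors is replaced by its pointwise bound and the
  other one is integrated. The cheaper choice may be made in every coordinate separately, which
  produces the \<open>min\<close> and thereby the almost orthogonality of different degrees.\<close>

lemma torus_pair_integral:
  fixes a b :: "nat \<Rightarrow> ennreal"
  assumes "finite I" "A \<in> borel_measurable (borel :: (nat \<Rightarrow> real) measure)" "B \<in> borel_measurable (borel :: (nat \<Rightarrow> real) measure)"
    and "\<And>i x. i \<in> I \<Longrightarrow> A x \<le> a i * (\<integral>\<^sup>+t. A (x(i := t)) \<partial>circ)"
    and "\<And>i x. i \<in> I \<Longrightarrow> B x \<le> b i * (\<integral>\<^sup>+t. B (x(i := t)) \<partial>circ)"
  shows "(\<integral>\<^sup>+x. A x * B x \<partial>PiM I (\<lambda>_. circ)) \<le>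
    (\<Prod>i\<in>I. min (a i) (b i)) * ((\<integral>\<^sup>+x. A x \<partial>PiM I (\<lambda>_. circ)) * (\<integral>\<^sup>+x. B x \<partial>PiM I (\<lambda>_. circ)))"
  using assms
proof (induction I arbitrary: A B rule: finite_induct)
  case empty
  then show ?case by (simp add: torus.nn_integral_empty)
next
  case (insert i I)
  note A = insert.prems(1) and B = insert.prems(2)
  define A' where "A' = (\<lambda>x. \<integral>\<^sup>+t. A (x(i := t)) \<partial>circ)"
  define B' where "B' = (\<lambda>x. \<integral>\<^sup>+t. B (x(i := t)) \<partial>circ)"
  have A': "A' \<in> borel_measurable borel" unfolding A'_def by (rule measurable_circ_integral[OF A])
  have B': "B' \<in> borel_measurable borel" unfolding B'_def by (rule measurable_circ_integral[OF B])
  have Ale: "A (x(i := t)) \<le> a i * A' x" and Ble: "B (x(i := t)) \<le> b i * B' x" for x t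
    using insert.prems(3)[of i "x(i := t)"] insert.prems(4)[of i "x(i := t)"]
    unfolding A'_def B'_def fun_upd_upd by blast+
  have inner: "(\<integral>\<^sup>+t. A (x(i := t)) * B (x(i := t)) \<partial>circ) \<le> min (a i) (b i) * (A' x * B' x)" for x
  proof (cases "a i \<le> b i")
    case True
    have "(\<integral>\<^sup>+t. A (x(i := t)) * B (x(i := t)) \<partial>circ) \<le> (\<integral>\<^sup>+t. (a i * A' x) * B (x(i := t)) \<partial>circ)"
      by (intro nn_integral_mono mult_right_mono Ale) simp
    also have "\<dots> = (a i * A' x) * B' x"
      unfolding B'_def by (intro nn_integral_cmult measurable_fun_upd_circ[OF B])
    finally show ?thesis using True by (simp add: min_def mult.assoc)
  next
    case False
    have "(\<integral>\<^sup>+t. A (x(i := t)) * B (x(i := t)) \<partial>circ) \<le> (\<integral>\<^sup>+t. (b i * B' x) * A (x(i := t)) \<partial>circ)"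
      by (subst mult.commute) (intro nn_integral_mono mult_right_mono Ble, simp)
    also have "\<dots> = (b i * B' x) * A' x"
      unfolding A'_def by (intro nn_integral_cmult measurable_fun_upd_circ[OF A])
    finally show ?thesis using False by (simp add: min_def mult_ac)
  qed
  have "(\<integral>\<^sup>+x. A x * B x \<partial>PiM (insert i I) (\<lambda>_. circ)) =
      (\<integral>\<^sup>+x. (\<integral>\<^sup>+t. A (x(i := t)) * B (x(i := t)) \<partial>circ) \<partial>PiM I (\<lambda>_. circ))"
    using insert A B by (intro nn_integral_torus_insert) auto
  also have "\<dots> \<le> (\<integral>\<^sup>+x. min (a i) (b i) * (A' x * B' x) \<partial>PiM I (\<lambda>_. circ))"
    by (intro nn_integral_mono inner)
  also have "\<dots> = min (a i) (b i) * (\<integral>\<^sup>+x. A' x * B' x \<partial>PiM I (\<lambda>_. circ))"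
    using A' B' by (intro nn_integral_cmult measurable_torus) auto
  also have "\<dots> \<le> min (a i) (b i) * ((\<Prod>i\<in>I. min (a i) (b i)) * ((\<integral>\<^sup>+x. A' x \<partial>PiM I (\<lambda>_. circ)) * (\<integral>\<^sup>+x. B' x \<partial>PiM I (\<lambda>_. circ))))"
  proof (intro mult_left_mono insert.IH A' B')
    fix k x assume k: "k \<in> I"
    then have ik: "i \<noteq> k" using insert.hyps by auto
    show "A' x \<le> a k * (\<integral>\<^sup>+s. A' (x(k := s)) \<partial>circ)"
      unfolding A'_def using insert.prems(3)[of k] k by (intro circ_integral_nikolskii A ik) auto
    show "B' x \<le> b k * (\<integral>\<^sup>+s. B' (x(k := s)) \<partial>circ)"
      unfolding B'_def using insert.prems(4)[of k] k by (intro circ_integral_nikolskii B ik) auto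
  qed simp
  also have "(\<integral>\<^sup>+x. A' x \<partial>PiM I (\<lambda>_. circ)) = (\<integral>\<^sup>+x. A x \<partial>PiM (insert i I) (\<lambda>_. circ))"
    unfolding A'_def using insert A by (intro nn_integral_torus_insert[symmetric])
  also have "(\<integral>\<^sup>+x. B' x \<partial>PiM I (\<lambda>_. circ)) = (\<integral>\<^sup>+x. B x \<partial>PiM (insert i I) (\<lambda>_. circ))"
    unfolding B'_def using insert B by (intro nn_integral_torus_insert[symmetric])
  finally show ?case using insert.hyps by (simp add: mult.assoc)
qed

lemma sum_PiE_insert:
  assumes "i \<notin> I"
  shows "(\<Sum>u\<in>PiE (insert i I) U. f u) = (\<Sum>u\<in>PiE I U. \<Sum>v\<in>U i. f (u(i := v)))"
proof -
  have "(\<Sum>u\<in>PiE (insert i I) U. f u) = (\<Sum>(v, u)\<in>U i \<times> PiE I U. f (u(i := v)))"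
    unfolding PiE_insert_eq by (subst sum.reindex[OF inj_combinator[OF assms]]) (simp add: case_prod_beta)
  also have "\<dots> = (\<Sum>v\<in>U i. \<Sum>u\<in>PiE I U. f (u(i := v)))"
    by (rule sum.cartesian_product[symmetric])
  finally show ?thesis by (subst sum.swap)
qed

text \<open>One-dimensional sampling inequalities tensorize: the node sum in the new coordinate is
  replaced by an integral, and Fubini's theorem transfers the hypothesis to the integrated function.
  Nodes and index sets are arbitrary, so that singletons yield the pointwise bound in
  \<open>trig_poly_d_sup\<close>.\<close>

lemma torus_sampling:
  fixes a :: "nat \<Rightarrow> ennreal" and pt :: "nat \<Rightarrow> int \<Rightarrow> real"
  assumes "finite I" "A \<in> borel_measurable (borel :: (nat \<Rightarrow> real) measure)"
    and "\<And>i x. i \<in> I \<Longrightarrow> (\<Sum>v\<in>U i. A (x(i := pt i v))) \<le> a i * (\<integral>\<^sup>+t. A (x(i := t)) \<partial>circ)"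
  shows "(\<Sum>u\<in>PiE I U. A (restrict (\<lambda>i. pt i (u i)) I)) \<le> (\<Prod>i\<in>I. a i) * (\<integral>\<^sup>+x. A x \<partial>PiM I (\<lambda>_. circ))"
  using assms
proof (induction I arbitrary: A rule: finite_induct)
  case empty
  then show ?case by (simp add: torus.nn_integral_empty)
next
  case (insert i I)
  note A = insert.prems(1)
  define A' where "A' = (\<lambda>x. \<integral>\<^sup>+t. A (x(i := t)) \<partial>circ)"
  have A': "A' \<in> borel_measurable borel" unfolding A'_def by (rule measurable_circ_integral[OF A])
  have "(\<Sum>u\<in>PiE (insert i I) U. A (restrict (\<lambda>i. pt i (u i)) (insert i I))) =
     (\<Sum>u\<in>PiE I U. \<Sum>v\<in>U i. A ((restrict (\<lambda>i. pt i (u i)) I)(i := pt i v)))"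
    unfolding sum_PiE_insert[OF insert.hyps(2)]
    using insert.hyps by (intro sum.cong refl arg_cong[where f = A]) (auto simp: restrict_def fun_eq_iff)
  also have "\<dots> \<le> (\<Sum>u\<in>PiE I U. a i * A' (restrict (\<lambda>i. pt i (u i)) I))"
    unfolding A'_def by (intro sum_mono insert.prems(2)) simp
  also have "\<dots> = a i * (\<Sum>u\<in>PiE I U. A' (restrict (\<lambda>i. pt i (u i)) I))"
    by (simp add: sum_distrib_left)
  also have "\<dots> \<le> a i * ((\<Prod>i\<in>I. a i) * (\<integral>\<^sup>+x. A' x \<partial>PiM I (\<lambda>_. circ)))"
  proof (intro mult_left_mono insert.IH A')
    fix k x assume k: "k \<in> I"
    then have ik: "i \<noteq> k" using insert.hyps by auto
    have "(\<Sum>v\<in>U k. A' (x(k := pt k v))) = (\<integral>\<^sup>+t. (\<Sum>v\<in>U k. A (x(i := t, k := pt k v))) \<partial>circ)"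
      unfolding A'_def
      by (subst nn_integral_sum) (use ik in \<open>auto intro: measurable_fun_upd_circ[OF A] simp: fun_upd_twist[of i k]\<close>)
    also have "\<dots> \<le> (\<integral>\<^sup>+t. a k * (\<integral>\<^sup>+s. A (x(i := t, k := s)) \<partial>circ) \<partial>circ)"
      using k by (intro nn_integral_mono insert.prems(2)) simp
    also have "\<dots> = a k * (\<integral>\<^sup>+t. \<integral>\<^sup>+s. A (x(i := t, k := s)) \<partial>circ \<partial>circ)"
      by (rule nn_integral_cmult) (rule measurable_fun_upd_circ[OF measurable_circ_integral[OF A]])
    also have "\<dots> = a k * (\<integral>\<^sup>+s. A' (x(k := s)) \<partial>circ)"
      unfolding A'_def by (simp only: circ_Fubini[OF A ik])
    finally show "(\<Sum>v\<in>U k. A' (x(k := pt k v))) \<le> a k * (\<integral>\<^sup>+s. A' (x(k := s)) \<partial>circ)" .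
  qed simp
  also have "(\<integral>\<^sup>+x. A' x \<partial>PiM I (\<lambda>_. circ)) = (\<integral>\<^sup>+x. A x \<partial>PiM (insert i I) (\<lambda>_. circ))"
    unfolding A'_def using insert A by (intro nn_integral_torus_insert[symmetric])
  finally show ?case using insert.hyps by (simp add: mult.assoc)
qed

subsection \<open>Hoelder's inequality\<close>

text \<open>Convexity of the exponential at the logarithms of the \<open>x i\<close>; a vanishing
  factor makes the left side zero.\<close>

lemma weighted_am_gm:
  fixes w x :: "'a \<Rightarrow> real"
  assumes "finite S" "\<And>i. i \<in> S \<Longrightarrow> 0 < w i" "(\<Sum>i\<in>S. w i) = 1" "\<And>i. i \<in> S \<Longrightarrow> 0 \<le> x i"
  shows "(\<Prod>i\<in>S. x i powr w i) \<le> (\<Sum>i\<in>S. w i * x i)"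
proof (cases "\<exists>i\<in>S. x i = 0")
  case True
  then have "(\<Prod>i\<in>S. x i powr w i) = 0" using assms(1) by (auto intro: prod_zero)
  moreover have "0 \<le> (\<Sum>i\<in>S. w i * x i)"
    using assms by (intro sum_nonneg mult_nonneg_nonneg) (auto intro: less_imp_le)
  ultimately show ?thesis by simp
next
  case False
  have x: "0 < x i" if "i \<in> S" for i using assms(4)[OF that] False that by (metis less_eq_real_def)
  have "S \<noteq> {}" using assms(3) by auto
  have "(\<Prod>i\<in>S. x i powr w i) = exp (\<Sum>i\<in>S. w i *\<^sub>R ln (x i))"
    unfolding exp_sum[OF assms(1)] using x by (intro prod.cong refl) (simp add: powr_def less_imp_neq[symmetric])
  also have "\<dots> \<le> (\<Sum>i\<in>S. w i * exp (ln (x i)))"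
    using assms \<open>S \<noteq> {}\<close> by (intro convex_on_sum[OF _ _ exp_convex]) (auto intro: less_imp_le)
  also have "\<dots> = (\<Sum>i\<in>S. w i * x i)" using x by (intro sum.cong refl) auto
  finally show ?thesis .
qed

text \<open>Each \<open>f i\<close> is divided by its bound \<open>C i\<close>, and the weighted
  AM-GM inequality is integrated pointwise. If some \<open>C i\<close> is 0, that factor vanishes
  almost everywhere.\<close>

lemma Hoelder_nn_integral:
  fixes w C :: "'i \<Rightarrow> real" and f :: "'i \<Rightarrow> 'a \<Rightarrow> real"
  assumes S: "finite S" and w: "\<And>i. i \<in> S \<Longrightarrow> 0 < w i" "(\<Sum>i\<in>S. w i) = 1"
    and f: "\<And>i x. i \<in> S \<Longrightarrow> 0 \<le> f i x" "\<And>i. i \<in> S \<Longrightarrow> f i \<in> borel_measurable M"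
    and C: "\<And>i. i \<in> S \<Longrightarrow> 0 \<le> C i" "\<And>i. i \<in> S \<Longrightarrow> (\<integral>\<^sup>+x. ennreal (f i x) \<partial>M) \<le> ennreal (C i)"
  shows "(\<integral>\<^sup>+x. ennreal (\<Prod>i\<in>S. f i x powr w i) \<partial>M) \<le> ennreal (\<Prod>i\<in>S. C i powr w i)"
proof (cases "\<exists>i\<in>S. C i = 0")
  case True
  then obtain k where k: "k \<in> S" "C k = 0" by blast
  have "(\<integral>\<^sup>+x. ennreal (f k x) \<partial>M) = 0" using C(2)[OF k(1)] k(2) by simp
  then have "AE x in M. ennreal (f k x) = 0"
    using f(2)[OF k(1)] by (subst (asm) nn_integral_0_iff_AE) auto
  then have "AE x in M. ennreal (\<Prod>i\<in>S. f i x powr w i) = 0"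
  proof (eventually_elim)
    case (elim x)
    then have "f k x = 0" using f(1)[OF k(1), of x] by (simp add: ennreal_eq_0_iff)
    then have "(\<Prod>i\<in>S. f i x powr w i) = 0" using k S by (intro prod_zero) auto
    then show ?case by simp
  qed
  then have "(\<integral>\<^sup>+x. ennreal (\<Prod>i\<in>S. f i x powr w i) \<partial>M) = (\<integral>\<^sup>+x. 0 \<partial>M)" by (rule nn_integral_cong_AE)
  then show ?thesis by simp
next
  case False
  then have Cp: "0 < C i" if "i \<in> S" for i using C(1)[OF that] that by (metis less_eq_real_def)
  define D where "D = (\<Prod>i\<in>S. C i powr w i)"
  have D: "0 < D" unfolding D_def using Cp by (intro prod_pos) (simp add: less_imp_neq[symmetric])
  have "(\<integral>\<^sup>+x. ennreal (\<Prod>i\<in>S. f i x powr w i) \<partial>M) \<le> (\<integral>\<^sup>+x. (\<Sum>i\<in>S. ennreal (D * (w i / C i)) * ennreal (f i x)) \<partial>M)"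
  proof (rule nn_integral_mono)
    fix x
    have "(\<Prod>i\<in>S. f i x powr w i) = D * (\<Prod>i\<in>S. (f i x / C i) powr w i)"
      unfolding D_def prod.distrib[symmetric] using Cp f(1)
      by (intro prod.cong refl) (simp add: powr_divide less_imp_neq[symmetric] less_imp_le)
    also have "\<dots> \<le> D * (\<Sum>i\<in>S. w i * (f i x / C i))"
      using D S w f(1) Cp by (intro mult_left_mono weighted_am_gm) (auto intro: divide_nonneg_pos)
    also have "\<dots> = (\<Sum>i\<in>S. (D * (w i / C i)) * f i x)" by (simp add: sum_distrib_left mult.assoc)
    finally have "ennreal (\<Prod>i\<in>S. f i x powr w i) \<le> ennreal (\<Sum>i\<in>S. (D * (w i / C i)) * f i x)" by (rule ennreal_leI)
    also have "\<dots> = (\<Sum>i\<in>S. ennreal ((D * (w i / C i)) * f i x))"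
      using D w Cp f(1) by (intro sum_ennreal[symmetric]) (simp add: less_imp_le)
    also have "\<dots> = (\<Sum>i\<in>S. ennreal (D * (w i / C i)) * ennreal (f i x))"
      using D w Cp f(1) by (intro sum.cong refl ennreal_mult) (auto simp: less_imp_le)
    finally show "ennreal (\<Prod>i\<in>S. f i x powr w i) \<le> (\<Sum>i\<in>S. ennreal (D * (w i / C i)) * ennreal (f i x))" .
  qed
  also have "\<dots> = (\<Sum>i\<in>S. ennreal (D * (w i / C i)) * (\<integral>\<^sup>+x. ennreal (f i x) \<partial>M))"
    using f(2) by (subst nn_integral_sum) (auto intro!: sum.cong nn_integral_cmult)
  also have "\<dots> \<le> (\<Sum>i\<in>S. ennreal (D * (w i / C i)) * ennreal (C i))"
    by (intro sum_mono mult_left_mono C(2)) auto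
  also have "\<dots> = (\<Sum>i\<in>S. ennreal (D * w i))"
    using D w Cp by (intro sum.cong refl) (simp add: ennreal_mult[symmetric] less_imp_le, metis less_irrefl)
  also have "\<dots> = ennreal (\<Sum>i\<in>S. D * w i)"
    using D w by (intro sum_ennreal) (simp add: less_imp_le)
  also have "(\<Sum>i\<in>S. D * w i) = D" using w by (simp add: sum_distrib_left[symmetric])
  finally show ?thesis by (simp add: D_def)
qed

lemma Hoelder_sum:
  fixes w :: "'i \<Rightarrow> real" and f :: "'i \<Rightarrow> 'a \<Rightarrow> real"
  assumes S: "finite S" and w: "\<And>i. i \<in> S \<Longrightarrow> 0 < w i" "(\<Sum>i\<in>S. w i) = 1"
    and f: "\<And>i x. i \<in> S \<Longrightarrow> 0 \<le> f i x" and U: "finite U"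
  shows "(\<Sum>x\<in>U. \<Prod>i\<in>S. f i x powr w i) \<le> (\<Prod>i\<in>S. (\<Sum>x\<in>U. f i x) powr w i)"
proof -
  have "(\<integral>\<^sup>+x. ennreal (\<Prod>i\<in>S. f i x powr w i) \<partial>count_space U) \<le> ennreal (\<Prod>i\<in>S. (\<Sum>x\<in>U. f i x) powr w i)"
    using f U by (intro Hoelder_nn_integral S w) (auto simp: nn_integral_count_space_finite sum_nonneg)
  then have "ennreal (\<Sum>x\<in>U. \<Prod>i\<in>S. f i x powr w i) \<le> ennreal (\<Prod>i\<in>S. (\<Sum>x\<in>U. f i x) powr w i)"
    using U by (simp add: nn_integral_count_space_finite sum_nonneg prod_nonneg)
  then show ?thesis by (subst (asm) ennreal_le_iff) (auto intro: prod_nonneg)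
qed

lemma sum_powr_le_powr_sum:
  fixes f :: "'a \<Rightarrow> real"
  assumes "finite U" "\<And>x. x \<in> U \<Longrightarrow> 0 \<le> f x" "1 \<le> t"
  shows "(\<Sum>x\<in>U. f x powr t) \<le> (\<Sum>x\<in>U. f x) powr t"
proof -
  let ?B = "\<Sum>x\<in>U. f x"
  have B: "0 \<le> ?B" using assms by (intro sum_nonneg) auto
  have "(\<Sum>x\<in>U. f x powr t) \<le> (\<Sum>x\<in>U. ?B powr (t - 1) * f x)"
  proof (rule sum_mono)
    fix x assume x: "x \<in> U"
    have "f x \<le> ?B" using assms x by (intro member_le_sum) auto
    then have "f x powr (t - 1) * f x \<le> ?B powr (t - 1) * f x"
      using assms x by (intro mult_right_mono powr_mono2) auto
    moreover have "f x powr t = f x powr (t - 1) * f x"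
      using assms(2)[OF x] by (cases "f x = 0") (auto simp: powr_diff)
    ultimately show "f x powr t \<le> ?B powr (t - 1) * f x" by simp
  qed
  also have "\<dots> = ?B powr (t - 1) * ?B" by (simp add: sum_distrib_left)
  also have "\<dots> = ?B powr t"
    using B by (cases "?B = 0") (auto simp: powr_diff)
  finally show ?thesis .
qed


text \<open>Elementary substitute for Minkowski's inequality, valid for all exponents \<open>P > 0\<close> at the price
  of geometric weights \<open>v\<close>.\<close>

lemma weighted_sum_powr_le:
  fixes x v :: "'a \<Rightarrow> real"
  assumes K: "finite K" and x: "\<And>k. k \<in> K \<Longrightarrow> 0 \<le> x k" and v: "\<And>k. k \<in> K \<Longrightarrow> 0 < v k"
    and V: "(\<Sum>k\<in>K. v k) \<le> V" and P: "0 < P"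
  shows "(\<Sum>k\<in>K. x k) powr P \<le> V powr P * (\<Sum>k\<in>K. (x k / v k) powr P)"
proof (cases "K = {}")
  case False
  \<comment> \<open>The maximal ratio \<open>m\<close> bounds the whole sum by \<open>V * m\<close>,
    and \<open>m powr P\<close> is itself one of the summands on the right.\<close>
  define m where "m = Max ((\<lambda>k. x k / v k) ` K)"
  have "m \<in> (\<lambda>k. x k / v k) ` K" unfolding m_def using K False by (intro Max_in) auto
  then obtain k where k: "k \<in> K" "m = x k / v k" by blast
  have m: "x l / v l \<le> m" if "l \<in> K" for l unfolding m_def using K that by (intro Max_ge) auto
  have m0: "0 \<le> m" using k x v by (simp add: less_imp_le)
  have V0: "0 \<le> V" using V sum_nonneg[of K v] v by (meson less_imp_le order_trans)
  have "(\<Sum>k\<in>K. x k) \<le> (\<Sum>k\<in>K. v k * m)"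
    using m v by (intro sum_mono) (simp add: pos_divide_le_eq mult.commute)
  also have "\<dots> \<le> V * m" unfolding sum_distrib_right[symmetric] using V m0 by (intro mult_right_mono)
  finally have "(\<Sum>k\<in>K. x k) powr P \<le> (V * m) powr P"
    using x P by (intro powr_mono2) (auto intro: sum_nonneg)
  also have "\<dots> = V powr P * m powr P" using V0 m0 by (simp add: powr_mult)
  also have "\<dots> \<le> V powr P * (\<Sum>k\<in>K. (x k / v k) powr P)"
    unfolding k(2) using k K by (intro mult_left_mono member_le_sum) auto
  finally show ?thesis .
qed simp

text \<open>The abstract form of the Jawerth--Franke embedding: almost orthogonality of pairs suffices.
  The \<open>N\<close>-fold product in the expansion of the \<open>N\<close>-th power is distributed over all \<open>N\<^sup>2\<close> pairs of
  its factors by Hoelder's inequality.\<close>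

lemma nn_integral_powr_sum_le:
  fixes x :: "'j \<Rightarrow> 'a \<Rightarrow> real" and a :: "'j \<Rightarrow> real" and w :: "'j \<Rightarrow> 'j \<Rightarrow> real" and N :: nat
  assumes J: "finite J" and N: "1 \<le> N" "0 < q" "q \<le> real N"
    and x: "\<And>s \<omega>. s \<in> J \<Longrightarrow> 0 \<le> x s \<omega>" "\<And>s. s \<in> J \<Longrightarrow> x s \<in> borel_measurable M"
    and a: "\<And>s. s \<in> J \<Longrightarrow> 0 \<le> a s" and w: "\<And>s t. 0 < w s t" "\<And>s t. w s t \<le> 1"
    and pairs: "\<And>s t. s \<in> J \<Longrightarrow> t \<in> J \<Longrightarrow>
      (\<integral>\<^sup>+\<omega>. ennreal ((x s \<omega> * x t \<omega>) powr (q / 2)) \<partial>M) \<le> ennreal (w s t * (a s * a t) powr (q / 2))"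
    and W: "\<And>s. s \<in> J \<Longrightarrow> (\<Sum>t\<in>J. w s t powr (1 / real N ^ 2)) \<le> W"
  shows "(\<integral>\<^sup>+\<omega>. ennreal ((\<Sum>s\<in>J. x s \<omega>) powr q) \<partial>M) \<le> ennreal (W ^ N * (\<Sum>s\<in>J. a s powr q))"
proof -
  define H where "H = PiE {..<N} (\<lambda>_. J)"
  have H: "finite H" unfolding H_def using J by (intro finite_PiE) auto
  have Hm: "h i \<in> J" if "h \<in> H" "i < N" for h i using that unfolding H_def by auto
  define e where "e = 1 / real N ^ 2"
  have e: "e > 0" using N by (simp add: e_def)
  have N0: "0 < real N" using N by simp
  \<comment> \<open>Each of the \<open>N ^ 2\<close> ordered pairs gets Hoelder weight
    \<open>e\<close>. An index fills \<open>2 * N\<close> slots of these pairs, and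
    \<open>2 * N * (q / 2) * e = q / N\<close>.\<close>
  have pairprod: "(\<Prod>i<N. \<Prod>k<N. ((y i * y k) powr (q / 2)) powr e) = (\<Prod>i<N. y i powr (q / real N))"
    if y: "\<And>i. i < N \<Longrightarrow> 0 \<le> y i" for y :: "nat \<Rightarrow> real"
  proof -
    have pw: "((\<Prod>i<N. y i powr (q / 2 * e)) ^ N) = (\<Prod>i<N. y i powr (q / 2 * e * real N))"
    proof -
      have "(y i powr (q / 2 * e)) ^ N = y i powr (q / 2 * e * real N)" if "i < N" for i
        using N by (cases "y i = 0") (auto simp: powr_power mult_ac)
      then show ?thesis unfolding prod_power_distrib by (intro prod.cong) auto
    qed
    have "(\<Prod>i<N. \<Prod>k<N. ((y i * y k) powr (q / 2)) powr e) = (\<Prod>i<N. \<Prod>k<N. y i powr (q / 2 * e) * y k powr (q / 2 * e))"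
      using y by (intro prod.cong refl) (auto simp: powr_powr powr_mult)
    also have "\<dots> = (\<Prod>i<N. (y i powr (q / 2 * e)) ^ N) * (\<Prod>i<N. y i powr (q / 2 * e)) ^ N"
      by (simp add: prod.distrib)
    also have "\<dots> = (\<Prod>i<N. y i powr (q / 2 * e * real N)) * (\<Prod>i<N. y i powr (q / 2 * e * real N))"
      using pw by (simp add: prod_power_distrib)
    also have "\<dots> = (\<Prod>i<N. y i powr (q / real N))"
      unfolding prod.distrib[symmetric] powr_add[symmetric]
      using N0 by (intro prod.cong refl) (simp add: e_def power2_eq_square)
    finally show ?thesis .
  qed
  have single: "(\<integral>\<^sup>+\<omega>. ennreal (\<Prod>i<N. x (h i) \<omega> powr (q / real N)) \<partial>M) \<le>
      ennreal (\<Sum>i<N. 1 / real N * (a (h i) powr q * (\<Prod>k<N. w (h i) (h k) powr e)))" if h: "h \<in> H" for h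
  proof -
    let ?f = "\<lambda>(i, k) \<omega>. (x (h i) \<omega> * x (h k) \<omega>) powr (q / 2)"
    let ?C = "\<lambda>(i, k). w (h i) (h k) * (a (h i) * a (h k)) powr (q / 2)"
    have "(\<integral>\<^sup>+\<omega>. ennreal (\<Prod>p\<in>{..<N} \<times> {..<N}. ?f p \<omega> powr e) \<partial>M) \<le> ennreal (\<Prod>p\<in>{..<N} \<times> {..<N}. ?C p powr e)"
    proof (rule Hoelder_nn_integral)
      show "(\<Sum>p\<in>{..<N} \<times> {..<N}. e) = 1" using N0 by (simp add: e_def power2_eq_square)
      fix p assume p: "p \<in> {..<N} \<times> {..<N}"
      have 1: "x (h (fst p)) \<in> borel_measurable M" "x (h (snd p)) \<in> borel_measurable M"
        using x(2) Hm[OF h] p by auto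
      show "?f p \<in> borel_measurable M"
        unfolding case_prod_beta by (intro powr_real_measurable borel_measurable_times 1) simp
      show "(\<integral>\<^sup>+\<omega>. ennreal (?f p \<omega>) \<partial>M) \<le> ennreal (?C p)"
        using p pairs Hm[OF h] by auto
      show "0 \<le> ?C p" using w(1) by (auto simp: case_prod_beta less_imp_le)
    qed (use e in auto)
    moreover have "(\<Prod>p\<in>{..<N} \<times> {..<N}. ?f p \<omega> powr e) = (\<Prod>i<N. x (h i) \<omega> powr (q / real N))" for \<omega>
      using pairprod[of "\<lambda>i. x (h i) \<omega>"] x(1) Hm[OF h] by (simp add: prod.cartesian_product case_prod_beta)
    moreover have "(\<Prod>p\<in>{..<N} \<times> {..<N}. ?C p powr e) \<le> (\<Sum>i<N. 1 / real N * (a (h i) powr q * (\<Prod>k<N. w (h i) (h k) powr e)))"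
    proof -
      let ?w = "\<Prod>i<N. \<Prod>k<N. w (h i) (h k) powr e"
      have "(\<Prod>p\<in>{..<N} \<times> {..<N}. ?C p powr e) = ?w * (\<Prod>i<N. \<Prod>k<N. ((a (h i) * a (h k)) powr (q / 2)) powr e)"
        using w(1) by (simp add: prod.cartesian_product case_prod_beta powr_mult less_imp_le prod.distrib[symmetric])
      also have "(\<Prod>i<N. \<Prod>k<N. ((a (h i) * a (h k)) powr (q / 2)) powr e) = (\<Prod>i<N. (a (h i) powr q) powr (1 / real N))"
        using pairprod[of "\<lambda>i. a (h i)"] a Hm[OF h] by (simp add: powr_powr)
      \<comment> \<open>AM-GM turns the mixed product of the \<open>a (h i)\<close> into an average,
        so every term singles out one index \<open>i\<close>. Afterwards only the weights in row
        \<open>i\<close> are kept, the other factors being at most 1.\<close>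
      also have "\<dots> \<le> (\<Sum>i<N. 1 / real N * a (h i) powr q)"
        using N0 by (intro weighted_am_gm) auto
      finally have "(\<Prod>p\<in>{..<N} \<times> {..<N}. ?C p powr e) \<le> ?w * (\<Sum>i<N. 1 / real N * a (h i) powr q)"
        using w(1) by (simp add: mult_left_mono prod_nonneg)
      also have "\<dots> = (\<Sum>i<N. ?w * (1 / real N * a (h i) powr q))" by (rule sum_distrib_left)
      also have "\<dots> \<le> (\<Sum>i<N. 1 / real N * (a (h i) powr q * (\<Prod>k<N. w (h i) (h k) powr e)))"
      proof (rule sum_mono)
        fix i assume i: "i \<in> {..<N}"
        have p01: "0 \<le> (\<Prod>k<N. w (h i) (h k) powr e)" "(\<Prod>k<N. w (h i) (h k) powr e) \<le> 1" for i
          using w e by (auto intro!: prod_nonneg prod_le_1 powr_le1 simp: less_imp_le)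
        have "?w = (\<Prod>k<N. w (h i) (h k) powr e) * (\<Prod>i\<in>{..<N} - {i}. \<Prod>k<N. w (h i) (h k) powr e)"
          using i by (subst prod.remove[of _ i]) auto
        also have "\<dots> \<le> (\<Prod>k<N. w (h i) (h k) powr e) * 1"
          using p01 by (intro mult_left_mono prod_le_1) auto
        finally have "?w * (1 / real N * a (h i) powr q) \<le> (\<Prod>k<N. w (h i) (h k) powr e) * (1 / real N * a (h i) powr q)"
          using N0 by (intro mult_right_mono) auto
        then show "?w * (1 / real N * a (h i) powr q) \<le> 1 / real N * (a (h i) powr q * (\<Prod>k<N. w (h i) (h k) powr e))"
          by (simp add: mult_ac)
      qed
      finally show ?thesis .
    qed
    ultimately show ?thesis by (simp only:) (meson ennreal_leI order_trans)
  qed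
  have "(\<integral>\<^sup>+\<omega>. ennreal ((\<Sum>s\<in>J. x s \<omega>) powr q) \<partial>M) \<le> (\<integral>\<^sup>+\<omega>. (\<Sum>h\<in>H. ennreal (\<Prod>i<N. x (h i) \<omega> powr (q / real N))) \<partial>M)"
  proof (rule nn_integral_mono)
    fix \<omega>
    have S: "0 \<le> (\<Sum>s\<in>J. x s \<omega>)" using x(1) by (intro sum_nonneg) auto
    have "(\<Sum>s\<in>J. x s \<omega>) powr q = ((\<Sum>s\<in>J. x s \<omega>) powr (q / real N)) ^ N"
      using S N N0 by (cases "(\<Sum>s\<in>J. x s \<omega>) = 0") (auto simp: powr_power)
    also have "\<dots> \<le> (\<Sum>s\<in>J. x s \<omega> powr (q / real N)) ^ N"
      using J x(1) N N0 by (intro power_mono powr_sum_le) auto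
    also have "\<dots> = (\<Prod>i<N. \<Sum>s\<in>J. x s \<omega> powr (q / real N))" by simp
    also have "\<dots> = (\<Sum>h\<in>H. \<Prod>i<N. x (h i) \<omega> powr (q / real N))"
      unfolding H_def using J by (intro prod_sum_PiE) auto
    finally show "ennreal ((\<Sum>s\<in>J. x s \<omega>) powr q) \<le> (\<Sum>h\<in>H. ennreal (\<Prod>i<N. x (h i) \<omega> powr (q / real N)))"
      by (simp add: sum_ennreal prod_nonneg ennreal_leI)
  qed
  also have "\<dots> = (\<Sum>h\<in>H. \<integral>\<^sup>+\<omega>. ennreal (\<Prod>i<N. x (h i) \<omega> powr (q / real N)) \<partial>M)"
  proof (intro nn_integral_sum)
    fix h assume h: "h \<in> H"
    show "(\<lambda>\<omega>. ennreal (\<Prod>i<N. x (h i) \<omega> powr (q / real N))) \<in> borel_measurable M"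
      using x(2) Hm[OF h] by (intro measurable_compose[OF _ measurable_ennreal] borel_measurable_prod powr_real_measurable) auto
  qed
  also have "\<dots> \<le> (\<Sum>h\<in>H. ennreal (\<Sum>i<N. 1 / real N * (a (h i) powr q * (\<Prod>k<N. w (h i) (h k) powr e))))"
    by (intro sum_mono single)
  also have "\<dots> = ennreal (\<Sum>h\<in>H. \<Sum>i<N. 1 / real N * (a (h i) powr q * (\<Prod>k<N. w (h i) (h k) powr e)))"
    by (intro sum_ennreal sum_nonneg mult_nonneg_nonneg prod_nonneg) auto
  also have "\<dots> \<le> ennreal (W ^ N * (\<Sum>s\<in>J. a s powr q))"
  proof (rule ennreal_leI)
    \<comment> \<open>Replacing \<open>h i\<close> by a separate sum over \<open>s\<close> makes the
      summand independent of \<open>i\<close>. For fixed \<open>s\<close> the sum over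
      \<open>H\<close> then factors into \<open>N\<close> equal sums, each at most
      \<open>W\<close>.\<close>
    have "(\<Sum>h\<in>H. \<Sum>i<N. 1 / real N * (a (h i) powr q * (\<Prod>k<N. w (h i) (h k) powr e))) \<le>
      (\<Sum>h\<in>H. \<Sum>i<N. \<Sum>s\<in>J. 1 / real N * (a s powr q * (\<Prod>k<N. w s (h k) powr e)))"
    proof (intro sum_mono)
      fix h i assume "h \<in> H" "i \<in> {..<N}"
      then have "h i \<in> J" using Hm by auto
      then show "1 / real N * (a (h i) powr q * (\<Prod>k<N. w (h i) (h k) powr e)) \<le>
          (\<Sum>s\<in>J. 1 / real N * (a s powr q * (\<Prod>k<N. w s (h k) powr e)))"
        using J by (intro member_le_sum[of "h i" J "\<lambda>s. 1 / real N * (a s powr q * (\<Prod>k<N. w s (h k) powr e))"] mult_nonneg_nonneg prod_nonneg) auto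
    qed
    also have "\<dots> = (\<Sum>h\<in>H. \<Sum>s\<in>J. a s powr q * (\<Prod>k<N. w s (h k) powr e))"
      using N0 by (simp add: sum_distrib_left[symmetric] sum_divide_distrib[symmetric])
    also have "\<dots> = (\<Sum>s\<in>J. a s powr q * (\<Sum>h\<in>H. \<Prod>k<N. w s (h k) powr e))"
      by (subst sum.swap) (simp add: sum_distrib_left)
    also have "\<dots> = (\<Sum>s\<in>J. a s powr q * (\<Sum>t\<in>J. w s t powr e) ^ N)"
    proof (intro sum.cong refl)
      fix s
      have "(\<Sum>t\<in>J. w s t powr e) ^ N = (\<Prod>k<N. \<Sum>t\<in>J. w s t powr e)" by simp
      also have "\<dots> = (\<Sum>h\<in>H. \<Prod>k<N. w s (h k) powr e)"
        unfolding H_def using J by (intro prod_sum_PiE) auto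
      finally show "a s powr q * (\<Sum>h\<in>H. \<Prod>k<N. w s (h k) powr e) = a s powr q * (\<Sum>t\<in>J. w s t powr e) ^ N" by simp
    qed
    also have "\<dots> \<le> (\<Sum>s\<in>J. a s powr q * W ^ N)"
      using W by (intro sum_mono mult_left_mono power_mono) (auto simp: e_def intro: sum_nonneg)
    also have "\<dots> = W ^ N * (\<Sum>s\<in>J. a s powr q)" by (simp add: sum_distrib_left mult.commute)
    finally show "(\<Sum>h\<in>H. \<Sum>i<N. 1 / real N * (a (h i) powr q * (\<Prod>k<N. w (h i) (h k) powr e))) \<le> W ^ N * (\<Sum>s\<in>J. a s powr q)" .
  qed
  finally show ?thesis .
qed

subsection \<open>Trigonometric polynomials in several variables\<close>

text \<open>Slices instead of coefficients, since every inequality is applied in one coordinate at a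
  time. Continuity and boundedness provide measurability and finite integrals; dependence on the
  first \<open>d\<close> coordinates identifies extensional points with arbitrary ones.\<close>

definition trig_poly_d :: "nat \<Rightarrow> (nat \<Rightarrow> nat) \<Rightarrow> ((nat \<Rightarrow> real) \<Rightarrow> complex) \<Rightarrow> bool" where
  "trig_poly_d d n F \<longleftrightarrow> continuous_on UNIV F \<and> (\<exists>M. \<forall>x. cmod (F x) \<le> M) \<and>
     (\<forall>x y. (\<forall>i<d. x i = y i) \<longrightarrow> F x = F y) \<and> (\<forall>i<d. \<forall>x. trig_poly (n i) (\<lambda>t. F (x(i := t))))"

lemma trig_poly_dI:
  assumes "continuous_on UNIV F" "\<And>x. cmod (F x) \<le> M" "\<And>x y. (\<And>i. i < d \<Longrightarrow> x i = y i) \<Longrightarrow> F x = F y"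
    "\<And>i x. i < d \<Longrightarrow> trig_poly (n i) (\<lambda>t. F (x(i := t)))"
  shows "trig_poly_d d n F"
  using assms unfolding trig_poly_d_def by blast

lemma trig_poly_dD:
  assumes "trig_poly_d d n F"
  shows "continuous_on UNIV F" "\<exists>M. \<forall>x. cmod (F x) \<le> M" "\<And>x y. (\<And>i. i < d \<Longrightarrow> x i = y i) \<Longrightarrow> F x = F y"
    "\<And>i x. i < d \<Longrightarrow> trig_poly (n i) (\<lambda>t. F (x(i := t)))"
  using assms unfolding trig_poly_d_def by blast+

lemma trig_poly_d_cmult:
  assumes "trig_poly_d d n F"
  shows "trig_poly_d d n (\<lambda>x. c * F x)"
proof -
  obtain M where M: "\<And>x. cmod (F x) \<le> M" using trig_poly_dD(2)[OF assms] by blast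
  show ?thesis
  proof (rule trig_poly_dI[where M = "cmod c * M"])
    show "continuous_on UNIV (\<lambda>x. c * F x)" by (intro continuous_on_mult continuous_on_const trig_poly_dD(1)[OF assms])
    show "cmod (c * F x) \<le> cmod c * M" for x unfolding norm_mult by (intro mult_left_mono M) simp
    show "c * F x = c * F y" if "\<And>i. i < d \<Longrightarrow> x i = y i" for x y
      using trig_poly_dD(3)[OF assms, of x y] that by simp
    show "trig_poly (n i) (\<lambda>t. c * F (x(i := t)))" if "i < d" for i x
      by (intro trig_poly_cmult trig_poly_dD(4)[OF assms] that)
  qed
qed

lemma trig_poly_d_sum:
  assumes "\<And>i. i \<in> S \<Longrightarrow> trig_poly_d d n (F i)"
  shows "trig_poly_d d n (\<lambda>x. \<Sum>i\<in>S. F i x)"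
proof -
  have "\<forall>i\<in>S. \<exists>M. \<forall>x. cmod (F i x) \<le> M" by (intro ballI trig_poly_dD(2)[OF assms])
  from bchoice[OF this] obtain M where "\<forall>i\<in>S. \<forall>x. cmod (F i x) \<le> M i" ..
  then have M: "\<And>i x. i \<in> S \<Longrightarrow> cmod (F i x) \<le> M i" by blast
  show ?thesis
  proof (rule trig_poly_dI[where M = "\<Sum>i\<in>S. M i"])
    show "continuous_on UNIV (\<lambda>x. \<Sum>i\<in>S. F i x)" by (intro continuous_on_sum trig_poly_dD(1)[OF assms])
    show "cmod (\<Sum>i\<in>S. F i x) \<le> (\<Sum>i\<in>S. M i)" for x by (rule order_trans[OF norm_sum]) (intro sum_mono M)
    show "(\<Sum>i\<in>S. F i x) = (\<Sum>i\<in>S. F i y)" if "\<And>i. i < d \<Longrightarrow> x i = y i" for x y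
      by (intro sum.cong refl trig_poly_dD(3)[OF assms] that)
    show "trig_poly (n i) (\<lambda>t. \<Sum>k\<in>S. F k (x(i := t)))" if "i < d" for i x
      by (intro trig_poly_sum trig_poly_dD(4)[OF assms] that)
  qed
qed

lemma trig_poly_d_mono:
  assumes "trig_poly_d d n F" "\<And>i. i < d \<Longrightarrow> n i \<le> m i"
  shows "trig_poly_d d m F"
  using assms unfolding trig_poly_d_def by (meson trig_poly_mono)

lemma trig_poly_d_prod:
  assumes "\<And>i. i < d \<Longrightarrow> trig_poly (n i) (g i)"
  shows "trig_poly_d d n (\<lambda>x. \<Prod>i<d. g i (x i))"
proof -
  have "\<forall>i\<in>{..<d}. \<exists>x0. \<forall>x. cmod (g i x) \<le> cmod (g i x0)"
  proof
    fix i assume "i \<in> {..<d}"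
    then show "\<exists>x0. \<forall>x. cmod (g i x) \<le> cmod (g i x0)"
      using trig_poly_sup[OF assms[of i]] by (metis lessThan_iff)
  qed
  from bchoice[OF this] obtain t0 where "\<forall>i\<in>{..<d}. \<forall>x. cmod (g i x) \<le> cmod (g i (t0 i))" ..
  then have t0: "\<And>i x. i < d \<Longrightarrow> cmod (g i x) \<le> cmod (g i (t0 i))" by blast
  show ?thesis
  proof (rule trig_poly_dI[where M = "\<Prod>i<d. cmod (g i (t0 i))"])
    show "continuous_on UNIV (\<lambda>x. \<Prod>i<d. g i (x i))"
    proof (intro continuous_on_prod)
      fix i assume "i \<in> {..<d}"
      then show "continuous_on UNIV (\<lambda>x. g i (x i))"
        using trig_poly_continuous[OF assms] continuous_on_compose2[of UNIV "g i" UNIV "\<lambda>x. x i"] continuous_on_coord by auto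
    qed
    show "cmod (\<Prod>i<d. g i (x i)) \<le> (\<Prod>i<d. cmod (g i (t0 i)))" for x
      unfolding prod_norm[symmetric] using t0 by (intro prod_mono) auto
    show "(\<Prod>i<d. g i (x i)) = (\<Prod>i<d. g i (y i))" if "\<And>i. i < d \<Longrightarrow> x i = y i" for x y
      using that by (intro prod.cong) auto
    fix i :: nat and x assume i: "i < d"
    have "(\<Prod>k<d. g k ((x(i := t)) k)) = (\<Prod>k\<in>{..<d} - {i}. g k (x k)) * g i t" for t
      using i by (subst prod.remove[of _ i]) auto
    then show "trig_poly (n i) (\<lambda>t. \<Prod>k<d. g k ((x(i := t)) k))"
      using trig_poly_cmult[OF assms[OF i]] by simp
  qed
qed

text \<open>The \<open>P\<close>-th power of \<open>Lp_norm\<close>, the quantity in which sampling,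
  synthesis and pair estimates take their simplest form.\<close>

definition Lpi :: "nat \<Rightarrow> real \<Rightarrow> ((nat \<Rightarrow> real) \<Rightarrow> complex) \<Rightarrow> real" where
  "Lpi d P F = integral\<^sup>L (torus d) (\<lambda>x. cmod (F x) powr P)"

lemma Lpi_nonneg: "0 \<le> Lpi d P F"
  unfolding Lpi_def by (intro integral_nonneg_AE) auto

lemma Lp_norm_Lpi: "Lp_norm d P F = Lpi d P F powr (1 / P)"
  by (simp add: Lp_norm_def Lpi_def)

lemma measurable_cmod_powr:
  assumes "continuous_on UNIV (F :: (nat \<Rightarrow> real) \<Rightarrow> complex)" "0 < P"
  shows "(\<lambda>x. ennreal (cmod (F x) powr P)) \<in> borel_measurable borel"
  by (intro measurable_compose[OF borel_measurable_continuous_onI measurable_ennreal] continuous_on_cmod_powr assms)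

lemma nn_integral_Lpi:
  assumes F: "continuous_on UNIV F" "\<And>x. cmod (F x) \<le> M" and P: "0 < P"
  shows "(\<integral>\<^sup>+x. ennreal (cmod (F x) powr P) \<partial>PiM {..<d} (\<lambda>_. circ)) = ennreal (Lpi d P F)"
proof -
  have "integrable (PiM {..<d} (\<lambda>_. circ)) (\<lambda>x. cmod (F x) powr P)"
  proof (rule integrable_torus_bounded)
    show "continuous_on UNIV (\<lambda>x. cmod (F x) powr P)" by (intro continuous_on_cmod_powr F P)
    show "norm (cmod (F x) powr P) \<le> M powr P" for x
      using F(2)[of x] P by (auto intro: powr_mono2)
  qed simp
  then show ?thesis unfolding Lpi_def torus_def by (intro nn_integral_eq_integral) auto
qed

lemma nn_integral_trig_poly_d:
  assumes "trig_poly_d d n F" "0 < P"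
  shows "(\<integral>\<^sup>+x. ennreal (cmod (F x) powr P) \<partial>PiM {..<d} (\<lambda>_. circ)) = ennreal (Lpi d P F)"
proof -
  obtain M where "\<And>x. cmod (F x) \<le> M" using trig_poly_dD(2)[OF assms(1)] by blast
  then show ?thesis by (rule nn_integral_Lpi[OF trig_poly_dD(1)[OF assms(1)] _ assms(2)])
qed

text \<open>Hoelder's inequality for the three functions \<open>A * B\<close>, \<open>A\<close> and
  \<open>B\<close> with weights \<open>\<tau>\<close>, \<open>(1 - \<tau>) / 2\<close> and
  \<open>(1 - \<tau>) / 2\<close>, where \<open>\<tau> = q / P - 1\<close>. The range of
  \<open>q\<close> is exactly \<open>0 < \<tau> < 1\<close>. The integral of \<open>A * B\<close>
  contributes the smaller of the two degrees in every coordinate.\<close>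

lemma trig_poly_d_pair:
  assumes P: "0 < P" and q: "P < q" "q < 2 * P"
  shows "\<exists>c>0. \<forall>n m F G. (\<forall>i<d. 1 \<le> n i \<and> 1 \<le> m i) \<longrightarrow> trig_poly_d d n F \<longrightarrow> trig_poly_d d m G \<longrightarrow>
    (\<integral>\<^sup>+x. ennreal ((cmod (F x) * cmod (G x)) powr (q / 2)) \<partial>PiM {..<d} (\<lambda>_. circ)) \<le>
      ennreal ((\<Prod>i<d. c * real (min (n i) (m i))) powr (q / P - 1) * (Lpi d P F * Lpi d P G) powr (q / (2 * P)))"
proof -
  obtain c where c: "c > 0" "\<And>n g x. 1 \<le> n \<Longrightarrow> trig_poly n g \<Longrightarrow>
    ennreal (cmod (g x) powr P) \<le> ennreal (c * real n) * (\<integral>\<^sup>+t. ennreal (cmod (g t) powr P) \<partial>circ)"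
    using nikolskii[OF P] by blast
  define \<tau> where "\<tau> = q / P - 1"
  have \<tau>: "0 < \<tau>" "\<tau> < 1" "q = P * (1 + \<tau>)" unfolding \<tau>_def using P q by (auto simp: field_simps)
  show ?thesis
  proof (intro exI[of _ c] conjI c(1) allI impI)
    fix n m :: "nat \<Rightarrow> nat" and F G
    assume nm: "\<forall>i<d. 1 \<le> n i \<and> 1 \<le> m i" and F: "trig_poly_d d n F" and G: "trig_poly_d d m G"
    let ?T = "PiM {..<d} (\<lambda>_::nat. circ)"
    define A where "A = (\<lambda>x. cmod (F x) powr P)"
    define B where "B = (\<lambda>x. cmod (G x) powr P)"
    have Am: "(\<lambda>x. ennreal (A x)) \<in> borel_measurable borel" unfolding A_def by (rule measurable_cmod_powr[OF trig_poly_dD(1)[OF F] P])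
    have Bm: "(\<lambda>x. ennreal (B x)) \<in> borel_measurable borel" unfolding B_def by (rule measurable_cmod_powr[OF trig_poly_dD(1)[OF G] P])
    have IA: "(\<integral>\<^sup>+x. ennreal (A x) \<partial>?T) = ennreal (Lpi d P F)" unfolding A_def by (rule nn_integral_trig_poly_d[OF F P])
    have IB: "(\<integral>\<^sup>+x. ennreal (B x) \<partial>?T) = ennreal (Lpi d P G)" unfolding B_def by (rule nn_integral_trig_poly_d[OF G P])
    let ?c = "\<Prod>i<d. c * real (min (n i) (m i))"
    have c0: "0 \<le> ?c" using c by (intro prod_nonneg) auto
    have "(\<integral>\<^sup>+x. ennreal (A x) * ennreal (B x) \<partial>?T) \<le>
       (\<Prod>i<d. min (ennreal (c * real (n i))) (ennreal (c * real (m i)))) * ((\<integral>\<^sup>+x. ennreal (A x) \<partial>?T) * (\<integral>\<^sup>+x. ennreal (B x) \<partial>?T))"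
    proof (rule torus_pair_integral[OF _ Am Bm])
      fix i x assume "i \<in> {..<d}"
      then have i: "i < d" by simp
      show "ennreal (A x) \<le> ennreal (c * real (n i)) * (\<integral>\<^sup>+t. ennreal (A (x(i := t))) \<partial>circ)"
        using c(2)[OF _ trig_poly_dD(4)[OF F i, of x], of "x i"] nm i by (simp add: A_def)
      show "ennreal (B x) \<le> ennreal (c * real (m i)) * (\<integral>\<^sup>+t. ennreal (B (x(i := t))) \<partial>circ)"
        using c(2)[OF _ trig_poly_dD(4)[OF G i, of x], of "x i"] nm i by (simp add: B_def)
    qed simp
    also have "(\<Prod>i<d. min (ennreal (c * real (n i))) (ennreal (c * real (m i)))) = (\<Prod>i<d. ennreal (c * real (min (n i) (m i))))"
      using c by (intro prod.cong refl) (auto simp: min_def ennreal_le_iff mult_le_cancel_left_pos)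
    also have "\<dots> = ennreal ?c" using c by (intro prod_ennreal) auto
    also have "ennreal ?c * ((\<integral>\<^sup>+x. ennreal (A x) \<partial>?T) * (\<integral>\<^sup>+x. ennreal (B x) \<partial>?T)) = ennreal (?c * (Lpi d P F * Lpi d P G))"
      unfolding IA IB using Lpi_nonneg c0 by (simp add: ennreal_mult)
    finally have IAB: "(\<integral>\<^sup>+x. ennreal (A x * B x) \<partial>?T) \<le> ennreal (?c * (Lpi d P F * Lpi d P G))"
      by (simp add: ennreal_mult A_def B_def)
    have Ar: "A \<in> borel_measurable ?T" and Br: "B \<in> borel_measurable ?T"
      unfolding A_def B_def by (intro measurable_torus_cont continuous_on_cmod_powr trig_poly_dD(1)[OF F] trig_poly_dD(1)[OF G] P)+
    let ?w = "\<lambda>k::nat. if k = 2 then \<tau> else (1 - \<tau>) / 2"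
    let ?f = "\<lambda>(k::nat) x. if k = 2 then A x * B x else if k = 1 then B x else A x"
    let ?C = "\<lambda>k::nat. if k = 2 then ?c * (Lpi d P F * Lpi d P G) else if k = 1 then Lpi d P G else Lpi d P F"
    have "(\<integral>\<^sup>+x. ennreal (\<Prod>k\<in>{0,1,2}. ?f k x powr ?w k) \<partial>?T) \<le> ennreal (\<Prod>k\<in>{0,1,2}. ?C k powr ?w k)"
    proof (rule Hoelder_nn_integral)
      fix k :: nat assume "k \<in> {0, 1, 2}"
      then consider "k = 0" | "k = 1" | "k = 2" by auto
      then show "?f k \<in> borel_measurable ?T" "(\<integral>\<^sup>+x. ennreal (?f k x) \<partial>?T) \<le> ennreal (?C k)" "0 \<le> ?C k"
        using Ar Br IA IB IAB c0 Lpi_nonneg by (cases, auto)+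
    qed (use \<tau> in \<open>auto simp: A_def B_def\<close>)
    moreover have "(\<Prod>k\<in>{0,1,2}. ?f k x powr ?w k) = (cmod (F x) * cmod (G x)) powr (q / 2)" for x
    proof -
      have "(\<Prod>k\<in>{0,1,2}. ?f k x powr ?w k) = (A x * B x) powr ((1 - \<tau>) / 2) * (A x * B x) powr \<tau>"
        by (simp add: powr_mult)
      also have "\<dots> = (A x * B x) powr ((1 + \<tau>) / 2)"
        by (simp add: powr_add[symmetric] field_simps)
      also have "\<dots> = ((cmod (F x) * cmod (G x)) powr P) powr ((1 + \<tau>) / 2)" by (simp add: A_def B_def powr_mult)
      also have "\<dots> = (cmod (F x) * cmod (G x)) powr (q / 2)" by (simp add: powr_powr \<tau>(3))
      finally show ?thesis .
    qed
    moreover have "(\<Prod>k\<in>{0,1,2}. ?C k powr ?w k) = ?c powr (q / P - 1) * (Lpi d P F * Lpi d P G) powr (q / (2 * P))"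
    proof -
      let ?l = "Lpi d P F * Lpi d P G"
      have "(\<Prod>k\<in>{0,1,2}. ?C k powr ?w k) = ?c powr \<tau> * (?l powr ((1 - \<tau>) / 2) * ?l powr \<tau>)"
        by (simp add: powr_mult)
      also have "?l powr ((1 - \<tau>) / 2) * ?l powr \<tau> = ?l powr ((1 + \<tau>) / 2)"
        by (simp add: powr_add[symmetric] field_simps)
      also have "(1 + \<tau>) / 2 = q / (2 * P)" using P by (simp add: \<tau>(3))
      finally show ?thesis by (simp add: \<tau>_def)
    qed
    ultimately show "(\<integral>\<^sup>+x. ennreal ((cmod (F x) * cmod (G x)) powr (q / 2)) \<partial>?T) \<le>
      ennreal (?c powr (q / P - 1) * (Lpi d P F * Lpi d P G) powr (q / (2 * P)))" by (simp only:)
  qed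
qed

subsection \<open>Sums over multi-indices\<close>

lemma sum_idx_prod_le:
  fixes h :: "nat \<Rightarrow> nat \<Rightarrow> real"
  assumes J: "finite J" "J \<subseteq> idx d" and h: "\<And>i n. 0 \<le> h i n" and H: "\<And>i N. i < d \<Longrightarrow> (\<Sum>n\<le>N. h i n) \<le> H i"
  shows "(\<Sum>t\<in>J. \<Prod>i<d. h i (t i)) \<le> (\<Prod>i<d. H i)"
proof -
  define N where "N = Max (insert 0 (\<Union>t\<in>J. t ` {..<d}))"
  have N: "t i \<le> N" if "t \<in> J" "i < d" for t i
    unfolding N_def using that J(1) by (intro Max_ge) auto
  have inj: "inj_on (\<lambda>t. restrict t {..<d}) J"
  proof (rule inj_onI)
    fix s t assume st: "s \<in> J" "t \<in> J" "restrict s {..<d} = restrict t {..<d}"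
    show "s = t"
    proof
      fix i
      have "s \<in> idx d" "t \<in> idx d" using st J(2) by auto
      then show "s i = t i"
        using fun_cong[OF st(3), of i] by (cases "i < d") (auto simp: idx_def)
    qed
  qed
  have "(\<Sum>t\<in>J. \<Prod>i<d. h i (t i)) = (\<Sum>u\<in>(\<lambda>t. restrict t {..<d}) ` J. \<Prod>i<d. h i (u i))"
    using inj by (simp add: sum.reindex)
  also have "\<dots> \<le> (\<Sum>u\<in>PiE {..<d} (\<lambda>_. {..N}). \<Prod>i<d. h i (u i))"
  proof (rule sum_mono2)
    show "(\<lambda>t. restrict t {..<d}) ` J \<subseteq> PiE {..<d} (\<lambda>_. {..N})"
      using N by (intro image_subsetI) (simp add: restrict_PiE_iff)
  qed (auto intro!: finite_PiE prod_nonneg h)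
  also have "\<dots> = (\<Prod>i<d. \<Sum>n\<le>N. h i n)" by (intro prod_sum_PiE[symmetric]) auto
  also have "\<dots> \<le> (\<Prod>i<d. H i)" using h H by (intro prod_mono) (auto intro: sum_nonneg)
  finally show ?thesis .
qed

lemma sum_geometric_inj:
  fixes \<rho> :: real
  assumes "0 \<le> \<rho>" "\<rho> < 1" "finite A" "inj_on f A"
  shows "(\<Sum>a\<in>A. \<rho> ^ f a) \<le> 1 / (1 - \<rho>)"
proof -
  have "(\<Sum>a\<in>A. \<rho> ^ f a) = (\<Sum>n\<in>f ` A. \<rho> ^ n)" using assms by (simp add: sum.reindex)
  also have "\<dots> \<le> (\<Sum>n. \<rho> ^ n)" using assms by (intro sum_le_suminf summable_geometric) auto
  also have "\<dots> = 1 / (1 - \<rho>)" using assms by (intro suminf_geometric) auto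
  finally show ?thesis .
qed

lemma sum_geometric_dist:
  fixes \<rho> :: real
  assumes "0 \<le> \<rho>" "\<rho> < 1"
  shows "(\<Sum>n\<le>N. \<rho> ^ nat \<bar>int s - int n\<bar>) \<le> 2 / (1 - \<rho>)"
proof -
  have "(\<Sum>n\<le>N. \<rho> ^ nat \<bar>int s - int n\<bar>) =
    (\<Sum>n\<in>{n\<in>{..N}. n \<le> s}. \<rho> ^ nat \<bar>int s - int n\<bar>) + (\<Sum>n\<in>{n\<in>{..N}. \<not> n \<le> s}. \<rho> ^ nat \<bar>int s - int n\<bar>)"
    by (subst sum.union_disjoint[symmetric]) (auto intro: sum.cong)
  also have "\<dots> \<le> 1 / (1 - \<rho>) + 1 / (1 - \<rho>)"
    using assms by (intro add_mono sum_geometric_inj) (auto simp: inj_on_def)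
  finally show ?thesis by simp
qed

text \<open>The smaller of \<open>2 ^ s i\<close> and \<open>2 ^ t i\<close> is their geometric mean
  times \<open>2 powr (- |s i - t i| / 2)\<close>. The means are absorbed into the numbers
  \<open>a\<close>, the deviations form the weight \<open>w\<close>, whose sums over
  \<open>t\<close> factor into geometric series.\<close>

lemma jawerth_franke:
  assumes P: "0 < P" and q: "P < q" "q < 2 * P"
  shows "\<exists>C>0. \<forall>J F. finite J \<longrightarrow> J \<subseteq> idx d \<longrightarrow> (\<forall>j\<in>J. trig_poly_d d (\<lambda>i. 2 ^ j i) (F j)) \<longrightarrow>
    (\<integral>\<^sup>+x. ennreal ((\<Sum>j\<in>J. cmod (F j x)) powr q) \<partial>PiM {..<d} (\<lambda>_. circ)) \<le>
      ennreal (C * (\<Sum>j\<in>J. (2 powr (\<Sum>i<d. real (j i))) powr (q / P - 1) * Lpi d P (F j) powr (q / P)))"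
proof -
  obtain c where c: "c > 0" "\<And>n m F G. (\<forall>i<d. 1 \<le> n i \<and> 1 \<le> m i) \<Longrightarrow> trig_poly_d d n F \<Longrightarrow> trig_poly_d d m G \<Longrightarrow>
    (\<integral>\<^sup>+x. ennreal ((cmod (F x) * cmod (G x)) powr (q / 2)) \<partial>PiM {..<d} (\<lambda>_. circ)) \<le>
      ennreal ((\<Prod>i<d. c * real (min (n i) (m i))) powr (q / P - 1) * (Lpi d P F * Lpi d P G) powr (q / (2 * P)))"
    using trig_poly_d_pair[OF P q, of d] by blast
  define \<tau> where "\<tau> = q / P - 1"
  have \<tau>: "0 < \<tau>" unfolding \<tau>_def using P q by (auto simp: field_simps)
  have q0: "0 < q" using P q by simp
  define N where "N = nat \<lceil>q\<rceil>"
  have N: "1 \<le> N" "q \<le> real N" unfolding N_def using q0 by linarith+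
  define \<rho> :: real where "\<rho> = 2 powr (- \<tau> / 2)"
  \<comment> \<open>The ratio of the geometric series after the weights have been raised to the
    Hoelder weight \<open>1 / N ^ 2\<close> of a pair.\<close>
  define \<rho>' where "\<rho>' = \<rho> powr (1 / real N ^ 2)"
  have \<rho>: "0 < \<rho>" "\<rho> < 1" unfolding \<rho>_def using \<tau> by (auto simp: powr_less_one)
  have \<rho>': "0 < \<rho>'" "\<rho>' < 1" unfolding \<rho>'_def using \<rho> N by (auto simp: powr01_less_one)
  define W where "W = (\<Prod>i<d. 2 / (1 - \<rho>'))"
  have W: "0 < W" unfolding W_def using \<rho>' by (intro prod_pos) auto
  define w :: "(nat \<Rightarrow> nat) \<Rightarrow> (nat \<Rightarrow> nat) \<Rightarrow> real" where "w = (\<lambda>s t. \<Prod>i<d. \<rho> ^ nat \<bar>int (s i) - int (t i)\<bar>)"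
  have w: "0 < w s t" "w s t \<le> 1" for s t
    unfolding w_def using \<rho> by (auto intro!: prod_pos prod_le_1 power_le_one simp: less_imp_le)
  define S where "S = (\<lambda>j::nat \<Rightarrow> nat. 2 powr (\<Sum>i<d. real (j i)))"
  have S0: "0 < S j" for j by (simp add: S_def)
  define D where "D = (c ^ d) powr \<tau>"
  have D: "0 < D" unfolding D_def using c by simp
  show ?thesis
  proof (intro exI[of _ "W ^ N * D"] conjI allI impI)
    fix J F assume J: "finite J" "J \<subseteq> idx d" and F: "\<forall>j\<in>J. trig_poly_d d (\<lambda>i. 2 ^ j i) (F j)"
    \<comment> \<open>Chosen so that \<open>a j powr q\<close> is \<open>D\<close> times the summand
      for \<open>j\<close> in the claimed bound; \<open>D\<close> collects the constants of
      Nikolskii's inequality.\<close>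
    define a where "a = (\<lambda>j. D powr (1 / q) * (S j powr \<tau> * Lpi d P (F j) powr (q / P)) powr (1 / q))"
    have a0: "0 \<le> a j" for j unfolding a_def by simp
    have aq: "a j powr q = D * (S j powr \<tau> * Lpi d P (F j) powr (q / P))" for j
      unfolding a_def using D q0 by (simp add: powr_mult powr_powr less_imp_le)
    have "(\<integral>\<^sup>+x. ennreal ((\<Sum>j\<in>J. cmod (F j x)) powr q) \<partial>PiM {..<d} (\<lambda>_. circ)) \<le> ennreal (W ^ N * (\<Sum>j\<in>J. a j powr q))"
    proof (rule nn_integral_powr_sum_le[OF J(1) N(1) q0 N(2)])
      fix s assume s: "s \<in> J"
      show "(\<lambda>x. cmod (F s x)) \<in> borel_measurable (PiM {..<d} (\<lambda>_. circ))"
        using F s by (intro measurable_torus_cont continuous_on_norm) (auto dest: trig_poly_dD)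
      show "(\<Sum>t\<in>J. w s t powr (1 / real N ^ 2)) \<le> W"
      proof -
        have "w s t powr (1 / real N ^ 2) = (\<Prod>i<d. \<rho>' ^ nat \<bar>int (s i) - int (t i)\<bar>)" for t
          unfolding w_def prod_powr_distrib \<rho>'_def using \<rho> by (intro prod.cong refl) (simp add: powr_powr powr_realpow[symmetric] mult.commute)
        moreover have "(\<Sum>t\<in>J. \<Prod>i<d. \<rho>' ^ nat \<bar>int (s i) - int (t i)\<bar>) \<le> W"
          unfolding W_def using \<rho>' by (intro sum_idx_prod_le[OF J, where h = "\<lambda>i n. \<rho>' ^ nat \<bar>int (s i) - int n\<bar>"] sum_geometric_dist) auto
        ultimately show ?thesis by simp
      qed
      fix t assume t: "t \<in> J"
      have "(\<integral>\<^sup>+x. ennreal ((cmod (F s x) * cmod (F t x)) powr (q / 2)) \<partial>PiM {..<d} (\<lambda>_. circ)) \<le>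
        ennreal ((\<Prod>i<d. c * real (min (2 ^ s i) (2 ^ t i))) powr (q / P - 1) * (Lpi d P (F s) * Lpi d P (F t)) powr (q / (2 * P)))"
        using F s t by (intro c(2)) auto
      also have "(\<Prod>i<d. c * real (min (2 ^ s i) (2 ^ t i))) powr (q / P - 1) * (Lpi d P (F s) * Lpi d P (F t)) powr (q / (2 * P)) =
          w s t * (a s * a t) powr (q / 2)"
      proof -
        have m: "real (min (2 ^ s i) (2 ^ t i)) powr \<tau> = \<rho> ^ nat \<bar>int (s i) - int (t i)\<bar> * (2 powr real (s i) * 2 powr real (t i)) powr (\<tau> / 2)" for i
        proof -
          have "real (min (2 ^ s i) (2 ^ t i)) = 2 powr (min (real (s i)) (real (t i)))"
            by (auto simp: min_def powr_realpow)
          moreover have "\<rho> ^ nat \<bar>int (s i) - int (t i)\<bar> = 2 powr (- \<tau> / 2 * \<bar>real (s i) - real (t i)\<bar>)"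
          proof -
            have "real (nat \<bar>int (s i) - int (t i)\<bar>) = \<bar>real (s i) - real (t i)\<bar>" by linarith
            then show ?thesis unfolding \<rho>_def by (simp add: powr_powr powr_realpow[symmetric])
          qed
          moreover have "\<tau> * min (real (s i)) (real (t i)) = - \<tau> / 2 * \<bar>real (s i) - real (t i)\<bar> + \<tau> / 2 * (real (s i) + real (t i))"
            by (auto simp: min_def abs_if field_simps)
          ultimately show ?thesis
            by (simp add: powr_powr powr_add[symmetric] mult.commute)
        qed
        have "(\<Prod>i<d. c * real (min (2 ^ s i) (2 ^ t i))) powr \<tau> = D * (\<Prod>i<d. real (min (2 ^ s i) (2 ^ t i)) powr \<tau>)"
          unfolding prod.distrib powr_mult by (simp add: D_def prod_powr_distrib)
        also have "(\<Prod>i<d. real (min (2 ^ s i) (2 ^ t i)) powr \<tau>) = w s t * (\<Prod>i<d. (2 powr real (s i) * 2 powr real (t i)) powr (\<tau> / 2))"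
          unfolding m prod.distrib w_def ..
        also have "(\<Prod>i<d. (2 powr real (s i) * 2 powr real (t i)) powr (\<tau> / 2)) = (S s * S t) powr (\<tau> / 2)"
          unfolding S_def by (simp add: prod_powr_distrib[symmetric] prod.distrib powr_sum)
        finally have 1: "(\<Prod>i<d. c * real (min (2 ^ s i) (2 ^ t i))) powr \<tau> = D * (w s t * (S s * S t) powr (\<tau> / 2))" .
        have "(a s * a t) powr (q / 2) = (a s powr q * a t powr q) powr (1 / 2)"
          by (simp add: powr_mult powr_powr)
        also have "\<dots> = (D * D) powr (1 / 2) * ((S s powr \<tau> * S t powr \<tau>) powr (1 / 2) * ((Lpi d P (F s) * Lpi d P (F t)) powr (q / P)) powr (1 / 2))"
          unfolding aq by (simp add: powr_mult mult_ac)
        also have "(D * D) powr (1 / 2) = D" using D by (simp add: powr_half_sqrt)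
        also have "(S s powr \<tau> * S t powr \<tau>) powr (1 / 2) = (S s * S t) powr (\<tau> / 2)" by (simp add: powr_mult[symmetric] powr_powr)
        also have "((Lpi d P (F s) * Lpi d P (F t)) powr (q / P)) powr (1 / 2) = (Lpi d P (F s) * Lpi d P (F t)) powr (q / (2 * P))"
          by (simp add: powr_powr mult.commute)
        finally show ?thesis unfolding \<tau>_def[symmetric] 1 by (simp add: mult_ac)
      qed
      finally show "(\<integral>\<^sup>+x. ennreal ((cmod (F s x) * cmod (F t x)) powr (q / 2)) \<partial>PiM {..<d} (\<lambda>_. circ)) \<le> ennreal (w s t * (a s * a t) powr (q / 2))" .
    qed (use a0 w in auto)
    then show "(\<integral>\<^sup>+x. ennreal ((\<Sum>j\<in>J. cmod (F j x)) powr q) \<partial>PiM {..<d} (\<lambda>_. circ)) \<le>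
      ennreal (W ^ N * D * (\<Sum>j\<in>J. (2 powr (\<Sum>i<d. real (j i))) powr (q / P - 1) * Lpi d P (F j) powr (q / P)))"
      unfolding aq by (simp add: S_def \<tau>_def sum_distrib_left mult.assoc)
  qed (use W D in auto)
qed

subsection \<open>The tensor product operators\<close>

lemma in_var_eta_op:
  "in_var k (eta_op L m) G x = (\<Sum>v\<in>Uset m. G (x(k := 2 * pi * of_int v / 2 ^ m)) * eta_kernel L m (x k) v)"
  unfolding in_var_def by (rule eta_op_kernel)

text \<open>The operators act in different variables, so the nested node sums combine into a single
  sum over the tensor grid; coordinates outside \<open>xs\<close> are left as they are.\<close>

lemma foldr_in_var:
  assumes "distinct xs"
  shows "foldr (\<lambda>i g. in_var i (eta_op L (j i)) g) xs g x =
    (\<Sum>u\<in>PiE (set xs) (\<lambda>i. Uset (j i)). (\<Prod>i\<in>set xs. eta_kernel L (j i) (x i) (u i)) *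
       g (\<lambda>i. if i \<in> set xs then 2 * pi * of_int (u i) / 2 ^ j i else x i))"
  using assms
proof (induction xs arbitrary: x)
  case Nil
  then show ?case by simp
next
  case (Cons k xs)
  let ?U = "\<lambda>i. Uset (j i)"
  let ?p = "\<lambda>i u. 2 * pi * real_of_int u / 2 ^ j i"
  have k: "k \<notin> set xs" using Cons.prems by simp
  have "foldr (\<lambda>i g. in_var i (eta_op L (j i)) g) (k # xs) g x =
     (\<Sum>v\<in>Uset (j k). foldr (\<lambda>i g. in_var i (eta_op L (j i)) g) xs g (x(k := ?p k v)) * eta_kernel L (j k) (x k) v)"
  proof -
    define G where "G = foldr (\<lambda>i g. in_var i (eta_op L (j i)) g) xs g"
    have "foldr (\<lambda>i g. in_var i (eta_op L (j i)) g) (k # xs) g = in_var k (eta_op L (j k)) G"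
      unfolding G_def by simp
    then show ?thesis unfolding G_def[symmetric] by (simp only: in_var_eta_op)
  qed
  also have "\<dots> = (\<Sum>v\<in>Uset (j k). \<Sum>u\<in>PiE (set xs) ?U. (\<Prod>i\<in>set (k # xs). eta_kernel L (j i) (x i) ((u(k := v)) i)) *
       g (\<lambda>i. if i \<in> set (k # xs) then ?p i ((u(k := v)) i) else x i))"
  proof (rule sum.cong[OF refl])
    fix v
    have IH: "foldr (\<lambda>i g. in_var i (eta_op L (j i)) g) xs g (x(k := ?p k v)) =
      (\<Sum>u\<in>PiE (set xs) ?U. (\<Prod>i\<in>set xs. eta_kernel L (j i) ((x(k := ?p k v)) i) (u i)) *
       g (\<lambda>i. if i \<in> set xs then ?p i (u i) else (x(k := ?p k v)) i))"
      using Cons.prems by (intro Cons.IH) simp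
    show "foldr (\<lambda>i g. in_var i (eta_op L (j i)) g) xs g (x(k := ?p k v)) * eta_kernel L (j k) (x k) v =
      (\<Sum>u\<in>PiE (set xs) ?U. (\<Prod>i\<in>set (k # xs). eta_kernel L (j i) (x i) ((u(k := v)) i)) *
       g (\<lambda>i. if i \<in> set (k # xs) then ?p i ((u(k := v)) i) else x i))"
      unfolding IH sum_distrib_right
    proof (rule sum.cong[OF refl])
      fix u
      have 1: "(\<Prod>i\<in>set (k # xs). eta_kernel L (j i) (x i) ((u(k := v)) i)) =
        eta_kernel L (j k) (x k) v * (\<Prod>i\<in>set xs. eta_kernel L (j i) ((x(k := ?p k v)) i) (u i))"
      proof -
        have A: "(\<Prod>i\<in>set xs. eta_kernel L (j i) (x i) ((u(k := v)) i)) = (\<Prod>i\<in>set xs. eta_kernel L (j i) ((x(k := ?p k v)) i) (u i))"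
          using k by (intro prod.cong refl) auto
        show ?thesis unfolding list.set(2) prod.insert[OF finite_set k] fun_upd_same A ..
      qed
      have 2: "(\<lambda>i. if i \<in> set (k # xs) then ?p i ((u(k := v)) i) else x i) = (\<lambda>i. if i \<in> set xs then ?p i (u i) else (x(k := ?p k v)) i)"
        using k by (intro ext) auto
      show "(\<Prod>i\<in>set xs. eta_kernel L (j i) ((x(k := ?p k v)) i) (u i)) *
          g (\<lambda>i. if i \<in> set xs then ?p i (u i) else (x(k := ?p k v)) i) * eta_kernel L (j k) (x k) v =
        (\<Prod>i\<in>set (k # xs). eta_kernel L (j i) (x i) ((u(k := v)) i)) *
          g (\<lambda>i. if i \<in> set (k # xs) then ?p i ((u(k := v)) i) else x i)"
        unfolding 1 2 by (simp only: mult_ac)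
    qed
  qed
  also have "\<dots> = (\<Sum>u\<in>PiE (insert k (set xs)) ?U. (\<Prod>i\<in>set (k # xs). eta_kernel L (j i) (x i) (u i)) *
       g (\<lambda>i. if i \<in> set (k # xs) then ?p i (u i) else x i))"
    unfolding sum_PiE_insert[OF k] by (rule sum.swap)
  finally show ?case by (simp only: list.set)
qed

lemma qop_eq_sum:
  "qop L d j g x = (\<Sum>u\<in>PiE {..<d} (\<lambda>i. Uset (j i)). (\<Prod>i<d. eta_kernel L (j i) (x i) (u i)) *
       g (\<lambda>i. if i < d then 2 * pi * of_int (u i) / 2 ^ j i else x i))"
  unfolding qop_def using foldr_in_var[of "[0..<d]" L j g x] by (simp add: atLeast0LessThan)

lemma qop_tensor:
  "qop L d j (\<lambda>x. \<Prod>i<d. h i (x i)) x = (\<Prod>i<d. eta_op L (j i) (h i) (x i))"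
proof -
  have "(\<Prod>i<d. eta_op L (j i) (h i) (x i)) = (\<Prod>i<d. \<Sum>v\<in>Uset (j i). h i (2 * pi * of_int v / 2 ^ j i) * eta_kernel L (j i) (x i) v)"
    by (simp add: eta_op_kernel)
  also have "\<dots> = (\<Sum>u\<in>PiE {..<d} (\<lambda>i. Uset (j i)). \<Prod>i<d. h i (2 * pi * of_int (u i) / 2 ^ j i) * eta_kernel L (j i) (x i) (u i))"
    by (intro prod_sum_PiE) auto
  finally show ?thesis by (simp add: qop_eq_sum prod.distrib mult.commute)
qed

lemma qop_sum: "qop L d j (\<lambda>x. \<Sum>k\<in>S. F k x) x = (\<Sum>k\<in>S. qop L d j (F k) x)"
  unfolding qop_eq_sum sum_distrib_left by (rule sum.swap)

lemma qop_cmult: "qop L d j (\<lambda>x. c * F x) x = c * qop L d j F x"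
  unfolding qop_eq_sum by (simp add: sum_distrib_left mult.left_commute)

text \<open>A \<open>qop\<close> is a finite combination of point values, so pointwise convergence
  of the partial sums is enough to pass to the limit.\<close>

lemma qop_tendsto:
  assumes "\<And>x. (\<lambda>n. F n x) \<longlonglongrightarrow> f x"
  shows "(\<lambda>n. qop L d j (F n) x) \<longlonglongrightarrow> qop L d j f x"
  unfolding qop_eq_sum by (intro tendsto_sum tendsto_mult tendsto_const assms)

subsection \<open>Boundedness of sampling and synthesis\<close>

lemma finite_grid: "finite (PiE {..<d::nat} (\<lambda>i. Uset (j i)))"
  by (intro finite_PiE) auto

lemma prod_kernel_sum_bound:
  fixes d :: nat
  assumes L: "1 \<le> L" and s: "1 / real L < s"
  shows "\<exists>C>0. \<forall>j x. (\<Sum>u\<in>PiE {..<d} (\<lambda>i. Uset (j i)). (\<Prod>i<d. cmod (eta_kernel L (j i) (x i) (u i))) powr s) \<le> C"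
proof -
  obtain C where C: "C > 0" "\<And>j x. (\<Sum>u\<in>Uset j. cmod (eta_kernel L j x u) powr s) \<le> C"
    using eta_kernel_sum_bound[OF L s] by blast
  show ?thesis
  proof (intro exI[of _ "C ^ d"] conjI allI)
    fix j :: "nat \<Rightarrow> nat" and x :: "nat \<Rightarrow> real"
    have "(\<Sum>u\<in>PiE {..<d} (\<lambda>i. Uset (j i)). (\<Prod>i<d. cmod (eta_kernel L (j i) (x i) (u i))) powr s) =
      (\<Prod>i<d. \<Sum>v\<in>Uset (j i). cmod (eta_kernel L (j i) (x i) v) powr s)"
      unfolding prod_powr_distrib by (intro prod_sum_PiE[symmetric]) auto
    also have "\<dots> \<le> (\<Prod>i<d. C)" using C(2) by (intro prod_mono) (auto intro: sum_nonneg)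
    finally show "(\<Sum>u\<in>PiE {..<d} (\<lambda>i. Uset (j i)). (\<Prod>i<d. cmod (eta_kernel L (j i) (x i) (u i))) powr s) \<le> C ^ d" by simp
  qed (use C in auto)
qed

lemma measurable_prod_kernel:
  fixes d :: nat
  assumes "1 \<le> L"
  shows "(\<lambda>x. \<Prod>i<d. cmod (eta_kernel L (j i) (x i) (u i))) \<in> borel_measurable (PiM I (\<lambda>_. circ))"
proof (intro measurable_torus_cont continuous_on_prod continuous_on_norm)
  fix i
  show "continuous_on UNIV (\<lambda>x::nat \<Rightarrow> real. eta_kernel L (j i) (x i) (u i))"
    by (rule continuous_on_compose2[OF continuous_eta_kernel[OF assms] continuous_on_coord]) simp
qed

lemma prod_kernel_integral_bound:
  fixes d :: nat
  assumes L: "1 \<le> L" and s: "1 / real L < s"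
  shows "\<exists>C>0. \<forall>j u. (\<integral>\<^sup>+x. ennreal ((\<Prod>i<d. cmod (eta_kernel L (j i) (x i) (u i))) powr s) \<partial>PiM {..<d} (\<lambda>_. circ))
    \<le> ennreal (C / 2 ^ (\<Sum>i<d. j i))"
proof -
  have s0: "0 < s" using s by (rule le_less_trans[rotated]) simp
  obtain C where C: "C > 0" "\<And>j u. (\<integral>\<^sup>+t. ennreal (cmod (eta_kernel L j t u) powr s) \<partial>circ) \<le> ennreal (C / 2 ^ j)"
    using eta_kernel_integral_bound[OF L s] by blast
  show ?thesis
  proof (intro exI[of _ "C ^ d"] conjI allI)
    fix j :: "nat \<Rightarrow> nat" and u :: "nat \<Rightarrow> int"
    have "(\<integral>\<^sup>+x. ennreal ((\<Prod>i<d. cmod (eta_kernel L (j i) (x i) (u i))) powr s) \<partial>PiM {..<d} (\<lambda>_. circ)) =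
       (\<integral>\<^sup>+x. (\<Prod>i<d. ennreal (cmod (eta_kernel L (j i) (x i) (u i)) powr s)) \<partial>PiM {..<d} (\<lambda>_. circ))"
      unfolding prod_powr_distrib by (simp add: prod_ennreal)
    also have "\<dots> = (\<Prod>i<d. \<integral>\<^sup>+t. ennreal (cmod (eta_kernel L (j i) t (u i)) powr s) \<partial>circ)"
    proof (rule torus.product_nn_integral_prod[where f = "\<lambda>i t. ennreal (cmod (eta_kernel L (j i) t (u i)) powr s)"])
      fix i
      show "(\<lambda>t. ennreal (cmod (eta_kernel L (j i) t (u i)) powr s)) \<in> borel_measurable circ"
        by (intro measurable_compose[OF measurable_circ_cont measurable_ennreal] continuous_on_cmod_powr continuous_eta_kernel L s0)
    qed simp
    also have "\<dots> \<le> (\<Prod>i<d. ennreal (C / 2 ^ j i))" by (rule prod_mono_ennreal) (rule C(2))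
    also have "\<dots> = ennreal (\<Prod>i<d. C / 2 ^ j i)" using C(1) by (intro prod_ennreal) auto
    also have "(\<Prod>i<d. C / 2 ^ j i) = C ^ d / 2 ^ (\<Sum>i<d. j i)" by (simp add: prod_dividef power_sum)
    finally show "(\<integral>\<^sup>+x. ennreal ((\<Prod>i<d. cmod (eta_kernel L (j i) (x i) (u i))) powr s) \<partial>PiM {..<d} (\<lambda>_. circ))
      \<le> ennreal (C ^ d / 2 ^ (\<Sum>i<d. j i))" .
  qed (use C in auto)
qed

text \<open>For \<open>P <= 1\<close> subadditivity separates the nodes, and the embedding of
  \<open>l_p\<close> into \<open>l_P\<close> changes the exponent of the coefficients.\<close>

lemma nn_integral_sum_powr_le1:
  fixes E :: "'u \<Rightarrow> 'x \<Rightarrow> real" and b :: "'u \<Rightarrow> real"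
  assumes U: "finite U" and E: "\<And>u x. 0 \<le> E u x" "\<And>u. E u \<in> borel_measurable M" and b: "\<And>u. 0 \<le> b u"
    and p: "0 < p" "p < P" "P \<le> 1" and D: "0 \<le> D" "\<And>u. (\<integral>\<^sup>+x. ennreal (E u x powr P) \<partial>M) \<le> ennreal D"
  shows "(\<integral>\<^sup>+x. ennreal ((\<Sum>u\<in>U. E u x * b u) powr P) \<partial>M) \<le> ennreal (D * (\<Sum>u\<in>U. b u powr p) powr (P / p))"
proof -
  have m: "(\<lambda>x. ennreal (E u x powr P)) \<in> borel_measurable M" for u
    by (intro measurable_compose[OF _ measurable_ennreal] powr_real_measurable E) simp
  have "(\<integral>\<^sup>+x. ennreal ((\<Sum>u\<in>U. E u x * b u) powr P) \<partial>M) \<le>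
     (\<integral>\<^sup>+x. (\<Sum>u\<in>U. ennreal (b u powr P) * ennreal (E u x powr P)) \<partial>M)"
  proof (rule nn_integral_mono)
    fix x
    have "(\<Sum>u\<in>U. E u x * b u) powr P \<le> (\<Sum>u\<in>U. (E u x * b u) powr P)"
      using p E(1) b by (intro powr_sum_le U) auto
    then have "ennreal ((\<Sum>u\<in>U. E u x * b u) powr P) \<le> ennreal (\<Sum>u\<in>U. b u powr P * E u x powr P)"
      by (intro ennreal_leI) (simp add: powr_mult mult.commute)
    also have "\<dots> = (\<Sum>u\<in>U. ennreal (b u powr P) * ennreal (E u x powr P))"
      by (simp add: sum_ennreal[symmetric] ennreal_mult)
    finally show "ennreal ((\<Sum>u\<in>U. E u x * b u) powr P) \<le> (\<Sum>u\<in>U. ennreal (b u powr P) * ennreal (E u x powr P))" .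
  qed
  also have "\<dots> = (\<Sum>u\<in>U. ennreal (b u powr P) * (\<integral>\<^sup>+x. ennreal (E u x powr P) \<partial>M))"
    using m by (subst nn_integral_sum) (auto intro!: sum.cong nn_integral_cmult)
  also have "\<dots> \<le> (\<Sum>u\<in>U. ennreal (b u powr P) * ennreal D)"
    by (intro sum_mono mult_left_mono D(2)) simp
  also have "\<dots> = ennreal (D * (\<Sum>u\<in>U. (b u powr p) powr (P / p)))"
  proof -
    have "(\<Sum>u\<in>U. ennreal (b u powr P) * ennreal D) = ennreal (\<Sum>u\<in>U. b u powr P * D)"
      using D(1) by (subst sum_ennreal[symmetric]) (auto simp: ennreal_mult)
    also have "(\<Sum>u\<in>U. b u powr P * D) = D * (\<Sum>u\<in>U. (b u powr p) powr (P / p))"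
      using p by (simp add: powr_powr sum_distrib_left mult.commute)
    finally show ?thesis .
  qed
  also have "\<dots> \<le> ennreal (D * (\<Sum>u\<in>U. b u powr p) powr (P / p))"
    using D(1) p by (intro ennreal_leI mult_left_mono sum_powr_le_powr_sum U) auto
  finally show ?thesis .
qed

text \<open>The loss in the exponent, \<open>p < P\<close>, makes up for the kernel of \<open>L = 1\<close> failing to be integrable.\<close>

lemma nn_integral_sum_powr_gt1:
  fixes E :: "'u \<Rightarrow> 'x \<Rightarrow> real" and b :: "'u \<Rightarrow> real"
  assumes U: "finite U" and E: "\<And>u x. 0 \<le> E u x" "\<And>u. E u \<in> borel_measurable M" and b: "\<And>u. 0 \<le> b u"
    and p: "0 < p" "p < p0" "1 < p0" "p0 < P" and s: "s = 1 / (1 + 1 / P - 1 / p0)"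
    and D: "0 \<le> D" "\<And>u. (\<integral>\<^sup>+x. ennreal (E u x powr s) \<partial>M) \<le> ennreal D" and B: "\<And>x. (\<Sum>u\<in>U. E u x powr s) \<le> B"
  shows "(\<integral>\<^sup>+x. ennreal ((\<Sum>u\<in>U. E u x * b u) powr P) \<partial>M) \<le>
    ennreal (B powr (P * (1 - 1 / p0)) * D * (\<Sum>u\<in>U. b u powr p) powr (P / p))"
proof -
  have i: "0 < 1 / P" "1 / P < 1 / p0" "1 / p0 < 1" using p by (auto simp: field_simps)
  have "0 < 1 + 1 / P - 1 / p0" using i by linarith
  then have s1: "s * (1 + 1 / P - 1 / p0) = 1" unfolding s by simp
  define B' where "B' = B powr (P * (1 - 1 / p0))"
  have B': "0 \<le> B'" by (simp add: B'_def)
  define \<alpha> where "\<alpha> = (\<Sum>u\<in>U. b u powr p0)"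
  have \<alpha>: "0 \<le> \<alpha>" unfolding \<alpha>_def by (intro sum_nonneg) auto
  have m: "(\<lambda>x. ennreal (E u x powr s)) \<in> borel_measurable M" for u
    by (intro measurable_compose[OF _ measurable_ennreal] powr_real_measurable E) simp
  have pw: "(\<Sum>u\<in>U. E u x * b u) powr P \<le> (\<Sum>u\<in>U. (B' * \<alpha> powr (P / p0 - 1) * b u powr p0) * E u x powr s)" for x
  proof -
    \<comment> \<open>The proof of Young's inequality: each summand is split into three factors with
      Hoelder weights \<open>1 / P\<close>, \<open>1 / p0 - 1 / P\<close> and
      \<open>1 - 1 / p0\<close>. The relation \<open>1 / s = 1 + 1 / P - 1 / p0\<close> makes the
      exponents of \<open>E\<close> add up to 1.\<close>
    let ?w = "\<lambda>k::nat. if k = 0 then 1 / P else if k = 1 then 1 / p0 - 1 / P else 1 - 1 / p0"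
    let ?f = "\<lambda>(k::nat) u. if k = 0 then b u powr p0 * E u x powr s else if k = 1 then b u powr p0 else E u x powr s"
    define \<beta> where "\<beta> = (\<Sum>u\<in>U. b u powr p0 * E u x powr s)"
    have \<beta>: "0 \<le> \<beta>" unfolding \<beta>_def by (intro sum_nonneg) auto
    have fac: "E u x * b u = (\<Prod>k\<in>{0,1,2}. ?f k u powr ?w k)" for u
    proof -
      have "p0 / P + p0 * (1 / p0 - 1 / P) = 1" using p by (simp add: right_diff_distrib)
      then have 1: "b u powr (p0 / P) * b u powr (p0 * (1 / p0 - 1 / P)) = b u"
        using b[of u] by (simp only: powr_add[symmetric]) simp
      have "s / P + s * (1 - 1 / p0) = 1" using s1 by (simp add: algebra_simps)
      then have 2: "E u x powr (s / P) * E u x powr (s * (1 - 1 / p0)) = E u x"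
        using E(1)[of u x] by (simp only: powr_add[symmetric]) simp
      have "(\<Prod>k\<in>{0,1,2}. ?f k u powr ?w k) = (b u powr (p0 / P) * b u powr (p0 * (1 / p0 - 1 / P))) *
          (E u x powr (s / P) * E u x powr (s * (1 - 1 / p0)))"
        by (simp add: powr_mult powr_powr mult_ac)
      then show ?thesis unfolding 1 2 by simp
    qed
    have "(\<Sum>u\<in>U. E u x * b u) \<le> (\<Prod>k\<in>{0,1,2}. (\<Sum>u\<in>U. ?f k u) powr ?w k)"
      unfolding fac using i by (intro Hoelder_sum U) auto
    also have "\<dots> = \<beta> powr (1 / P) * (\<alpha> powr (1 / p0 - 1 / P) * (\<Sum>u\<in>U. E u x powr s) powr (1 - 1 / p0))"
      by (simp add: \<alpha>_def \<beta>_def)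
    also have "\<dots> \<le> \<beta> powr (1 / P) * (\<alpha> powr (1 / p0 - 1 / P) * B powr (1 - 1 / p0))"
      using B[of x] i by (intro mult_left_mono powr_mono2) (auto intro: sum_nonneg)
    finally have "(\<Sum>u\<in>U. E u x * b u) powr P \<le> (\<beta> powr (1 / P) * (\<alpha> powr (1 / p0 - 1 / P) * B powr (1 - 1 / p0))) powr P"
      using p E(1) b by (intro powr_mono2 sum_nonneg) auto
    also have "\<dots> = \<beta> * (\<alpha> powr (P / p0 - 1) * B')"
    proof -
      have "(1 / p0 - 1 / P) * P = P / p0 - 1" using p by (simp add: left_diff_distrib)
      then show ?thesis using \<beta> p unfolding B'_def powr_mult powr_powr by (simp add: mult.commute)
    qed
    also have "\<dots> = (\<Sum>u\<in>U. (B' * \<alpha> powr (P / p0 - 1) * b u powr p0) * E u x powr s)"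
      unfolding \<beta>_def by (simp add: sum_distrib_left sum_distrib_right mult_ac)
    finally show ?thesis .
  qed
  have "(\<integral>\<^sup>+x. ennreal ((\<Sum>u\<in>U. E u x * b u) powr P) \<partial>M) \<le>
     (\<integral>\<^sup>+x. (\<Sum>u\<in>U. ennreal (B' * \<alpha> powr (P / p0 - 1) * b u powr p0) * ennreal (E u x powr s)) \<partial>M)"
  proof (rule nn_integral_mono)
    fix x
    have "ennreal ((\<Sum>u\<in>U. E u x * b u) powr P) \<le> ennreal (\<Sum>u\<in>U. (B' * \<alpha> powr (P / p0 - 1) * b u powr p0) * E u x powr s)"
      by (intro ennreal_leI pw)
    also have "\<dots> = (\<Sum>u\<in>U. ennreal (B' * \<alpha> powr (P / p0 - 1) * b u powr p0) * ennreal (E u x powr s))"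
      using B' by (subst sum_ennreal[symmetric]) (auto simp: ennreal_mult)
    finally show "ennreal ((\<Sum>u\<in>U. E u x * b u) powr P) \<le>
       (\<Sum>u\<in>U. ennreal (B' * \<alpha> powr (P / p0 - 1) * b u powr p0) * ennreal (E u x powr s))" .
  qed
  also have "\<dots> = (\<Sum>u\<in>U. ennreal (B' * \<alpha> powr (P / p0 - 1) * b u powr p0) * (\<integral>\<^sup>+x. ennreal (E u x powr s) \<partial>M))"
    using m by (subst nn_integral_sum) (auto intro!: sum.cong nn_integral_cmult)
  also have "\<dots> \<le> (\<Sum>u\<in>U. ennreal (B' * \<alpha> powr (P / p0 - 1) * b u powr p0) * ennreal D)"
    by (intro sum_mono mult_left_mono D(2)) simp
  also have "\<dots> = ennreal (\<Sum>u\<in>U. B' * \<alpha> powr (P / p0 - 1) * b u powr p0 * D)"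
    using D(1) B' by (subst sum_ennreal[symmetric]) (auto simp: ennreal_mult)
  also have "\<dots> \<le> ennreal (B' * D * (\<Sum>u\<in>U. b u powr p) powr (P / p))"
  proof (rule ennreal_leI)
    have "(\<Sum>u\<in>U. B' * \<alpha> powr (P / p0 - 1) * b u powr p0 * D) = B' * D * (\<alpha> powr (P / p0 - 1) * \<alpha>)"
      unfolding sum_distrib_left[symmetric] sum_distrib_right[symmetric] \<alpha>_def[symmetric] by simp
    moreover have "\<alpha> powr (P / p0 - 1) * \<alpha> = \<alpha> powr (P / p0)"
      using \<alpha> by (cases "\<alpha> = 0") (auto simp: powr_diff)
    moreover have "B' * D * \<alpha> powr (P / p0) \<le> B' * D * (\<Sum>u\<in>U. b u powr p) powr (P / p)"
    proof (rule mult_left_mono)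
      have "\<alpha> = (\<Sum>u\<in>U. (b u powr p) powr (p0 / p))"
        unfolding \<alpha>_def using p by (simp add: powr_powr)
      also have "\<dots> \<le> (\<Sum>u\<in>U. b u powr p) powr (p0 / p)"
        using p by (intro sum_powr_le_powr_sum U) auto
      finally have "\<alpha> powr (P / p0) \<le> ((\<Sum>u\<in>U. b u powr p) powr (p0 / p)) powr (P / p0)"
        using \<alpha> p by (intro powr_mono2) auto
      then show "\<alpha> powr (P / p0) \<le> (\<Sum>u\<in>U. b u powr p) powr (P / p)"
        using p by (simp add: powr_powr)
    qed (use B' D in auto)
    ultimately show "(\<Sum>u\<in>U. B' * \<alpha> powr (P / p0 - 1) * b u powr p0 * D) \<le> B' * D * (\<Sum>u\<in>U. b u powr p) powr (P / p)"
      by simp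
  qed
  finally show ?thesis unfolding B'_def .
qed

text \<open>The kernels enter through two bounds only: the integrals of their powers are of order
  \<open>2 ^ (- |j|)\<close>, and for \<open>P > 1\<close> also the sums of their powers over the
  grid are bounded.\<close>

lemma synthesis_bound:
  fixes d :: nat
  assumes L: "1 \<le> L" and p: "0 < p" "p < P" "1 / real L < P"
  shows "\<exists>C>0. \<forall>j (a :: (nat \<Rightarrow> int) \<Rightarrow> complex).
    (\<integral>\<^sup>+x. ennreal (cmod (\<Sum>u\<in>PiE {..<d} (\<lambda>i. Uset (j i)). (\<Prod>i<d. eta_kernel L (j i) (x i) (u i)) * a u) powr P) \<partial>PiM {..<d} (\<lambda>_. circ))
    \<le> ennreal (C / 2 ^ (\<Sum>i<d. j i) * (\<Sum>u\<in>PiE {..<d} (\<lambda>i. Uset (j i)). cmod (a u) powr p) powr (P / p))"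
proof -
  define E where "E = (\<lambda>(j::nat \<Rightarrow> nat) (u::nat \<Rightarrow> int) (x::nat \<Rightarrow> real). \<Prod>i<d. cmod (eta_kernel L (j i) (x i) (u i)))"
  have E: "0 \<le> E j u x" "E j u \<in> borel_measurable (PiM {..<d} (\<lambda>_. circ))" for j u x
    unfolding E_def by (auto intro!: prod_nonneg measurable_prod_kernel L)
  have "\<exists>C>0. \<forall>j b. (\<forall>u. 0 \<le> b u) \<longrightarrow>
    (\<integral>\<^sup>+x. ennreal ((\<Sum>u\<in>PiE {..<d} (\<lambda>i. Uset (j i)). E j u x * b u) powr P) \<partial>PiM {..<d} (\<lambda>_. circ))
    \<le> ennreal (C / 2 ^ (\<Sum>i<d. j i) * (\<Sum>u\<in>PiE {..<d} (\<lambda>i. Uset (j i)). b u powr p) powr (P / p))"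
  proof (cases "P \<le> 1")
    case True
    obtain C where C: "C > 0" "\<And>j u. (\<integral>\<^sup>+x. ennreal (E j u x powr P) \<partial>PiM {..<d} (\<lambda>_. circ)) \<le> ennreal (C / 2 ^ (\<Sum>i<d. j i))"
      using prod_kernel_integral_bound[OF L p(3), of d] unfolding E_def by blast
    show ?thesis
      using C(1) by (intro exI[of _ C] conjI allI impI nn_integral_sum_powr_le1 finite_grid E p True C(2)) auto
  next
    case False
    \<comment> \<open>A point strictly between \<open>max p 1\<close> and \<open>P\<close>. Then
      \<open>s > 1 >= 1 / L\<close>, so the bounds for \<open>s\<close>-th powers of the kernels are
      available also when \<open>L = 1\<close>.\<close>
    define p0 where "p0 = (max p 1 + P) / 2"
    have p0: "p < p0" "1 < p0" "p0 < P" unfolding p0_def using p False by auto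
    define s where "s = 1 / (1 + 1 / P - 1 / p0)"
    have "0 < 1 / P" "1 / P < 1 / p0" "1 / p0 < 1" using p0 p by (auto simp: field_simps)
    then have "0 < 1 + 1 / P - 1 / p0" "1 + 1 / P - 1 / p0 < 1" by linarith+
    then have "1 < s" unfolding s_def by (simp add: less_divide_eq)
    moreover have "1 / real L \<le> 1" using L by simp
    ultimately have sL: "1 / real L < s" by linarith
    obtain C where C: "C > 0" "\<And>j u. (\<integral>\<^sup>+x. ennreal (E j u x powr s) \<partial>PiM {..<d} (\<lambda>_. circ)) \<le> ennreal (C / 2 ^ (\<Sum>i<d. j i))"
      using prod_kernel_integral_bound[OF L sL, of d] unfolding E_def by blast
    obtain B where B: "B > 0" "\<And>j x. (\<Sum>u\<in>PiE {..<d} (\<lambda>i. Uset (j i)). E j u x powr s) \<le> B"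
      using prod_kernel_sum_bound[OF L sL, of d] unfolding E_def by blast
    show ?thesis
    proof (intro exI[of _ "B powr (P * (1 - 1 / p0)) * C"] conjI allI impI)
      fix j and b :: "(nat \<Rightarrow> int) \<Rightarrow> real" assume "\<forall>u. 0 \<le> b u"
      then have "(\<integral>\<^sup>+x. ennreal ((\<Sum>u\<in>PiE {..<d} (\<lambda>i. Uset (j i)). E j u x * b u) powr P) \<partial>PiM {..<d} (\<lambda>_. circ))
        \<le> ennreal (B powr (P * (1 - 1 / p0)) * (C / 2 ^ (\<Sum>i<d. j i)) * (\<Sum>u\<in>PiE {..<d} (\<lambda>i. Uset (j i)). b u powr p) powr (P / p))"
        using C(1) by (intro nn_integral_sum_powr_gt1[OF finite_grid E _ p(1) p0 s_def _ C(2) B(2)]) auto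
      then show "(\<integral>\<^sup>+x. ennreal ((\<Sum>u\<in>PiE {..<d} (\<lambda>i. Uset (j i)). E j u x * b u) powr P) \<partial>PiM {..<d} (\<lambda>_. circ))
        \<le> ennreal (B powr (P * (1 - 1 / p0)) * C / 2 ^ (\<Sum>i<d. j i) * (\<Sum>u\<in>PiE {..<d} (\<lambda>i. Uset (j i)). b u powr p) powr (P / p))"
        by (simp only: times_divide_eq_right)
    qed (use B C in auto)
  qed
  then obtain C where C: "C > 0" "\<And>j b. (\<forall>u. 0 \<le> b u) \<Longrightarrow>
    (\<integral>\<^sup>+x. ennreal ((\<Sum>u\<in>PiE {..<d} (\<lambda>i. Uset (j i)). E j u x * b u) powr P) \<partial>PiM {..<d} (\<lambda>_. circ))
    \<le> ennreal (C / 2 ^ (\<Sum>i<d. j i) * (\<Sum>u\<in>PiE {..<d} (\<lambda>i. Uset (j i)). b u powr p) powr (P / p))"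
    by blast
  show ?thesis
  proof (intro exI[of _ C] conjI allI C(1))
    fix j and a :: "(nat \<Rightarrow> int) \<Rightarrow> complex"
    let ?U = "PiE {..<d} (\<lambda>i. Uset (j i))"
    have "cmod ((\<Prod>i<d. eta_kernel L (j i) (x i) (u i)) * a u) = E j u x * cmod (a u)" for u x
      unfolding E_def norm_mult prod_norm ..
    then have le: "cmod (\<Sum>u\<in>?U. (\<Prod>i<d. eta_kernel L (j i) (x i) (u i)) * a u) \<le> (\<Sum>u\<in>?U. E j u x * cmod (a u))" for x
      using norm_sum[of "\<lambda>u. (\<Prod>i<d. eta_kernel L (j i) (x i) (u i)) * a u" ?U] by simp
    have "(\<integral>\<^sup>+x. ennreal (cmod (\<Sum>u\<in>?U. (\<Prod>i<d. eta_kernel L (j i) (x i) (u i)) * a u) powr P) \<partial>PiM {..<d} (\<lambda>_. circ)) \<le>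
      (\<integral>\<^sup>+x. ennreal ((\<Sum>u\<in>?U. E j u x * cmod (a u)) powr P) \<partial>PiM {..<d} (\<lambda>_. circ))"
      using p by (intro nn_integral_mono ennreal_leI powr_mono2 le) auto
    also have "\<dots> \<le> ennreal (C / 2 ^ (\<Sum>i<d. j i) * (\<Sum>u\<in>?U. cmod (a u) powr p) powr (P / p))"
      by (rule C(2)) simp
    finally show "(\<integral>\<^sup>+x. ennreal (cmod (\<Sum>u\<in>?U. (\<Prod>i<d. eta_kernel L (j i) (x i) (u i)) * a u) powr P) \<partial>PiM {..<d} (\<lambda>_. circ))
      \<le> ennreal (C / 2 ^ (\<Sum>i<d. j i) * (\<Sum>u\<in>?U. cmod (a u) powr p) powr (P / p))" .
  qed
qed

text \<open>Sampling bounds the \<open>l_p\<close> sum of the node values by the product of the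
  degrees times \<open>Lpi d p F\<close>, and synthesis raises this to the power
  \<open>P / p\<close>. The condition \<open>2 ^ j i <= n i\<close> is that of the sampling
  inequality; in the application the pairs of levels violating it give zero.\<close>

lemma qop_bound:
  assumes L: "1 \<le> L" and p: "0 < p" "p < P" "1 / real L < P"
  shows "\<exists>C>0. \<forall>j n F. trig_poly_d d n F \<longrightarrow> (\<forall>i<d. 2 ^ j i \<le> n i) \<longrightarrow>
    (\<integral>\<^sup>+x. ennreal (cmod (qop L d j F x) powr P) \<partial>PiM {..<d} (\<lambda>_. circ))
    \<le> ennreal (C / 2 ^ (\<Sum>i<d. j i) * ((\<Prod>i<d. real (n i)) * Lpi d p F) powr (P / p))"
proof -
  obtain C where C: "C > 0" "\<And>j (a :: (nat \<Rightarrow> int) \<Rightarrow> complex).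
    (\<integral>\<^sup>+x. ennreal (cmod (\<Sum>u\<in>PiE {..<d} (\<lambda>i. Uset (j i)). (\<Prod>i<d. eta_kernel L (j i) (x i) (u i)) * a u) powr P) \<partial>PiM {..<d} (\<lambda>_. circ))
    \<le> ennreal (C / 2 ^ (\<Sum>i<d. j i) * (\<Sum>u\<in>PiE {..<d} (\<lambda>i. Uset (j i)). cmod (a u) powr p) powr (P / p))"
    using synthesis_bound[OF L p, of d] by blast
  obtain c where c: "c > 0" "\<And>m j g. 2 ^ j \<le> m \<Longrightarrow> trig_poly m g \<Longrightarrow>
    (\<Sum>u\<in>Uset j. ennreal (cmod (g (2 * pi * of_int u / 2 ^ j)) powr p))
      \<le> ennreal (c * real m) * (\<integral>\<^sup>+t. ennreal (cmod (g t) powr p) \<partial>circ)"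
    using sampling_inequality[OF p(1)] by blast
  show ?thesis
  proof (intro exI[of _ "C * (c ^ d) powr (P / p)"] conjI allI impI)
    fix j n F assume F: "trig_poly_d d n F" and jn: "\<forall>i<d. 2 ^ j i \<le> n i"
    let ?T = "PiM {..<d} (\<lambda>_::nat. circ)" and ?U = "PiE {..<d} (\<lambda>i. Uset (j i))"
    let ?g = "\<lambda>u. restrict (\<lambda>i. 2 * pi * real_of_int (u i) / 2 ^ j i) {..<d}"
    have "qop L d j F x = (\<Sum>u\<in>?U. (\<Prod>i<d. eta_kernel L (j i) (x i) (u i)) * F (?g u))" for x
      unfolding qop_eq_sum
      by (intro sum.cong refl arg_cong2[where f = "(*)"] trig_poly_dD(3)[OF F]) auto
    then have "(\<integral>\<^sup>+x. ennreal (cmod (qop L d j F x) powr P) \<partial>?T) \<le>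
       ennreal (C / 2 ^ (\<Sum>i<d. j i) * (\<Sum>u\<in>?U. cmod (F (?g u)) powr p) powr (P / p))"
      using C(2)[of j "\<lambda>u. F (?g u)"] by simp
    also have "\<dots> \<le> ennreal (C * (c ^ d) powr (P / p) / 2 ^ (\<Sum>i<d. j i) * ((\<Prod>i<d. real (n i)) * Lpi d p F) powr (P / p))"
    proof (rule ennreal_leI)
      have "(\<Sum>u\<in>?U. ennreal (cmod (F (?g u)) powr p)) \<le>
        (\<Prod>i<d. ennreal (c * real (n i))) * (\<integral>\<^sup>+x. ennreal (cmod (F x) powr p) \<partial>?T)"
      proof (rule torus_sampling[where A = "\<lambda>x. ennreal (cmod (F x) powr p)" and pt = "\<lambda>i v. 2 * pi * real_of_int v / 2 ^ j i"])
        show "(\<lambda>x. ennreal (cmod (F x) powr p)) \<in> borel_measurable borel"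
          by (rule measurable_cmod_powr[OF trig_poly_dD(1)[OF F] p(1)])
        fix i x assume i: "i \<in> {..<d}"
        then show "(\<Sum>v\<in>Uset (j i). ennreal (cmod (F (x(i := 2 * pi * real_of_int v / 2 ^ j i))) powr p))
          \<le> ennreal (c * real (n i)) * (\<integral>\<^sup>+t. ennreal (cmod (F (x(i := t))) powr p) \<partial>circ)"
          using jn by (intro c(2)[of "j i" "n i" "\<lambda>t. F (x(i := t))"] trig_poly_dD(4)[OF F]) auto
      qed simp
      also have "(\<Prod>i<d. ennreal (c * real (n i))) = ennreal (c ^ d * (\<Prod>i<d. real (n i)))"
        using c(1) by (subst prod_ennreal) (auto simp: prod.distrib)
      also have "(\<integral>\<^sup>+x. ennreal (cmod (F x) powr p) \<partial>?T) = ennreal (Lpi d p F)"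
        by (rule nn_integral_trig_poly_d[OF F p(1)])
      also have "ennreal (c ^ d * (\<Prod>i<d. real (n i))) * ennreal (Lpi d p F) = ennreal (c ^ d * ((\<Prod>i<d. real (n i)) * Lpi d p F))"
        using c(1) Lpi_nonneg by (simp add: ennreal_mult[symmetric] prod_nonneg mult.assoc)
      finally have "ennreal (\<Sum>u\<in>?U. cmod (F (?g u)) powr p) \<le> ennreal (c ^ d * ((\<Prod>i<d. real (n i)) * Lpi d p F))"
        by (subst sum_ennreal[symmetric]) (rule powr_ge_zero)
      then have "(\<Sum>u\<in>?U. cmod (F (?g u)) powr p) \<le> c ^ d * ((\<Prod>i<d. real (n i)) * Lpi d p F)"
        using c(1) Lpi_nonneg by (subst (asm) ennreal_le_iff) (auto intro!: mult_nonneg_nonneg prod_nonneg)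
      then have "(\<Sum>u\<in>?U. cmod (F (?g u)) powr p) powr (P / p) \<le> (c ^ d * ((\<Prod>i<d. real (n i)) * Lpi d p F)) powr (P / p)"
        using p by (intro powr_mono2 sum_nonneg) auto
      then have "C / 2 ^ (\<Sum>i<d. j i) * (\<Sum>u\<in>?U. cmod (F (?g u)) powr p) powr (P / p) \<le>
          C / 2 ^ (\<Sum>i<d. j i) * (c ^ d * ((\<Prod>i<d. real (n i)) * Lpi d p F)) powr (P / p)"
        using C(1) by (intro mult_left_mono) auto
      then show "C / 2 ^ (\<Sum>i<d. j i) * (\<Sum>u\<in>?U. cmod (F (?g u)) powr p) powr (P / p) \<le>
          C * (c ^ d) powr (P / p) / 2 ^ (\<Sum>i<d. j i) * ((\<Prod>i<d. real (n i)) * Lpi d p F) powr (P / p)"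
        by (simp add: powr_mult mult_ac)
    qed
    finally show "(\<integral>\<^sup>+x. ennreal (cmod (qop L d j F x) powr P) \<partial>?T)
      \<le> ennreal (C * (c ^ d) powr (P / p) / 2 ^ (\<Sum>i<d. j i) * ((\<Prod>i<d. real (n i)) * Lpi d p F) powr (P / p))" .
  qed (use C c in auto)
qed

subsection \<open>Counting outside the hyperbolic layer\<close>

lemma sum_powr_tail_le:
  fixes s a \<tau> :: real
  assumes "0 < s" "0 < a" "finite A" "\<And>l. l \<in> A \<Longrightarrow> \<tau> \<le> a * real l"
  shows "(\<Sum>l\<in>A. 2 powr (- (s * (a * real l)))) \<le> 2 powr (- (s * \<tau>)) * (1 / (1 - 2 powr (- (s * a))))"
proof (cases "A = {}")
  case False
  define \<rho> where "\<rho> = 2 powr (- (s * a))"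
  have \<rho>: "0 < \<rho>" "\<rho> < 1" unfolding \<rho>_def using assms by (auto simp: powr_less_one)
  define l0 where "l0 = Min A"
  have l0: "l0 \<in> A" "\<And>l. l \<in> A \<Longrightarrow> l0 \<le> l" unfolding l0_def using assms False by auto
  have e: "2 powr (- (s * (a * real l))) = \<rho> ^ l" for l
    unfolding \<rho>_def by (simp add: powr_powr powr_realpow[symmetric] mult.assoc)
  have "(\<Sum>l\<in>A. 2 powr (- (s * (a * real l)))) = (\<Sum>l\<in>A. \<rho> ^ l0 * \<rho> ^ (l - l0))"
    unfolding e using l0(2) by (intro sum.cong refl) (simp add: power_add[symmetric])
  also have "\<dots> = \<rho> ^ l0 * (\<Sum>l\<in>A. \<rho> ^ (l - l0))" by (simp add: sum_distrib_left)
  also have "\<dots> \<le> 2 powr (- (s * \<tau>)) * (1 / (1 - \<rho>))"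
  proof (rule mult_mono)
    show "\<rho> ^ l0 \<le> 2 powr (- (s * \<tau>))"
      unfolding e[symmetric] using assms l0(1) by (intro powr_mono) auto
    have "l1 = l2" if "l1 \<in> A" "l2 \<in> A" "l1 - l0 = l2 - l0" for l1 l2
      using l0(2)[OF that(1)] l0(2)[OF that(2)] that(3) by simp
    then have "inj_on (\<lambda>l. l - l0) A" by (simp add: inj_on_def)
    then show "(\<Sum>l\<in>A. \<rho> ^ (l - l0)) \<le> 1 / (1 - \<rho>)"
      using \<rho> assms by (intro sum_geometric_inj) auto
  qed (use \<rho> in \<open>auto intro: sum_nonneg\<close>)
  finally show ?thesis by (simp add: \<rho>_def)
next
  case True
  have "2 powr (- (s * a)) < 1" using assms by (simp add: powr_less_one)
  then show ?thesis using True by simp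
qed

lemma idx_fiber:
  assumes "J \<subseteq> idx (Suc n)" "finite J"
  shows "(\<Sum>j\<in>J. f j) = (\<Sum>l\<in>(\<lambda>j. j n) ` J. \<Sum>j\<in>{j \<in> idx n. j(n := l) \<in> J}. f (j(n := l)))"
proof -
  have "(\<Sum>j\<in>J. f j) = (\<Sum>l\<in>(\<lambda>j. j n) ` J. \<Sum>j\<in>{j \<in> J. j n = l}. f j)"
    using assms(2) by (rule sum.image_gen)
  also have "\<dots> = (\<Sum>l\<in>(\<lambda>j. j n) ` J. \<Sum>j\<in>{j \<in> idx n. j(n := l) \<in> J}. f (j(n := l)))"
  proof (rule sum.cong[OF refl])
    fix l
    show "(\<Sum>j\<in>{j \<in> J. j n = l}. f j) = (\<Sum>j\<in>{j \<in> idx n. j(n := l) \<in> J}. f (j(n := l)))"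
    proof (rule sum.reindex_bij_witness[of _ "\<lambda>j. j(n := l)" "\<lambda>j. j(n := 0)"])
      fix j assume j: "j \<in> {j \<in> J. j n = l}"
      then have "j \<in> idx (Suc n)" using assms by auto
      then show "j(n := 0) \<in> {j \<in> idx n. j(n := l) \<in> J}"
        using j by (auto simp: idx_def fun_upd_idem)
      show "(j(n := 0))(n := l) = j" using j by auto
      then show "f ((j(n := 0))(n := l)) = f j" by simp
    next
      fix j assume "j \<in> {j \<in> idx n. j(n := l) \<in> J}"
      then show "(j(n := l))(n := 0) = j" "j(n := l) \<in> {j \<in> J. j n = l}"
        by (auto simp: idx_def fun_eq_iff)
    qed
  qed
  finally show ?thesis .
qed

text \<open>Fixing the last coordinate at \<open>l\<close> leaves the threshold
  \<open>t - \<eta> n * l\<close> for the others. The polynomial factor is bounded by its value at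
  the full threshold, so only the exponential has to be summed over \<open>l\<close>.\<close>

lemma hyperbolic_sum_step:
  fixes \<alpha> \<eta> :: "nat \<Rightarrow> real" and s C :: real and e :: nat
  assumes s: "0 < s" and IH: "\<And>t J. finite J \<Longrightarrow> J \<subseteq> idx n \<Longrightarrow> (\<And>j. j \<in> J \<Longrightarrow> t < (\<Sum>i<n. \<eta> i * real (j i))) \<Longrightarrow>
      (\<Sum>j\<in>J. 2 powr (- (s * (\<Sum>i<n. \<alpha> i * real (j i))))) \<le> C * 2 powr (- (s * max t 0)) * (1 + max t 0) ^ e"
    and C: "0 \<le> C" and \<eta>: "0 < \<eta> n"
    and J: "finite J" "J \<subseteq> idx (Suc n)" "\<And>j. j \<in> J \<Longrightarrow> t < (\<Sum>i<Suc n. \<eta> i * real (j i))"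
  shows "(\<Sum>j\<in>J. 2 powr (- (s * (\<Sum>i<Suc n. \<alpha> i * real (j i))))) \<le>
    C * (1 + max t 0) ^ e * (\<Sum>l\<in>(\<lambda>j. j n) ` J. 2 powr (- (s * (\<alpha> n * real l + max (t - \<eta> n * real l) 0))))"
proof -
  have eq: "(\<Sum>i<n. \<gamma> i * real ((j(n := l)) i)) = (\<Sum>i<n. \<gamma> i * real (j i))" for \<gamma> :: "nat \<Rightarrow> real" and j l
    by (intro sum.cong) auto
  have "(\<Sum>j\<in>J. 2 powr (- (s * (\<Sum>i<Suc n. \<alpha> i * real (j i))))) =
    (\<Sum>l\<in>(\<lambda>j. j n) ` J. 2 powr (- (s * (\<alpha> n * real l))) *
       (\<Sum>j\<in>{j \<in> idx n. j(n := l) \<in> J}. 2 powr (- (s * (\<Sum>i<n. \<alpha> i * real (j i))))))"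
    unfolding idx_fiber[OF J(2,1)] sum_distrib_left
    by (intro sum.cong refl) (simp add: eq powr_add[symmetric] distrib_left add.commute)
  also have "\<dots> \<le> (\<Sum>l\<in>(\<lambda>j. j n) ` J. 2 powr (- (s * (\<alpha> n * real l))) * (C * 2 powr (- (s * max (t - \<eta> n * real l) 0)) * (1 + max t 0) ^ e))"
  proof (intro sum_mono mult_left_mono)
    fix l
    let ?J = "{j \<in> idx n. j(n := l) \<in> J}"
    have "inj_on (\<lambda>j. j(n := l)) ?J"
    proof (rule inj_onI)
      fix j j' assume "j \<in> ?J" "j' \<in> ?J" and e: "j(n := l) = j'(n := l)"
      then have "j n = j' n" by (auto simp: idx_def)
      then show "j = j'" using e by (metis fun_upd_triv fun_upd_upd)
    qed
    moreover have "(\<lambda>j. j(n := l)) ` ?J \<subseteq> J" by auto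
    ultimately have fin: "finite ?J" using J(1) by (meson finite_imageD finite_subset)
    have "(\<Sum>j\<in>?J. 2 powr (- (s * (\<Sum>i<n. \<alpha> i * real (j i))))) \<le>
        C * 2 powr (- (s * max (t - \<eta> n * real l) 0)) * (1 + max (t - \<eta> n * real l) 0) ^ e"
    proof (rule IH[OF fin])
      fix j assume "j \<in> ?J"
      then have "t < (\<Sum>i<Suc n. \<eta> i * real ((j(n := l)) i))" using J(3) by blast
      then show "t - \<eta> n * real l < (\<Sum>i<n. \<eta> i * real (j i))" by (simp add: eq)
    qed auto
    also have "\<dots> \<le> C * 2 powr (- (s * max (t - \<eta> n * real l) 0)) * (1 + max t 0) ^ e"
    proof -
      have "0 \<le> \<eta> n * real l" using \<eta> by simp
      then have "max (t - \<eta> n * real l) 0 \<le> max t 0" by linarith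
      then show ?thesis using C by (intro mult_left_mono power_mono) auto
    qed
    finally show "(\<Sum>j\<in>?J. 2 powr (- (s * (\<Sum>i<n. \<alpha> i * real (j i))))) \<le> C * 2 powr (- (s * max (t - \<eta> n * real l) 0)) * (1 + max t 0) ^ e" .
  qed simp
  also have "\<dots> = C * (1 + max t 0) ^ e * (\<Sum>l\<in>(\<lambda>j. j n) ` J. 2 powr (- (s * (\<alpha> n * real l + max (t - \<eta> n * real l) 0))))"
    unfolding sum_distrib_left by (intro sum.cong refl) (simp add: powr_add[symmetric] distrib_left mult_ac)
  finally show ?thesis .
qed

text \<open>The first coordinate gives a geometric tail without polynomial factor. In every further
  critical direction about \<open>t / \<eta> 0\<close> values of \<open>l\<close> contribute
  equally, which raises the power by one; in a noncritical direction the gap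
  \<open>\<alpha> n - \<eta> n > 0\<close> makes the sum over \<open>l\<close> converge. Truncating
  \<open>t\<close> at 0 covers values of \<open>l\<close> that exceed the threshold alone.\<close>

lemma hyperbolic_sum:
  fixes \<alpha> \<eta> :: "nat \<Rightarrow> real" and s :: real and \<mu> :: nat
  assumes s: "0 < s" and \<mu>: "1 \<le> \<mu>" and \<eta>0: "0 < \<eta> 0"
    and crit: "\<And>i. i < \<mu> \<Longrightarrow> \<alpha> i = \<eta> 0 \<and> \<eta> i = \<eta> 0"
    and noncrit: "\<And>i. \<mu> \<le> i \<Longrightarrow> i < d \<Longrightarrow> 0 < \<eta> i \<and> \<eta> i < \<alpha> i"
    and n: "1 \<le> n" "n \<le> d"
  shows "\<exists>C>0. \<forall>t J. finite J \<longrightarrow> J \<subseteq> idx n \<longrightarrow> (\<forall>j\<in>J. t < (\<Sum>i<n. \<eta> i * real (j i))) \<longrightarrow>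
      (\<Sum>j\<in>J. 2 powr (- (s * (\<Sum>i<n. \<alpha> i * real (j i))))) \<le> C * 2 powr (- (s * max t 0)) * (1 + max t 0) ^ (min n \<mu> - 1)"
  using n
proof (induction n rule: nat_induct_at_least)
  case base
  define G where "G = 1 / (1 - 2 powr (- (s * \<eta> 0)))"
  have G: "0 < G" unfolding G_def using s \<eta>0 by (auto simp: powr_less_one)
  have c0: "\<alpha> 0 = \<eta> 0" using crit[of 0] \<mu> by simp
  show ?case
  proof (intro exI[of _ G] conjI G allI impI)
    fix t J assume J: "finite J" "J \<subseteq> idx 1" "\<forall>j\<in>J. t < (\<Sum>i<1. \<eta> i * real (j i))"
    have inj: "inj_on (\<lambda>j. j 0) J"
    proof (rule inj_onI)
      fix j j' assume "j \<in> J" "j' \<in> J" and e: "j 0 = j' 0"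
      then have "j \<in> idx 1" "j' \<in> idx 1" using J(2) by auto
      then show "j = j'" using e by (intro ext, case_tac "x = 0") (auto simp: idx_def)
    qed
    have "(\<Sum>j\<in>J. 2 powr (- (s * (\<Sum>i<1. \<alpha> i * real (j i))))) = (\<Sum>l\<in>(\<lambda>j. j 0) ` J. 2 powr (- (s * (\<eta> 0 * real l))))"
      using inj by (simp add: sum.reindex c0)
    also have "\<dots> \<le> 2 powr (- (s * max t 0)) * G"
      unfolding G_def using J s \<eta>0 by (intro sum_powr_tail_le) (auto simp: less_imp_le)
    finally show "(\<Sum>j\<in>J. 2 powr (- (s * (\<Sum>i<1. \<alpha> i * real (j i))))) \<le> G * 2 powr (- (s * max t 0)) * (1 + max t 0) ^ (min 1 \<mu> - 1)"
      using \<mu> by (simp add: mult.commute)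
  qed
next
  case (Suc n)
  then obtain C where C: "0 < C" "\<And>t J. finite J \<Longrightarrow> J \<subseteq> idx n \<Longrightarrow> (\<And>j. j \<in> J \<Longrightarrow> t < (\<Sum>i<n. \<eta> i * real (j i))) \<Longrightarrow>
      (\<Sum>j\<in>J. 2 powr (- (s * (\<Sum>i<n. \<alpha> i * real (j i))))) \<le> C * 2 powr (- (s * max t 0)) * (1 + max t 0) ^ (min n \<mu> - 1)"
    by (auto dest: Suc_leD)
  have \<eta>n: "0 < \<eta> n" using crit[of n] noncrit[of n] \<eta>0 Suc.prems by (cases "n < \<mu>") auto
  note step = hyperbolic_sum_step[where n = n and \<eta> = \<eta> and \<alpha> = \<alpha> and C = C and e = "min n \<mu> - 1",
      OF s C(2) less_imp_le[OF C(1)] \<eta>n]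
  show ?case
  proof (cases "n < \<mu>")
    case True
    define G where "G = 1 / \<eta> 0 + 1 + 1 / (1 - 2 powr (- (s * \<eta> 0)))"
    have "0 < 1 / (1 - 2 powr (- (s * \<eta> 0)))" using s \<eta>0 by (auto simp: powr_less_one)
    then have G: "0 < G" unfolding G_def using \<eta>0 by (simp add: add_pos_pos)
    have c: "\<alpha> n = \<eta> 0" "\<eta> n = \<eta> 0" using crit[OF True] by auto
    have ex: "Suc (min n \<mu> - 1) = min (Suc n) \<mu> - 1" using True Suc.hyps by simp
    show ?thesis
    proof (intro exI[of _ "C * G"] conjI allI impI)
      fix t J assume J: "finite J" "J \<subseteq> idx (Suc n)" "\<forall>j\<in>J. t < (\<Sum>i<Suc n. \<eta> i * real (j i))"
      let ?L = "(\<lambda>j. j n) ` J" and ?t = "max t 0"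
      have fL: "finite ?L" using J by simp
      \<comment> \<open>Split by whether \<open>l\<close> alone exhausts the threshold: below it
        every term equals at most \<open>2 powr (- (s * max t 0))\<close>, above it a geometric tail
        of the same size remains.\<close>
      have "(\<Sum>l\<in>?L. 2 powr (- (s * (\<alpha> n * real l + max (t - \<eta> n * real l) 0)))) \<le>
         (\<Sum>l\<in>{l\<in>?L. \<eta> 0 * real l \<le> ?t}. 2 powr (- (s * ?t))) + (\<Sum>l\<in>{l\<in>?L. \<not> \<eta> 0 * real l \<le> ?t}. 2 powr (- (s * (\<eta> 0 * real l))))"
      proof -
        have "(\<Sum>l\<in>?L. 2 powr (- (s * (\<alpha> n * real l + max (t - \<eta> n * real l) 0)))) =
          (\<Sum>l\<in>{l\<in>?L. \<eta> 0 * real l \<le> ?t}. 2 powr (- (s * (\<alpha> n * real l + max (t - \<eta> n * real l) 0)))) +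
          (\<Sum>l\<in>{l\<in>?L. \<not> \<eta> 0 * real l \<le> ?t}. 2 powr (- (s * (\<alpha> n * real l + max (t - \<eta> n * real l) 0))))"
          using fL by (subst sum.union_disjoint[symmetric]) (auto intro: sum.cong)
        also have "\<dots> \<le> (\<Sum>l\<in>{l\<in>?L. \<eta> 0 * real l \<le> ?t}. 2 powr (- (s * ?t))) + (\<Sum>l\<in>{l\<in>?L. \<not> \<eta> 0 * real l \<le> ?t}. 2 powr (- (s * (\<eta> 0 * real l))))"
          unfolding c
        proof (intro add_mono sum_mono powr_mono)
          fix l
          have nn: "0 \<le> \<eta> 0 * real l" using \<eta>0 by simp
          show "- (s * (\<eta> 0 * real l + max (t - \<eta> 0 * real l) 0)) \<le> - (s * ?t)"
            using s nn by (auto simp: mult_le_cancel_left_pos)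
          show "- (s * (\<eta> 0 * real l + max (t - \<eta> 0 * real l) 0)) \<le> - (s * (\<eta> 0 * real l))"
            using s by (auto simp: mult_le_cancel_left_pos)
        qed auto
        finally show ?thesis .
      qed
      also have "(\<Sum>l\<in>{l\<in>?L. \<not> \<eta> 0 * real l \<le> ?t}. 2 powr (- (s * (\<eta> 0 * real l)))) \<le> 2 powr (- (s * ?t)) * (1 / (1 - 2 powr (- (s * \<eta> 0))))"
        using s \<eta>0 fL by (intro sum_powr_tail_le) auto
      also have "(\<Sum>l\<in>{l\<in>?L. \<eta> 0 * real l \<le> ?t}. 2 powr (- (s * ?t))) \<le> 2 powr (- (s * ?t)) * (?t / \<eta> 0 + 1)"
      proof -
        have "{l\<in>?L. \<eta> 0 * real l \<le> ?t} \<subseteq> {..nat \<lfloor>?t / \<eta> 0\<rfloor>}"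
        proof
          fix l assume "l \<in> {l\<in>?L. \<eta> 0 * real l \<le> ?t}"
          then have "real l \<le> ?t / \<eta> 0" using \<eta>0 by (simp add: field_simps)
          then show "l \<in> {..nat \<lfloor>?t / \<eta> 0\<rfloor>}" by (simp add: le_nat_floor)
        qed
        then have "card {l\<in>?L. \<eta> 0 * real l \<le> ?t} \<le> Suc (nat \<lfloor>?t / \<eta> 0\<rfloor>)"
          using card_mono[of "{..nat \<lfloor>?t / \<eta> 0\<rfloor>}"] by force
        moreover have "0 \<le> ?t / \<eta> 0" using \<eta>0 by simp
        ultimately have "real (card {l\<in>?L. \<eta> 0 * real l \<le> ?t}) \<le> ?t / \<eta> 0 + 1" by linarith
        then show ?thesis by (simp add: mult.commute)
      qed
      finally have "(\<Sum>l\<in>?L. 2 powr (- (s * (\<alpha> n * real l + max (t - \<eta> n * real l) 0)))) \<le>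
          2 powr (- (s * ?t)) * (?t / \<eta> 0 + 1) + 2 powr (- (s * ?t)) * (1 / (1 - 2 powr (- (s * \<eta> 0))))" by simp
      also have "\<dots> \<le> 2 powr (- (s * ?t)) * (G * (1 + ?t))"
      proof -
        have "?t / \<eta> 0 + 1 + 1 / (1 - 2 powr (- (s * \<eta> 0))) \<le> G * (1 + ?t)"
        proof -
          have "1 / \<eta> 0 * ?t \<le> G * ?t"
            unfolding G_def using \<open>0 < 1 / (1 - 2 powr (- (s * \<eta> 0)))\<close> by (intro mult_right_mono) auto
          moreover have "1 + 1 / (1 - 2 powr (- (s * \<eta> 0))) \<le> G" unfolding G_def using \<eta>0 by simp
          ultimately show ?thesis by (simp add: distrib_left)
        qed
        then have "2 powr (- (s * ?t)) * (?t / \<eta> 0 + 1 + 1 / (1 - 2 powr (- (s * \<eta> 0)))) \<le> 2 powr (- (s * ?t)) * (G * (1 + ?t))"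
          by (intro mult_left_mono) auto
        then show ?thesis by (simp only: distrib_left)
      qed
      finally have "C * (1 + ?t) ^ (min n \<mu> - 1) * (\<Sum>l\<in>?L. 2 powr (- (s * (\<alpha> n * real l + max (t - \<eta> n * real l) 0))))
          \<le> C * (1 + ?t) ^ (min n \<mu> - 1) * (2 powr (- (s * ?t)) * (G * (1 + ?t)))"
        using C(1) by (intro mult_left_mono) auto
      also have "\<dots> = C * G * 2 powr (- (s * ?t)) * (1 + ?t) ^ (min (Suc n) \<mu> - 1)"
        unfolding ex[symmetric] by simp
      finally show "(\<Sum>j\<in>J. 2 powr (- (s * (\<Sum>i<Suc n. \<alpha> i * real (j i))))) \<le> C * G * 2 powr (- (s * ?t)) * (1 + ?t) ^ (min (Suc n) \<mu> - 1)"
        using step[OF _ _ _ J(1,2), of t] J(3) by (meson order_trans)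
    qed (use C G in auto)
  next
    case False
    then have nc: "0 < \<eta> n" "\<eta> n < \<alpha> n" using noncrit[of n] Suc.prems by auto
    define G where "G = 1 / (1 - 2 powr (- (s * (\<alpha> n - \<eta> n))))"
    have G: "0 < G" unfolding G_def using s nc by (auto simp: powr_less_one)
    have ex: "min (Suc n) \<mu> = min n \<mu>" using False by simp
    show ?thesis
    proof (intro exI[of _ "C * G"] conjI allI impI)
      fix t J assume J: "finite J" "J \<subseteq> idx (Suc n)" "\<forall>j\<in>J. t < (\<Sum>i<Suc n. \<eta> i * real (j i))"
      let ?L = "(\<lambda>j. j n) ` J" and ?t = "max t 0"
      have fL: "finite ?L" using J by simp
      have "(\<Sum>l\<in>?L. 2 powr (- (s * (\<alpha> n * real l + max (t - \<eta> n * real l) 0)))) \<le>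
          (\<Sum>l\<in>?L. 2 powr (- (s * ?t)) * 2 powr (- (s * ((\<alpha> n - \<eta> n) * real l))))"
      proof (rule sum_mono)
        fix l
        have "0 \<le> \<eta> n * real l" using nc by simp
        then have "?t + (\<alpha> n - \<eta> n) * real l \<le> \<alpha> n * real l + max (t - \<eta> n * real l) 0"
          by (auto simp: max_def left_diff_distrib)
        then have "s * (?t + (\<alpha> n - \<eta> n) * real l) \<le> s * (\<alpha> n * real l + max (t - \<eta> n * real l) 0)"
          using s by (intro mult_left_mono) auto
        then have "2 powr (- (s * (\<alpha> n * real l + max (t - \<eta> n * real l) 0))) \<le> 2 powr (- (s * (?t + (\<alpha> n - \<eta> n) * real l)))"
          by (intro powr_mono) auto
        then show "2 powr (- (s * (\<alpha> n * real l + max (t - \<eta> n * real l) 0))) \<le> 2 powr (- (s * ?t)) * 2 powr (- (s * ((\<alpha> n - \<eta> n) * real l)))"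
          by (simp add: powr_add[symmetric] distrib_left)
      qed
      also have "\<dots> \<le> 2 powr (- (s * ?t)) * G"
        unfolding sum_distrib_left[symmetric]
      proof (rule mult_left_mono)
        have "(\<Sum>l\<in>?L. 2 powr (- (s * ((\<alpha> n - \<eta> n) * real l)))) \<le> 2 powr (- (s * 0)) * G"
          unfolding G_def using s nc fL by (intro sum_powr_tail_le) auto
        then show "(\<Sum>l\<in>?L. 2 powr (- (s * ((\<alpha> n - \<eta> n) * real l)))) \<le> G" by simp
      qed simp
      finally have "C * (1 + ?t) ^ (min n \<mu> - 1) * (\<Sum>l\<in>?L. 2 powr (- (s * (\<alpha> n * real l + max (t - \<eta> n * real l) 0))))
          \<le> C * (1 + ?t) ^ (min n \<mu> - 1) * (2 powr (- (s * ?t)) * G)"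
        using C(1) by (intro mult_left_mono) auto
      also have "\<dots> = C * G * 2 powr (- (s * ?t)) * (1 + ?t) ^ (min (Suc n) \<mu> - 1)"
        unfolding ex by simp
      finally show "(\<Sum>j\<in>J. 2 powr (- (s * (\<Sum>i<Suc n. \<alpha> i * real (j i))))) \<le> C * G * 2 powr (- (s * ?t)) * (1 + ?t) ^ (min (Suc n) \<mu> - 1)"
        using step[OF _ _ _ J(1,2), of t] J(3) by (meson order_trans)
    qed (use C G in auto)
  qed
qed


lemma hyperbolic_sum_outside:
  fixes \<alpha> \<eta> :: "nat \<Rightarrow> real" and s :: real and \<mu> :: nat
  assumes s: "0 < s" and \<mu>: "1 \<le> \<mu>" "\<mu> \<le> d" and \<eta>0: "0 < \<eta> 0"
    and crit: "\<And>i. i < \<mu> \<Longrightarrow> \<alpha> i = \<eta> 0 \<and> \<eta> i = \<eta> 0"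
    and noncrit: "\<And>i. \<mu> \<le> i \<Longrightarrow> i < d \<Longrightarrow> 0 < \<eta> i \<and> \<eta> i < \<alpha> i"
  shows "\<exists>C>0. \<forall>m\<ge>1. \<forall>J. finite J \<longrightarrow> J \<subseteq> idx d \<longrightarrow> (\<forall>j\<in>J. \<eta> 0 * real m < (\<Sum>i<d. \<eta> i * real (j i))) \<longrightarrow>
      (\<Sum>j\<in>J. (2 powr (- (\<Sum>i<d. \<alpha> i * real (j i)))) powr s) \<le> C * (2 powr (- (real m * \<eta> 0))) powr s * real m powr (real \<mu> - 1)"
proof -
  obtain C where C: "C > 0" "\<And>t J. finite J \<Longrightarrow> J \<subseteq> idx d \<Longrightarrow> (\<forall>j\<in>J. t < (\<Sum>i<d. \<eta> i * real (j i))) \<Longrightarrow>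
      (\<Sum>j\<in>J. 2 powr (- (s * (\<Sum>i<d. \<alpha> i * real (j i))))) \<le> C * 2 powr (- (s * max t 0)) * (1 + max t 0) ^ (min d \<mu> - 1)"
    using hyperbolic_sum[where \<alpha> = \<alpha> and \<eta> = \<eta> and d = d and \<mu> = \<mu> and n = d, OF s \<mu>(1) \<eta>0 crit noncrit] \<mu> by auto
  show ?thesis
  proof (intro exI[of _ "C * (1 + \<eta> 0) ^ (\<mu> - 1)"] conjI allI impI)
    fix m :: nat and J assume m: "1 \<le> m" and J: "finite J" "J \<subseteq> idx d" "\<forall>j\<in>J. \<eta> 0 * real m < (\<Sum>i<d. \<eta> i * real (j i))"
    have mx: "max (\<eta> 0 * real m) 0 = \<eta> 0 * real m" using \<eta>0 by (intro max_absorb1 mult_nonneg_nonneg) auto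
    have "(\<Sum>j\<in>J. (2 powr (- (\<Sum>i<d. \<alpha> i * real (j i)))) powr s) = (\<Sum>j\<in>J. 2 powr (- (s * (\<Sum>i<d. \<alpha> i * real (j i)))))"
      by (simp add: powr_powr mult.commute)
    also have "\<dots> \<le> C * 2 powr (- (s * (\<eta> 0 * real m))) * (1 + \<eta> 0 * real m) ^ (\<mu> - 1)"
      using C(2)[OF J] \<mu>(2) unfolding mx by (simp add: min_def split: if_splits)
    \<comment> \<open>Since \<open>m >= 1\<close>, the summand 1 is absorbed into a multiple of
      \<open>m\<close>.\<close>
    also have "\<dots> \<le> C * 2 powr (- (s * (\<eta> 0 * real m))) * ((1 + \<eta> 0) * real m) ^ (\<mu> - 1)"
      using C(1) m \<eta>0 by (intro mult_left_mono power_mono) (auto simp: distrib_right)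
    also have "\<dots> = C * (1 + \<eta> 0) ^ (\<mu> - 1) * (2 powr (- (real m * \<eta> 0))) powr s * real m powr (real \<mu> - 1)"
      using m \<mu>(1) by (simp add: power_mult_distrib powr_powr powr_realpow[symmetric] of_nat_diff mult_ac)
    finally show "(\<Sum>j\<in>J. (2 powr (- (\<Sum>i<d. \<alpha> i * real (j i)))) powr s) \<le>
        C * (1 + \<eta> 0) ^ (\<mu> - 1) * (2 powr (- (real m * \<eta> 0))) powr s * real m powr (real \<mu> - 1)" .
  qed (use C \<eta>0 in auto)
qed

section \<open>Double sums over pairs of levels\<close>

lemma sum_geometric_above:
  fixes \<rho> :: real
  assumes "0 \<le> \<rho>" "\<rho> < 1"
  shows "(\<Sum>n\<le>N. if a \<le> n + c then \<rho> ^ (n + c - a) else 0) \<le> 1 / (1 - \<rho>)"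
    and "(\<Sum>n\<le>N. if n \<le> a then \<rho> ^ (a - n) else 0) \<le> 1 / (1 - \<rho>)"
proof -
  have "(\<Sum>n\<le>N. if a \<le> n + c then \<rho> ^ (n + c - a) else 0) = (\<Sum>n\<in>{n\<in>{..N}. a \<le> n + c}. \<rho> ^ (n + c - a))"
    by (intro sum.inter_filter[symmetric]) simp
  also have "\<dots> \<le> 1 / (1 - \<rho>)" using assms by (intro sum_geometric_inj) (auto simp: inj_on_def)
  finally show "(\<Sum>n\<le>N. if a \<le> n + c then \<rho> ^ (n + c - a) else 0) \<le> 1 / (1 - \<rho>)" .
  have "(\<Sum>n\<le>N. if n \<le> a then \<rho> ^ (a - n) else 0) = (\<Sum>n\<in>{n\<in>{..N}. n \<le> a}. \<rho> ^ (a - n))"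
    by (intro sum.inter_filter[symmetric]) simp
  also have "\<dots> \<le> 1 / (1 - \<rho>)" using assms by (intro sum_geometric_inj) (auto simp: inj_on_def)
  finally show "(\<Sum>n\<le>N. if n \<le> a then \<rho> ^ (a - n) else 0) \<le> 1 / (1 - \<rho>)" .
qed

text \<open>The coupling between sampling level \<open>j\<close> and block level \<open>k\<close>:
  zero as soon as some \<open>j i > k i + c\<close>, where \<open>q_j D_k\<close> vanishes, and
  otherwise geometric in the distance. Its sum over either index is bounded uniformly in the other,
  as in Schur's test.\<close>

definition geo_weight :: "nat \<Rightarrow> nat \<Rightarrow> real \<Rightarrow> (nat \<Rightarrow> nat) \<Rightarrow> (nat \<Rightarrow> nat) \<Rightarrow> real" where
  "geo_weight d c \<rho> j k = (\<Prod>i<d. if j i \<le> k i + c then \<rho> ^ (k i + c - j i) else 0)"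

lemma geo_weight_nonneg: "0 \<le> \<rho> \<Longrightarrow> 0 \<le> geo_weight d c \<rho> j k"
  unfolding geo_weight_def by (intro prod_nonneg) auto

lemma geo_weight_powr:
  assumes "0 < \<rho>"
  shows "geo_weight d c \<rho> j k powr x = geo_weight d c (\<rho> powr x) j k"
  unfolding geo_weight_def prod_powr_distrib
proof (rule prod.cong[OF refl])
  fix i
  show "(if j i \<le> k i + c then \<rho> ^ (k i + c - j i) else 0) powr x = (if j i \<le> k i + c then (\<rho> powr x) ^ (k i + c - j i) else 0)"
    using assms by (simp add: powr_realpow[symmetric] powr_powr mult.commute)
qed

lemma geo_weight_sums:
  assumes "0 \<le> \<rho>" "\<rho> < 1" "finite J" "J \<subseteq> idx d"
  shows "(\<Sum>k\<in>J. geo_weight d c \<rho> j k) \<le> (1 / (1 - \<rho>)) ^ d" and "(\<Sum>j\<in>J. geo_weight d c \<rho> j k) \<le> (1 / (1 - \<rho>)) ^ d"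
proof -
  have "(\<Sum>k\<in>J. geo_weight d c \<rho> j k) \<le> (\<Prod>i<d. 1 / (1 - \<rho>))"
    unfolding geo_weight_def
    by (rule sum_idx_prod_le[OF assms(3,4), where h = "\<lambda>i n. if j i \<le> n + c then \<rho> ^ (n + c - j i) else 0"])
       (use assms sum_geometric_above in auto)
  then show "(\<Sum>k\<in>J. geo_weight d c \<rho> j k) \<le> (1 / (1 - \<rho>)) ^ d" by simp
  have "(\<Sum>j\<in>J. geo_weight d c \<rho> j k) \<le> (\<Prod>i<d. 1 / (1 - \<rho>))"
    unfolding geo_weight_def
    by (rule sum_idx_prod_le[OF assms(3,4), where h = "\<lambda>i n. if n \<le> k i + c then \<rho> ^ (k i + c - n) else 0"])
       (use assms sum_geometric_above in auto)
  then show "(\<Sum>j\<in>J. geo_weight d c \<rho> j k) \<le> (1 / (1 - \<rho>)) ^ d" by simp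
qed

lemma Hoelder_sum2:
  fixes f g :: "'a \<Rightarrow> real"
  assumes "finite U" "0 < a" "0 < b" "a + b = 1" "\<And>x. 0 \<le> f x" "\<And>x. 0 \<le> g x"
  shows "(\<Sum>x\<in>U. f x powr a * g x powr b) \<le> (\<Sum>x\<in>U. f x) powr a * (\<Sum>x\<in>U. g x) powr b"
  using Hoelder_sum[of "{True, False}" "\<lambda>t. if t then a else b" "\<lambda>t. if t then f else g" U] assms by simp

text \<open>\<open>N\<close> stands for the Besov norm and \<open>B\<close> for the sequence of its building blocks.\<close>

lemma besov_double_sum:
  fixes \<alpha> \<eta> :: "nat \<Rightarrow> real" and q \<rho> :: real and \<mu> :: nat and \<theta> :: ereal
  assumes q: "0 < q" and \<theta>: "0 < \<theta>" and \<rho>: "0 < \<rho>" "\<rho> < 1" and \<mu>: "1 \<le> \<mu>" "\<mu> \<le> d" and \<eta>0: "0 < \<eta> 0"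
    and crit: "\<And>i. i < \<mu> \<Longrightarrow> \<alpha> i = \<eta> 0 \<and> \<eta> i = \<eta> 0"
    and noncrit: "\<And>i. \<mu> \<le> i \<Longrightarrow> i < d \<Longrightarrow> 0 < \<eta> i \<and> \<eta> i < \<alpha> i"
  shows "\<exists>C>0. \<forall>m\<ge>1. \<forall>J K B N. finite J \<longrightarrow> J \<subseteq> idx d \<longrightarrow> (\<forall>j\<in>J. \<eta> 0 * real m < (\<Sum>i<d. \<eta> i * real (j i))) \<longrightarrow>
      finite K \<longrightarrow> K \<subseteq> idx d \<longrightarrow> (\<forall>k. 0 \<le> B k) \<longrightarrow> 0 \<le> N \<longrightarrow>
      (if \<theta> = \<infinity> then \<forall>k\<in>K. B k \<le> N else (\<Sum>k\<in>K. B k powr real_of_ereal \<theta>) \<le> N powr real_of_ereal \<theta>) \<longrightarrow>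
      (\<Sum>j\<in>J. \<Sum>k\<in>K. (geo_weight d c \<rho> j k * 2 powr (- (\<Sum>i<d. \<alpha> i * real (j i))) * B k) powr q) \<le>
        C * (2 powr (- (real m * \<eta> 0)) * real m powr ((real \<mu> - 1) * max (1 / q - inv_theta \<theta>) 0) * N) powr q"
proof -
  define A where "A = (\<lambda>j::nat \<Rightarrow> nat. 2 powr (- (\<Sum>i<d. \<alpha> i * real (j i))))"
  have A0: "0 < A j" for j by (simp add: A_def)
  define w where "w = geo_weight d c (\<rho> powr q)"
  have \<rho>q: "0 \<le> \<rho> powr q" "\<rho> powr q < 1" using \<rho> q by (auto simp: powr01_less_one)
  have w0: "0 \<le> w j k" for j k unfolding w_def by (rule geo_weight_nonneg) simp
  define H where "H = (1 / (1 - \<rho> powr q)) ^ d"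
  have H: "0 < H" unfolding H_def using \<rho>q by simp
  have wk: "(\<Sum>k\<in>J. w j k) \<le> H" and wj: "(\<Sum>j\<in>J. w j k) \<le> H" if "finite J" "J \<subseteq> idx d" for J j k
    unfolding w_def H_def using geo_weight_sums[OF \<rho>q that] by auto
  have term_eq: "(geo_weight d c \<rho> j k * A j * B) powr q = w j k * A j powr q * B powr q" for j k B
    unfolding w_def by (simp add: powr_mult geo_weight_powr \<rho>)
  show ?thesis
  proof (cases "\<theta> \<noteq> \<infinity> \<and> real_of_ereal \<theta> \<le> q")
    case True
    \<comment> \<open>For \<open>\<theta> <= q\<close> the weights \<open>A j\<close> are replaced
      by their bound outside the layer, the coupling is summed over \<open>j\<close>, and
      \<open>l_\<theta>\<close> embeds into \<open>l_q\<close>. No counting of indices takes place,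
      hence no power of \<open>m\<close>.\<close>
    define t where "t = real_of_ereal \<theta>"
    have t: "0 < t" "t \<le> q" using True \<theta> unfolding t_def by (auto simp: zero_less_real_of_ereal)
    have mx: "max (1 / q - inv_theta \<theta>) 0 = 0"
      using True t q by (auto simp: inv_theta_def t_def field_simps max_def)
    show ?thesis
    proof (intro exI[of _ H] conjI H allI impI)
      fix m :: nat and J K and B :: "(nat \<Rightarrow> nat) \<Rightarrow> real" and N
      assume m: "1 \<le> m" and J: "finite J" "J \<subseteq> idx d" "\<forall>j\<in>J. \<eta> 0 * real m < (\<Sum>i<d. \<eta> i * real (j i))"
        and K: "finite K" "K \<subseteq> idx d" and B: "\<forall>k. 0 \<le> B k" and N: "0 \<le> N"
        and BN: "if \<theta> = \<infinity> then \<forall>k\<in>K. B k \<le> N else (\<Sum>k\<in>K. B k powr real_of_ereal \<theta>) \<le> N powr real_of_ereal \<theta>"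
      have Aj: "A j \<le> 2 powr (- (real m * \<eta> 0))" if j: "j \<in> J" for j
      proof -
        have "(\<Sum>i<d. \<eta> i * real (j i)) \<le> (\<Sum>i<d. \<alpha> i * real (j i))"
        proof (intro sum_mono mult_right_mono)
          fix i assume "i \<in> {..<d}"
          then show "\<eta> i \<le> \<alpha> i" using crit[of i] noncrit[of i] by (cases "i < \<mu>") auto
        qed simp
        then have "real m * \<eta> 0 \<le> (\<Sum>i<d. \<alpha> i * real (j i))"
          using J(3)[rule_format, OF j] by (simp add: mult.commute[of "real m"])
        then show ?thesis unfolding A_def by (intro powr_mono) auto
      qed
      have "(\<Sum>j\<in>J. \<Sum>k\<in>K. (geo_weight d c \<rho> j k * A j * B k) powr q) \<le> (\<Sum>j\<in>J. \<Sum>k\<in>K. w j k * (2 powr (- (real m * \<eta> 0))) powr q * B k powr q)"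
        unfolding term_eq using Aj A0 w0 q by (intro sum_mono mult_right_mono mult_left_mono powr_mono2) (auto simp: less_imp_le)
      also have "\<dots> = (2 powr (- (real m * \<eta> 0))) powr q * (\<Sum>k\<in>K. B k powr q * (\<Sum>j\<in>J. w j k))"
        by (subst sum.swap) (simp add: sum_distrib_left sum_distrib_right mult_ac)
      also have "\<dots> \<le> (2 powr (- (real m * \<eta> 0))) powr q * (\<Sum>k\<in>K. B k powr q * H)"
        using wj[OF J(1,2)] by (intro mult_left_mono sum_mono) auto
      also have "\<dots> = (2 powr (- (real m * \<eta> 0))) powr q * H * (\<Sum>k\<in>K. (B k powr t) powr (q / t))"
        using t by (simp add: sum_distrib_left powr_powr mult_ac)
      also have "\<dots> \<le> (2 powr (- (real m * \<eta> 0))) powr q * H * (\<Sum>k\<in>K. B k powr t) powr (q / t)"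
        using t H by (intro mult_left_mono sum_powr_le_powr_sum K) auto
      also have "\<dots> \<le> (2 powr (- (real m * \<eta> 0))) powr q * H * (N powr t) powr (q / t)"
        using t H BN True by (intro mult_left_mono powr_mono2 sum_nonneg) (auto simp: t_def)
      also have "\<dots> = H * (2 powr (- (real m * \<eta> 0)) * real m powr ((real \<mu> - 1) * max (1 / q - inv_theta \<theta>) 0) * N) powr q"
        unfolding mx using t m N by (simp add: powr_powr powr_mult)
      finally show "(\<Sum>j\<in>J. \<Sum>k\<in>K. (geo_weight d c \<rho> j k * 2 powr (- (\<Sum>i<d. \<alpha> i * real (j i))) * B k) powr q) \<le>
        H * (2 powr (- (real m * \<eta> 0)) * real m powr ((real \<mu> - 1) * max (1 / q - inv_theta \<theta>) 0) * N) powr q"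
        unfolding A_def .
    qed
  next
    case big: False
    \<comment> \<open>The Hoelder exponents are \<open>s / q\<close> and
      \<open>\<theta> / q\<close>, where \<open>1 / s = 1 / q - 1 / \<theta>\<close>, and
      \<open>s = q\<close> if \<open>\<theta>\<close> is infinite. The count of critical indices
      enters with power \<open>1 / s = e\<close>, which is the exponent of the logarithmic
      factor.\<close>
    define e where "e = 1 / q - inv_theta \<theta>"
    have e: "0 < e"
    proof (cases "\<theta> = \<infinity>")
      case False
      then have "q < real_of_ereal \<theta>" using big by simp
      then show ?thesis using False q unfolding e_def inv_theta_def by (simp add: field_simps)
    qed (use q in \<open>simp add: e_def inv_theta_def\<close>)
    define s where "s = 1 / e"
    have s: "0 < s" using e by (simp add: s_def)
    have "\<exists>C>0. \<forall>m\<ge>1. \<forall>J. finite J \<longrightarrow> J \<subseteq> idx d \<longrightarrow> (\<forall>j\<in>J. \<eta> 0 * real m < (\<Sum>i<d. \<eta> i * real (j i))) \<longrightarrow>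
        (\<Sum>j\<in>J. A j powr s) \<le> C * (2 powr (- (real m * \<eta> 0))) powr s * real m powr (real \<mu> - 1)"
      unfolding A_def by (rule hyperbolic_sum_outside[where \<alpha> = \<alpha> and \<eta> = \<eta> and d = d and \<mu> = \<mu>, OF s \<mu> \<eta>0 crit noncrit])
    then obtain C where C: "C > 0" "\<forall>m\<ge>1. \<forall>J. finite J \<longrightarrow> J \<subseteq> idx d \<longrightarrow> (\<forall>j\<in>J. \<eta> 0 * real m < (\<Sum>i<d. \<eta> i * real (j i))) \<longrightarrow>
        (\<Sum>j\<in>J. A j powr s) \<le> C * (2 powr (- (real m * \<eta> 0))) powr s * real m powr (real \<mu> - 1)"
      by (elim exE conjE) (rule that)
    have mx: "max (1 / q - inv_theta \<theta>) 0 = e" using e by (simp add: e_def)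
    define D where "D = (H * C) powr (q / s) * H powr (q * inv_theta \<theta>)"
    show ?thesis
    proof (intro exI[of _ D] conjI allI impI)
      show "0 < D" unfolding D_def using H C by simp
      fix m :: nat and J K and B :: "(nat \<Rightarrow> nat) \<Rightarrow> real" and N
      assume m: "1 \<le> m" and J: "finite J" "J \<subseteq> idx d" "\<forall>j\<in>J. \<eta> 0 * real m < (\<Sum>i<d. \<eta> i * real (j i))"
        and K: "finite K" "K \<subseteq> idx d" and B: "\<forall>k. 0 \<le> B k" and N: "0 \<le> N"
        and BN: "if \<theta> = \<infinity> then \<forall>k\<in>K. B k \<le> N else (\<Sum>k\<in>K. B k powr real_of_ereal \<theta>) \<le> N powr real_of_ereal \<theta>"
      define X where "X = C * (2 powr (- (real m * \<eta> 0))) powr s * real m powr (real \<mu> - 1)"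
      have X: "(\<Sum>j\<in>J. A j powr s) \<le> X" unfolding X_def using C(2) m J by blast
      have X0: "0 \<le> X" unfolding X_def using C by simp
      have SA: "(\<Sum>j\<in>J. \<Sum>k\<in>K. w j k * A j powr s) \<le> H * X"
      proof -
        have "(\<Sum>j\<in>J. \<Sum>k\<in>K. w j k * A j powr s) = (\<Sum>j\<in>J. (\<Sum>k\<in>K. w j k) * A j powr s)"
          by (simp add: sum_distrib_right)
        also have "\<dots> \<le> (\<Sum>j\<in>J. H * A j powr s)" using wk[OF K] by (intro sum_mono mult_right_mono) auto
        also have "\<dots> \<le> H * X" unfolding sum_distrib_left[symmetric] using X H by (intro mult_left_mono) auto
        finally show ?thesis .
      qed
      have main: "(\<Sum>j\<in>J. \<Sum>k\<in>K. w j k * A j powr q * B k powr q) \<le> (H * X) powr (q / s) * (H powr (q * inv_theta \<theta>) * N powr q)"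
      proof (cases "\<theta> = \<infinity>")
        case True
        then have sq: "s = q" using q by (simp add: s_def e_def inv_theta_def)
        have "(\<Sum>j\<in>J. \<Sum>k\<in>K. w j k * A j powr q * B k powr q) \<le> (\<Sum>j\<in>J. \<Sum>k\<in>K. w j k * A j powr q * N powr q)"
          using BN True B w0 q by (intro sum_mono mult_left_mono powr_mono2) auto
        also have "\<dots> = (\<Sum>j\<in>J. \<Sum>k\<in>K. w j k * A j powr s) * N powr q" by (simp add: sum_distrib_right sq)
        also have "\<dots> \<le> H * X * N powr q" using SA by (intro mult_right_mono) auto
        finally show ?thesis using True q H X0 by (simp add: sq inv_theta_def)
      next
        case False
        define t where "t = real_of_ereal \<theta>"
        have t: "q < t" "0 < t" using big False q unfolding t_def by auto
        have it: "inv_theta \<theta> = 1 / t" using False by (simp add: inv_theta_def t_def)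
        have ab: "0 < q / s" "0 < q / t" "q / s + q / t = 1"
        proof -
          show "0 < q / s" "0 < q / t" using q s t by auto
          have "q / s = q * (1 / q - 1 / t)" by (simp add: s_def e_def it)
          then show "q / s + q / t = 1" using q by (simp add: right_diff_distrib)
        qed
        \<comment> \<open>The coupling \<open>w\<close> is distributed over both factors according
          to the Hoelder weights, so that the first can be summed over \<open>k\<close> and the
          second over \<open>j\<close>.\<close>
        have split: "w j k * A j powr q * B k powr q = (w j k * A j powr s) powr (q / s) * (w j k * B k powr t) powr (q / t)" for j k
        proof -
          have "(w j k * A j powr s) powr (q / s) * (w j k * B k powr t) powr (q / t) =
              (w j k powr (q / s) * w j k powr (q / t)) * A j powr q * B k powr q"
            using s t by (simp add: powr_mult powr_powr mult_ac)
          also have "w j k powr (q / s) * w j k powr (q / t) = w j k"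
            unfolding powr_add[symmetric] ab(3) using w0 by simp
          finally show ?thesis by simp
        qed
        have "(\<Sum>j\<in>J. \<Sum>k\<in>K. w j k * A j powr q * B k powr q) =
            (\<Sum>(j, k)\<in>J \<times> K. (w j k * A j powr s) powr (q / s) * (w j k * B k powr t) powr (q / t))"
          unfolding split by (rule sum.cartesian_product)
        also have "\<dots> \<le> (\<Sum>(j, k)\<in>J \<times> K. w j k * A j powr s) powr (q / s) * (\<Sum>(j, k)\<in>J \<times> K. w j k * B k powr t) powr (q / t)"
          using Hoelder_sum2[of "J \<times> K" "q / s" "q / t" "\<lambda>(j, k). w j k * A j powr s" "\<lambda>(j, k). w j k * B k powr t"] J K ab w0
          by (simp add: case_prod_beta)
        also have "\<dots> \<le> (H * X) powr (q / s) * (H * N powr t) powr (q / t)"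
        proof (intro mult_mono powr_mono2)
          show "(\<Sum>(j, k)\<in>J \<times> K. w j k * A j powr s) \<le> H * X"
            using SA by (simp add: sum.cartesian_product)
          have "(\<Sum>(j, k)\<in>J \<times> K. w j k * B k powr t) = (\<Sum>k\<in>K. (\<Sum>j\<in>J. w j k) * B k powr t)"
            unfolding sum.cartesian_product[symmetric] by (subst sum.swap) (simp add: sum_distrib_right)
          also have "\<dots> \<le> (\<Sum>k\<in>K. H * B k powr t)" using wj[OF J(1,2)] by (intro sum_mono mult_right_mono) auto
          also have "\<dots> \<le> H * N powr t"
            unfolding sum_distrib_left[symmetric] using BN False H by (intro mult_left_mono) (auto simp: t_def)
          finally show "(\<Sum>(j, k)\<in>J \<times> K. w j k * B k powr t) \<le> H * N powr t" .
        qed (use ab w0 in \<open>auto intro!: sum_nonneg\<close>)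
        also have "(H * N powr t) powr (q / t) = H powr (q * inv_theta \<theta>) * N powr q"
          using t by (simp add: powr_mult powr_powr it)
        finally show ?thesis .
      qed
      also have "\<dots> = D * (2 powr (- (real m * \<eta> 0)) * real m powr ((real \<mu> - 1) * max (1 / q - inv_theta \<theta>) 0) * N) powr q"
      proof -
        have "(H * X) powr (q / s) = (H * C) powr (q / s) * ((2 powr (- (real m * \<eta> 0))) powr q * (real m powr ((real \<mu> - 1) * e)) powr q)"
          unfolding X_def using s by (simp add: powr_mult powr_powr s_def mult_ac)
        then show ?thesis unfolding mx D_def by (simp add: powr_mult mult_ac)
      qed
      finally have "(\<Sum>j\<in>J. \<Sum>k\<in>K. (geo_weight d c \<rho> j k * A j * B k) powr q) \<le>
        D * (2 powr (- (real m * \<eta> 0)) * real m powr ((real \<mu> - 1) * max (1 / q - inv_theta \<theta>) 0) * N) powr q"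
        unfolding term_eq .
      then show "(\<Sum>j\<in>J. \<Sum>k\<in>K. (geo_weight d c \<rho> j k * 2 powr (- (\<Sum>i<d. \<alpha> i * real (j i))) * B k) powr q) \<le>
        D * (2 powr (- (real m * \<eta> 0)) * real m powr ((real \<mu> - 1) * max (1 / q - inv_theta \<theta>) 0) * N) powr q"
        unfolding A_def .
    qed
  qed
qed

subsection \<open>Exponential sums\<close>

lemma trig_poly_d_exp:
  assumes "\<And>\<kappa> i. \<kappa> \<in> S \<Longrightarrow> i < d \<Longrightarrow> \<bar>\<kappa> i\<bar> \<le> int (n i)"
  shows "trig_poly_d d n (\<lambda>x. \<Sum>\<kappa>\<in>S. a \<kappa> * (\<Prod>i<d. cis (of_int (\<kappa> i) * x i)))"
proof (intro trig_poly_d_sum trig_poly_d_cmult)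
  fix \<kappa> assume "\<kappa> \<in> S"
  then show "trig_poly_d d n (\<lambda>x. \<Prod>i<d. cis (of_int (\<kappa> i) * x i))"
    by (intro trig_poly_d_prod trig_poly_cis assms)
qed

lemma qop_exp:
  "qop L d j (\<lambda>x. \<Sum>\<kappa>\<in>S. a \<kappa> * (\<Prod>i<d. cis (of_int (\<kappa> i) * x i))) x =
    (\<Sum>\<kappa>\<in>S. a \<kappa> * (\<Prod>i<d. eta_op L (j i) (\<lambda>t. cis (of_int (\<kappa> i) * t)) (x i)))"
  unfolding qop_sum qop_cmult
  using qop_tensor[of L d j "\<lambda>i t. cis (of_int (\<kappa> i) * t)" x for \<kappa>] by simp

lemma qop_exp_trig_poly_d:
  assumes "1 \<le> L"
  shows "trig_poly_d d (\<lambda>i. 2 ^ j i) (qop L d j (\<lambda>x. \<Sum>\<kappa>\<in>S. a \<kappa> * (\<Prod>i<d. cis (of_int (\<kappa> i) * x i))))"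
  unfolding qop_exp[abs_def]
  by (intro trig_poly_d_sum trig_poly_d_cmult trig_poly_d_prod eta_op_cis_trig_poly assms)

lemma qop_exp_vanish:
  assumes L: "1 \<le> L" and i: "i < d" "1 \<le> j i" and k: "\<And>\<kappa>. \<kappa> \<in> S \<Longrightarrow> 2 ^ Suc L * \<bar>\<kappa> i\<bar> < 2 ^ j i"
  shows "qop L d j (\<lambda>x. \<Sum>\<kappa>\<in>S. a \<kappa> * (\<Prod>i<d. cis (of_int (\<kappa> i) * x i))) x = 0"
  unfolding qop_exp
proof (rule sum.neutral, rule ballI)
  fix \<kappa> assume "\<kappa> \<in> S"
  then have "eta_op L (j i) (\<lambda>t. cis (of_int (\<kappa> i) * t)) (x i) = 0"
    by (intro eta_op_cis_vanish L k i)
  then have "(\<Prod>i<d. eta_op L (j i) (\<lambda>t. cis (of_int (\<kappa> i) * t)) (x i)) = 0"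
    using i by (intro prod_zero) auto
  then show "a \<kappa> * (\<Prod>i<d. eta_op L (j i) (\<lambda>t. cis (of_int (\<kappa> i) * t)) (x i)) = 0" by simp
qed

definition idx_box :: "nat \<Rightarrow> nat \<Rightarrow> (nat \<Rightarrow> nat) set" where
  "idx_box d N = {j \<in> idx d. \<forall>i<d. j i \<le> N}"

lemma idx_box_bij: "bij_betw (\<lambda>u i. if i < d then u i else 0) (PiE {..<d} (\<lambda>_. {..N})) (idx_box d N)"
proof (rule bij_betw_byWitness[where f' = "\<lambda>j. restrict j {..<d}"])
  show "\<forall>u\<in>PiE {..<d} (\<lambda>_. {..N}). restrict (\<lambda>i. if i < d then u i else 0) {..<d} = u"
    by (auto simp: fun_eq_iff restrict_def PiE_def extensional_def)
  show "\<forall>j\<in>idx_box d N. (\<lambda>i. if i < d then restrict j {..<d} i else 0) = j"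
    by (auto simp: fun_eq_iff idx_box_def idx_def)
  show "(\<lambda>u i. if i < d then u i else 0) ` (PiE {..<d} (\<lambda>_. {..N})) \<subseteq> idx_box d N"
    by (auto simp: idx_box_def idx_def PiE_def Pi_def)
  show "(\<lambda>j. restrict j {..<d}) ` idx_box d N \<subseteq> PiE {..<d} (\<lambda>_. {..N})"
    by (intro image_subsetI) (simp add: restrict_PiE_iff idx_box_def)
qed

lemma finite_idx_box [simp]: "finite (idx_box d N)"
  using bij_betw_finite[OF idx_box_bij] finite_PiE[of "{..<d}" "\<lambda>_. {..N}"] by auto

lemma sum_idx_box_prod:
  fixes h :: "nat \<Rightarrow> nat \<Rightarrow> 'c::comm_semiring_1"
  shows "(\<Sum>j\<in>idx_box d N. \<Prod>i<d. h i (j i)) = (\<Prod>i<d. \<Sum>n\<le>N. h i n)"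
proof -
  have "(\<Prod>i<d. \<Sum>n\<le>N. h i n) = (\<Sum>u\<in>PiE {..<d} (\<lambda>_. {..N}). \<Prod>i<d. h i (u i))"
    by (intro prod_sum_PiE) auto
  also have "\<dots> = (\<Sum>u\<in>PiE {..<d} (\<lambda>_. {..N}). \<Prod>i<d. h i ((\<lambda>i. if i < d then u i else 0) i))"
    by (intro sum.cong prod.cong refl) auto
  also have "\<dots> = (\<Sum>j\<in>idx_box d N. \<Prod>i<d. h i (j i))"
    by (rule sum.reindex_bij_betw[OF idx_box_bij, where g = "\<lambda>j. \<Prod>i<d. h i (j i)"])
  finally show ?thesis ..
qed

text \<open>Summation over a box factorizes into one telescoping sum per coordinate. Each of them is
  an interpolation operator of level \<open>N\<close>, which reproduces the frequencies at
  hand.\<close>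

lemma qop_exp_complete:
  assumes L: "1 \<le> L" and k: "\<And>\<kappa> i. \<kappa> \<in> S \<Longrightarrow> i < d \<Longrightarrow> 2 ^ L * \<bar>\<kappa> i\<bar> < 2 ^ N"
  shows "(\<Sum>j\<in>idx_box d N. qop L d j (\<lambda>x. \<Sum>\<kappa>\<in>S. a \<kappa> * (\<Prod>i<d. cis (of_int (\<kappa> i) * x i))) x) =
    (\<Sum>\<kappa>\<in>S. a \<kappa> * (\<Prod>i<d. cis (of_int (\<kappa> i) * x i)))"
proof -
  have "(\<Sum>j\<in>idx_box d N. qop L d j (\<lambda>x. \<Sum>\<kappa>\<in>S. a \<kappa> * (\<Prod>i<d. cis (of_int (\<kappa> i) * x i))) x) =
    (\<Sum>\<kappa>\<in>S. a \<kappa> * (\<Sum>j\<in>idx_box d N. \<Prod>i<d. eta_op L (j i) (\<lambda>t. cis (of_int (\<kappa> i) * t)) (x i)))"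
    unfolding qop_exp by (subst sum.swap) (simp add: sum_distrib_left)
  also have "\<dots> = (\<Sum>\<kappa>\<in>S. a \<kappa> * (\<Prod>i<d. cis (of_int (\<kappa> i) * x i)))"
  proof (rule sum.cong[OF refl])
    fix \<kappa> assume \<kappa>: "\<kappa> \<in> S"
    have "(\<Sum>j\<in>idx_box d N. \<Prod>i<d. eta_op L (j i) (\<lambda>t. cis (of_int (\<kappa> i) * t)) (x i)) =
      (\<Prod>i<d. \<Sum>n\<le>N. eta_op L n (\<lambda>t. cis (of_int (\<kappa> i) * t)) (x i))"
      by (rule sum_idx_box_prod[where h = "\<lambda>i n. eta_op L n (\<lambda>t. cis (of_int (\<kappa> i) * t)) (x i)"])
    also have "\<dots> = (\<Prod>i<d. cis (of_int (\<kappa> i) * x i))"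
      unfolding sum_eta_op using k[OF \<kappa>] by (intro prod.cong refl) (simp add: Iop_cis_reproduce[OF L])
    finally show "a \<kappa> * (\<Sum>j\<in>idx_box d N. \<Prod>i<d. eta_op L (j i) (\<lambda>t. cis (of_int (\<kappa> i) * t)) (x i)) =
      a \<kappa> * (\<Prod>i<d. cis (of_int (\<kappa> i) * x i))" by simp
  qed
  finally show ?thesis .
qed

subsection \<open>The error estimate for polynomials\<close>

lemma geo_weight_eq:
  assumes "\<And>i. i < d \<Longrightarrow> j i \<le> k i + c"
  shows "geo_weight d c (2 powr a) j k = 2 powr (a * (\<Sum>i<d. real (k i) + real c - real (j i)))"
proof -
  have "geo_weight d c (2 powr a) j k = (\<Prod>i<d. 2 powr (a * (real (k i) + real c - real (j i))))"
    unfolding geo_weight_def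
  proof (intro prod.cong refl)
    fix i assume "i \<in> {..<d}"
    then have "j i \<le> k i + c" using assms by auto
    then show "(if j i \<le> k i + c then (2 powr a) ^ (k i + c - j i) else 0) = 2 powr (a * (real (k i) + real c - real (j i)))"
      by (simp add: powr_realpow[symmetric] powr_powr of_nat_diff)
  qed
  then show ?thesis by (simp add: powr_sum[symmetric] sum_distrib_left)
qed

text \<open>Bookkeeping of the powers of two that arise for a single pair of levels in the estimate of the error.\<close>

lemma core_exponents:
  fixes r :: "nat \<Rightarrow> real" and j k :: "nat \<Rightarrow> nat" and p q P \<beta> :: real and c :: nat
  assumes \<beta>: "\<And>i. i < d \<Longrightarrow> \<beta> \<le> r i - 1 / p" and jk: "\<And>i. i < d \<Longrightarrow> j i \<le> k i + c"
    and P: "0 < P" and q: "0 < q"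
  defines "M \<equiv> \<Sum>i<d. real (k i) + real c - real (j i)" and "\<delta> \<equiv> \<beta> / (2 * (1 + 1 / P))"
  shows "(q / P - 1) * (\<Sum>i<d. real (j i)) + q / P * (\<delta> * (P + 1) * M - (\<Sum>i<d. real (j i)) + P / p * (\<Sum>i<d. real (c + k i)))
    \<le> q * (- (\<beta> / 2) * M - (\<Sum>i<d. (r i - 1 / p + 1 / q) * real (j i)) + (\<Sum>i<d. r i * real (k i))) +
      q * (\<Sum>i<d. (r i - 1 / p) * real c + real c / p)"
proof -
  \<comment> \<open>The weights are used once with power \<open>P\<close> and once with power 1
    before the outer power \<open>q / P\<close> is taken; the choice of \<open>\<delta>\<close>
    makes this total loss exactly half of the margin \<open>\<beta>\<close>.\<close>
  have \<delta>: "\<delta> * (P + 1) = P * (\<beta> / 2)" unfolding \<delta>_def using P by (simp add: field_simps)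
  have main: "\<beta> * M \<le> (\<Sum>i<d. (r i - 1 / p) * (real (k i) + real c - real (j i)))"
    unfolding M_def sum_distrib_left
  proof (intro sum_mono mult_right_mono)
    fix i assume "i \<in> {..<d}"
    then show "\<beta> \<le> r i - 1 / p" "0 \<le> real (k i) + real c - real (j i)" using \<beta> jk[of i] by auto
  qed
  define SJ where "SJ = (\<Sum>i<d. real (j i))"
  define SC where "SC = (\<Sum>i<d. real (c + k i))"
  define R where "R = (\<Sum>i<d. (r i - 1 / p) * (real (k i) + real c - real (j i)))"
  define Z where "Z = - (\<Sum>i<d. (r i - 1 / p + 1 / q) * real (j i)) + (\<Sum>i<d. r i * real (k i)) + (\<Sum>i<d. (r i - 1 / p) * real c + real c / p)"
  have le: "q * (\<beta> * M) \<le> q * R" if "\<beta> * M \<le> R" using that q by (intro mult_left_mono) auto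
  \<comment> \<open>The parts with \<open>1 / p\<close> from sampling, from the smoothness and from
    the shift \<open>c\<close> recombine: what remains are the weights in \<open>j\<close> and
    \<open>k\<close> and a constant depending on \<open>c\<close>.\<close>
  have "R - SJ * (1 / q) + SC / p = Z"
    unfolding R_def SJ_def SC_def Z_def sum_negf[symmetric] sum_distrib_right sum_divide_distrib sum.distrib[symmetric] sum_subtractf[symmetric]
    by (intro sum.cong refl) (simp add: algebra_simps add_divide_distrib)
  then have "q * (R - SJ * (1 / q) + SC / p) = q * Z" by simp
  then have Z: "q * R - SJ + q * (SC / p) = q * Z" using q by (simp add: algebra_simps)
  have "(q / P - 1) * SJ + q / P * (P * (\<beta> / 2) * M - SJ + P / p * SC) = q * (\<beta> * M) / 2 - SJ + q * (SC / p)"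
    using P by (simp add: field_simps)
  also have "\<dots> \<le> - (q * (\<beta> * M) / 2) + q * Z"
    using Z le main unfolding R_def[symmetric] by linarith
  also have "\<dots> = q * (- (\<beta> / 2) * M - (\<Sum>i<d. (r i - 1 / p + 1 / q) * real (j i)) + (\<Sum>i<d. r i * real (k i))) +
      q * (\<Sum>i<d. (r i - 1 / p) * real c + real c / p)"
    unfolding Z_def distrib_left right_diff_distrib by simp
  finally show ?thesis unfolding \<delta> SJ_def SC_def .
qed

text \<open>For fixed \<open>j\<close> the blocks \<open>k\<close> are first collected into one
  polynomial \<open>F j\<close> of degree \<open>2 ^ j i\<close>, with weights geometric in
  \<open>k - j\<close> in place of the triangle inequality. The Jawerth-Franke inequality is then
  applied to the family indexed by \<open>j\<close> alone.\<close>

lemma error_core: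
  fixes r :: "nat \<Rightarrow> real" and p q \<beta> :: real and L c d :: nat
  assumes L: "1 \<le> L" "1 / q < real L" and p: "0 < p" "p < q"
    and \<beta>: "0 < \<beta>" "\<And>i. i < d \<Longrightarrow> \<beta> \<le> r i - 1 / p"
  shows "\<exists>C>0. \<forall>J K D. finite J \<longrightarrow> J \<subseteq> idx d \<longrightarrow> finite K \<longrightarrow> K \<subseteq> idx d \<longrightarrow>
    (\<forall>k\<in>K. trig_poly_d d (\<lambda>i. 2 ^ (c + k i)) (D k)) \<longrightarrow>
    (\<forall>j\<in>J. \<forall>k\<in>K. trig_poly_d d (\<lambda>i. 2 ^ j i) (qop L d j (D k))) \<longrightarrow>
    (\<forall>j\<in>J. \<forall>k\<in>K. \<forall>i<d. k i + c < j i \<longrightarrow> (\<forall>x. qop L d j (D k) x = 0)) \<longrightarrow>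
    (\<integral>\<^sup>+x. ennreal ((\<Sum>j\<in>J. cmod (\<Sum>k\<in>K. qop L d j (D k) x)) powr q) \<partial>PiM {..<d} (\<lambda>_. circ)) \<le>
      ennreal (C * (\<Sum>j\<in>J. \<Sum>k\<in>K. (geo_weight d c (2 powr (- (\<beta> / 2))) j k * 2 powr (- (\<Sum>i<d. (r i - 1 / p + 1 / q) * real (j i))) *
         (2 powr (\<Sum>i<d. r i * real (k i)) * Lp_norm d p (D k))) powr q))"
proof -
  have q0: "0 < q" using p by simp
  have "1 / real L < q" using L q0 by (simp add: field_simps)
  \<comment> \<open>\<open>P\<close> is the midpoint of \<open>m\<close> and \<open>q\<close>, hence
    strictly above all three lower bounds and strictly below \<open>q\<close>.\<close>
  define m where "m = max p (max (1 / real L) (q / 2))"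
  define P where "P = (m + q) / 2"
  have "m < q" unfolding m_def using p q0 \<open>1 / real L < q\<close> by simp
  then have "m < P" "P < q" unfolding P_def by auto
  moreover have "p \<le> m" "1 / real L \<le> m" "q / 2 \<le> m" unfolding m_def by auto
  ultimately have P: "p < P" "1 / real L < P" "P < q" "q < 2 * P" by linarith+
  have P0: "0 < P" using P p by simp
  obtain C1 where C1: "C1 > 0" "\<And>j n F. trig_poly_d d n F \<Longrightarrow> (\<forall>i<d. 2 ^ j i \<le> n i) \<Longrightarrow>
    (\<integral>\<^sup>+x. ennreal (cmod (qop L d j F x) powr P) \<partial>PiM {..<d} (\<lambda>_. circ))
    \<le> ennreal (C1 / 2 ^ (\<Sum>i<d. j i) * ((\<Prod>i<d. real (n i)) * Lpi d p F) powr (P / p))"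
    using qop_bound[OF L(1) p(1) P(1,2), of d] by blast
  obtain C2 where C2: "C2 > 0" "\<And>J F. finite J \<Longrightarrow> J \<subseteq> idx d \<Longrightarrow> (\<forall>j\<in>J. trig_poly_d d (\<lambda>i. 2 ^ j i) (F j)) \<Longrightarrow>
    (\<integral>\<^sup>+x. ennreal ((\<Sum>j\<in>J. cmod (F j x)) powr q) \<partial>PiM {..<d} (\<lambda>_. circ)) \<le>
      ennreal (C2 * (\<Sum>j\<in>J. (2 powr (\<Sum>i<d. real (j i))) powr (q / P - 1) * Lpi d P (F j) powr (q / P)))"
    using jawerth_franke[OF P0 P(3,4), of d] by blast
  \<comment> \<open>The rate of the auxiliary weights \<open>v\<close>. Using them twice costs half
    of the margin \<open>\<beta>\<close>; see \<open>core_exponents\<close>.\<close>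
  define \<delta> where "\<delta> = \<beta> / (2 * (1 + 1 / P))"
  have \<delta>: "0 < \<delta>" unfolding \<delta>_def using \<beta> P0 by (intro divide_pos_pos mult_pos_pos add_pos_pos) auto
  define \<rho> where "\<rho> = 2 powr (- \<delta>)"
  have \<rho>: "0 < \<rho>" "\<rho> < 1" unfolding \<rho>_def using \<delta> by (auto simp: powr_less_one)
  define V where "V = (1 / (1 - \<rho>)) ^ d"
  have V: "0 < V" unfolding V_def using \<rho> by simp
  \<comment> \<open>Collects the powers of two caused by the shift \<open>c\<close> in the degrees
    of the blocks.\<close>
  define E where "E = q * (\<Sum>i<d. (r i - 1 / p) * real c + real c / p)"
  define C where "C = C2 * (V powr q * V powr (q / P) * (C1 powr (q / P) * 2 powr E))"
  have C: "0 < C" unfolding C_def using C1 C2 V by simp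
  define A where "A = (\<lambda>j::nat \<Rightarrow> nat. 2 powr (- (\<Sum>i<d. (r i - 1 / p + 1 / q) * real (j i))))"
  define W where "W = geo_weight d c (2 powr (- (\<beta> / 2)))"
  show ?thesis
  proof (intro exI[of _ C] conjI C allI impI)
    fix J K :: "(nat \<Rightarrow> nat) set" and D :: "(nat \<Rightarrow> nat) \<Rightarrow> (nat \<Rightarrow> real) \<Rightarrow> complex"
    assume J: "finite J" "J \<subseteq> idx d" and K: "finite K" "K \<subseteq> idx d"
      and D: "\<forall>k\<in>K. trig_poly_d d (\<lambda>i. 2 ^ (c + k i)) (D k)"
      and Q: "\<forall>j\<in>J. \<forall>k\<in>K. trig_poly_d d (\<lambda>i. 2 ^ j i) (qop L d j (D k))"
      and Q0: "\<forall>j\<in>J. \<forall>k\<in>K. \<forall>i<d. k i + c < j i \<longrightarrow> (\<forall>x. qop L d j (D k) x = 0)"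
    define B where "B = (\<lambda>k. 2 powr (\<Sum>i<d. r i * real (k i)) * Lp_norm d p (D k))"
    define F where "F = (\<lambda>j x. \<Sum>k\<in>K. qop L d j (D k) x)"
    have Ftp: "\<forall>j\<in>J. trig_poly_d d (\<lambda>i. 2 ^ j i) (F j)"
      unfolding F_def using Q by (intro ballI trig_poly_d_sum) auto
    let ?T = "PiM {..<d} (\<lambda>_::nat. circ)"
    have each: "(2 powr (\<Sum>i<d. real (j i))) powr (q / P - 1) * Lpi d P (F j) powr (q / P) \<le>
       (V powr q * V powr (q / P) * (C1 powr (q / P) * 2 powr E)) * (\<Sum>k\<in>K. (W j k * A j * B k) powr q)" if j: "j \<in> J" for j
    proof -
      \<comment> \<open>On these blocks \<open>q_j D_k\<close> may be nonzero, the weights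
        \<open>v\<close> are positive, and the degree condition of the sampling inequality
        holds.\<close>
      define Kj where "Kj = {k \<in> K. \<forall>i<d. j i \<le> k i + c}"
      have Kj: "finite Kj" "Kj \<subseteq> idx d" "Kj \<subseteq> K" unfolding Kj_def using K by auto
      define v where "v = geo_weight d c \<rho> j"
      define M where "M = (\<lambda>k::nat \<Rightarrow> nat. \<Sum>i<d. real (k i) + real c - real (j i))"
      have jk: "j i \<le> k i + c" if "k \<in> Kj" "i < d" for k i using that by (auto simp: Kj_def)
      have v: "v k = 2 powr (- \<delta> * M k)" if "k \<in> Kj" for k
        unfolding v_def \<rho>_def M_def by (rule geo_weight_eq) (rule jk[OF that])
      have v0: "0 < v k" if "k \<in> Kj" for k using v[OF that] by simp
      have vV: "(\<Sum>k\<in>Kj. v k) \<le> V"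
        unfolding v_def V_def using \<rho> by (intro geo_weight_sums Kj) auto
      have I: "Lpi d P (qop L d j (D k)) \<le> C1 / 2 ^ (\<Sum>i<d. j i) * (2 powr (\<Sum>i<d. real (c + k i)) * Lpi d p (D k)) powr (P / p)"
        if k: "k \<in> Kj" for k
      proof -
        have kK: "k \<in> K" using k Kj by auto
        have "\<forall>i<d. (2::nat) ^ j i \<le> 2 ^ (c + k i)" using jk[OF k] by (simp add: add.commute)
        then have "(\<integral>\<^sup>+x. ennreal (cmod (qop L d j (D k) x) powr P) \<partial>?T)
          \<le> ennreal (C1 / 2 ^ (\<Sum>i<d. j i) * ((\<Prod>i<d. real (2 ^ (c + k i))) * Lpi d p (D k)) powr (P / p))"
          using D kK by (intro C1(2)) auto
        then have "ennreal (Lpi d P (qop L d j (D k))) \<le> ennreal (C1 / 2 ^ (\<Sum>i<d. j i) * ((\<Prod>i<d. real (2 ^ (c + k i))) * Lpi d p (D k)) powr (P / p))"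
          using nn_integral_trig_poly_d[of d "\<lambda>i. 2 ^ j i" "qop L d j (D k)" P] Q j kK P0 by auto
        then have "Lpi d P (qop L d j (D k)) \<le> C1 / 2 ^ (\<Sum>i<d. j i) * ((\<Prod>i<d. real (2 ^ (c + k i))) * Lpi d p (D k)) powr (P / p)"
          using C1(1) by (subst (asm) ennreal_le_iff) auto
        moreover have "(\<Prod>i<d. real (2 ^ (c + k i))) = 2 powr (\<Sum>i<d. real (c + k i))"
          by (simp add: powr_sum powr_realpow[symmetric])
        ultimately show ?thesis by simp
      qed
      \<comment> \<open>First use of the weights, pointwise under the integral with exponent
        \<open>P\<close>.\<close>
      have "Lpi d P (F j) \<le> V powr P * (\<Sum>k\<in>Kj. Lpi d P (qop L d j (D k)) / v k powr P)"
      proof -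
        have "ennreal (Lpi d P (F j)) = (\<integral>\<^sup>+x. ennreal (cmod (F j x) powr P) \<partial>?T)"
          using Ftp j by (intro nn_integral_trig_poly_d[symmetric] P0) auto
        also have "\<dots> \<le> (\<integral>\<^sup>+x. (\<Sum>k\<in>Kj. ennreal (V powr P / v k powr P) * ennreal (cmod (qop L d j (D k) x) powr P)) \<partial>?T)"
        proof (rule nn_integral_mono)
          fix x
          have "F j x = (\<Sum>k\<in>Kj. qop L d j (D k) x)"
            unfolding F_def
          proof (rule sum.mono_neutral_right)
            show "\<forall>k\<in>K - Kj. qop L d j (D k) x = 0"
            proof
              fix k assume k: "k \<in> K - Kj"
              then obtain i where "i < d" "k i + c < j i" unfolding Kj_def using not_le by blast
              then show "qop L d j (D k) x = 0" using Q0 j k by blast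
            qed
          qed (use K Kj in auto)
          then have "cmod (F j x) \<le> (\<Sum>k\<in>Kj. cmod (qop L d j (D k) x))" by (simp add: norm_sum)
          then have "cmod (F j x) powr P \<le> (\<Sum>k\<in>Kj. cmod (qop L d j (D k) x)) powr P"
            using P0 by (intro powr_mono2) auto
          also have "\<dots> \<le> V powr P * (\<Sum>k\<in>Kj. (cmod (qop L d j (D k) x) / v k) powr P)"
            by (intro weighted_sum_powr_le Kj v0 vV P0) auto
          also have "\<dots> = (\<Sum>k\<in>Kj. V powr P / v k powr P * cmod (qop L d j (D k) x) powr P)"
            unfolding sum_distrib_left using v0 by (intro sum.cong refl) (simp add: powr_divide less_imp_le)
          finally have "ennreal (cmod (F j x) powr P) \<le> ennreal (\<Sum>k\<in>Kj. V powr P / v k powr P * cmod (qop L d j (D k) x) powr P)"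
            by (rule ennreal_leI)
          also have "\<dots> = (\<Sum>k\<in>Kj. ennreal (V powr P / v k powr P) * ennreal (cmod (qop L d j (D k) x) powr P))"
            by (simp only: ennreal_mult[OF divide_nonneg_nonneg[OF powr_ge_zero powr_ge_zero] powr_ge_zero, symmetric])
               (intro sum_ennreal[symmetric] mult_nonneg_nonneg divide_nonneg_nonneg powr_ge_zero)
          finally show "ennreal (cmod (F j x) powr P) \<le> (\<Sum>k\<in>Kj. ennreal (V powr P / v k powr P) * ennreal (cmod (qop L d j (D k) x) powr P))" .
        qed
        also have "\<dots> = (\<Sum>k\<in>Kj. ennreal (V powr P / v k powr P) * ennreal (Lpi d P (qop L d j (D k))))"
        proof -
          have tp: "trig_poly_d d (\<lambda>i. 2 ^ j i) (qop L d j (D k))" if "k \<in> Kj" for k using Q j that Kj by auto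
          have ms: "(\<lambda>x. ennreal (cmod (qop L d j (D k) x) powr P)) \<in> borel_measurable ?T" if "k \<in> Kj" for k
            by (intro measurable_torus measurable_cmod_powr trig_poly_dD(1)[OF tp[OF that]] P0)
          have "(\<integral>\<^sup>+x. (\<Sum>k\<in>Kj. ennreal (V powr P / v k powr P) * ennreal (cmod (qop L d j (D k) x) powr P)) \<partial>?T) =
            (\<Sum>k\<in>Kj. \<integral>\<^sup>+x. ennreal (V powr P / v k powr P) * ennreal (cmod (qop L d j (D k) x) powr P) \<partial>?T)"
            using ms by (intro nn_integral_sum) auto
          also have "\<dots> = (\<Sum>k\<in>Kj. ennreal (V powr P / v k powr P) * (\<integral>\<^sup>+x. ennreal (cmod (qop L d j (D k) x) powr P) \<partial>?T))"
            by (intro sum.cong refl nn_integral_cmult ms)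
          finally show ?thesis using nn_integral_trig_poly_d[OF tp P0] by simp
        qed
        also have "\<dots> = ennreal (V powr P * (\<Sum>k\<in>Kj. Lpi d P (qop L d j (D k)) / v k powr P))"
          unfolding sum_distrib_left using Lpi_nonneg
          by (subst sum_ennreal[symmetric]) (auto simp: ennreal_mult[symmetric])
        finally show ?thesis
          using Lpi_nonneg by (subst (asm) ennreal_le_iff) (auto intro!: mult_nonneg_nonneg sum_nonneg divide_nonneg_nonneg)
      qed
      then have "Lpi d P (F j) powr (q / P) \<le> (V powr P * (\<Sum>k\<in>Kj. Lpi d P (qop L d j (D k)) / v k powr P)) powr (q / P)"
        using Lpi_nonneg P0 q0 by (intro powr_mono2) auto
      also have "\<dots> = V powr q * (\<Sum>k\<in>Kj. Lpi d P (qop L d j (D k)) / v k powr P) powr (q / P)"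
        using P0 by (simp add: powr_mult powr_powr)
      \<comment> \<open>Second use of the weights, now with exponent \<open>q / P\<close> for the
        sum of the integrals, so that the \<open>q\<close>-th powers of the single blocks
        appear.\<close>
      also have "\<dots> \<le> V powr q * (V powr (q / P) * (\<Sum>k\<in>Kj. (Lpi d P (qop L d j (D k)) / v k powr P / v k) powr (q / P)))"
        using P0 q0 Lpi_nonneg by (intro mult_left_mono weighted_sum_powr_le Kj v0 vV) auto
      finally have "(2 powr (\<Sum>i<d. real (j i))) powr (q / P - 1) * Lpi d P (F j) powr (q / P) \<le>
         (2 powr (\<Sum>i<d. real (j i))) powr (q / P - 1) * (V powr q * (V powr (q / P) * (\<Sum>k\<in>Kj. (Lpi d P (qop L d j (D k)) / v k powr P / v k) powr (q / P))))"
        by (intro mult_left_mono) auto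
      also have "\<dots> = V powr q * V powr (q / P) * (\<Sum>k\<in>Kj. (2 powr (\<Sum>i<d. real (j i))) powr (q / P - 1) * (Lpi d P (qop L d j (D k)) / v k powr P / v k) powr (q / P))"
        by (simp add: sum_distrib_left mult_ac)
      also have "\<dots> \<le> V powr q * V powr (q / P) * (\<Sum>k\<in>Kj. (C1 powr (q / P) * 2 powr E) * (W j k * A j * B k) powr q)"
      proof (intro mult_left_mono sum_mono)
        fix k assume k: "k \<in> Kj"
        define Sj where "Sj = (\<Sum>i<d. real (j i))"
        define Sk where "Sk = (\<Sum>i<d. real (c + k i))"
        have S2: "(2::real) ^ (\<Sum>i<d. j i) = 2 powr Sj" unfolding Sj_def by (simp add: powr_realpow[symmetric])
        have lp: "Lpi d p (D k) powr (1 / p) = Lp_norm d p (D k)" by (simp add: Lp_norm_Lpi)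
        have "Lpi d P (qop L d j (D k)) / v k powr P / v k \<le>
          C1 / 2 powr Sj * (2 powr Sk * Lpi d p (D k)) powr (P / p) / v k powr P / v k"
          using I[OF k] v0[OF k] unfolding S2 Sk_def by (intro divide_right_mono) auto
        also have "\<dots> = C1 * 2 powr (\<delta> * (P + 1) * M k - Sj + P / p * Sk) * Lpi d p (D k) powr (P / p)"
        proof -
          have "2 powr (\<delta> * (P + 1) * M k - Sj + P / p * Sk) = 2 powr (P / p * Sk) / 2 powr Sj / 2 powr (- \<delta> * M k * P) / 2 powr (- \<delta> * M k)"
            unfolding powr_diff[symmetric] by (rule arg_cong[where f = "\<lambda>x. 2 powr x"]) (simp add: algebra_simps)
          then show ?thesis unfolding v[OF k] powr_mult powr_powr by (simp add: mult_ac)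
        qed
        finally have "(Lpi d P (qop L d j (D k)) / v k powr P / v k) powr (q / P) \<le>
           (C1 * 2 powr (\<delta> * (P + 1) * M k - Sj + P / p * Sk) * Lpi d p (D k) powr (P / p)) powr (q / P)"
          using Lpi_nonneg v0[OF k] P0 q0 by (intro powr_mono2) auto
        also have "\<dots> = C1 powr (q / P) * 2 powr (q / P * (\<delta> * (P + 1) * M k - Sj + P / p * Sk)) * Lp_norm d p (D k) powr q"
          unfolding lp[symmetric] powr_mult powr_powr using P0 p by (simp add: mult.commute)
        finally have "(2 powr Sj) powr (q / P - 1) * (Lpi d P (qop L d j (D k)) / v k powr P / v k) powr (q / P) \<le>
           (2 powr Sj) powr (q / P - 1) * (C1 powr (q / P) * 2 powr (q / P * (\<delta> * (P + 1) * M k - Sj + P / p * Sk)) * Lp_norm d p (D k) powr q)"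
          by (intro mult_left_mono) auto
        also have "\<dots> = C1 powr (q / P) * 2 powr ((q / P - 1) * Sj + q / P * (\<delta> * (P + 1) * M k - Sj + P / p * Sk)) * Lp_norm d p (D k) powr q"
          unfolding powr_powr powr_add by (simp add: mult_ac)
        also have "\<dots> \<le> C1 powr (q / P) * 2 powr (q * (- (\<beta> / 2) * M k - (\<Sum>i<d. (r i - 1 / p + 1 / q) * real (j i)) + (\<Sum>i<d. r i * real (k i))) + E) * Lp_norm d p (D k) powr q"
          unfolding Sj_def Sk_def M_def E_def \<delta>_def
          using core_exponents[OF \<beta>(2) jk[OF k] P0 q0] by (intro mult_right_mono mult_left_mono powr_mono) auto
        also have "\<dots> = (C1 powr (q / P) * 2 powr E) * (W j k * A j * B k) powr q"
        proof -
          have "W j k = 2 powr (- (\<beta> / 2) * M k)"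
            unfolding W_def M_def by (rule geo_weight_eq) (rule jk[OF k])
          moreover define e2 where "e2 = (\<Sum>i<d. (r i - 1 / p + 1 / q) * real (j i))"
          moreover define e3 where "e3 = (\<Sum>i<d. r i * real (k i))"
          ultimately have "W j k * A j * B k = 2 powr (- (\<beta> / 2) * M k - e2 + e3) * Lp_norm d p (D k)"
            unfolding A_def B_def by (simp only: powr_add diff_conv_add_uminus mult.assoc)
          then have "(W j k * A j * B k) powr q = 2 powr ((- (\<beta> / 2) * M k - e2 + e3) * q) * Lp_norm d p (D k) powr q"
            by (simp only: powr_mult powr_powr)
          then show ?thesis unfolding e2_def e3_def powr_add by (simp only: mult_ac)
        qed
        finally show "(2 powr (\<Sum>i<d. real (j i))) powr (q / P - 1) * (Lpi d P (qop L d j (D k)) / v k powr P / v k) powr (q / P) \<le>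
            (C1 powr (q / P) * 2 powr E) * (W j k * A j * B k) powr q"
          unfolding Sj_def .
      qed simp
      also have "\<dots> = (V powr q * V powr (q / P) * (C1 powr (q / P) * 2 powr E)) * (\<Sum>k\<in>Kj. (W j k * A j * B k) powr q)"
        by (simp add: sum_distrib_left mult.assoc)
      also have "\<dots> \<le> (V powr q * V powr (q / P) * (C1 powr (q / P) * 2 powr E)) * (\<Sum>k\<in>K. (W j k * A j * B k) powr q)"
        using K Kj by (intro mult_left_mono sum_mono2) auto
      finally show ?thesis .
    qed
    have "(\<integral>\<^sup>+x. ennreal ((\<Sum>j\<in>J. cmod (F j x)) powr q) \<partial>?T) \<le>
      ennreal (C2 * (\<Sum>j\<in>J. (2 powr (\<Sum>i<d. real (j i))) powr (q / P - 1) * Lpi d P (F j) powr (q / P)))"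
      by (rule C2(2)[OF J Ftp])
    also have "\<dots> \<le> ennreal (C2 * (\<Sum>j\<in>J. (V powr q * V powr (q / P) * (C1 powr (q / P) * 2 powr E)) * (\<Sum>k\<in>K. (W j k * A j * B k) powr q)))"
      using C2(1) by (intro ennreal_leI mult_left_mono sum_mono each) auto
    also have "\<dots> = ennreal (C * (\<Sum>j\<in>J. \<Sum>k\<in>K. (W j k * A j * B k) powr q))"
      unfolding C_def sum_distrib_left[symmetric] by (simp add: mult.assoc)
    finally show "(\<integral>\<^sup>+x. ennreal ((\<Sum>j\<in>J. cmod (\<Sum>k\<in>K. qop L d j (D k) x)) powr q) \<partial>?T) \<le>
      ennreal (C * (\<Sum>j\<in>J. \<Sum>k\<in>K. (geo_weight d c (2 powr (- (\<beta> / 2))) j k * 2 powr (- (\<Sum>i<d. (r i - 1 / p + 1 / q) * real (j i))) *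
         (2 powr (\<Sum>i<d. r i * real (k i)) * Lp_norm d p (D k))) powr q))"
      unfolding F_def W_def A_def B_def .
  qed
qed

subsection \<open>Reconstruction from the dyadic blocks\<close>

definition freq :: "nat \<Rightarrow> nat \<Rightarrow> (nat \<Rightarrow> nat) \<Rightarrow> (nat \<Rightarrow> int) set" where
  "freq C d k = {\<kappa> \<in> int_idx d. \<forall>i<d. \<bar>\<kappa> i\<bar> \<le> int (C * 2 ^ k i)}"

lemma finite_freq [simp]: "finite (freq C d k)"
proof (rule finite_subset)
  define M where "M = (\<Sum>i<d. int (C * 2 ^ k i))"
  show "freq C d k \<subseteq> {\<kappa>. \<forall>i. (i \<in> {..<d} \<longrightarrow> \<kappa> i \<in> {-M..M}) \<and> (i \<notin> {..<d} \<longrightarrow> \<kappa> i = 0)}"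
  proof (rule subsetI, rule CollectI, rule allI)
    fix \<kappa> i assume \<kappa>: "\<kappa> \<in> freq C d k"
    show "(i \<in> {..<d} \<longrightarrow> \<kappa> i \<in> {-M..M}) \<and> (i \<notin> {..<d} \<longrightarrow> \<kappa> i = 0)"
    proof (cases "i < d")
      case True
      have "\<bar>\<kappa> i\<bar> \<le> int (C * 2 ^ k i)" using \<kappa> True unfolding freq_def by blast
      also have "\<dots> \<le> M" unfolding M_def using True by (intro member_le_sum) auto
      finally show ?thesis using True by auto
    next
      case False
      then show ?thesis using \<kappa> by (simp add: freq_def int_idx_def)
    qed
  qed
  show "finite {\<kappa>. \<forall>i. (i \<in> {..<d} \<longrightarrow> \<kappa> i \<in> {-M..M}) \<and> (i \<notin> {..<d} \<longrightarrow> \<kappa> i = (0::int))}"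
    by (intro finite_set_of_finite_funs) auto
qed

text \<open>One integer majorant for the constants of \<open>\<phi> 0\<close> and of the other
  \<open>\<phi> j\<close>, at least 1, so that \<open>C * 2 ^ k i\<close> can serve as a positive
  degree.\<close>

lemma admissible_support:
  assumes "admissible \<phi>"
  obtains C :: nat where "1 \<le> C" "\<forall>j x. \<phi> j x \<noteq> 0 \<longrightarrow> \<bar>x\<bar> \<le> real C * 2 ^ j" "\<And>x. (\<lambda>j. \<phi> j x) sums 1"
proof -
  from assms obtain A B C where A: "\<forall>x. \<phi> 0 x \<noteq> 0 \<longrightarrow> \<bar>x\<bar> \<le> A"
    and C: "\<forall>j\<ge>1. \<forall>x. \<phi> j x \<noteq> 0 \<longrightarrow> B * 2 ^ j \<le> \<bar>x\<bar> \<and> \<bar>x\<bar> \<le> C * 2 ^ j" and s: "\<forall>x. (\<lambda>j. \<phi> j x) sums 1"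
    unfolding admissible_def by (elim exE conjE)
  define C' where "C' = nat \<lceil>max 1 (max A C)\<rceil>"
  have C': "max 1 (max A C) \<le> real C'" unfolding C'_def by linarith
  show thesis
  proof (rule that)
    show "1 \<le> C'" using C' by auto
    show "\<forall>j x. \<phi> j x \<noteq> 0 \<longrightarrow> \<bar>x\<bar> \<le> real C' * 2 ^ j"
    proof (intro allI impI)
      fix j x assume nz: "\<phi> j x \<noteq> 0"
      show "\<bar>x\<bar> \<le> real C' * 2 ^ j"
      proof (cases "j = 0")
        case True
        then have "\<bar>x\<bar> \<le> A" using A nz by auto
        then show ?thesis using C' True by auto
      next
        case False
        then have "\<bar>x\<bar> \<le> C * 2 ^ j" using C nz by (metis One_nat_def Suc_leI neq0_conv)
        also have "\<dots> \<le> real C' * 2 ^ j" using C' by (intro mult_right_mono) auto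
        finally show ?thesis .
      qed
    qed
    show "(\<lambda>j. \<phi> j x) sums 1" for x using s by blast
  qed
qed

lemma freq_outside:
  assumes "\<forall>j x. \<phi> j x \<noteq> 0 \<longrightarrow> \<bar>x\<bar> \<le> real C * 2 ^ j" and \<kappa>: "\<kappa> \<in> int_idx d - freq C d k"
  shows "(\<Prod>i<d. \<phi> (k i) (of_int (\<kappa> i))) = (0::real)"
proof -
  obtain i where i: "i < d" "\<not> \<bar>\<kappa> i\<bar> \<le> int (C * 2 ^ k i)" using \<kappa> unfolding freq_def by blast
  have "\<phi> (k i) (of_int (\<kappa> i)) = 0"
  proof (rule ccontr)
    assume "\<phi> (k i) (of_int (\<kappa> i)) \<noteq> 0"
    then have "\<bar>real_of_int (\<kappa> i)\<bar> \<le> real C * 2 ^ k i" using assms(1) by blast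
    then have "real_of_int \<bar>\<kappa> i\<bar> \<le> real_of_int (int (C * 2 ^ k i))" by simp
    then show False using i(2) by (simp only: of_int_le_iff)
  qed
  then show ?thesis using i by (intro prod_zero) auto
qed

lemma delta_eq:
  assumes "\<forall>j x. \<phi> j x \<noteq> 0 \<longrightarrow> \<bar>x\<bar> \<le> real C * 2 ^ j"
  shows "delta \<phi> d k f = (\<lambda>x. \<Sum>\<kappa>\<in>freq C d k. (complex_of_real (\<Prod>i<d. \<phi> (k i) (of_int (\<kappa> i))) * fourier_coeff d f \<kappa>) *
    (\<Prod>i<d. cis (of_int (\<kappa> i) * x i)))"
proof
  fix x
  have "delta \<phi> d k f x = infsum (\<lambda>\<kappa>. (complex_of_real (\<Prod>i<d. \<phi> (k i) (of_int (\<kappa> i))) * fourier_coeff d f \<kappa>) *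
    (\<Prod>i<d. cis (of_int (\<kappa> i) * x i))) (freq C d k)"
    unfolding delta_def
  proof (rule infsum_cong_neutral)
    fix \<kappa> assume "\<kappa> \<in> int_idx d - freq C d k"
    then have "(\<Prod>i<d. \<phi> (k i) (of_int (\<kappa> i))) = 0" by (rule freq_outside[OF assms])
    then show "complex_of_real (\<Prod>i<d. \<phi> (k i) (of_int (\<kappa> i))) * fourier_coeff d f \<kappa> * cis (\<Sum>i<d. of_int (\<kappa> i) * x i) = 0"
      by (simp only: of_real_0 mult_zero_left)
  next
    fix \<kappa> assume "\<kappa> \<in> freq C d k - int_idx d"
    then show "(complex_of_real (\<Prod>i<d. \<phi> (k i) (of_int (\<kappa> i))) * fourier_coeff d f \<kappa>) *
      (\<Prod>i<d. cis (of_int (\<kappa> i) * x i)) = 0" unfolding freq_def by blast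
  qed (simp only: prod_cis)
  then show "delta \<phi> d k f x = (\<Sum>\<kappa>\<in>freq C d k. (complex_of_real (\<Prod>i<d. \<phi> (k i) (of_int (\<kappa> i))) * fourier_coeff d f \<kappa>) *
    (\<Prod>i<d. cis (of_int (\<kappa> i) * x i)))" by (simp only: infsum_finite[OF finite_freq])
qed

lemma trig_poly_d_delta:
  assumes "\<forall>j x. \<phi> j x \<noteq> 0 \<longrightarrow> \<bar>x\<bar> \<le> real C * 2 ^ j"
  shows "trig_poly_d d (\<lambda>i. C * 2 ^ k i) (delta \<phi> d k f)"
  unfolding delta_eq[OF assms] by (rule trig_poly_d_exp) (simp add: freq_def)

text \<open>Nikolskii's inequality in one variable is a sampling inequality with a single node;
  tensorizing it at the coordinates of \<open>x\<close> gives the version in \<open>d\<close>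
  variables.\<close>

lemma trig_poly_d_sup:
  assumes p: "0 < p"
  shows "\<exists>c>0. \<forall>n F x. (\<forall>i<d. 1 \<le> n i) \<longrightarrow> trig_poly_d d n F \<longrightarrow>
    cmod (F x) powr p \<le> (\<Prod>i<d. c * real (n i)) * Lpi d p F"
proof -
  obtain c where c: "c > 0" "\<And>n g x. 1 \<le> n \<Longrightarrow> trig_poly n g \<Longrightarrow>
    ennreal (cmod (g x) powr p) \<le> ennreal (c * real n) * (\<integral>\<^sup>+t. ennreal (cmod (g t) powr p) \<partial>circ)"
    using nikolskii[OF p] by blast
  show ?thesis
  proof (intro exI[of _ c] conjI c(1) allI impI)
    fix n F x assume n: "\<forall>i<d. 1 \<le> n i" and F: "trig_poly_d d n F"
    define A where "A = (\<lambda>y. ennreal (cmod (F y) powr p))"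
    have "(\<Sum>u\<in>PiE {..<d} (\<lambda>_. {0::int}). A (restrict (\<lambda>i. x i) {..<d})) \<le>
      (\<Prod>i<d. ennreal (c * real (n i))) * (\<integral>\<^sup>+y. A y \<partial>PiM {..<d} (\<lambda>_. circ))"
    proof (rule torus_sampling[where pt = "\<lambda>i _. x i"])
      show "A \<in> borel_measurable borel" unfolding A_def by (intro measurable_cmod_powr trig_poly_dD(1)[OF F] p)
      show "(\<Sum>v\<in>{0::int}. A (y(i := x i))) \<le> ennreal (c * real (n i)) * (\<integral>\<^sup>+t. A (y(i := t)) \<partial>circ)" if "i \<in> {..<d}" for i y
        using c(2)[OF _ trig_poly_dD(4)[OF F, of i y], of "x i"] that n unfolding A_def by simp
    qed simp
    moreover have "(\<Sum>u\<in>PiE {..<d} (\<lambda>_. {0::int}). A (restrict (\<lambda>i. x i) {..<d})) = A x"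
    proof -
      have "PiE {..<d} (\<lambda>_. {0::int}) = {restrict (\<lambda>_. 0) {..<d}}"
        using PiE_singleton[of "restrict (\<lambda>_. 0::int) {..<d}" "{..<d}"] by (auto simp: PiE_def Pi_def extensional_def)
      moreover have "F (restrict (\<lambda>i. x i) {..<d}) = F x" by (rule trig_poly_dD(3)[OF F]) simp
      ultimately show ?thesis unfolding A_def by simp
    qed
    ultimately have "A x \<le> (\<Prod>i<d. ennreal (c * real (n i))) * ennreal (Lpi d p F)"
      unfolding A_def nn_integral_trig_poly_d[OF F p] by simp
    also have "\<dots> = ennreal ((\<Prod>i<d. c * real (n i)) * Lpi d p F)"
      using c(1) Lpi_nonneg by (subst prod_ennreal) (auto simp: ennreal_mult prod_nonneg)
    finally show "cmod (F x) powr p \<le> (\<Prod>i<d. c * real (n i)) * Lpi d p F"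
      unfolding A_def using c(1) Lpi_nonneg by (subst (asm) ennreal_le_iff) (auto intro!: mult_nonneg_nonneg prod_nonneg)
  qed
qed

text \<open>Passing from \<open>L_p\<close> to the supremum costs \<open>2 powr (k i / p)\<close> in
  each direction, while the Besov weight supplies \<open>2 powr (- r i * k i)\<close>. At least
  \<open>\<beta>\<close> per level remains as decay.\<close>

lemma delta_sup_bound:
  assumes supp: "\<forall>j x. \<phi> j x \<noteq> 0 \<longrightarrow> \<bar>x\<bar> \<le> real C * 2 ^ j" and C: "1 \<le> C" and p: "0 < p"
    and \<beta>: "\<And>i. i < d \<Longrightarrow> \<beta> \<le> r i - 1 / p"
  shows "\<exists>c>0. \<forall>f k x N. besov_term r p \<phi> d f k \<le> N \<longrightarrow>
    cmod (delta \<phi> d k f x) \<le> c * N * (\<Prod>i<d. (2 powr (- \<beta>)) ^ k i)"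
proof -
  obtain c0 where c0: "c0 > 0" "\<And>n F x. (\<forall>i<d. 1 \<le> n i) \<Longrightarrow> trig_poly_d d n F \<Longrightarrow>
    cmod (F x) powr p \<le> (\<Prod>i<d. c0 * real (n i)) * Lpi d p F"
    using trig_poly_d_sup[OF p, of d] by blast
  define c where "c = ((c0 * real C) ^ d) powr (1 / p)"
  have c: "c > 0" unfolding c_def using c0 C by simp
  show ?thesis
  proof (intro exI[of _ c] conjI c allI impI)
    fix f k x N assume N: "besov_term r p \<phi> d f k \<le> N"
    define D where "D = delta \<phi> d k f"
    have tp: "trig_poly_d d (\<lambda>i. C * 2 ^ k i) D" unfolding D_def by (rule trig_poly_d_delta[OF supp])
    have "cmod (D x) = (cmod (D x) powr p) powr (1 / p)" using p by (simp add: powr_powr)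
    also have "\<dots> \<le> ((\<Prod>i<d. c0 * real (C * 2 ^ k i)) * Lpi d p D) powr (1 / p)"
      using p C by (intro powr_mono2 c0(2) tp) auto
    also have "(\<Prod>i<d. c0 * real (C * 2 ^ k i)) = (c0 * real C) ^ d * 2 powr (\<Sum>i<d. real (k i))"
      by (simp add: powr_sum powr_realpow prod.distrib power_mult_distrib)
    also have "((c0 * real C) ^ d * 2 powr (\<Sum>i<d. real (k i)) * Lpi d p D) powr (1 / p) =
        c * 2 powr ((\<Sum>i<d. real (k i)) * (1 / p)) * Lp_norm d p D"
      unfolding powr_mult powr_powr c_def Lp_norm_Lpi ..
    also have "Lp_norm d p D = 2 powr (- (\<Sum>i<d. r i * real (k i))) * besov_term r p \<phi> d f k"
      unfolding besov_term_def D_def by (simp add: mult.assoc[symmetric] powr_add[symmetric])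
    also have "c * 2 powr ((\<Sum>i<d. real (k i)) * (1 / p)) * (2 powr (- (\<Sum>i<d. r i * real (k i))) * besov_term r p \<phi> d f k) =
       c * 2 powr (\<Sum>i<d. - (r i - 1 / p) * real (k i)) * besov_term r p \<phi> d f k"
    proof -
      have "(\<Sum>i<d. - (r i - 1 / p) * real (k i)) = (\<Sum>i<d. real (k i)) * (1 / p) + - (\<Sum>i<d. r i * real (k i))"
        unfolding sum_negf[symmetric] sum_distrib_right sum.distrib[symmetric] by (intro sum.cong refl) (simp add: algebra_simps)
      then show ?thesis by (simp only: powr_add mult_ac)
    qed
    also have "\<dots> \<le> c * 2 powr (\<Sum>i<d. - \<beta> * real (k i)) * N"
    proof -
      have "- (r i - 1 / p) * real (k i) \<le> - \<beta> * real (k i)" if "i < d" for i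
        using \<beta>[of i] that by (intro mult_right_mono) auto
      then have "2 powr (\<Sum>i<d. - (r i - 1 / p) * real (k i)) \<le> 2 powr (\<Sum>i<d. - \<beta> * real (k i))"
        by (intro powr_mono sum_mono) auto
      then have "c * 2 powr (\<Sum>i<d. - (r i - 1 / p) * real (k i)) \<le> c * 2 powr (\<Sum>i<d. - \<beta> * real (k i))"
        using c by simp
      then show ?thesis
        using c N by (intro mult_mono) (auto simp: besov_term_def Lp_norm_def)
    qed
    also have "2 powr (\<Sum>i<d. - \<beta> * real (k i)) = (\<Prod>i<d. (2 powr (- \<beta>)) ^ k i)"
      by (simp add: powr_sum powr_realpow[symmetric] powr_powr)
    finally show "cmod (delta \<phi> d k f x) \<le> c * N * (\<Prod>i<d. (2 powr (- \<beta>)) ^ k i)"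
      unfolding D_def by (simp only: mult_ac)
  qed
qed

lemma besov_term_nonneg: "0 \<le> besov_term r p \<phi> d f k"
  by (simp add: besov_term_def Lp_norm_def)

text \<open>Phrased with finite sums and a case distinction so as to match the hypothesis of
  \<open>besov_double_sum\<close>.\<close>

lemma besov_partial_sum:
  assumes \<theta>: "0 < \<theta>" and f: "in_besov r p \<theta> \<phi> d f" and K: "finite K" "K \<subseteq> idx d"
  shows "if \<theta> = \<infinity> then \<forall>k\<in>K. besov_term r p \<phi> d f k \<le> besov_norm r p \<theta> \<phi> d f
    else (\<Sum>k\<in>K. besov_term r p \<phi> d f k powr real_of_ereal \<theta>) \<le> besov_norm r p \<theta> \<phi> d f powr real_of_ereal \<theta>"
proof (cases "\<theta> = \<infinity>")
  case True
  have "besov_term r p \<phi> d f k \<le> besov_norm r p \<theta> \<phi> d f" if "k \<in> K" for k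
    using f K(2) that True unfolding in_besov_def besov_norm_def by (auto intro!: cSup_upper)
  then show ?thesis using True by simp
next
  case False
  then have \<theta>': "0 < real_of_ereal \<theta>" using \<theta> by (cases \<theta>) auto
  have s: "(\<lambda>k. besov_term r p \<phi> d f k powr real_of_ereal \<theta>) summable_on idx d"
    using f False by (simp add: in_besov_def)
  have "(\<Sum>k\<in>K. besov_term r p \<phi> d f k powr real_of_ereal \<theta>) \<le> (\<Sum>\<^sub>\<infinity>k\<in>idx d. besov_term r p \<phi> d f k powr real_of_ereal \<theta>)"
    using s K by (intro finite_sum_le_infsum) auto
  also have "\<dots> = besov_norm r p \<theta> \<phi> d f powr real_of_ereal \<theta>"
    using False \<theta>' by (simp add: besov_norm_def powr_powr infsum_nonneg)
  finally show ?thesis using False by simp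
qed

lemma besov_norm_nonneg:
  assumes "0 < \<theta>" "in_besov r p \<theta> \<phi> d f"
  shows "0 \<le> besov_norm r p \<theta> \<phi> d f"
proof (cases "\<theta> = \<infinity>")
  case True
  have "(\<lambda>_. 0) \<in> idx d" by (simp add: idx_def)
  then have "besov_term r p \<phi> d f (\<lambda>_. 0) \<le> besov_norm r p \<theta> \<phi> d f"
    using besov_partial_sum[OF assms, of "{\<lambda>_. 0}"] True by simp
  then show ?thesis using besov_term_nonneg order_trans by blast
qed (simp add: besov_norm_def)

lemma besov_term_le_norm:
  assumes \<theta>: "0 < \<theta>" and f: "in_besov r p \<theta> \<phi> d f" and k: "k \<in> idx d"
  shows "besov_term r p \<phi> d f k \<le> besov_norm r p \<theta> \<phi> d f"
proof (cases "\<theta> = \<infinity>")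
  case True
  then show ?thesis using besov_partial_sum[OF \<theta> f, of "{k}"] k by simp
next
  case False
  then have \<theta>': "0 < real_of_ereal \<theta>" using \<theta> by (cases \<theta>) auto
  have "besov_term r p \<phi> d f k powr real_of_ereal \<theta> \<le> besov_norm r p \<theta> \<phi> d f powr real_of_ereal \<theta>"
    using besov_partial_sum[OF \<theta> f, of "{k}"] k False by simp
  then show ?thesis
    using \<theta>' besov_norm_nonneg[OF \<theta> f] powr_less_mono2[of "real_of_ereal \<theta>" "besov_norm r p \<theta> \<phi> d f" "besov_term r p \<phi> d f k"]
    by linarith
qed

lemma periodic_torus_reduce:
  assumes "periodic_torus d f"
  obtains y where "\<And>i. i < d \<Longrightarrow> y i \<in> {-pi..pi}" "f x = f (\<lambda>i. if i < d then y i else z i)"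
proof -
  have "\<forall>i. \<exists>l::int. x i - 2 * pi * of_int l \<in> {-pi..pi}" using reduce_2pi by blast
  from choice[OF this] obtain l where l: "\<forall>i. x i - 2 * pi * of_int (l i) \<in> {-pi..pi}" by blast
  show thesis
  proof (rule that[of "\<lambda>i. x i - 2 * pi * of_int (l i)"])
    show "x i - 2 * pi * of_int (l i) \<in> {-pi..pi}" for i using l by blast
    have "\<forall>i<d. \<exists>k::int. x i = (if i < d then x i - 2 * pi * of_int (l i) else z i) + 2 * pi * of_int k"
    proof (intro allI impI)
      fix i assume "i < d"
      then show "\<exists>k::int. x i = (if i < d then x i - 2 * pi * of_int (l i) else z i) + 2 * pi * of_int k"
        by (intro exI[of _ "l i"]) simp
    qed
    then show "f x = f (\<lambda>i. if i < d then x i - 2 * pi * of_int (l i) else z i)"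
      by (rule assms[unfolded periodic_torus_def, THEN spec, THEN spec, THEN mp])
  qed
qed

text \<open>By periodicity every value is attained on a cube with all coordinates beyond
  \<open>d\<close> set to 0. This set is compact by Tychonoff's theorem.\<close>

lemma periodic_bounded:
  assumes cont: "continuous_on UNIV f" and per: "periodic_torus d f"
  obtains M where "\<And>x. cmod (f x) \<le> M"
proof -
  define S where "S = (\<lambda>i::nat. if i < d then {-pi..pi} else {0::real})"
  have "compactin (product_topology (\<lambda>i::nat. euclidean :: real topology) UNIV) (PiE UNIV S)"
    by (subst compactin_PiE) (auto simp: S_def)
  then have "compact (PiE UNIV S)" by (simp add: euclidean_product_topology)
  then have "compact (f ` PiE UNIV S)"
    by (intro compact_continuous_image continuous_on_subset[OF cont]) auto
  then have "bounded (f ` PiE UNIV S)" by (rule compact_imp_bounded)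
  then obtain M where M: "\<forall>w\<in>f ` PiE UNIV S. cmod w \<le> M" unfolding bounded_iff by blast
  have "cmod (f x) \<le> M" for x
  proof -
    obtain y where y: "\<And>i. i < d \<Longrightarrow> y i \<in> {-pi..pi}" "f x = f (\<lambda>i. if i < d then y i else (\<lambda>_. 0) i)"
      by (rule periodic_torus_reduce[OF per, where x = x and z = "\<lambda>_. 0"]) blast
    have "(\<lambda>i. if i < d then y i else 0) \<in> PiE UNIV S" using y(1) by (simp add: S_def PiE_UNIV_domain Pi_def)
    then show ?thesis using M y(2) by auto
  qed
  then show thesis by (rule that)
qed

text \<open>Uniqueness is available at interior points of the cube. A point on its boundary is the
  end of the segment \<open>Y\<close> from the centre, all of whose earlier points are
  interior.\<close>

lemma periodic_fourier_uniqueness: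
  assumes cont: "continuous_on UNIV h" and per: "periodic_torus d h"
    and zero: "\<And>k. integral\<^sup>L (torus d) (\<lambda>x. h x * cis (- (\<Sum>i<d. of_int (k i) * x i))) = 0"
  shows "h x = 0"
proof -
  obtain M where M: "\<And>x. cmod (h x) \<le> M" by (rule periodic_bounded[OF cont per]) blast
  obtain y where y: "\<And>i. i < d \<Longrightarrow> y i \<in> {-pi..pi}" "h x = h (\<lambda>i. if i < d then y i else (\<lambda>_. undefined) i)"
    by (rule periodic_torus_reduce[OF per, where x = x and z = "\<lambda>_. undefined"]) blast
  \<comment> \<open>The value \<open>undefined\<close> beyond \<open>d\<close> makes the points
    extensional, as \<open>fourier_uniqueness\<close> demands.\<close>
  define Y where "Y = (\<lambda>s::real. (\<lambda>i. if i < d then s * y i else undefined))"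
  have Yc: "continuous_on UNIV Y"
  proof (rule continuous_on_coordinatewise_then_product)
    fix i show "continuous_on UNIV (\<lambda>s. Y s i)" unfolding Y_def by (cases "i < d") (auto intro!: continuous_intros)
  qed
  have "continuous_on UNIV (\<lambda>s. h (Y s))"
    by (rule continuous_on_compose2[OF cont Yc]) simp
  then have "isCont (\<lambda>s. h (Y s)) 1" by (simp add: continuous_on_eq_continuous_at)
  moreover have "(\<lambda>n. 1 - 1 / real (Suc n)) \<longlonglongrightarrow> 1 - 0"
    by (intro tendsto_diff tendsto_const LIMSEQ_Suc lim_1_over_n)
  ultimately have "(\<lambda>n. h (Y (1 - 1 / real (Suc n)))) \<longlonglongrightarrow> h (Y 1)"
    using isCont_tendsto_compose[of 1 "\<lambda>s. h (Y s)" "\<lambda>n. 1 - 1 / real (Suc n)" sequentially] by simp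
  moreover have "h (Y (1 - 1 / real (Suc n))) = 0" for n
  proof (rule fourier_uniqueness[OF cont M zero])
    show "Y (1 - 1 / real (Suc n)) \<in> extensional {..<d}" by (simp add: Y_def extensional_def)
    fix i assume i: "i < d"
    have "\<bar>(1 - 1 / real (Suc n)) * y i\<bar> = (1 - 1 / real (Suc n)) * \<bar>y i\<bar>" by (simp add: abs_mult)
    also have "\<dots> \<le> (1 - 1 / real (Suc n)) * pi" using y(1)[OF i] by (intro mult_left_mono) auto
    also have "\<dots> < 1 * pi" by (intro mult_strict_right_mono) auto
    finally show "\<bar>Y (1 - 1 / real (Suc n)) i\<bar> < pi" using i by (simp add: Y_def)
  qed
  ultimately have "h (Y 1) = 0" by (simp add: LIMSEQ_const_iff)
  moreover have "Y 1 = (\<lambda>i. if i < d then y i else undefined)" unfolding Y_def by (rule ext) simp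
  ultimately show ?thesis using y(2) by simp
qed

lemma integral_torus_exp:
  "integral\<^sup>L (torus d) (\<lambda>x. (\<Prod>i<d. cis (of_int (\<kappa> i) * x i)) * cis (- (\<Sum>i<d. of_int (l i) * x i))) =
    (if \<forall>i<d. \<kappa> i = l i then complex_of_real ((2 * pi) ^ d) else 0)"
proof -
  have "(\<lambda>x. (\<Prod>i<d. cis (of_int (\<kappa> i) * x i)) * cis (- (\<Sum>i<d. of_int (l i) * x i))) =
    (\<lambda>x::nat\<Rightarrow>real. \<Prod>i<d. cis (of_int (\<kappa> i - l i) * x i))"
    unfolding prod_cis cis_mult by (simp add: sum_subtractf left_diff_distrib)
  moreover have "integral\<^sup>L (PiM {..<d} (\<lambda>_. circ)) (\<lambda>x. \<Prod>i<d. cis (of_int (\<kappa> i - l i) * x i)) =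
    (\<Prod>i<d. integral\<^sup>L circ (\<lambda>t. cis (of_int (\<kappa> i - l i) * t)))"
    by (rule torus.product_integral_prod[where f = "\<lambda>i t. cis (of_int (\<kappa> i - l i) * t)"])
      (intro integrable_circ_cont continuous_on_cis_int finite_lessThan)+
  ultimately have "integral\<^sup>L (torus d) (\<lambda>x. (\<Prod>i<d. cis (of_int (\<kappa> i) * x i)) * cis (- (\<Sum>i<d. of_int (l i) * x i))) =
    (\<Prod>i<d. integral\<^sup>L circ (\<lambda>t. cis (of_int (\<kappa> i - l i) * t)))"
    unfolding torus_def by simp
  also have "\<dots> = (\<Prod>i<d. if \<kappa> i = l i then complex_of_real (2 * pi) else 0)"
    unfolding integral_circ_cis by simp
  also have "\<dots> = (if \<forall>i<d. \<kappa> i = l i then complex_of_real ((2 * pi) ^ d) else 0)"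
  proof (cases "\<forall>i<d. \<kappa> i = l i")
    case False
    then show ?thesis by (auto intro!: prod_zero)
  qed simp
  finally show ?thesis .
qed

lemma delta_coefficient:
  assumes supp: "\<forall>j x. \<phi> j x \<noteq> 0 \<longrightarrow> \<bar>x\<bar> \<le> real C * 2 ^ j"
  shows "integral\<^sup>L (torus d) (\<lambda>x. delta \<phi> d k f x * cis (- (\<Sum>i<d. of_int (l i) * x i))) =
    complex_of_real (\<Prod>i<d. \<phi> (k i) (of_int (l i))) *
      integral\<^sup>L (torus d) (\<lambda>x. f x * cis (- (\<Sum>i<d. of_int (l i) * x i)))"
proof -
  define E :: "(nat \<Rightarrow> real) \<Rightarrow> complex" where "E = (\<lambda>x. cis (- (\<Sum>i<d. of_int (l i) * x i)))"
  define a where "a = (\<lambda>\<kappa>. complex_of_real (\<Prod>i<d. \<phi> (k i) (of_int (\<kappa> i))) * fourier_coeff d f \<kappa>)"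
  define e :: "(nat \<Rightarrow> int) \<Rightarrow> (nat \<Rightarrow> real) \<Rightarrow> complex" where "e = (\<lambda>\<kappa> x. \<Prod>i<d. cis (of_int (\<kappa> i) * x i))"
  \<comment> \<open>Frequencies in \<open>freq\<close> vanish beyond \<open>d\<close>, so
    \<open>l\<close> is truncated before it is compared with them.\<close>
  define l' where "l' = (\<lambda>i. if i < d then l i else 0)"
  have l': "l' \<in> int_idx d" by (simp add: l'_def int_idx_def)
  have int: "integrable (torus d) (\<lambda>x. e \<kappa> x * E x)" for \<kappa>
    unfolding torus_def
  proof (rule integrable_torus_bounded[where M = 1])
    show "continuous_on UNIV (\<lambda>x. e \<kappa> x * E x)"
      unfolding e_def E_def by (intro continuous_intros)
    show "norm (e \<kappa> x * E x) \<le> 1" for x by (simp add: e_def E_def norm_mult prod_norm[symmetric])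
  qed simp
  have "integral\<^sup>L (torus d) (\<lambda>x. delta \<phi> d k f x * E x) = integral\<^sup>L (torus d) (\<lambda>x. \<Sum>\<kappa>\<in>freq C d k. a \<kappa> * (e \<kappa> x * E x))"
    unfolding delta_eq[OF supp] a_def e_def by (simp only: sum_distrib_right mult.assoc)
  also have "\<dots> = (\<Sum>\<kappa>\<in>freq C d k. a \<kappa> * integral\<^sup>L (torus d) (\<lambda>x. e \<kappa> x * E x))"
    by (subst Bochner_Integration.integral_sum) (simp_all add: int)
  also have "\<dots> = (\<Sum>\<kappa>\<in>freq C d k. if l' = \<kappa> then a \<kappa> * complex_of_real ((2 * pi) ^ d) else 0)"
  proof (rule sum.cong[OF refl])
    fix \<kappa> assume "\<kappa> \<in> freq C d k"
    then have "(\<forall>i<d. \<kappa> i = l i) \<longleftrightarrow> l' = \<kappa>"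
      unfolding freq_def int_idx_def l'_def fun_eq_iff by (auto simp: not_less)
    then show "a \<kappa> * integral\<^sup>L (torus d) (\<lambda>x. e \<kappa> x * E x) = (if l' = \<kappa> then a \<kappa> * complex_of_real ((2 * pi) ^ d) else 0)"
      unfolding e_def E_def integral_torus_exp by simp
  qed
  also have "\<dots> = a l' * complex_of_real ((2 * pi) ^ d)"
  proof (cases "l' \<in> freq C d k")
    case False
    then have "(\<Prod>i<d. \<phi> (k i) (of_int (l' i))) = 0" using l' by (intro freq_outside[OF supp]) auto
    then show ?thesis using False by (simp add: a_def)
  qed simp
  also have "\<dots> = complex_of_real (\<Prod>i<d. \<phi> (k i) (of_int (l i))) * integral\<^sup>L (torus d) (\<lambda>x. f x * E x)"
  proof -
    have "(\<Prod>i<d. \<phi> (k i) (of_int (l' i))) = (\<Prod>i<d. \<phi> (k i) (of_int (l i)))" by (simp add: l'_def)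
    moreover have "(\<lambda>x::nat \<Rightarrow> real. \<Sum>i<d. of_int (l' i) * x i) = (\<lambda>x. \<Sum>i<d. of_int (l i) * x i)" by (simp add: l'_def)
    ultimately show ?thesis unfolding a_def fourier_coeff_def E_def by (simp add: field_simps fun_eq_iff)
  qed
  finally show ?thesis unfolding E_def .
qed

lemma idx_box_exhausts: "filterlim (idx_box d) (finite_subsets_at_top (idx d)) sequentially"
  unfolding filterlim_iff eventually_finite_subsets_at_top
proof (intro allI impI, elim exE conjE)
  fix P X assume X: "finite X" "X \<subseteq> idx d" and P: "\<forall>Y. finite Y \<and> X \<subseteq> Y \<and> Y \<subseteq> idx d \<longrightarrow> P Y"
  show "\<forall>\<^sub>F n in sequentially. P (idx_box d n)"
    unfolding eventually_sequentially
  \<comment> \<open>The total of all entries is a crude bound for every single coordinate of the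
    finitely many indices.\<close>
  proof (intro exI[of _ "\<Sum>k\<in>X. \<Sum>i<d. k i"] allI impI)
    fix n assume n: "(\<Sum>k\<in>X. \<Sum>i<d. k i) \<le> n"
    have "k i \<le> n" if "k \<in> X" "i < d" for k i
    proof -
      have "k i \<le> (\<Sum>i<d. k i)" using that by (intro member_le_sum) auto
      also have "\<dots> \<le> (\<Sum>k\<in>X. \<Sum>i<d. k i)" using that X by (intro member_le_sum[where f = "\<lambda>k. \<Sum>i<d. k i"]) auto
      finally show ?thesis using n by simp
    qed
    then have "X \<subseteq> idx_box d n" using X(2) unfolding idx_box_def by blast
    moreover have "idx_box d n \<subseteq> idx d" unfolding idx_box_def by blast
    ultimately show "P (idx_box d n)" using P by simp
  qed
qed

lemma periodic_torus_delta:
  assumes "\<forall>j x. \<phi> j x \<noteq> 0 \<longrightarrow> \<bar>x\<bar> \<le> real C * 2 ^ j"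
  shows "periodic_torus d (delta \<phi> d k f)"
  unfolding periodic_torus_def
proof (intro allI impI)
  fix x y :: "nat \<Rightarrow> real" assume xy: "\<forall>i<d. \<exists>k::int. x i = y i + 2 * pi * of_int k"
  have "(\<Prod>i<d. cis (of_int (\<kappa> i) * x i)) = (\<Prod>i<d. cis (of_int (\<kappa> i) * y i))" for \<kappa>
  proof (rule prod.cong[OF refl])
    fix i assume "i \<in> {..<d}"
    then obtain l :: int where "x i = y i + 2 * pi * of_int l" using xy by blast
    then show "cis (of_int (\<kappa> i) * x i) = cis (of_int (\<kappa> i) * y i)" by (simp only: cis_plus_2pi_int)
  qed
  then show "delta \<phi> d k f x = delta \<phi> d k f y" unfolding delta_eq[OF assms] by simp
qed

text \<open>The block series has a continuous periodic limit \<open>g\<close> by the M-test. The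
  partial sum over a box multiplies the coefficient with index \<open>l\<close> by a product of
  partial sums of the \<open>\<phi> k\<close> at \<open>l i\<close>, which tends to 1. So
  \<open>g\<close> and \<open>f\<close> have the same Fourier coefficients, and uniqueness
  identifies them.\<close>

lemma besov_reconstruction:
  assumes supp: "\<forall>j x. \<phi> j x \<noteq> 0 \<longrightarrow> \<bar>x\<bar> \<le> real C * 2 ^ j" and C: "1 \<le> C"
    and unity: "\<And>x. (\<lambda>j. \<phi> j x) sums 1" and p: "0 < p"
    and \<beta>: "0 < \<beta>" "\<And>i. i < d \<Longrightarrow> \<beta> \<le> r i - 1 / p" and \<theta>: "0 < \<theta>"
    and cont: "continuous_on UNIV f" and per: "periodic_torus d f" and f: "in_besov r p \<theta> \<phi> d f"
  shows "(\<lambda>n. \<Sum>k\<in>idx_box d n. delta \<phi> d k f x) \<longlonglongrightarrow> f x"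
proof -
  define N where "N = besov_norm r p \<theta> \<phi> d f"
  have N: "0 \<le> N" unfolding N_def by (rule besov_norm_nonneg[OF \<theta> f])
  define \<rho> where "\<rho> = 2 powr (- \<beta>)"
  have \<rho>: "0 < \<rho>" "\<rho> < 1" unfolding \<rho>_def using \<beta>(1) by (auto simp: powr_less_one)
  have "\<exists>c>0. \<forall>f k x N. besov_term r p \<phi> d f k \<le> N \<longrightarrow> cmod (delta \<phi> d k f x) \<le> c * N * (\<Prod>i<d. \<rho> ^ k i)"
    unfolding \<rho>_def by (rule delta_sup_bound[OF supp C p]) (rule \<beta>(2))
  then obtain c where c: "c > 0" "\<And>f k x N. besov_term r p \<phi> d f k \<le> N \<Longrightarrow>
    cmod (delta \<phi> d k f x) \<le> c * N * (\<Prod>i<d. \<rho> ^ k i)"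
    by blast
  define M where "M = (\<lambda>k::nat \<Rightarrow> nat. c * N * (\<Prod>i<d. \<rho> ^ k i))"
  define H where "H = c * N * (\<Prod>i<d. 1 / (1 - \<rho>))"
  have bd: "cmod (delta \<phi> d k f x) \<le> M k" if "k \<in> idx d" for k x
    unfolding M_def by (rule c(2)) (use besov_term_le_norm[OF \<theta> f that] in \<open>simp add: N_def\<close>)
  have Msum: "sum M K \<le> H" if "finite K" "K \<subseteq> idx d" for K
  proof -
    have "(\<Sum>k\<in>K. \<Prod>i<d. \<rho> ^ k i) \<le> (\<Prod>i<d. 1 / (1 - \<rho>))"
    proof (rule sum_idx_prod_le[OF that])
      show "(\<Sum>n\<le>N. \<rho> ^ n) \<le> 1 / (1 - \<rho>)" for N
        using \<rho> sum_geometric_inj[of \<rho> "{..N}" "\<lambda>n. n"] by simp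
    qed (use \<rho> in auto)
    then show ?thesis unfolding M_def H_def sum_distrib_left[symmetric] using c(1) N by (intro mult_left_mono) auto
  qed
  have "M summable_on idx d"
  proof (rule nonneg_bdd_above_summable_on)
    show "0 \<le> M k" for k unfolding M_def using c(1) N \<rho> by (intro mult_nonneg_nonneg prod_nonneg) auto
    show "bdd_above (sum M ` {F. F \<subseteq> idx d \<and> finite F})" using Msum by (intro bdd_aboveI[of _ H]) auto
  qed
  define g where "g = (\<lambda>x. \<Sum>\<^sub>\<infinity>k\<in>idx d. delta \<phi> d k f x)"
  define G where "G = (\<lambda>n x. \<Sum>k\<in>idx_box d n. delta \<phi> d k f x)"
  have "uniform_limit UNIV (\<lambda>X x. \<Sum>k\<in>X. delta \<phi> d k f x) g (finite_subsets_at_top (idx d))"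
    unfolding g_def by (rule Weierstrass_m_test_general[OF bd \<open>M summable_on idx d\<close>])
  from filterlim_compose[OF this idx_box_exhausts]
  have unif: "uniform_limit UNIV G g sequentially" unfolding G_def .
  have D: "continuous_on UNIV (delta \<phi> d k f)" for k by (rule trig_poly_dD(1)[OF trig_poly_d_delta[OF supp]])
  have Gc: "continuous_on UNIV (G n)" for n unfolding G_def by (intro continuous_on_sum D)
  have gc: "continuous_on UNIV g" by (rule uniform_limit_theorem[OF _ unif]) (simp_all add: Gc)
  have G: "(\<lambda>n. G n x) \<longlonglongrightarrow> g x" for x by (rule tendsto_uniform_limitI[OF unif]) simp
  have Gbd: "cmod (G n x) \<le> H" for n x
  proof -
    have "cmod (G n x) \<le> (\<Sum>k\<in>idx_box d n. M k)"
      unfolding G_def by (rule order_trans[OF norm_sum]) (intro sum_mono bd, simp add: idx_box_def)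
    also have "\<dots> \<le> H" by (rule Msum[OF finite_idx_box]) (auto simp: idx_box_def)
    finally show ?thesis .
  qed
  have Gper: "G n x = G n y" if "\<forall>i<d. \<exists>k::int. x i = y i + 2 * pi * of_int k" for n x y
    unfolding G_def
    by (intro sum.cong refl periodic_torus_delta[OF supp, unfolded periodic_torus_def, THEN spec, THEN spec, THEN mp] that)
  have gper: "periodic_torus d g"
    unfolding periodic_torus_def
  proof (intro allI impI)
    fix x y :: "nat \<Rightarrow> real" assume "\<forall>i<d. \<exists>k::int. x i = y i + 2 * pi * of_int k"
    then have "G n x = G n y" for n by (rule Gper)
    then have "(\<lambda>n. G n x) \<longlonglongrightarrow> g y" using G[of y] by simp
    then show "g x = g y" by (rule LIMSEQ_unique[OF G])
  qed
  have "g x - f x = 0"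
  proof (rule periodic_fourier_uniqueness[where d = d])
    show "continuous_on UNIV (\<lambda>x. g x - f x)" by (intro continuous_on_diff gc cont)
    show "periodic_torus d (\<lambda>x. g x - f x)"
      unfolding periodic_torus_def
    proof (intro allI impI)
      fix x y :: "nat \<Rightarrow> real" assume xy: "\<forall>i<d. \<exists>k::int. x i = y i + 2 * pi * of_int k"
      have "g x = g y" by (rule gper[unfolded periodic_torus_def, THEN spec, THEN spec, THEN mp, OF xy])
      moreover have "f x = f y" by (rule per[unfolded periodic_torus_def, THEN spec, THEN spec, THEN mp, OF xy])
      ultimately show "g x - f x = g y - f y" by simp
    qed
    fix l :: "nat \<Rightarrow> int"
    define E :: "(nat \<Rightarrow> real) \<Rightarrow> complex" where "E = (\<lambda>x. cis (- (\<Sum>i<d. of_int (l i) * x i)))"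
    have Ec: "continuous_on UNIV E" unfolding E_def by (intro continuous_intros)
    have E1: "cmod (E x) = 1" for x by (simp add: E_def)
    define T where "T = torus d"
    have int: "integrable T (\<lambda>x. u x * E x)" if "continuous_on UNIV u" "\<And>x. cmod (u x) \<le> B" for u B
      unfolding T_def torus_def
      by (rule integrable_torus_bounded[where M = B]) (auto intro!: continuous_on_mult that Ec simp: norm_mult E1)
    obtain B where B: "\<And>x. cmod (f x) \<le> B" by (rule periodic_bounded[OF cont per]) blast
    have gbd: "cmod (g x) \<le> H" for x
      by (rule LIMSEQ_le_const2[OF tendsto_norm[OF G]]) (use Gbd in blast)
    have lim: "(\<lambda>n. integral\<^sup>L T (\<lambda>x. G n x * E x)) \<longlonglongrightarrow> integral\<^sup>L T (\<lambda>x. g x * E x)"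
    proof (rule integral_dominated_convergence[where w = "\<lambda>_. H"])
      show "(\<lambda>x. g x * E x) \<in> borel_measurable T" by (rule borel_measurable_integrable[OF int[OF gc gbd]])
      show "(\<lambda>x. G n x * E x) \<in> borel_measurable T" for n by (rule borel_measurable_integrable[OF int[OF Gc Gbd]])
      show "integrable T (\<lambda>_. H)" unfolding T_def torus_def
        by (rule integrable_torus_bounded[where M = "\<bar>H\<bar>"]) auto
      show "AE x in T. (\<lambda>n. G n x * E x) \<longlonglongrightarrow> g x * E x" by (intro AE_I2 tendsto_mult G tendsto_const)
      show "AE x in T. norm (G n x * E x) \<le> H" for n by (intro AE_I2) (simp add: norm_mult E1 Gbd)
    qed
    have eq: "integral\<^sup>L T (\<lambda>x. G n x * E x) = complex_of_real (\<Prod>i<d. \<Sum>k\<le>n. \<phi> k (of_int (l i))) * integral\<^sup>L T (\<lambda>x. f x * E x)" for n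
    proof -
      have "integral\<^sup>L T (\<lambda>x. G n x * E x) = (\<Sum>k\<in>idx_box d n. integral\<^sup>L T (\<lambda>x. delta \<phi> d k f x * E x))"
      proof -
        have "integrable T (\<lambda>x. delta \<phi> d k f x * E x)" if "k \<in> idx_box d n" for k
          by (rule int[OF D bd]) (use that in \<open>simp add: idx_box_def\<close>)
        then show ?thesis unfolding G_def sum_distrib_right by (intro Bochner_Integration.integral_sum)
      qed
      also have "\<dots> = (\<Sum>k\<in>idx_box d n. complex_of_real (\<Prod>i<d. \<phi> (k i) (of_int (l i)))) * integral\<^sup>L T (\<lambda>x. f x * E x)"
        unfolding T_def E_def delta_coefficient[OF supp] sum_distrib_right ..
      also have "(\<Sum>k\<in>idx_box d n. complex_of_real (\<Prod>i<d. \<phi> (k i) (of_int (l i)))) = complex_of_real (\<Prod>i<d. \<Sum>k\<le>n. \<phi> k (of_int (l i)))"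
        unfolding of_real_sum[symmetric]
        by (rule arg_cong[where f = complex_of_real], rule sum_idx_box_prod[where h = "\<lambda>i k. \<phi> k (of_int (l i))"])
      finally show ?thesis .
    qed
    have "(\<lambda>n. complex_of_real (\<Prod>i<d. \<Sum>k\<le>n. \<phi> k (of_int (l i))) * integral\<^sup>L T (\<lambda>x. f x * E x)) \<longlonglongrightarrow>
      complex_of_real (\<Prod>i<d. 1) * integral\<^sup>L T (\<lambda>x. f x * E x)"
      by (intro tendsto_mult tendsto_of_real tendsto_prod tendsto_const) (use unity in \<open>simp add: sums_def_le\<close>)
    then have "(\<lambda>n. integral\<^sup>L T (\<lambda>x. G n x * E x)) \<longlonglongrightarrow> integral\<^sup>L T (\<lambda>x. f x * E x)"
      unfolding eq by simp
    with lim have "integral\<^sup>L T (\<lambda>x. g x * E x) = integral\<^sup>L T (\<lambda>x. f x * E x)" by (rule LIMSEQ_unique)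
    moreover have "integral\<^sup>L T (\<lambda>x. (g x - f x) * E x) = integral\<^sup>L T (\<lambda>x. g x * E x) - integral\<^sup>L T (\<lambda>x. f x * E x)"
      unfolding left_diff_distrib by (intro Bochner_Integration.integral_diff int[OF gc gbd] int[OF cont B])
    ultimately show "integral\<^sup>L (torus d) (\<lambda>x. (g x - f x) * cis (- (\<Sum>i<d. of_int (l i) * x i))) = 0"
      unfolding T_def E_def by simp
  qed
  then show ?thesis using G[of x] unfolding G_def by simp
qed

subsection \<open>The error estimate\<close>

text \<open>Fatou's lemma is used for the nonnegative integral, where integrability of the limit is
  not presupposed; the finite bound is then transferred to the Bochner integral in
  \<open>Lp_norm\<close>.\<close>

lemma Lp_norm_le_limit:
  assumes F: "\<And>n. continuous_on UNIV (F n)" "\<And>x. (\<lambda>n. F n x) \<longlonglongrightarrow> h x" and q: "0 < q" and Y: "0 \<le> Y"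
    and bd: "\<And>n. (\<integral>\<^sup>+x. ennreal (cmod (F n x) powr q) \<partial>PiM {..<d} (\<lambda>_. circ)) \<le> ennreal (Y powr q)"
  shows "Lp_norm d q h \<le> Y"
proof -
  let ?T = "PiM {..<d} (\<lambda>_::nat. circ)"
  have lim: "(\<lambda>n. cmod (F n x) powr q) \<longlonglongrightarrow> cmod (h x) powr q" for x
    using q by (intro tendsto_powr' tendsto_norm F tendsto_const) auto
  have ms: "(\<lambda>x. cmod (F n x) powr q) \<in> borel_measurable ?T" for n
    by (intro measurable_torus_cont continuous_on_cmod_powr F q)
  have hm: "(\<lambda>x. cmod (h x) powr q) \<in> borel_measurable ?T"
    by (rule borel_measurable_LIMSEQ_real[OF lim ms])
  have "(\<integral>\<^sup>+x. ennreal (cmod (h x) powr q) \<partial>?T) = (\<integral>\<^sup>+x. liminf (\<lambda>n. ennreal (cmod (F n x) powr q)) \<partial>?T)"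
  proof (rule nn_integral_cong)
    fix x
    have "(\<lambda>n. ennreal (cmod (F n x) powr q)) \<longlonglongrightarrow> ennreal (cmod (h x) powr q)" by (intro tendsto_ennrealI lim)
    then show "ennreal (cmod (h x) powr q) = liminf (\<lambda>n. ennreal (cmod (F n x) powr q))"
      by (rule lim_imp_Liminf[OF sequentially_bot, symmetric])
  qed
  also have "\<dots> \<le> liminf (\<lambda>n. \<integral>\<^sup>+x. ennreal (cmod (F n x) powr q) \<partial>?T)"
    using ms by (intro nn_integral_liminf) auto
  also have "\<dots> \<le> liminf (\<lambda>n::nat. ennreal (Y powr q))"
    using bd by (intro Liminf_mono) simp
  also have "\<dots> = ennreal (Y powr q)" by (simp add: Liminf_const)
  finally have le: "(\<integral>\<^sup>+x. ennreal (cmod (h x) powr q) \<partial>?T) \<le> ennreal (Y powr q)" .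
  have "integral\<^sup>L ?T (\<lambda>x. cmod (h x) powr q) = enn2real (\<integral>\<^sup>+x. ennreal (cmod (h x) powr q) \<partial>?T)"
    by (rule integral_eq_nn_integral[OF hm]) simp
  also have "\<dots> \<le> enn2real (ennreal (Y powr q))" by (rule enn2real_mono[OF le]) simp
  finally have "integral\<^sup>L ?T (\<lambda>x. cmod (h x) powr q) \<le> Y powr q" by simp
  then have "integral\<^sup>L ?T (\<lambda>x. cmod (h x) powr q) powr (1 / q) \<le> (Y powr q) powr (1 / q)"
    using q by (intro powr_mono2) auto
  then show ?thesis using q Y by (simp add: Lp_norm_def torus_def powr_powr)
qed

text \<open>\<open>\<eta> 0\<close> is the smallest weight, so no coordinate exceeds
  \<open>m\<close>. In particular the index set is finite and the sum defining
  \<open>smolyak\<close> is a genuine one.\<close>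

lemma smolyak_index_box:
  assumes "0 < \<eta> 0" "\<And>i. i < d \<Longrightarrow> \<eta> 0 \<le> \<eta> i"
  shows "{j \<in> idx d. (\<Sum>i<d. \<eta> i * real (j i)) \<le> \<eta> 0 * real m} \<subseteq> idx_box d m"
proof
  fix j assume j: "j \<in> {j \<in> idx d. (\<Sum>i<d. \<eta> i * real (j i)) \<le> \<eta> 0 * real m}"
  have "j i \<le> m" if i: "i < d" for i
  proof -
    have nn: "0 \<le> \<eta> i" if "i < d" for i using assms(1) assms(2)[OF that] by linarith
    have "\<eta> 0 * real (j i) \<le> \<eta> i * real (j i)" using assms(2)[OF i] by (intro mult_right_mono) auto
    also have "\<dots> \<le> (\<Sum>i<d. \<eta> i * real (j i))"
      using i nn by (intro member_le_sum[where f = "\<lambda>i. \<eta> i * real (j i)"]) auto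
    also have "\<dots> \<le> \<eta> 0 * real m" using j by blast
    finally show ?thesis using assms(1) by simp
  qed
  then show "j \<in> idx_box d m" using j unfolding idx_box_def by blast
qed

text \<open>The operators use point values, so \<open>f\<close> is given as a continuous function,
  periodic in its first \<open>d\<close> coordinates; the smoothness \<open>r_1\<close> appears as
  \<open>r 0\<close>.\<close>

theorem theorem6:
  fixes d \<mu> L :: nat and p q :: real and \<theta> :: ereal
    and r \<nu> :: "nat \<Rightarrow> real" and \<phi> :: "nat \<Rightarrow> real \<Rightarrow> real"
  assumes "0 < p" and "p < q" and "0 < \<theta>" and "real L > 1 / q"
    and "1 \<le> \<mu>" and "\<mu> \<le> d"
    and "\<forall>s<\<mu>. r s = r 0"
    and "\<mu> < d \<longrightarrow> r 0 < r \<mu>"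
    and "\<forall>s t. \<mu> \<le> s \<longrightarrow> s \<le> t \<longrightarrow> t < d \<longrightarrow> r s \<le> r t"
    and "r 0 > 1 / p"
    and "\<forall>s<\<mu>. \<nu> s = r s"
    and "\<forall>s. \<mu> \<le> s \<longrightarrow> s < d \<longrightarrow> r 0 < \<nu> s \<and> \<nu> s < r s"
    and "admissible \<phi>"
  shows "\<exists>C>0. \<forall>m\<ge>1. \<forall>f. continuous_on UNIV f \<longrightarrow> periodic_torus d f \<longrightarrow>
           in_besov r p \<theta> \<phi> d f \<longrightarrow>
           Lp_norm d q (\<lambda>x. f x - smolyak L d (\<lambda>s. \<nu> s - 1 / p + 1 / q) m f x)
             \<le> C * 2 powr (- real m * (r 0 - 1 / p + 1 / q))
                 * real m powr ((real \<mu> - 1) * max (1 / q - inv_theta \<theta>) 0)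
                 * besov_norm r p \<theta> \<phi> d f"
proof -
  have q0: "0 < q" using assms(1,2) by simp
  have iq: "0 < 1 / q" using q0 by simp
  have "0 < real L" using assms(4) iq by linarith
  then have L: "1 \<le> L" by simp
  define \<beta> where "\<beta> = r 0 - 1 / p"
  have \<beta>0: "0 < \<beta>" unfolding \<beta>_def using assms(10) by simp
  have \<beta>: "\<beta> \<le> r i - 1 / p" if "i < d" for i
  proof (cases "i < \<mu>")
    case True
    then show ?thesis using assms(7)[rule_format, OF True] by (simp add: \<beta>_def)
  next
    case False
    then have "r 0 < r \<mu>" using assms(8) that by simp
    moreover have "r \<mu> \<le> r i" using assms(9)[rule_format, of \<mu> i] False that by simp
    ultimately show ?thesis by (simp add: \<beta>_def)
  qed
  define \<alpha> where "\<alpha> = (\<lambda>i. r i - 1 / p + 1 / q)"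
  define \<eta> where "\<eta> = (\<lambda>i. \<nu> i - 1 / p + 1 / q)"
  have \<nu>: "\<nu> i = r 0 \<and> r i = r 0" if "i < \<mu>" for i
    using assms(7)[rule_format, OF that] assms(11)[rule_format, OF that] by simp
  have \<eta>0: "\<eta> 0 = r 0 - 1 / p + 1 / q" using \<nu>[of 0] assms(5) by (simp add: \<eta>_def)
  have \<eta>pos: "0 < \<eta> 0" unfolding \<eta>0 using assms(10) iq by linarith
  have crit: "\<alpha> i = \<eta> 0 \<and> \<eta> i = \<eta> 0" if "i < \<mu>" for i
    using \<nu>[OF that] unfolding \<eta>0 by (simp add: \<alpha>_def \<eta>_def)
  have noncrit: "\<eta> 0 < \<eta> i \<and> \<eta> i < \<alpha> i" if "\<mu> \<le> i" "i < d" for i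
    unfolding \<eta>0 using assms(12)[rule_format, OF that] by (simp add: \<alpha>_def \<eta>_def)
  obtain C :: nat where C: "1 \<le> C" and supp: "\<forall>j x. \<phi> j x \<noteq> 0 \<longrightarrow> \<bar>x\<bar> \<le> real C * 2 ^ j"
    and unity: "\<And>x. (\<lambda>j. \<phi> j x) sums 1"
    by (rule admissible_support[OF assms(13)]) blast
  \<comment> \<open>\<open>2 ^ C\<close> exceeds \<open>C\<close> and absorbs the support constant;
    \<open>Suc L\<close> accounts for the threshold in \<open>eta_op_cis_vanish\<close>. Thus
    \<open>q_j D_k\<close> vanishes once some \<open>j i > k i + c\<close>.\<close>
  define c where "c = Suc L + C"
  have cC: "2 ^ Suc L * C \<le> 2 ^ c"
    unfolding c_def power_add by (intro mult_left_mono less_imp_le[OF less_exp]) simp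
  have freq: "2 ^ Suc L * \<bar>\<kappa> i\<bar> \<le> (2::int) ^ (c + k i)" if "\<kappa> \<in> freq C d k" "i < d" for \<kappa> k i
  proof -
    have "\<bar>\<kappa> i\<bar> \<le> int (C * 2 ^ k i)" using that unfolding freq_def by blast
    then have "2 ^ Suc L * \<bar>\<kappa> i\<bar> \<le> 2 ^ Suc L * int (C * 2 ^ k i)" by (intro mult_left_mono) auto
    also have "\<dots> = int (2 ^ Suc L * C * 2 ^ k i)" by simp
    also have "\<dots> \<le> int (2 ^ c * 2 ^ k i)" by (simp only: of_nat_le_iff) (intro mult_right_mono cC, simp)
    also have "\<dots> = 2 ^ (c + k i)" by (simp add: power_add)
    finally show ?thesis .
  qed
  define \<rho> where "\<rho> = 2 powr (- (\<beta> / 2))"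
  have \<rho>: "0 < \<rho>" "\<rho> < 1" unfolding \<rho>_def using \<beta>0 by (auto simp: powr_less_one)
  let ?T = "PiM {..<d} (\<lambda>_::nat. circ)"
  have "\<exists>C>0. \<forall>J K D. finite J \<longrightarrow> J \<subseteq> idx d \<longrightarrow> finite K \<longrightarrow> K \<subseteq> idx d \<longrightarrow>
    (\<forall>k\<in>K. trig_poly_d d (\<lambda>i. 2 ^ (c + k i)) (D k)) \<longrightarrow>
    (\<forall>j\<in>J. \<forall>k\<in>K. trig_poly_d d (\<lambda>i. 2 ^ j i) (qop L d j (D k))) \<longrightarrow>
    (\<forall>j\<in>J. \<forall>k\<in>K. \<forall>i<d. k i + c < j i \<longrightarrow> (\<forall>x. qop L d j (D k) x = 0)) \<longrightarrow>
    (\<integral>\<^sup>+x. ennreal ((\<Sum>j\<in>J. cmod (\<Sum>k\<in>K. qop L d j (D k) x)) powr q) \<partial>?T) \<le>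
      ennreal (C * (\<Sum>j\<in>J. \<Sum>k\<in>K. (geo_weight d c \<rho> j k * 2 powr (- (\<Sum>i<d. \<alpha> i * real (j i))) *
         (2 powr (\<Sum>i<d. r i * real (k i)) * Lp_norm d p (D k))) powr q))"
    unfolding \<rho>_def \<alpha>_def by (rule error_core[OF L assms(4,1,2) \<beta>0 \<beta>])
  then obtain C1 where C1: "C1 > 0" "\<And>J K D. finite J \<Longrightarrow> J \<subseteq> idx d \<Longrightarrow> finite K \<Longrightarrow> K \<subseteq> idx d \<Longrightarrow>
    (\<forall>k\<in>K. trig_poly_d d (\<lambda>i. 2 ^ (c + k i)) (D k)) \<Longrightarrow>
    (\<forall>j\<in>J. \<forall>k\<in>K. trig_poly_d d (\<lambda>i. 2 ^ j i) (qop L d j (D k))) \<Longrightarrow>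
    (\<forall>j\<in>J. \<forall>k\<in>K. \<forall>i<d. k i + c < j i \<longrightarrow> (\<forall>x. qop L d j (D k) x = 0)) \<Longrightarrow>
    (\<integral>\<^sup>+x. ennreal ((\<Sum>j\<in>J. cmod (\<Sum>k\<in>K. qop L d j (D k) x)) powr q) \<partial>?T) \<le>
      ennreal (C1 * (\<Sum>j\<in>J. \<Sum>k\<in>K. (geo_weight d c \<rho> j k * 2 powr (- (\<Sum>i<d. \<alpha> i * real (j i))) *
         (2 powr (\<Sum>i<d. r i * real (k i)) * Lp_norm d p (D k))) powr q))"
    by blast
  have "\<exists>C>0. \<forall>m\<ge>1. \<forall>J K B N. finite J \<longrightarrow> J \<subseteq> idx d \<longrightarrow> (\<forall>j\<in>J. \<eta> 0 * real m < (\<Sum>i<d. \<eta> i * real (j i))) \<longrightarrow>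
      finite K \<longrightarrow> K \<subseteq> idx d \<longrightarrow> (\<forall>k. 0 \<le> B k) \<longrightarrow> 0 \<le> N \<longrightarrow>
      (if \<theta> = \<infinity> then \<forall>k\<in>K. B k \<le> N else (\<Sum>k\<in>K. B k powr real_of_ereal \<theta>) \<le> N powr real_of_ereal \<theta>) \<longrightarrow>
      (\<Sum>j\<in>J. \<Sum>k\<in>K. (geo_weight d c \<rho> j k * 2 powr (- (\<Sum>i<d. \<alpha> i * real (j i))) * B k) powr q) \<le>
        C * (2 powr (- (real m * \<eta> 0)) * real m powr ((real \<mu> - 1) * max (1 / q - inv_theta \<theta>) 0) * N) powr q"
  proof (rule besov_double_sum[where \<alpha> = \<alpha> and \<eta> = \<eta> and \<mu> = \<mu> and d = d, OF q0 assms(3) \<rho> assms(5,6) \<eta>pos])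
    show "\<alpha> i = \<eta> 0 \<and> \<eta> i = \<eta> 0" if "i < \<mu>" for i by (rule crit[OF that])
    show "0 < \<eta> i \<and> \<eta> i < \<alpha> i" if "\<mu> \<le> i" "i < d" for i using noncrit[OF that] \<eta>pos by linarith
  qed
  then obtain C2 where C2: "C2 > 0" "\<forall>m\<ge>1. \<forall>J K B N. finite J \<longrightarrow> J \<subseteq> idx d \<longrightarrow> (\<forall>j\<in>J. \<eta> 0 * real m < (\<Sum>i<d. \<eta> i * real (j i))) \<longrightarrow>
      finite K \<longrightarrow> K \<subseteq> idx d \<longrightarrow> (\<forall>k. 0 \<le> B k) \<longrightarrow> 0 \<le> N \<longrightarrow>
      (if \<theta> = \<infinity> then \<forall>k\<in>K. B k \<le> N else (\<Sum>k\<in>K. B k powr real_of_ereal \<theta>) \<le> N powr real_of_ereal \<theta>) \<longrightarrow>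
      (\<Sum>j\<in>J. \<Sum>k\<in>K. (geo_weight d c \<rho> j k * 2 powr (- (\<Sum>i<d. \<alpha> i * real (j i))) * B k) powr q) \<le>
        C2 * (2 powr (- (real m * \<eta> 0)) * real m powr ((real \<mu> - 1) * max (1 / q - inv_theta \<theta>) 0) * N) powr q"
    by (elim exE conjE)
  define C' where "C' = (C1 * C2) powr (1 / q)"
  have C': "C' > 0" "C' powr q = C1 * C2" unfolding C'_def using C1(1) C2(1) q0 by (auto simp: powr_powr)
  show ?thesis
  proof (intro exI[of _ C'] conjI C'(1) allI impI)
    fix m :: nat and f :: "(nat \<Rightarrow> real) \<Rightarrow> complex"
    assume m: "1 \<le> m" and cont: "continuous_on UNIV f" and per: "periodic_torus d f" and f: "in_besov r p \<theta> \<phi> d f"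
    define X where "X = 2 powr (- (real m * \<eta> 0)) * real m powr ((real \<mu> - 1) * max (1 / q - inv_theta \<theta>) 0) * besov_norm r p \<theta> \<phi> d f"
    have N: "0 \<le> besov_norm r p \<theta> \<phi> d f" by (rule besov_norm_nonneg[OF assms(3) f])
    have X: "0 \<le> X" unfolding X_def using N by simp
    define D where "D = (\<lambda>k. delta \<phi> d k f)"
    define G where "G = (\<lambda>n x. \<Sum>k\<in>idx_box d n. D k x)"
    define \<Delta> where "\<Delta> = {j \<in> idx d. (\<Sum>i<d. \<eta> i * real (j i)) \<le> \<eta> 0 * real m}"
    define T where "T = (\<lambda>u x. \<Sum>j\<in>\<Delta>. qop L d j u x)"
    have \<Delta>: "\<Delta> \<subseteq> idx_box d m"
      unfolding \<Delta>_def
    proof (rule smolyak_index_box[where \<eta> = \<eta> and d = d, OF \<eta>pos])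
      show "\<eta> 0 \<le> \<eta> i" if "i < d" for i
        using crit[of i] noncrit[of i] that by (cases "i < \<mu>") auto
    qed
    have Dtp: "trig_poly_d d (\<lambda>i. 2 ^ (c + k i)) (D k)" for k
    proof (rule trig_poly_d_mono)
      show "trig_poly_d d (\<lambda>i. C * 2 ^ k i) (D k)" unfolding D_def by (rule trig_poly_d_delta[OF supp])
      have "C \<le> 2 ^ Suc L * C" by simp
      then have "C \<le> 2 ^ c" using cC by linarith
      then show "C * 2 ^ k i \<le> 2 ^ (c + k i)" for i unfolding power_add by (rule mult_right_mono) simp
    qed
    have Qtp: "trig_poly_d d (\<lambda>i. 2 ^ j i) (qop L d j (D k))" for j k
      unfolding D_def delta_eq[OF supp] by (rule qop_exp_trig_poly_d[OF L])
    have Q0: "qop L d j (D k) x = 0" if "i < d" "k i + c < j i" for j k i x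
      unfolding D_def delta_eq[OF supp]
    proof (rule qop_exp_vanish[OF L that(1)])
      show "1 \<le> j i" using that(2) by simp
      fix \<kappa> assume "\<kappa> \<in> freq C d k"
      then have "2 ^ Suc L * \<bar>\<kappa> i\<bar> \<le> (2::int) ^ (c + k i)" by (rule freq[OF _ that(1)])
      also have "\<dots> < 2 ^ j i" using that(2) by simp
      finally show "2 ^ Suc L * \<bar>\<kappa> i\<bar> < 2 ^ j i" .
    qed
    have QG: "qop L d j (G n) x = (\<Sum>k\<in>idx_box d n. qop L d j (D k) x)" for j n x
      unfolding G_def by (rule qop_sum)
    have "Lp_norm d q (\<lambda>x. f x - T f x) \<le> C' * X"
    proof (rule Lp_norm_le_limit[where F = "\<lambda>n x. G n x - T (G n) x"])
      show "continuous_on UNIV (\<lambda>x. G n x - T (G n) x)" for n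
        unfolding T_def QG unfolding G_def
        by (intro continuous_on_diff continuous_on_sum trig_poly_dD(1)[OF Dtp] trig_poly_dD(1)[OF Qtp])
      have Glim: "(\<lambda>n. G n x) \<longlonglongrightarrow> f x" for x
        unfolding G_def D_def
        by (rule besov_reconstruction[OF supp C unity assms(1) \<beta>0 \<beta> assms(3) cont per f])
      show "(\<lambda>n. G n x - T (G n) x) \<longlonglongrightarrow> f x - T f x" for x
        unfolding T_def by (intro tendsto_diff tendsto_sum qop_tendsto Glim)
      show "0 \<le> C' * X" using C'(1) X by simp
      fix n
      \<comment> \<open>Large enough for the box to contain the Smolyak index set and for the sum of
        all \<open>q_j\<close> over the box to reproduce every block of the partial sum
        \<open>G n\<close>.\<close>
      define N' where "N' = max m (n + c)"
      define J where "J = idx_box d N' - \<Delta>"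
      have \<Delta>': "\<Delta> \<subseteq> idx_box d N'" using \<Delta> unfolding idx_box_def N'_def by fastforce
      have comp: "(\<Sum>j\<in>idx_box d N'. qop L d j (D k) x) = D k x" if k: "k \<in> idx_box d n" for k x
        unfolding D_def delta_eq[OF supp]
      proof (rule qop_exp_complete[OF L])
        fix \<kappa> i assume "\<kappa> \<in> freq C d k" and i: "i < d"
        then have "2 ^ Suc L * \<bar>\<kappa> i\<bar> \<le> (2::int) ^ (c + k i)" by (rule freq)
        also have "\<dots> \<le> 2 ^ N'" using k i unfolding N'_def by (intro power_increasing) (auto simp: idx_box_def)
        finally have "2 * (2 ^ L * \<bar>\<kappa> i\<bar>) \<le> (2::int) ^ N'" by simp
        moreover have "(0::int) < 2 ^ N'" by simp
        ultimately show "2 ^ L * \<bar>\<kappa> i\<bar> < 2 ^ N'" by linarith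
      qed
      \<comment> \<open>Writing \<open>G n\<close> itself as the sum of all \<open>q_j\<close> over
        the box leaves exactly the indices outside the Smolyak set, without any limit in
        \<open>j\<close>.\<close>
      have err: "G n x - T (G n) x = (\<Sum>j\<in>J. \<Sum>k\<in>idx_box d n. qop L d j (D k) x)" for x
      proof -
        have "G n x = (\<Sum>k\<in>idx_box d n. \<Sum>j\<in>idx_box d N'. qop L d j (D k) x)"
          unfolding G_def by (intro sum.cong refl comp[symmetric])
        also have "\<dots> = (\<Sum>j\<in>idx_box d N'. \<Sum>k\<in>idx_box d n. qop L d j (D k) x)" by (rule sum.swap)
        finally show ?thesis
          unfolding T_def QG J_def using \<Delta>' by (simp add: sum_diff)
      qed
      have "(\<integral>\<^sup>+x. ennreal (cmod (G n x - T (G n) x) powr q) \<partial>?T) \<le>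
        (\<integral>\<^sup>+x. ennreal ((\<Sum>j\<in>J. cmod (\<Sum>k\<in>idx_box d n. qop L d j (D k) x)) powr q) \<partial>?T)"
        unfolding err using q0 by (intro nn_integral_mono ennreal_leI powr_mono2 norm_sum) auto
      also have "\<dots> \<le> ennreal (C1 * (\<Sum>j\<in>J. \<Sum>k\<in>idx_box d n. (geo_weight d c \<rho> j k * 2 powr (- (\<Sum>i<d. \<alpha> i * real (j i))) *
         (2 powr (\<Sum>i<d. r i * real (k i)) * Lp_norm d p (D k))) powr q))"
      proof (rule C1(2))
        show "finite J" unfolding J_def by simp
        show "J \<subseteq> idx d" "idx_box d n \<subseteq> idx d" unfolding J_def idx_box_def by auto
      qed (use Dtp Qtp Q0 in \<open>simp_all\<close>)
      also have "\<dots> \<le> ennreal (C1 * (C2 * X powr q))"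
      proof (intro ennreal_leI mult_left_mono)
        show "(\<Sum>j\<in>J. \<Sum>k\<in>idx_box d n. (geo_weight d c \<rho> j k * 2 powr (- (\<Sum>i<d. \<alpha> i * real (j i))) *
          (2 powr (\<Sum>i<d. r i * real (k i)) * Lp_norm d p (D k))) powr q) \<le> C2 * X powr q"
          unfolding X_def D_def besov_term_def[symmetric]
        proof (rule C2(2)[THEN spec, THEN mp, OF m, THEN spec, THEN spec, THEN spec, THEN spec,
            THEN mp, THEN mp, THEN mp, THEN mp, THEN mp, THEN mp, THEN mp, THEN mp])
          show "finite J" unfolding J_def by simp
          show "J \<subseteq> idx d" "idx_box d n \<subseteq> idx d" unfolding J_def idx_box_def by auto
          show "\<forall>j\<in>J. \<eta> 0 * real m < (\<Sum>i<d. \<eta> i * real (j i))"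
            unfolding J_def \<Delta>_def idx_box_def by (auto simp: not_le)
          show "if \<theta> = \<infinity> then \<forall>k\<in>idx_box d n. besov_term r p \<phi> d f k \<le> besov_norm r p \<theta> \<phi> d f
            else (\<Sum>k\<in>idx_box d n. besov_term r p \<phi> d f k powr real_of_ereal \<theta>) \<le> besov_norm r p \<theta> \<phi> d f powr real_of_ereal \<theta>"
            by (rule besov_partial_sum[OF assms(3) f finite_idx_box]) (auto simp: idx_box_def)
        qed (simp_all add: besov_term_nonneg N)
      qed (use C1(1) in simp)
      also have "C1 * (C2 * X powr q) = (C' * X) powr q"
        unfolding powr_mult C'(2) by simp
      finally show "(\<integral>\<^sup>+x. ennreal (cmod (G n x - T (G n) x) powr q) \<partial>?T) \<le> ennreal ((C' * X) powr q)" .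
    qed (rule q0)
    then show "Lp_norm d q (\<lambda>x. f x - smolyak L d (\<lambda>s. \<nu> s - 1 / p + 1 / q) m f x)
      \<le> C' * 2 powr (- real m * (r 0 - 1 / p + 1 / q)) * real m powr ((real \<mu> - 1) * max (1 / q - inv_theta \<theta>) 0)
        * besov_norm r p \<theta> \<phi> d f"
      unfolding X_def \<eta>0 T_def \<Delta>_def \<eta>_def[symmetric] smolyak_def by (simp add: mult.assoc)
  qed
qed

end
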